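(* There is a positive absolute constant $A$ such that for all integers $d\ge1$ and $N\ge3$, $$\mathfrak C_2^*(N;d)\le A\sqrt d\,\log N.$$
   Context: For $v\in\mathbb R^2$ write $\langle v,1\rangle=(v_1,v_2,1)\in\mathbb R^3$. The directional Hilbert transform on $\mathbb R^3$ is $H_vf(x)=\mathrm{p.v.}\,\frac1\pi\int_{\mathbb R}f(x-t\langle v,1\rangle)\frac{dt}{t}$, bounded on $L^2(\mathbb R^3)$. For finite $\Omega\subset\mathbb R^2$, $H_\Omega f(x)=\sup_{v\in\Omega}|H_vf(x)|$, with operator norm $\|H_\Omega\|_{L^2(\mathbb R^3)\to L^2(\mathbb R^3)}$. Let $\mathcal P_d(2)$ be the set of all polynomials $P\in\mathbb R[x_1,x_2]$ of degree at most $d$ with $P\not\equiv0$, and $Z_{\mathbb R}(P)=\{x\in\mathbb R^2:P(x)=0\}$. Then $\mathfrak C_2^*(N;d)$ is the supremum of $\|H_\Omega\|_{L^2(\mathbb R^3)\to L^2(\mathbb R^3)}$ over all finite sets $\Omega\subset\mathbb R^2$ with $\#(\Omega)\le N$ for which there exists $P\in\mathcal P_d(2)$ with $\Omega\subset Z_{\mathbb R}(P)$. *)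

theory Defs
  imports "HOL-Analysis.Analysis" "HOL-Computational_Algebra.Polynomial"
begin

definition L2norm :: "(real^3 \<Rightarrow> ennreal) \<Rightarrow> ennreal" where
  "L2norm g =
     (let I = (\<integral>\<^sup>+ x. (g x)\<^sup>2 \<partial>lebesgue)
      in if I = \<infinity> then \<infinity> else ennreal (sqrt (enn2real I)))"

definition L2 :: "(real^3 \<Rightarrow> complex) set" where
  "L2 = {f \<in> borel_measurable lebesgue. L2norm (\<lambda>x. ennreal (cmod (f x))) < \<infinity>}"

definition lift_dir :: "real^2 \<Rightarrow> real^3" where
  "lift_dir v = vector [v $ 1, v $ 2, 1]"

(* For f in L2 and almost every x the truncated integrals converge absolutely
   (Cauchy-Schwarz on almost every line) and the limit exists; the values of the
   total functions at the remaining x do not affect any L2 norm. *)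
definition hilbert_dir :: "real^2 \<Rightarrow> (real^3 \<Rightarrow> complex) \<Rightarrow> real^3 \<Rightarrow> complex" where
  "hilbert_dir v f x =
     (1 / pi) *\<^sub>R
       Lim (at_right (0::real))
         (\<lambda>\<epsilon>. LINT t:{t. \<epsilon> < \<bar>t\<bar>}|lebesgue. (1 / t) *\<^sub>R f (x - t *\<^sub>R lift_dir v))"

(* The supremum is taken in ennreal, so it is 0 for empty \<Omega>. *)
definition hilbert_max :: "(real^2) set \<Rightarrow> (real^3 \<Rightarrow> complex) \<Rightarrow> real^3 \<Rightarrow> ennreal" where
  "hilbert_max \<Omega> f x = (SUP v\<in>\<Omega>. ennreal (cmod (hilbert_dir v f x)))"

definition op_norm_L2 :: "((real^3 \<Rightarrow> complex) \<Rightarrow> real^3 \<Rightarrow> ennreal) \<Rightarrow> ennreal" where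
  "op_norm_L2 T = (SUP f\<in>{f \<in> L2. L2norm (\<lambda>x. ennreal (cmod (f x))) \<le> 1}. L2norm (T f))"

(* A polynomial in two variables is encoded as an element of R[x2][x1]: the coefficient
   of x1^i x2^j is "coeff (coeff P i) j". *)
definition eval2 :: "real poly poly \<Rightarrow> real^2 \<Rightarrow> real" where
  "eval2 P x = poly (poly P [:x $ 1:]) (x $ 2)"

definition polys_deg_le :: "nat \<Rightarrow> real poly poly set" where
  "polys_deg_le d = {P. P \<noteq> 0 \<and> (\<forall>i j. coeff (coeff P i) j \<noteq> 0 \<longrightarrow> i + j \<le> d)}"

definition real_zeros :: "real poly poly \<Rightarrow> (real^2) set" where
  "real_zeros P = {x. eval2 P x = 0}"

definition C2_star :: "nat \<Rightarrow> nat \<Rightarrow> ennreal" where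
  "C2_star N d =
     (SUP \<Omega>\<in>{\<Omega>. finite \<Omega> \<and> card \<Omega> \<le> N \<and> (\<exists>P\<in>polys_deg_le d. \<Omega> \<subseteq> real_zeros P)}.
        op_norm_L2 (hilbert_max \<Omega>))"

end

theory Submission
  imports Defs "HOL-Computational_Algebra.Polynomial_Factorial" "HOL-Computational_Algebra.Field_as_Ring"
    "HOL-Probability.Probability"
begin

text \<open>
  By Plancherel, $\|H_pf-H_qf\|^2$ is four times the mass that $|\hat f|^2$ gives to those $\xi$ for which the
  line $\langle\xi,(v,1)\rangle=0$ in the $v$-plane separates $p$ from $q$. So if no line separates more than $k$
  of a family of pairs, then $\sum\|H_pf-H_qf\|^2\le 4k\|f\|^2$ over the family. Replacing one member of each pair
  by the other changes the norm of the maximal function by at most $2\sqrt k\|f\|$.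

  On a curve of degree $d$ one pairs consecutive points on the same arc. A line meets the curve in $O(d)$ points
  and separates $O(d)$ pairs, and all but $O(d^2)$ points have a successor, so a fixed fraction of the points
  can be discarded at cost $O(\sqrt d)$, and after $O(\log N)$ rounds $O(d^2)$ points are left. For $n$ arbitrary
  points a maximal $s$-separated subset with $s\approx\log N/\sqrt n$ has at most $n/4$ points, because a few
  well chosen lines separate all its pairs and $r$ lines cut the plane into at most $1+r+r^2$ cells. This costs
  $O(n^{1/4}\sqrt{\log N})$ per round, a geometric sum of size $O(\sqrt d\sqrt{\log N})$ for $n=O(d^2)$.

  The truncated integral at scale $2^{-j}$ differs from the average at scale $2^{-j}$ of the $L^2$ limit by a
  square summable sequence in $L^2$; with Lebesgue's differentiation theorem on lines this gives the almost
  everywhere existence of the principal value.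
\<close>

subsection \<open>Plane algebraic curves\<close>

text \<open>Pairing along arcs breaks down at about d^2 points: critical points and ends of arcs
  have no successor, and Bezout allows of order d^2 of them. The bound n^(1/4) for arbitrary sets is
  useless for all N points but equals sqrt d at exactly that size, so each of the two mechanisms
  contributes one term of size sqrt d log N. The geometry sees the operators only through the locale
  \<open>direction_family\<close>: a cost D p q for replacing one direction by another, with the
  single rule that pairs of which every generic line separates at most k have total cost at most 4k.
  Plancherel is available for bounded integrable functions only. Multiplier estimates are made there
  and pass to L2 by truncating the function. Squared norms are compared through |a - b|^2 <= 2|a|^2
  + 2|b|^2, so constants are lossy but absolute. The operator of the statement is a pointwise
  principal value of a Lebesgue measurable function; it has to be identified almost everywhere with
  an L2 limit before Plancherel says anything about it.\<close>

text \<open>A point $v$ of the plane has coordinates $t=v_2$ and $z=v_1$, so that the outer variable of the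
  polynomial is the fibre coordinate $z$ over the base coordinate $t$.\<close>

definition ev :: "real poly poly \<Rightarrow> real \<Rightarrow> real \<Rightarrow> real" where
  "ev F t z = poly (poly F [:z:]) t"

lemma eval2_eq_ev: "eval2 P v = ev P (v $ 2) (v $ 1)"
  by (simp add: eval2_def ev_def)

lemma ev_0 [simp]: "ev 0 t z = 0"
  and ev_pCons [simp]: "ev (pCons c F) t z = poly c t + z * ev F t z"
  and ev_add [simp]: "ev (F + G) t z = ev F t z + ev G t z"
  and ev_diff [simp]: "ev (F - G) t z = ev F t z - ev G t z"
  and ev_smult [simp]: "ev (smult c F) t z = poly c t * ev F t z"
  and ev_mult [simp]: "ev (F * G) t z = ev F t z * ev G t z"
  by (simp_all add: ev_def)

lemma ev_pcompose: "ev (pcompose F [:[:0, l:], 1:]) t z = ev F t (z + l * t)"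
  by (induction F) (auto simp: pcompose_pCons algebra_simps)

lemma has_real_derivative_ev: "((\<lambda>z. ev F t z) has_real_derivative ev (pderiv F) t z) (at z)"
  by (induction F) (auto simp: pderiv_pCons intro!: derivative_eq_intros)

lemma continuous_on_ev:
  "continuous_on S f \<Longrightarrow> continuous_on S g \<Longrightarrow> continuous_on S (\<lambda>x. ev F (f x) (g x))"
proof (induction F)
  case (pCons c F)
  have "continuous_on S (\<lambda>x. poly c (f x))"
    using pCons.prems(1) by (intro continuous_intros)
  then show ?case using pCons by (auto intro!: continuous_intros)
qed auto

section \<open>Total degree and the degrees in the two variables\<close>

definition tdle :: "real poly poly \<Rightarrow> nat \<Rightarrow> bool" where
  "tdle F d \<longleftrightarrow> (\<forall>i j. coeff (coeff F i) j \<noteq> 0 \<longrightarrow> i + j \<le> d)"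

lemma tdle_add: assumes "tdle F d" "tdle G d" shows "tdle (F + G) d"
  unfolding tdle_def
proof (intro allI impI)
  fix i j assume "coeff (coeff (F + G) i) j \<noteq> 0"
  then have "coeff (coeff F i) j \<noteq> 0 \<or> coeff (coeff G i) j \<noteq> 0" by auto
  then show "i + j \<le> d" using assms unfolding tdle_def by blast
qed

lemma tdle_uminus: "tdle F d \<Longrightarrow> tdle (- F) d"
  by (simp add: tdle_def)

lemma tdle_diff: "tdle F d \<Longrightarrow> tdle G d \<Longrightarrow> tdle (F - G) d"
  using tdle_add[of F d "- G"] tdle_uminus by simp

lemma tdle_mult: assumes "tdle F d" "tdle G e" shows "tdle (F * G) (d + e)"
  unfolding tdle_def
proof (intro allI impI)
  fix i j assume "coeff (coeff (F * G) i) j \<noteq> 0"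
  then have "(\<Sum>k\<le>i. coeff (coeff F k * coeff G (i - k)) j) \<noteq> 0"
    by (simp add: coeff_mult coeff_sum)
  then obtain k where k: "k \<le> i" "coeff (coeff F k * coeff G (i - k)) j \<noteq> 0"
    using sum.not_neutral_contains_not_neutral by (metis (no_types, lifting) atMost_iff)
  then have "(\<Sum>l\<le>j. coeff (coeff F k) l * coeff (coeff G (i - k)) (j - l)) \<noteq> 0"
    by (simp add: coeff_mult)
  then obtain l where l: "l \<le> j" "coeff (coeff F k) l * coeff (coeff G (i - k)) (j - l) \<noteq> 0"
    using sum.not_neutral_contains_not_neutral by (metis (no_types, lifting) atMost_iff)
  then have "coeff (coeff F k) l \<noteq> 0" "coeff (coeff G (i - k)) (j - l) \<noteq> 0" by auto
  then have "k + l \<le> d" "(i - k) + (j - l) \<le> e"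
    using assms unfolding tdle_def by blast+
  then show "i + j \<le> d + e" using k l by linarith
qed

lemma tdle_const: "degree c \<le> d \<Longrightarrow> tdle [:c:] d"
  by (auto simp: tdle_def coeff_pCons split: nat.splits) (meson le_degree order_trans)

lemma tdle_pderiv: assumes "tdle F d" shows "tdle (pderiv F) d"
  unfolding tdle_def
proof (intro allI impI)
  fix i j assume a: "coeff (coeff (pderiv F) i) j \<noteq> 0"
  have "coeff (pderiv F) i = of_nat (Suc i) * coeff F (Suc i)" by (simp add: coeff_pderiv)
  also have "\<dots> = smult (real (Suc i)) (coeff F (Suc i))" by (simp add: of_nat_poly)
  finally have "coeff (coeff F (Suc i)) j \<noteq> 0" using a by auto
  then have "Suc i + j \<le> d" using assms unfolding tdle_def by blast
  then show "i + j \<le> d" by simp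
qed

lemma tdle_pCons: assumes "tdle (pCons c F) d"
  shows "degree c \<le> d" "F \<noteq> 0 \<Longrightarrow> d \<ge> 1" "tdle F (d - 1)"
proof -
  show 1: "degree c \<le> d"
  proof (cases "c = 0")
    case False
    then have "coeff (coeff (pCons c F) 0) (degree c) \<noteq> 0" by simp
    then have "0 + degree c \<le> d" using assms unfolding tdle_def by blast
    then show ?thesis by simp
  qed simp
  have 2: "Suc (i + j) \<le> d" if "coeff (coeff F i) j \<noteq> 0" for i j
  proof -
    have "coeff (coeff (pCons c F) (Suc i)) j \<noteq> 0" using that by simp
    then have "Suc i + j \<le> d" using assms unfolding tdle_def by blast
    then show ?thesis by simp
  qed
  then show "tdle F (d - 1)" unfolding tdle_def by fastforce
  show "d \<ge> 1" if "F \<noteq> 0"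
  proof -
    have "coeff (coeff F (degree F)) (degree (coeff F (degree F))) \<noteq> 0" using that by simp
    from 2[OF this] show ?thesis by simp
  qed
qed

lemma tdle_pcompose: assumes "tdle q 1" shows "tdle F d \<Longrightarrow> tdle (pcompose F q) d"
proof (induction F arbitrary: d)
  case (pCons c F)
  note p = tdle_pCons[OF pCons.prems]
  show ?case
  proof (cases "F = 0")
    case True
    then show ?thesis using p by (simp add: pcompose_pCons tdle_const)
  next
    case False
    have "tdle (q * pcompose F q) (1 + (d - 1))" by (intro tdle_mult assms pCons.IH p)
    then show ?thesis using p(2)[OF False] p(1) by (simp add: pcompose_pCons tdle_add tdle_const)
  qed
qed auto

lemma tdle_degree: "tdle F d \<Longrightarrow> degree F \<le> d"
  using tdle_def[of F d] by (metis add_leD1 degree_0 le0 leading_coeff_0_iff)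

lemma tdle_degree_coeff: "tdle F d \<Longrightarrow> degree (coeff F i) \<le> d"
  using tdle_def[of F d] by (metis add_leD2 degree_0 le0 leading_coeff_0_iff)

lemma tdleI: assumes "degree F \<le> d" "\<And>i. degree (coeff F i) \<le> e" shows "tdle F (d + e)"
  unfolding tdle_def using assms by (metis add_mono coeff_0 le_degree order_trans)

lemma coeff_poly_const: "coeff (poly F [:z:]) a = poly (map_poly (\<lambda>c. coeff c a) F) (z::real)"
  by (induction F) (auto simp: map_poly_pCons)

lemma degree_poly_const_le:
  assumes "\<And>i. degree (coeff F i) \<le> a" shows "degree (poly F [:z::real:]) \<le> a"
proof (rule degree_le, intro allI impI)
  fix k assume "k > a"
  then have "coeff (coeff F i) k = 0" for i
    by (meson assms coeff_eq_0 le_less_trans)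
  then have "map_poly (\<lambda>c. coeff c k) F = 0" by (intro poly_eqI) (simp add: coeff_map_poly)
  then show "coeff (poly F [:z:]) k = 0" by (simp add: coeff_poly_const)
qed

text \<open>The coefficients of t^a, collected over all powers of z, form a nonzero polynomial in z.
  Off its finitely many roots the specialisation at z has degree at least a.\<close>

lemma finite_degree_poly_const_less:
  assumes "degree (coeff F i) = a" "F \<noteq> 0" "coeff F i \<noteq> 0"
  shows "finite {z::real. degree (poly F [:z:]) < a \<or> poly F [:z:] = 0}"
proof -
  have "coeff (map_poly (\<lambda>c. coeff c a) F) i \<noteq> 0"
    using assms by (auto simp: coeff_map_poly)
  then have "map_poly (\<lambda>c. coeff c a) F \<noteq> 0" by auto
  then have "finite {z. poly (map_poly (\<lambda>c. coeff c a) F) z = 0}" by (rule poly_roots_finite)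
  then show ?thesis
    by (rule rev_finite_subset) (auto simp flip: coeff_poly_const simp: coeff_eq_0)
qed

text \<open>Specialise the outer variable at a generic z, where F keeps the degree of its
  coefficient \<open>i\<close> and the cofactor does not vanish. Degrees of products over a field
  add, and P specialised at z has degree at most a.\<close>

lemma dvd_inner_degree:
  fixes F P :: "real poly poly"
  assumes "F dvd P" "P \<noteq> 0" "\<And>i. degree (coeff P i) \<le> a"
  shows "degree (coeff F i) \<le> a"
proof (cases "coeff F i = 0")
  case False
  obtain G where G: "P = F * G" using assms by auto
  have FG: "F \<noteq> 0" "G \<noteq> 0" using assms G by auto
  have lc: "coeff G (degree G) \<noteq> 0" using FG by simp
  have "finite ({z::real. degree (poly F [:z:]) < degree (coeff F i) \<or> poly F [:z:] = 0} \<union>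
      {z::real. degree (poly G [:z:]) < degree (lead_coeff G) \<or> poly G [:z:] = 0})"
    by (intro finite_UnI finite_degree_poly_const_less[OF refl FG(1) False] finite_degree_poly_const_less[OF refl FG(2) lc])
  then obtain z :: real where "\<not> (degree (poly F [:z:]) < degree (coeff F i) \<or> poly F [:z:] = 0)" "poly G [:z:] \<noteq> 0"
    by (metis (mono_tags, lifting) UnCI ex_new_if_finite infinite_UNIV_char_0 mem_Collect_eq)
  then have "degree (coeff F i) \<le> degree (poly P [:z:])"
    by (simp add: G degree_mult_eq)
  also have "\<dots> \<le> a" by (rule degree_poly_const_le) (rule assms)
  finally show ?thesis .
qed auto

text \<open>Supplies the injectivity in \<open>elimination\<close>. For a = 0 the last hypothesis
  already kills V; otherwise a nonzero V would force inner degree at most a - 1 on F through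
  \<open>dvd_inner_degree\<close>.\<close>

lemma dvd_small_inner_degree:
  fixes F V :: "real poly poly"
  assumes "F dvd V" "coeff F i0 \<noteq> 0" "degree (coeff F i0) = a" "\<And>i j. j \<ge> a \<Longrightarrow> coeff (coeff V i) j = 0"
  shows "V = 0"
proof (rule ccontr)
  assume V: "V \<noteq> 0"
  then have "coeff (lead_coeff V) (degree (lead_coeff V)) \<noteq> 0" by simp
  then have a: "a > 0" using assms(4) by (metis gr0I le0)
  have "degree (coeff V i) \<le> a - 1" for i
    by (rule degree_le) (use assms(4) in auto)
  then have "degree (coeff F i0) \<le> a - 1" by (intro dvd_inner_degree[OF assms(1) V])
  then show False using assms a by simp
qed

section \<open>Elimination of a variable and a Bezout bound\<close>

lemma linear_dependence:
  fixes A :: "'j \<Rightarrow> 'i \<Rightarrow> real"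
  assumes "finite J" "finite I" "card J < card I"
  shows "\<exists>c. (\<exists>i\<in>I. c i \<noteq> 0) \<and> (\<forall>j\<in>J. (\<Sum>i\<in>I. A j i * c i) = 0)"
  using assms
proof (induction J arbitrary: I A rule: finite_induct)
  case empty
  then show ?case by (intro exI[of _ "\<lambda>_. 1"]) (auto simp: card_gt_0_iff)
next
  case (insert j J)
  show ?case
  proof (cases "\<forall>i\<in>I. A j i = 0")
    case True
    then show ?thesis using insert.IH[of I A] insert by auto
  next
    case False
    then obtain i0 where i0: "i0 \<in> I" "A j i0 \<noteq> 0" by auto
    define I' where "I' = I - {i0}"
    have I': "finite I'" "I = insert i0 I'" "i0 \<notin> I'" using i0 insert by (auto simp: I'_def)
    have "card J < card I'" using insert I' by auto
    \<comment> \<open>Equation \<open>j\<close> is solved for the unknown \<open>i0\<close> and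
      substituted into the other equations.\<close>
    from insert.IH[OF I'(1) this, of "\<lambda>k i. A k i - A k i0 * A j i / A j i0"]
    obtain c where c: "\<exists>i\<in>I'. c i \<noteq> 0"
      "\<forall>k\<in>J. (\<Sum>i\<in>I'. (A k i - A k i0 * A j i / A j i0) * c i) = 0" by blast
    define s where "s = (\<Sum>i\<in>I'. A j i * c i)"
    define c' where "c' = c(i0 := - s / A j i0)"
    have sum: "(\<Sum>i\<in>I. A k i * c' i) = - A k i0 * s / A j i0 + (\<Sum>i\<in>I'. A k i * c i)" for k
    proof -
      have "(\<Sum>i\<in>I'. A k i * c' i) = (\<Sum>i\<in>I'. A k i * c i)"
        using I' by (intro sum.cong) (auto simp: c'_def)
      then show ?thesis using I' by (simp add: c'_def)
    qed
    have "(\<Sum>i\<in>I. A k i * c' i) = 0" if "k \<in> insert j J" for k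
    proof (cases "k = j")
      case True
      then show ?thesis using i0 by (simp add: sum s_def[symmetric])
    next
      case False
      then have "(\<Sum>i\<in>I'. (A k i - A k i0 * A j i / A j i0) * c i) = 0" using c that by auto
      also have "(\<Sum>i\<in>I'. (A k i - A k i0 * A j i / A j i0) * c i) = (\<Sum>i\<in>I'. A k i * c i) - A k i0 / A j i0 * s"
        by (simp add: s_def sum_distrib_left sum_subtractf algebra_simps)
      finally show ?thesis by (simp add: sum)
    qed
    moreover have "\<exists>i\<in>I. c' i \<noteq> 0" using c(1) I' by (auto simp: c'_def)
    ultimately show ?thesis by blast
  qed
qed

text \<open>A resultant by counting dimensions. The unknowns are the coefficients of h in R[z] and
  of U, V with h + F U + Q V = 0, in degree boxes that leave more unknowns than equations. At a
  common zero of F and Q the relation reads h(z) = 0. If h were zero, F would divide Q V, hence V,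
  whose inner degree is too small; so V = 0 and U = 0.\<close>

lemma elimination:
  assumes cop: "coprime F Q" and F: "F \<noteq> 0"
    and F1: "degree F \<le> d" "\<And>i. degree (coeff F i) \<le> d"
    and Q1: "degree Q \<le> e" "\<And>i. degree (coeff Q i) \<le> e" and e: "e \<ge> 1"
  shows "\<exists>h::real poly. h \<noteq> 0 \<and> degree h \<le> 2 * d * e \<and>
     (\<forall>t z. ev F t z = 0 \<longrightarrow> ev Q t z = 0 \<longrightarrow> poly h z = 0)"
proof -
  \<comment> \<open>The exact inner degree of F, attained at \<open>i0\<close>. V below has inner
    degree less than a, so that \<open>F dvd V\<close> forces V = 0; a mere upper bound d would not
    give this.\<close>
  define a where "a = Max ((\<lambda>i. degree (coeff F i)) ` {i. coeff F i \<noteq> 0})"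
  have fin: "finite {i. coeff F i \<noteq> 0}"
    by (rule finite_subset[of _ "{..degree F}"]) (auto simp: le_degree)
  have ne: "{i. coeff F i \<noteq> 0} \<noteq> {}" using F leading_coeff_0_iff by blast
  have "a \<in> (\<lambda>i. degree (coeff F i)) ` {i. coeff F i \<noteq> 0}" unfolding a_def using fin ne by (intro Max_in) auto
  then obtain i0 where i0: "coeff F i0 \<noteq> 0" "degree (coeff F i0) = a" by auto
  have ale: "degree (coeff F i) \<le> a" for i
  proof (cases "coeff F i = 0")
    case False then show ?thesis unfolding a_def using fin by (intro Max_ge) auto
  qed auto
  have ad: "a \<le> d" using i0 F1 by metis
  \<comment> \<open>The unknowns exceed the equations by M - de - ae, which is at least 1 because a
    is at most d. The outer degree D only has to leave room for z^k with k < M and for the products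
    with F and Q.\<close>
  define M where "M = 2 * d * e + 1"
  define D where "D = M + d + e"
  define I where "I = {..<M} <+> ({..D - d} \<times> {..<e} <+> {..D - e} \<times> {..<a})"
  define J where "J = {..D} \<times> {..<a + e}"
  define mm where "mm = (\<lambda>p. case p of (i, j) \<Rightarrow> monom (monom (1::real) j) i)"
  define B where "B = case_sum (\<lambda>k. monom [:1::real:] k) (case_sum (\<lambda>p. F * mm p) (\<lambda>p. Q * mm p))"
  have finI: "finite I" "finite J" unfolding I_def J_def by auto
  have "card J = (D + 1) * (a + e)" unfolding J_def by (simp add: card_cartesian_product)
  also have "\<dots> < M + (e * (D - d + 1) + a * (D - e + 1))"
  proof -
    obtain x where x: "D = x + d" "x = M + e" unfolding D_def by auto
    obtain y where y: "D = y + e" "y = M + d" unfolding D_def by auto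
    have "(D + 1) * (a + e) = a * (D + 1) + e * (D + 1)" by (simp add: algebra_simps)
    also have "a * (D + 1) = a * y + a + a * e" unfolding y(1) by (simp add: algebra_simps)
    also have "e * (D + 1) = e * x + e + d * e" unfolding x(1) by (simp add: algebra_simps)
    finally have "(D + 1) * (a + e) = a * y + a + a * e + (e * x + e + d * e)" .
    moreover have "e * (D - d + 1) + a * (D - e + 1) = e * x + e + a * y + a"
    proof -
      have "D - d = x" "D - e = y" using x y by auto
      then show ?thesis by (simp add: algebra_simps)
    qed
    moreover have "a * e \<le> d * e" using ad by (rule mult_le_mono1)
    moreover have "M = d * e + d * e + 1" unfolding M_def by simp
    ultimately show ?thesis by linarith
  qed
  also have "\<dots> = card I" unfolding I_def
    by (simp add: card_Plus card_cartesian_product mult.commute)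
  finally have card: "card J < card I" .
  from linear_dependence[OF finI(2,1) card, of "\<lambda>p i. coeff (coeff (B i) (fst p)) (snd p)"]
  obtain c where c: "\<exists>i\<in>I. c i \<noteq> 0"
    "\<forall>j\<in>J. (\<Sum>i\<in>I. coeff (coeff (B i) (fst j)) (snd j) * c i) = 0" by blast
  define S where "S = (\<Sum>i\<in>I. smult [:c i:] (B i))"
  have cS: "coeff (coeff S m) n = (\<Sum>i\<in>I. coeff (coeff (B i) m) n * c i)" for m n
    by (simp add: S_def coeff_sum mult.commute)
  have inner_mm: "coeff (coeff (G * mm (i,j)) m) n = 0" 
    if "n \<ge> g + Suc j" "\<And>i. degree (coeff G i) \<le> g" for G i j m n g
  proof -
    have "coeff (G * mm (i,j)) m = (if m < i then 0 else coeff G (m - i) * monom 1 j)"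
      by (simp add: mm_def coeff_monom_mult mult.commute[of G] mult.commute[of "monom 1 j"])
    moreover have "coeff (coeff G (m - i) * monom 1 j) n = (if n < j then 0 else coeff (coeff G (m - i)) (n - j))"
      by (simp add: coeff_monom_mult mult.commute[of _ "monom 1 j"])
    moreover have "coeff (coeff G (m - i)) (n - j) = 0"
      using that(1) that(2)[of "m - i"] by (intro coeff_eq_0) linarith
    ultimately show ?thesis by simp
  qed
  have outer_mm: "degree (G * mm (i,j)) \<le> degree G + i" for G i j
    by (rule order_trans[OF degree_mult_le]) (simp add: mm_def degree_monom_le)
  have "coeff (coeff (B i) m) n = 0" if "i \<in> I" "m > D \<or> n \<ge> a + e" for i m n
    using that(1) unfolding I_def
  proof (elim PlusE)
    fix k assume k: "k \<in> {..<M}" "i = Inl k"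
    have "M < D" unfolding D_def using e by simp
    then show ?thesis using k that(2) e by (auto simp: B_def coeff_pCons split: nat.splits)
  next
    fix b p assume "b = Inl p" "p \<in> {..D - d} \<times> {..<e}" "i = Inr b"
    then obtain k j where p: "i = Inr (Inl (k,j))" "k \<le> D - d" "j < e" by auto
    from that(2) show ?thesis
    proof
      assume "m > D"
      moreover have "degree (F * mm (k,j)) \<le> D" using outer_mm[of F k j] F1 p unfolding D_def by simp
      ultimately have "coeff (F * mm (k,j)) m = 0" by (intro coeff_eq_0) simp
      then show ?thesis using p by (simp add: B_def)
    next
      assume "n \<ge> a + e" then show ?thesis using p by (simp add: B_def inner_mm[of a, OF _ ale])
    qed
  next
    fix b p assume "b = Inr p" "p \<in> {..D - e} \<times> {..<a}" "i = Inr b"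
    then obtain k j where p: "i = Inr (Inr (k,j))" "k \<le> D - e" "j < a" by auto
    from that(2) show ?thesis
    proof
      assume "m > D"
      moreover have "degree (Q * mm (k,j)) \<le> D" using outer_mm[of Q k j] Q1 p unfolding D_def by simp
      ultimately have "coeff (Q * mm (k,j)) m = 0" by (intro coeff_eq_0) simp
      then show ?thesis using p by (simp add: B_def)
    next
      assume "n \<ge> a + e" then show ?thesis using p by (simp add: B_def inner_mm[of e, OF _ Q1(2)])
    qed
  qed
  then have out: "coeff (coeff (B i) m) n = 0" if "i \<in> I" "(m, n) \<notin> J" for i m n
    using that by (auto simp: J_def not_le not_less)
  have "coeff (coeff S m) n = 0" for m n
  proof (cases "(m,n) \<in> J")
    case True
    then show ?thesis unfolding cS using c(2) by fastforce
  next
    case False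
    then show ?thesis unfolding cS using out by (simp add: sum.neutral)
  qed
  then have S0: "S = 0" by (intro poly_eqI) auto
  define h where "h = (\<Sum>k<M. monom (c (Inl k)) k)"
  define U where "U = (\<Sum>p\<in>{..D - d} \<times> {..<e}. smult [:c (Inr (Inl p)):] (mm p))"
  define V where "V = (\<Sum>p\<in>{..D - e} \<times> {..<a}. smult [:c (Inr (Inr p)):] (mm p))"
  have Seq: "S = (\<Sum>k<M. smult [:c (Inl k):] (monom [:1:] k)) + (F * U + Q * V)"
    unfolding S_def I_def by (subst sum.Plus, simp, simp, subst sum.Plus)
      (simp_all add: B_def U_def V_def sum_distrib_left)
  have evh: "ev (\<Sum>k<M. smult [:c (Inl k):] (monom [:1:] k)) t z = poly h z" for t z
    unfolding ev_def h_def poly_sum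
    by (simp add: poly_sum poly_monom poly_const_pow mult.commute)
  have coeff_mm: "coeff (coeff (\<Sum>p\<in>X \<times> Y. smult [:g p:] (mm p)) i) j = (if (i,j) \<in> X \<times> Y then g (i,j) else 0)"
    if "finite X" "finite Y" for X Y i j and g :: "nat \<times> nat \<Rightarrow> real"
  proof -
    have "coeff (coeff (\<Sum>p\<in>X \<times> Y. smult [:g p:] (mm p)) i) j = (\<Sum>p\<in>X \<times> Y. if p = (i,j) then g p else 0)"
      unfolding coeff_sum by (intro sum.cong) (auto simp: mm_def coeff_monom split: if_splits)
    also have "\<dots> = (if (i,j) \<in> X \<times> Y then g (i,j) else 0)"
      using that by (subst sum.delta) auto
    finally show ?thesis .
  qed
  have "h \<noteq> 0"
  proof
    assume h0: "h = 0"
    have ch: "coeff h k = c (Inl k)" if "k < M" for k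
      using that by (simp add: h_def coeff_sum)
    then have c1: "c (Inl k) = 0" if "k < M" for k using h0 that by simp
    then have FU: "F * U = - Q * V" using Seq S0 by (simp add: eq_neg_iff_add_eq_0)
    then have "F dvd Q * V" by (metis dvd_minus_iff dvd_triv_left minus_mult_left)
    then have "F dvd V" using cop by (simp add: coprime_dvd_mult_right_iff)
    then have V0: "V = 0"
      by (rule dvd_small_inner_degree[OF _ i0]) (simp add: V_def coeff_mm)
    then have U0: "U = 0" using FU F by simp
    have "c (Inr (Inl p)) = 0" if "p \<in> {..D - d} \<times> {..<e}" for p
      using coeff_mm[of "{..D - d}" "{..<e}" "\<lambda>p. c (Inr (Inl p))" "fst p" "snd p"] U0 that
      unfolding U_def by (auto split: if_splits)
    moreover have "c (Inr (Inr p)) = 0" if "p \<in> {..D - e} \<times> {..<a}" for p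
      using coeff_mm[of "{..D - e}" "{..<a}" "\<lambda>p. c (Inr (Inr p))" "fst p" "snd p"] V0 that
      unfolding V_def by (auto split: if_splits)
    ultimately show False using c(1) c1 unfolding I_def by (auto elim!: PlusE)
  qed
  moreover have "degree h \<le> 2 * d * e"
    unfolding h_def by (intro degree_sum_le) (auto simp: M_def intro: order_trans[OF degree_monom_le])
  moreover have "poly h z = 0" if "ev F t z = 0" "ev Q t z = 0" for t z
    using arg_cong[OF Seq, of "\<lambda>S. ev S t z"] that S0 by (simp add: evh)
  ultimately show ?thesis by blast
qed

text \<open>The shear z -> z + l t is an automorphism of the polynomial ring, with inverse given by
  -l, so common divisors correspond.\<close>

lemma coprime_pcompose:
  fixes F Q :: "real poly poly"
  assumes "coprime F Q" shows "coprime (pcompose F [:[:0, l:], 1:]) (pcompose Q [:[:0, l:], 1:])"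
proof (rule coprimeI)
  let ?s = "[:[:0, l:], 1:]" and ?r = "[:[:0, - l:], 1:]"
  have inv: "pcompose (pcompose X ?s) ?r = X" "pcompose (pcompose X ?r) ?s = X" for X :: "real poly poly"
    by (simp_all add: pcompose_assoc[symmetric] pcompose_pCons)
  have dvd: "pcompose A q dvd pcompose B q" if "A dvd B" for A B q :: "real poly poly"
    using that by (auto simp: dvd_def pcompose_mult)
  fix G assume "G dvd pcompose F ?s" "G dvd pcompose Q ?s"
  then have "pcompose G ?r dvd F" "pcompose G ?r dvd Q"
    using dvd inv by metis+
  then have "pcompose G ?r dvd 1" using assms coprime_common_divisor by blast
  then have "pcompose (pcompose G ?r) ?s dvd pcompose 1 ?s" by (rule dvd)
  then show "is_unit G" by (simp add: inv pcompose_1)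
qed

text \<open>After a generic shear the common zeros have distinct z coordinates, and these are roots
  of the eliminant. The factor 2 against the classical bound comes from using the two partial
  degrees in place of the total degree.\<close>

lemma bezout_bound:
  assumes cop: "coprime F Q" and F: "F \<noteq> 0" and td: "tdle F d" "tdle Q e" "e \<ge> 1"
    and S: "finite S" "\<And>t z. (t, z) \<in> S \<Longrightarrow> ev F t z = 0 \<and> ev Q t z = 0"
  shows "card S \<le> 2 * d * e"
proof -
  \<comment> \<open>Slopes of the chords of S. For two points with equal t the division by zero only
    excludes the harmless slope 0.\<close>
  have "finite ((\<lambda>(p, q). (snd p - snd q) / (fst p - fst q)) ` (S \<times> S))" using S by auto
  then obtain l where l: "l \<notin> (\<lambda>(p, q). (snd p - snd q) / (fst p - fst q)) ` (S \<times> S)"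
    using ex_new_if_finite[OF infinite_UNIV_char_0] by blast
  have inj: "inj_on (\<lambda>p. snd p - l * fst p) S"
  proof (rule inj_onI)
    fix p q assume pq: "p \<in> S" "q \<in> S" "snd p - l * fst p = snd q - l * fst q"
    have "fst p = fst q"
    proof (rule ccontr)
      assume "fst p \<noteq> fst q"
      then have "l = (snd p - snd q) / (fst p - fst q)" using pq by (simp add: field_simps)
      then show False using l pq by force
    qed
    then show "p = q" using pq by (simp add: prod_eq_iff)
  qed
  let ?s = "[:[:0, l:], 1:] :: real poly poly"
  have q1: "tdle ?s 1" by (auto simp: tdle_def coeff_pCons split: nat.splits)
  have td': "tdle (pcompose F ?s) d" "tdle (pcompose Q ?s) e"
    using tdle_pcompose[OF q1] td by auto
  have F0: "pcompose F ?s \<noteq> 0" using F by (simp add: pcompose_eq_0_iff)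
  obtain h :: "real poly" where h: "h \<noteq> 0" "degree h \<le> 2 * d * e"
    "\<And>t z. ev (pcompose F ?s) t z = 0 \<Longrightarrow> ev (pcompose Q ?s) t z = 0 \<Longrightarrow> poly h z = 0"
    using elimination[OF coprime_pcompose[OF cop, of l] F0 tdle_degree[OF td'(1)] tdle_degree_coeff[OF td'(1)]
       tdle_degree[OF td'(2)] tdle_degree_coeff[OF td'(2)] td(3)] by blast
  have "poly h (snd p - l * fst p) = 0" if "p \<in> S" for p
    using S(2)[of "fst p" "snd p"] that by (intro h(3)[of "fst p"]) (auto simp: ev_pcompose)
  then have "(\<lambda>p. snd p - l * fst p) ` S \<subseteq> {z. poly h z = 0}" by blast
  then have "card ((\<lambda>p. snd p - l * fst p) ` S) \<le> card {z. poly h z = 0}"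
    using poly_roots_finite[OF h(1)] by (intro card_mono)
  also have "\<dots> \<le> degree h" using h(1) by (rule card_poly_roots_bound)
  finally show ?thesis using h(2) by (simp add: card_image[OF inj])
qed

text \<open>A prime dividing two members of the pencil would divide a unit, so each of the finitely
  many prime factors of F spoils at most one parameter. It serves to choose a boundary without
  common component with F in \<open>arcs_successor\<close>.\<close>

lemma ex_coprime_pencil:
  fixes F :: "real poly poly" and G :: "real \<Rightarrow> real poly poly"
  assumes "F \<noteq> 0" "infinite C" "\<And>c c'. c \<in> C \<Longrightarrow> c' \<in> C \<Longrightarrow> c \<noteq> c' \<Longrightarrow> is_unit (G c - G c')"
  shows "\<exists>c\<in>C. coprime F (G c)"
proof (rule ccontr)
  assume nt: "\<not> (\<exists>c\<in>C. coprime F (G c))"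
  then have "\<exists>p. p \<in> prime_factors F \<and> p dvd G c" if c: "c \<in> C" for c
  proof -
    have "\<not> coprime F (G c)" using nt c by blast
    then obtain g where g: "g dvd F" "g dvd G c" "\<not> is_unit g" unfolding coprime_def by blast
    then have "g \<noteq> 0" using assms by auto
    then obtain p where "prime p" "p dvd g" using g prime_divisor_exists by blast
    then show ?thesis using g assms by (metis dvd_trans prime_factorsI)
  qed
  then obtain p where p: "\<And>c. c \<in> C \<Longrightarrow> p c \<in> prime_factors F" "\<And>c. c \<in> C \<Longrightarrow> p c dvd G c" by metis
  have "inj_on p C"
  proof (rule inj_onI, rule ccontr)
    fix c c' assume cc: "c \<in> C" "c' \<in> C" "p c = p c'" "c \<noteq> c'"
    then have "p c dvd G c - G c'" using p by (metis dvd_diff)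
    then have "is_unit (p c)" using assms(3) cc dvd_trans by blast
    moreover have "prime (p c)" using p cc by blast
    ultimately show False using not_prime_unit by blast
  qed
  moreover have "p ` C \<subseteq> prime_factors F" using p by auto
  ultimately show False using assms(2) using finite_imageD[of p C] finite_subset[of "p ` C"] by blast
qed

text \<open>The squarefree part of \<^term>\<open>P\<close> with the factors depending on the base variable alone removed.\<close>

lemma squarefree_part:
  fixes P :: "real poly poly"
  assumes P: "P \<noteq> 0" "tdle P d"
  obtains F where "F \<noteq> 0" "coprime F (pderiv F)" "tdle F (2 * d)"
    "\<And>t z. ev P t z = 0 \<Longrightarrow> ev F t z = 0 \<or> (\<forall>z. ev P t z = 0)"
proof -
  \<comment> \<open>The prime factors of degree 0 in z are polynomials in t alone. Their zeros are
    vertical lines, which are no graphs over t and are left to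
    \<open>vertical_successor\<close>.\<close>
  define A where "A = {p \<in> prime_factors P. degree p > 0}"
  have finA: "finite A" unfolding A_def by auto
  have primeA: "prime p" if "p \<in> A" for p using that unfolding A_def by auto
  define F where "F = \<Prod>A"
  have F0: "F \<noteq> 0" unfolding F_def using finA primeA not_prime_0 by (metis prod_zero_iff)
  have PF: "prod_mset (prime_factorization P) dvd P" "P dvd prod_mset (prime_factorization P)"
    using prod_mset_prime_factorization_weak[OF P(1)] by (metis associatedD1 associatedD2)+
  have FP: "F dvd P"
  proof -
    have "mset_set A \<subseteq># prime_factorization P"
      using finA by (simp add: subseteq_mset_def count_mset_set' A_def Suc_le_eq)
    then have "prod_mset (mset_set A) dvd prod_mset (prime_factorization P)" by (rule prod_mset_subset_imp_dvd)
    moreover have "prod_mset (mset_set A) = F" by (simp add: F_def prod_unfold_prod_mset)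
    ultimately show ?thesis using PF(1) by (metis dvd_trans)
  qed
  have "coprime F (pderiv F)"
  proof (rule ccontr)
    assume "\<not> coprime F (pderiv F)"
    then obtain g where g: "g dvd F" "g dvd pderiv F" "\<not> is_unit g" unfolding coprime_def by blast
    then have "g \<noteq> 0" using F0 by auto
    then obtain q where q: "prime q" "q dvd g" using g prime_divisor_exists by blast
    then have qF: "q dvd F" "q dvd pderiv F" using g dvd_trans by blast+
    then obtain p where p: "p \<in> A" "q dvd p" unfolding F_def using q finA by (metis prime_dvd_prod_iff)
    then have qp: "q = p" using q primeA by (metis primes_dvd_imp_eq)
    define R where "R = \<Prod>(A - {p})"
    have FR: "F = p * R" unfolding F_def R_def using p finA by (simp add: prod.remove)
    have "\<not> p dvd R"
    proof
      assume "p dvd R"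
      then obtain p' where "p' \<in> A - {p}" "p dvd p'" unfolding R_def
        using p primeA finA by (metis finite_Diff prime_dvd_prod_iff)
      then show False using p primeA primes_dvd_imp_eq by (metis Diff_iff singletonI)
    qed
    moreover have "p dvd pderiv p * R"
    proof -
      have "p dvd p * pderiv R + R * pderiv p" using qF qp FR by (simp add: pderiv_mult)
      then show ?thesis by (metis dvd_add_right_iff dvd_triv_left mult.commute)
    qed
    ultimately have "p dvd pderiv p" using p primeA by (metis prime_dvd_mult_iff)
    \<comment> \<open>Positive degree and characteristic zero enter here: p cannot divide its own
      derivative, which is nonzero and of smaller degree.\<close>
    moreover have "pderiv p \<noteq> 0" using p by (simp add: pderiv_eq_0_iff A_def)
    ultimately have "degree p \<le> degree (pderiv p)" by (rule dvd_imp_degree_le)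
    moreover have "degree p > 0" using p by (simp add: A_def)
    ultimately show False by (simp add: degree_pderiv)
  qed
  \<comment> \<open>Divisibility is used for the two partial degrees separately, each at most d,
    which gives total degree 2d. This is the origin of the \<open>2 * d\<close> in
    \<open>curve_pairing\<close>.\<close>
  moreover have "tdle F (2 * d)"
  proof -
    have "degree F \<le> d" using FP P tdle_degree by (meson dvd_imp_degree_le order_trans)
    moreover have "degree (coeff F i) \<le> d" for i
      using dvd_inner_degree[OF FP P(1) tdle_degree_coeff[OF P(2)]] .
    ultimately show ?thesis using tdleI[of F d d] by (simp add: mult_2)
  qed
  moreover have "ev F t z = 0 \<or> (\<forall>z. ev P t z = 0)" if 0: "ev P t z = 0" for t z
  proof -
    have evprod: "ev (prod_mset X) t z = 0 \<Longrightarrow> \<exists>p\<in>#X. ev p t z = 0" for X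
    proof (induction X)
      case empty
      then show ?case by (simp add: ev_def)
    qed auto
    have "ev (prod_mset (prime_factorization P)) t z = 0" using 0 PF(2) by (metis dvdE ev_mult mult_zero_left)
    then obtain p where p: "p \<in> prime_factors P" "ev p t z = 0" using evprod by blast
    show ?thesis
    proof (cases "degree p > 0")
      case True
      then have "p dvd F" unfolding F_def A_def using p by (intro dvd_prodI) auto
      then show ?thesis using p by (metis dvdE ev_mult mult_zero_left)
    next
      case False
      then obtain c where c: "p = [:c:]" by (metis degree_eq_zeroE gr0I)
      obtain G where "P = p * G" using p by (metis dvdE in_prime_factors_imp_dvd)
      then have "\<forall>z. ev P t z = 0" using p c by (simp add: c)
      then show ?thesis by blast
    qed
  qed
  ultimately show ?thesis using F0 that by blast
qed

text \<open>On a vertical line inside the zero set all coefficients in z vanish at t, in particular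
  the leading one, which has at most d roots.\<close>

lemma finite_vertical:
  assumes "P \<noteq> 0" "tdle P d"
  shows "finite {t. \<forall>z. ev P t z = 0}" "card {t. \<forall>z. ev P t z = 0} \<le> d"
proof -
  have sub: "{t. \<forall>z. ev P t z = 0} \<subseteq> {t. poly (lead_coeff P) t = 0}"
  proof safe
    fix t assume "\<forall>z. ev P t z = 0"
    moreover have "ev P t z = poly (map_poly (\<lambda>c. poly c t) P) z" for z
      by (induction P) (auto simp: map_poly_pCons)
    ultimately have "map_poly (\<lambda>c. poly c t) P = 0" by (metis poly_all_0_iff_0)
    then show "poly (lead_coeff P) t = 0" by (metis coeff_0 coeff_map_poly poly_0)
  qed
  have lc: "lead_coeff P \<noteq> 0" using assms by simp
  note f = poly_roots_finite[OF lc]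
  show "finite {t. \<forall>z. ev P t z = 0}" using sub f by (rule finite_subset)
  have "card {t. \<forall>z. ev P t z = 0} \<le> card {t. poly (lead_coeff P) t = 0}" using sub f by (intro card_mono)
  also have "\<dots> \<le> degree (lead_coeff P)" using lc by (rule card_poly_roots_bound)
  also have "\<dots> \<le> d" using tdle_degree_coeff[OF assms(2)] .
  finally show "card {t. \<forall>z. ev P t z = 0} \<le> d" .
qed

lemma ev_line: "poly (poly F [:b, a:]) t = ev F t (b + a * t)"
  by (induction F) (auto simp: algebra_simps)

lemma degree_poly_line: "tdle F d \<Longrightarrow> degree (poly F [:b, a:]) \<le> d"
proof (induction F arbitrary: d)
  case (pCons c F)
  note p = tdle_pCons[OF pCons.prems]
  show ?case
  proof (cases "F = 0")
    case False
    have "degree ([:b, a:] * poly F [:b, a:]) \<le> 1 + (d - 1)"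
      by (rule order_trans[OF degree_mult_le add_mono]) (use pCons.IH[OF p(3)] in auto)
    then show ?thesis using p(1) p(2)[OF False] by (simp add: degree_add_le)
  qed (use p in simp)
qed auto

text \<open>A line z = b + a t inside the curve makes b + a t a root of F, regarded as a polynomial
  over R[t].\<close>

lemma finite_lines_in_curve:
  assumes "F \<noteq> 0" shows "finite {b. poly F [:b, a::real:] = 0}"
proof -
  have "finite {q. poly F q = 0}" using assms by (rule poly_roots_finite)
  then have "finite ((\<lambda>b. [:b, a:]) -` {q. poly F q = 0})"
    by (rule finite_vimageI) (auto simp: inj_on_def)
  then show ?thesis by (simp add: vimage_def)
qed

subsection \<open>Lines separating pairs of points\<close>

definition lin :: "real^3 \<Rightarrow> real^2 \<Rightarrow> real" where "lin \<xi> v = \<xi> \<bullet> lift_dir v"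

lemma lin_eq: "lin \<xi> v = \<xi> $ 1 * v $ 1 + \<xi> $ 2 * v $ 2 + \<xi> $ 3"
  by (simp add: lin_def lift_dir_def inner_vec_def sum_3)

lemma lin_convex: "lin \<xi> ((1 - u) *\<^sub>R v + u *\<^sub>R v') = (1 - u) * lin \<xi> v + u * lin \<xi> v'"
  by (simp add: lin_eq algebra_simps)

text \<open>The value 0 counts as negative. This convention matters only for a null set of
  \<xi>.\<close>

definition sep :: "real^3 \<Rightarrow> real^2 \<Rightarrow> real^2 \<Rightarrow> bool" where
  "sep \<xi> p q \<longleftrightarrow> (lin \<xi> p > 0) \<noteq> (lin \<xi> q > 0)"

text \<open>Adding \<open>i\<close> doubles only those patterns that occur with both truth values of
  Q: this is |X| + |Y| = |X \<union> Y| + |X \<inter> Y|.\<close>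

lemma card_split_patterns:
  assumes "finite S" and i: "\<And>s. s \<in> S \<Longrightarrow> i \<notin> pat s"
  shows "card ((\<lambda>s. if Q s then insert i (pat s) else pat s) ` S) \<le>
    card (pat ` S) + card {\<sigma>. \<exists>s\<in>S. \<exists>s'\<in>S. pat s = \<sigma> \<and> pat s' = \<sigma> \<and> Q s \<and> \<not> Q s'}"
proof -
  let ?X = "pat ` {s \<in> S. Q s}" and ?Y = "pat ` {s \<in> S. \<not> Q s}"
  have "(\<lambda>s. if Q s then insert i (pat s) else pat s) ` S \<subseteq> insert i ` ?X \<union> ?Y" by auto
  then have "card ((\<lambda>s. if Q s then insert i (pat s) else pat s) ` S) \<le> card (insert i ` ?X \<union> ?Y)"
    using assms by (intro card_mono) auto
  also have "\<dots> \<le> card (insert i ` ?X) + card ?Y" by (rule card_Un_le)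
  also have "\<dots> \<le> card ?X + card ?Y" using assms by (simp add: card_image_le)
  also have "\<dots> = card (?X \<union> ?Y) + card (?X \<inter> ?Y)" using assms by (intro card_Un_Int) auto
  also have "?X \<union> ?Y = pat ` S" by auto
  also have "?X \<inter> ?Y = {\<sigma>. \<exists>s\<in>S. \<exists>s'\<in>S. pat s = \<sigma> \<and> pat s' = \<sigma> \<and> Q s \<and> \<not> Q s'}" by auto
  finally show ?thesis .
qed

lemma convex_pos: assumes "0 \<le> u" "u \<le> 1" "x \<noteq> 0" "y \<noteq> 0" "(x > 0) = (y > (0::real))"
  shows "(1 - u) * x + u * y \<noteq> 0 \<and> ((1 - u) * x + u * y > 0 \<longleftrightarrow> x > 0)"
proof (cases "x > 0")
  case True
  then have "y > 0" using assms by simp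
  have "(1 - u) * x + u * y > 0"
  proof (cases "u = 1")
    case False
    then have "(1 - u) * x > 0" using assms True by simp
    then show ?thesis using assms \<open>y > 0\<close> by (simp add: add_pos_nonneg)
  qed (use \<open>y > 0\<close> in simp)
  then show ?thesis using True by simp
next
  case False
  then have "x < 0" "y < 0" using assms by auto
  have "(1 - u) * x + u * y < 0"
  proof (cases "u = 1")
    case False
    then have "(1 - u) * x < 0" using assms \<open>x < 0\<close> by (simp add: mult_pos_neg)
    moreover have "u * y \<le> 0" using assms \<open>y < 0\<close> by (simp add: mult_nonneg_nonpos)
    ultimately show ?thesis by simp
  qed (use \<open>y < 0\<close> in simp)
  then show ?thesis using \<open>x < 0\<close> by simp
qed

lemma convex_zero: assumes "x > 0" "y < (0::real)"
  obtains u where "0 \<le> u" "u \<le> 1" "(1 - u) * x + u * y = 0"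
proof
  show "0 \<le> x / (x - y)" "x / (x - y) \<le> 1" "(1 - x / (x - y)) * x + x / (x - y) * y = 0"
    using assms by (auto simp: field_simps)
qed

text \<open>The points -b/a cut the line into intervals. A new point can split only the one old
  pattern in which it lies itself, so each point adds at most 1.\<close>

lemma card_line_patterns:
  fixes a b :: "'i \<Rightarrow> real"
  assumes "finite I" "finite S" "\<And>i s. i \<in> I \<Longrightarrow> s \<in> S \<Longrightarrow> a i * s + b i \<noteq> 0"
  shows "card ((\<lambda>s. {i\<in>I. a i * s + b i > 0}) ` S) \<le> card I + 1"
  using assms
proof (induction I rule: finite_induct)
  case empty
  have "(\<lambda>s. {i \<in> {}. a i * s + b i > 0}) ` S \<subseteq> {{}}" by auto
  then show ?case by (rule order_trans[OF card_mono, rotated]) auto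
next
  case (insert i I)
  let ?pat = "\<lambda>s. {j\<in>I. a j * s + b j > 0}"
  let ?Q = "\<lambda>s. a i * s + b i > 0"
  have eq: "(\<lambda>s. {j\<in>insert i I. a j * s + b j > 0}) = (\<lambda>s. if ?Q s then insert i (?pat s) else ?pat s)"
    by (rule ext) auto
  have "{\<sigma>. \<exists>s\<in>S. \<exists>s'\<in>S. ?pat s = \<sigma> \<and> ?pat s' = \<sigma> \<and> ?Q s \<and> \<not> ?Q s'} \<subseteq> {?pat (- b i / a i)}"
  proof (rule subsetI, elim CollectE bexE conjE)
    fix \<sigma> s s' assume s: "s \<in> S" "s' \<in> S" "?pat s = \<sigma>" "?pat s' = \<sigma>" "?Q s" "\<not> ?Q s'"
    have "a i * s' + b i < 0" using insert.prems(2)[of i s'] s(2,6) by auto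
    with s(5) obtain u where u: "0 \<le> u" "u \<le> 1" "(1 - u) * (a i * s + b i) + u * (a i * s' + b i) = 0"
      by (rule convex_zero)
    have "a i \<noteq> 0" using s(5,6) by auto
    have x0: "(1 - u) * s + u * s' = - b i / a i"
      using u(3) \<open>a i \<noteq> 0\<close> by (simp add: field_simps)
    have "a j * (- b i / a i) + b j = (1 - u) * (a j * s + b j) + u * (a j * s' + b j)" for j
      unfolding x0[symmetric] by (simp add: algebra_simps)
    moreover have "(1 - u) * (a j * s + b j) + u * (a j * s' + b j) > 0 \<longleftrightarrow> a j * s + b j > 0" if "j \<in> I" for j
    proof -
      have "(a j * s + b j > 0) = (a j * s' + b j > 0)" using s(3,4) that by blast
      then show ?thesis
        using convex_pos[of u "a j * s + b j" "a j * s' + b j"] u insert.prems(2)[of j] s(1,2) that by auto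
    qed
    ultimately have "?pat s = ?pat (- b i / a i)" by auto
    then show "\<sigma> \<in> {?pat (- b i / a i)}" using s(3) by blast
  qed
  then have "card {\<sigma>. \<exists>s\<in>S. \<exists>s'\<in>S. ?pat s = \<sigma> \<and> ?pat s' = \<sigma> \<and> ?Q s \<and> \<not> ?Q s'} \<le> 1"
    by (rule order_trans[OF card_mono, rotated]) auto
  moreover have "card (?pat ` S) \<le> card I + 1" using insert by auto
  moreover have "card ((\<lambda>s. if ?Q s then insert i (?pat s) else ?pat s) ` S) \<le> card (?pat ` S) +
      card {\<sigma>. \<exists>s\<in>S. \<exists>s'\<in>S. ?pat s = \<sigma> \<and> ?pat s' = \<sigma> \<and> ?Q s \<and> \<not> ?Q s'}"
    by (rule card_split_patterns) (use insert in auto)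
  ultimately show ?case unfolding eq using insert by simp
qed

text \<open>The induction for line arrangements: a new line splits at most as many cells as the
  pieces into which the other r lines cut it, at most r + 1 by
  \<open>card_line_patterns\<close>.\<close>

lemma card_plane_patterns:
  assumes "finite \<Xi>" "finite V" "\<And>\<xi> v. \<xi> \<in> \<Xi> \<Longrightarrow> v \<in> V \<Longrightarrow> lin \<xi> v \<noteq> 0"
  shows "card ((\<lambda>v. {\<xi>\<in>\<Xi>. lin \<xi> v > 0}) ` V) \<le> 1 + card \<Xi> + (card \<Xi>)\<^sup>2"
  using assms
proof (induction \<Xi> rule: finite_induct)
  case empty
  have "(\<lambda>v. {\<xi> \<in> {}. lin \<xi> v > 0}) ` V \<subseteq> {{}}" by auto
  then have "card ((\<lambda>v. {\<xi> \<in> {}. lin \<xi> v > 0}) ` V) \<le> card {{}::(real^3) set}" by (intro card_mono) auto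
  then show ?case by simp
next
  case (insert \<xi>0 \<Xi>)
  let ?pat = "\<lambda>v. {\<xi>\<in>\<Xi>. lin \<xi> v > 0}"
  let ?Q = "\<lambda>v. lin \<xi>0 v > 0"
  let ?T = "{\<sigma>. \<exists>s\<in>V. \<exists>s'\<in>V. ?pat s = \<sigma> \<and> ?pat s' = \<sigma> \<and> ?Q s \<and> \<not> ?Q s'}"
  have finT: "finite ?T" by (rule finite_subset[of _ "Pow \<Xi>"]) (use insert in auto)
  have ex: "\<exists>u. lin \<xi>0 u = 0 \<and> ?pat u = \<sigma> \<and> (\<forall>\<xi>\<in>\<Xi>. lin \<xi> u \<noteq> 0) \<and> (\<xi>0 $ 1 \<noteq> 0 \<or> \<xi>0 $ 2 \<noteq> 0)" if "\<sigma> \<in> ?T" for \<sigma>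
  proof -
    from that obtain s s' where s: "s \<in> V" "s' \<in> V" "?pat s = \<sigma>" "?pat s' = \<sigma>" "?Q s" "\<not> ?Q s'" by blast
    have "lin \<xi>0 s' < 0" using insert.prems(2)[of \<xi>0 s'] s(2,6) by auto
    \<comment> \<open>The segment between two points of one cell on opposite sides of
      \<open>\<xi>0\<close> crosses this line inside the cell, by convexity. So every split pattern
      is realised on the line.\<close>
    with s(5) obtain u where u: "0 \<le> u" "u \<le> 1" "(1 - u) * lin \<xi>0 s + u * lin \<xi>0 s' = 0"
      by (rule convex_zero)
    have pos: "lin \<xi> ((1 - u) *\<^sub>R s + u *\<^sub>R s') \<noteq> 0 \<and> (lin \<xi> ((1 - u) *\<^sub>R s + u *\<^sub>R s') > 0 \<longleftrightarrow> lin \<xi> s > 0)" if "\<xi> \<in> \<Xi>" for \<xi>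
    proof -
      have "(lin \<xi> s > 0) = (lin \<xi> s' > 0)" using s that by blast
      then show ?thesis unfolding lin_convex
        using convex_pos[of u "lin \<xi> s" "lin \<xi> s'"] u insert.prems(2) s that by blast
    qed
    have "\<xi>0 $ 1 \<noteq> 0 \<or> \<xi>0 $ 2 \<noteq> 0" using s(5,6) by (auto simp: lin_eq)
    moreover have "lin \<xi>0 ((1 - u) *\<^sub>R s + u *\<^sub>R s') = 0" using u(3) by (simp add: lin_convex)
    moreover have "?pat ((1 - u) *\<^sub>R s + u *\<^sub>R s') = \<sigma>" using pos s(3) by blast
    ultimately show ?thesis using pos by blast
  qed
  have "card ?T \<le> card \<Xi> + 1"
  proof (cases "?T = {}")
    case False
    define U where "U = (\<lambda>\<sigma>. SOME u. lin \<xi>0 u = 0 \<and> ?pat u = \<sigma> \<and> (\<forall>\<xi>\<in>\<Xi>. lin \<xi> u \<noteq> 0) \<and> (\<xi>0 $ 1 \<noteq> 0 \<or> \<xi>0 $ 2 \<noteq> 0))"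
    have U': "lin \<xi>0 (U \<sigma>) = 0 \<and> ?pat (U \<sigma>) = \<sigma> \<and> (\<forall>\<xi>\<in>\<Xi>. lin \<xi> (U \<sigma>) \<noteq> 0) \<and> (\<xi>0 $ 1 \<noteq> 0 \<or> \<xi>0 $ 2 \<noteq> 0)"
      if "\<sigma> \<in> ?T" for \<sigma> unfolding U_def by (rule someI_ex) (rule ex[OF that])
    have U: "\<And>\<sigma>. \<sigma> \<in> ?T \<Longrightarrow> lin \<xi>0 (U \<sigma>) = 0" "\<And>\<sigma>. \<sigma> \<in> ?T \<Longrightarrow> ?pat (U \<sigma>) = \<sigma>"
       "\<And>\<sigma> \<xi>. \<sigma> \<in> ?T \<Longrightarrow> \<xi> \<in> \<Xi> \<Longrightarrow> lin \<xi> (U \<sigma>) \<noteq> 0" using U' by blast+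
    from False obtain \<sigma>0 where \<sigma>0: "\<sigma>0 \<in> ?T" by blast
    have nz: "\<xi>0 $ 1 \<noteq> 0 \<or> \<xi>0 $ 2 \<noteq> 0" using ex[OF \<sigma>0] by blast
    define x y where "x = \<xi>0 $ 1" and "y = \<xi>0 $ 2"
    define D where "D = x\<^sup>2 + y\<^sup>2"
    have D: "D > 0" using nz unfolding D_def x_def y_def by (auto simp: add_pos_nonneg add_nonneg_pos)
    \<comment> \<open>The coordinate along the line \<open>\<xi>0\<close> in direction (-y, x), with
      origin at the sample point of \<open>\<sigma>0\<close>. In it every \<open>lin \<xi>\<close>
      is affine.\<close>
    define s where "s = (\<lambda>\<sigma>. (- y * (U \<sigma> $ 1 - U \<sigma>0 $ 1) + x * (U \<sigma> $ 2 - U \<sigma>0 $ 2)) / D)"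
    define a where "a = (\<lambda>\<xi>::real^3. \<xi> $ 2 * x - \<xi> $ 1 * y)"
    define b where "b = (\<lambda>\<xi>. lin \<xi> (U \<sigma>0))"
    have lin_s: "lin \<xi> (U \<sigma>) = a \<xi> * s \<sigma> + b \<xi>" if \<sigma>: "\<sigma> \<in> ?T" for \<xi> \<sigma>
    proof -
      define p q where "p = U \<sigma> $ 1 - U \<sigma>0 $ 1" and "q = U \<sigma> $ 2 - U \<sigma>0 $ 2"
      have 0: "x * p + y * q = 0"
        using U(1)[OF \<sigma>] U(1)[OF \<sigma>0] unfolding lin_eq p_def q_def x_def y_def by (simp add: algebra_simps)
      have "D * p = - y * (- y * p + x * q)"
      proof -
        have "D * p - (- y * (- y * p + x * q)) = x * (x * p + y * q)" unfolding D_def power2_eq_square by (simp add: algebra_simps)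
        then show ?thesis using 0 by simp
      qed
      then have p: "p = - y * s \<sigma>" unfolding s_def p_def[symmetric] q_def[symmetric] using D by (simp add: field_simps)
      have "D * q = x * (- y * p + x * q)"
      proof -
        have "D * q - x * (- y * p + x * q) = y * (x * p + y * q)" unfolding D_def power2_eq_square by (simp add: algebra_simps)
        then show ?thesis using 0 by simp
      qed
      then have q: "q = x * s \<sigma>" unfolding s_def p_def[symmetric] q_def[symmetric] using D by (simp add: field_simps)
      have "lin \<xi> (U \<sigma>) = \<xi> $ 1 * p + \<xi> $ 2 * q + lin \<xi> (U \<sigma>0)"
        by (simp add: lin_eq p_def q_def algebra_simps)
      then show ?thesis unfolding a_def b_def p q by (simp add: algebra_simps)
    qed
    have "?T \<subseteq> (\<lambda>s. {\<xi>\<in>\<Xi>. a \<xi> * s + b \<xi> > 0}) ` (s ` ?T)"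
    proof
      fix \<sigma> assume \<sigma>: "\<sigma> \<in> ?T"
      have "\<sigma> = {\<xi>\<in>\<Xi>. a \<xi> * s \<sigma> + b \<xi> > 0}" using U(2)[OF \<sigma>] lin_s[OF \<sigma>] by simp
      then show "\<sigma> \<in> (\<lambda>s. {\<xi>\<in>\<Xi>. a \<xi> * s + b \<xi> > 0}) ` (s ` ?T)" using \<sigma> by blast
    qed
    then have "card ?T \<le> card ((\<lambda>s. {\<xi>\<in>\<Xi>. a \<xi> * s + b \<xi> > 0}) ` (s ` ?T))"
      using finT by (intro card_mono) auto
    also have "\<dots> \<le> card \<Xi> + 1"
    proof (rule card_line_patterns[OF insert.hyps(1)])
      show "finite (s ` ?T)" using finT by blast
      fix \<xi> r assume "\<xi> \<in> \<Xi>" "r \<in> s ` ?T"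
      then obtain \<sigma> where "\<sigma> \<in> ?T" "r = s \<sigma>" by blast
      then show "a \<xi> * r + b \<xi> \<noteq> 0" using U(3)[OF \<open>\<sigma> \<in> ?T\<close> \<open>\<xi> \<in> \<Xi>\<close>] lin_s[OF \<open>\<sigma> \<in> ?T\<close>] by simp
    qed
    finally show ?thesis .
  next
    case True
    then show ?thesis by (metis card.empty le0)
  qed
  moreover have "card (?pat ` V) \<le> 1 + card \<Xi> + (card \<Xi>)\<^sup>2" using insert by auto
  moreover have "card ((\<lambda>v. if ?Q v then insert \<xi>0 (?pat v) else ?pat v) ` V) \<le> card (?pat ` V) + card ?T"
    by (rule card_split_patterns) (use insert in auto)
  moreover have eq: "(\<lambda>v. {\<xi>\<in>insert \<xi>0 \<Xi>. lin \<xi> v > 0}) = (\<lambda>v. if ?Q v then insert \<xi>0 (?pat v) else ?pat v)"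
    by (rule ext) auto
  ultimately have "card ((\<lambda>v. {\<xi>\<in>insert \<xi>0 \<Xi>. lin \<xi> v > 0}) ` V) \<le> 1 + card \<Xi> + (card \<Xi>)\<^sup>2 + (card \<Xi> + 1)"
    unfolding eq by linarith
  then show ?case using insert.hyps by (simp add: power2_eq_square del: insert_iff)
qed

text \<open>Derandomised choice of separating lines: each new line separates a fraction \<open>s\<close> of the
  pairs not yet separated.\<close>

lemma card_le_of_separating_lines:
  assumes V: "finite V" and s: "0 \<le> s" "s \<le> 1"
    and G: "\<And>\<xi> v. \<xi> \<in> G \<Longrightarrow> v \<in> V \<Longrightarrow> lin \<xi> v \<noteq> 0"
    and H: "\<And>U. U \<subseteq> V \<times> V \<Longrightarrow> (\<forall>p\<in>U. fst p \<noteq> snd p) \<Longrightarrow> U \<noteq> {} \<Longrightarrow>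
       \<exists>\<xi>\<in>G. real (card {p\<in>U. sep \<xi> (fst p) (snd p)}) \<ge> s * real (card U)"
    and r: "(1 - s) ^ r * (real (card V))\<^sup>2 < 1"
  shows "card V \<le> 1 + r + r\<^sup>2"
proof -
  define Usep where "Usep = (\<lambda>\<Xi>. {p\<in>V \<times> V. fst p \<noteq> snd p \<and> (\<forall>\<xi>\<in>\<Xi>. \<not> sep \<xi> (fst p) (snd p))})"
  have finUs: "finite (Usep \<Xi>)" for \<Xi> unfolding Usep_def using V by simp
  have "\<exists>\<Xi>. finite \<Xi> \<and> \<Xi> \<subseteq> G \<and> card \<Xi> \<le> k \<and> real (card (Usep \<Xi>)) \<le> (1 - s) ^ k * (real (card V))\<^sup>2" for k
  proof (induction k)
    case 0
    have "card (Usep {}) \<le> card (V \<times> V)" using V by (intro card_mono) (auto simp: Usep_def)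
    then have "real (card (Usep {})) \<le> (real (card V))\<^sup>2"
      by (simp add: card_cartesian_product power2_eq_square flip: of_nat_mult)
    then show ?case by (intro exI[of _ "{}"]) auto
  next
    case (Suc k)
    then obtain \<Xi> where \<Xi>: "finite \<Xi>" "\<Xi> \<subseteq> G" "card \<Xi> \<le> k" "real (card (Usep \<Xi>)) \<le> (1 - s) ^ k * (real (card V))\<^sup>2"
      by blast
    show ?case
    proof (cases "Usep \<Xi> = {}")
      case True
      then show ?thesis using \<Xi> s by (intro exI[of _ \<Xi>]) auto
    next
      case False
      have "Usep \<Xi> \<subseteq> V \<times> V" "\<forall>p\<in>Usep \<Xi>. fst p \<noteq> snd p" unfolding Usep_def by auto
      from H[OF this False] obtain \<xi> where \<xi>: "\<xi> \<in> G"
        "real (card {p\<in>Usep \<Xi>. sep \<xi> (fst p) (snd p)}) \<ge> s * real (card (Usep \<Xi>))" by blast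
      have e1: "{p\<in>Usep \<Xi>. sep \<xi> (fst p) (snd p)} \<union> Usep (insert \<xi> \<Xi>) = Usep \<Xi>"
        and e2: "{p\<in>Usep \<Xi>. sep \<xi> (fst p) (snd p)} \<inter> Usep (insert \<xi> \<Xi>) = {}"
        unfolding Usep_def by auto
      have "card ({p\<in>Usep \<Xi>. sep \<xi> (fst p) (snd p)} \<union> Usep (insert \<xi> \<Xi>)) =
          card {p\<in>Usep \<Xi>. sep \<xi> (fst p) (snd p)} + card (Usep (insert \<xi> \<Xi>))"
        by (rule card_Un_disjoint[OF _ finUs e2]) (simp add: finUs)
      then have "card (Usep \<Xi>) = card {p\<in>Usep \<Xi>. sep \<xi> (fst p) (snd p)} + card (Usep (insert \<xi> \<Xi>))"
        unfolding e1 .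
      then have "real (card (Usep (insert \<xi> \<Xi>))) \<le> (1 - s) * real (card (Usep \<Xi>))"
        using \<xi>(2) by (simp add: algebra_simps)
      also have "\<dots> \<le> (1 - s) * ((1 - s) ^ k * (real (card V))\<^sup>2)"
        using \<Xi>(4) s by (intro mult_left_mono) auto
      finally have "real (card (Usep (insert \<xi> \<Xi>))) \<le> (1 - s) ^ Suc k * (real (card V))\<^sup>2" by simp
      moreover have "card (insert \<xi> \<Xi>) \<le> Suc k" using \<Xi> by (metis card_insert_le_m1 diff_Suc_1 zero_less_Suc)
      ultimately show ?thesis using \<Xi> \<xi> by (intro exI[of _ "insert \<xi> \<Xi>"]) auto
    qed
  qed
  then obtain \<Xi> where \<Xi>: "finite \<Xi>" "\<Xi> \<subseteq> G" "card \<Xi> \<le> r" "real (card (Usep \<Xi>)) \<le> (1 - s) ^ r * (real (card V))\<^sup>2"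
    by blast
  \<comment> \<open>By the choice of r the bound is below 1. So all pairs are separated, the points
    have distinct sign patterns, and counting cells counts points.\<close>
  then have "card (Usep \<Xi>) = 0" using r by linarith
  then have "Usep \<Xi> = {}" using finUs by simp
  have "inj_on (\<lambda>v. {\<xi>\<in>\<Xi>. lin \<xi> v > 0}) V"
  proof (rule inj_onI, rule ccontr)
    fix p q assume pq: "p \<in> V" "q \<in> V" "{\<xi>\<in>\<Xi>. lin \<xi> p > 0} = {\<xi>\<in>\<Xi>. lin \<xi> q > 0}" "p \<noteq> q"
    then have "(p, q) \<in> Usep \<Xi>" unfolding Usep_def sep_def by auto
    then show False using \<open>Usep \<Xi> = {}\<close> by simp
  qed
  then have "card V = card ((\<lambda>v. {\<xi>\<in>\<Xi>. lin \<xi> v > 0}) ` V)" by (simp add: card_image)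
  also have "\<dots> \<le> 1 + card \<Xi> + (card \<Xi>)\<^sup>2" using \<Xi> V G by (intro card_plane_patterns) auto
  also have "\<dots> \<le> 1 + r + r\<^sup>2" using \<Xi>(3) by (simp add: add_mono power_mono)
  finally show ?thesis .
qed

text \<open>Since s increases \<open>rk\<close>, the element of least rank is no value of s on A, so
  it can be coloured last, opposite to its own image.\<close>

lemma two_colouring:
  fixes rk :: "'a \<Rightarrow> real"
  assumes "finite A" "\<And>p. p \<in> A \<Longrightarrow> rk p < rk (s p)"
  shows "\<exists>c::'a \<Rightarrow> bool. \<forall>p\<in>A. c p \<noteq> c (s p)"
  using assms
proof (induction "card A" arbitrary: A)
  case (Suc n)
  then have ne: "A \<noteq> {}" by auto
  obtain p0 where p0: "p0 \<in> A" "\<And>p. p \<in> A \<Longrightarrow> rk p0 \<le> rk p"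
    using arg_min_if_finite(1)[OF Suc.prems(1) ne, of rk] arg_min_least[OF Suc.prems(1) ne, of _ rk] by blast
  have "n = card (A - {p0})" using Suc p0 by simp
  then have "\<exists>c::'a \<Rightarrow> bool. \<forall>p\<in>A - {p0}. c p \<noteq> c (s p)"
    by (rule Suc.hyps(1)) (use Suc.prems in auto)
  then obtain c :: "'a \<Rightarrow> bool" where c: "\<forall>p\<in>A - {p0}. c p \<noteq> c (s p)" by blast
  have "s p \<noteq> p0" if "p \<in> A" for p using p0(2)[OF that] Suc.prems(2)[OF that] by auto
  then show ?case using c p0 by (intro exI[of _ "c(p0 := \<not> c (s p0))"]) auto
qed auto

text \<open>The larger colour class. In \<open>E2_step\<close> the points of L are discarded in
  favour of their images, so the images have to survive.\<close>

lemma independent_half: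
  fixes rk :: "'a \<Rightarrow> real"
  assumes "finite A" "\<And>p. p \<in> A \<Longrightarrow> rk p < rk (s p)"
  obtains L where "L \<subseteq> A" "card A \<le> 2 * card L" "\<And>p. p \<in> L \<Longrightarrow> s p \<notin> L"
proof -
  obtain c :: "'a \<Rightarrow> bool" where c: "\<forall>p\<in>A. c p \<noteq> c (s p)" using two_colouring[of A rk s] assms by blast
  have "A = {p\<in>A. c p} \<union> {p\<in>A. \<not> c p}" by auto
  then have "card A \<le> card {p\<in>A. c p} + card {p\<in>A. \<not> c p}" by (metis card_Un_le)
  then consider "card A \<le> 2 * card {p\<in>A. c p}" | "card A \<le> 2 * card {p\<in>A. \<not> c p}" by linarith
  then show ?thesis
  proof cases
    case 1
    then show ?thesis by (rule that[rotated]) (use c in blast)+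
  next
    case 2
    then show ?thesis by (rule that[rotated]) (use c in blast)+
  qed
qed

subsection \<open>Pairing the points of a curve along its arcs\<close>

text \<open>On a small box F is strictly increasing in z and changes sign between the lower and the
  upper edge, so it has exactly one zero over each t. Persistence of the signs slightly above and
  below that zero gives continuity.\<close>

lemma implicit_local_pos:
  assumes 0: "ev F t1 z1 = 0" and pos: "ev (pderiv F) t1 z1 > 0"
  shows "\<exists>h>0. \<exists>\<eta>>0. \<exists>g. continuous_on {t1 - h..t1 + h} g \<and> g t1 = z1 \<and>
    (\<forall>t\<in>{t1 - h..t1 + h}. \<forall>z\<in>{z1 - \<eta>..z1 + \<eta>}. ev F t z = 0 \<longleftrightarrow> z = g t) \<and>
    (\<forall>t\<in>{t1 - h..t1 + h}. ev F t (g t) = 0 \<and> ev (pderiv F) t (g t) \<noteq> 0)"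
proof -
  let ?D = "\<lambda>p. ev (pderiv F) (fst p) (snd p)"
  have "open {p. ?D p > 0}"
    by (intro open_Collect_less continuous_on_ev continuous_intros)
  moreover have "(t1, z1) \<in> {p. ?D p > 0}" using pos by simp
  ultimately obtain e where e: "e > 0" "ball (t1, z1) e \<subseteq> {p. ?D p > 0}"
    using open_contains_ball by blast
  define r where "r = e / 3"
  have r: "r > 0" using e by (simp add: r_def)
  have D: "ev (pderiv F) t z > 0" if "\<bar>t - t1\<bar> \<le> r" "\<bar>z - z1\<bar> \<le> r" for t z
  proof -
    have "dist (t1, z1) (t, z) \<le> \<bar>t1 - t\<bar> + \<bar>z1 - z\<bar>"
      unfolding dist_Pair_Pair dist_real_def by (rule sqrt_sum_squares_le_sum) auto
    also have "\<dots> < e" using that r unfolding r_def by linarith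
    finally have "(t, z) \<in> ball (t1, z1) e" by simp
    then show ?thesis using e(2) by auto
  qed
  have mono: "ev F t x < ev F t y" if "\<bar>t - t1\<bar> \<le> r" "x < y" "z1 - r \<le> x" "y \<le> z1 + r" for t x y
  proof (rule DERIV_pos_imp_increasing[OF that(2)])
    fix u assume "x \<le> u" "u \<le> y"
    then have "ev (pderiv F) t u > 0" using D[of t u] that by auto
    then show "\<exists>d. ((\<lambda>z. ev F t z) has_real_derivative d) (at u) \<and> 0 < d"
      using has_real_derivative_ev by blast
  qed
  have up: "ev F t1 (z1 + r) > 0" and lo: "ev F t1 (z1 - r) < 0"
    using mono[of t1 z1 "z1 + r"] mono[of t1 "z1 - r" z1] r 0 by auto
  have "open {t. ev F t (z1 + r) > 0 \<and> ev F t (z1 - r) < 0}"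
    by (intro open_Collect_conj open_Collect_less continuous_on_ev continuous_intros)
  then obtain e' where e': "e' > 0" "ball t1 e' \<subseteq> {t. ev F t (z1 + r) > 0 \<and> ev F t (z1 - r) < 0}"
    using up lo unfolding open_contains_ball by blast
  define h where "h = min r (e' / 2)"
  have h: "h > 0" "h \<le> r" "h < e'" using r e' by (auto simp: h_def)
  have sgn: "ev F t (z1 + r) > 0" "ev F t (z1 - r) < 0" if "t \<in> {t1 - h..t1 + h}" for t
  proof -
    have "t \<in> ball t1 e'" using that h by (auto simp: dist_real_def)
    then show "ev F t (z1 + r) > 0" "ev F t (z1 - r) < 0" using e'(2) by auto
  qed
  have ex: "\<exists>z. z1 - r < z \<and> z < z1 + r \<and> ev F t z = 0" if t: "t \<in> {t1 - h..t1 + h}" for t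
  proof -
    have "\<exists>z\<ge>z1 - r. z \<le> z1 + r \<and> ev F t z = 0"
      by (rule IVT') (use sgn[OF t] r in \<open>auto intro!: continuous_on_ev continuous_intros\<close>)
    then show ?thesis using sgn[OF t] by (metis less_eq_real_def less_irrefl)
  qed
  define g where "g = (\<lambda>t. SOME z. z1 - r < z \<and> z < z1 + r \<and> ev F t z = 0)"
  have g: "z1 - r < g t" "g t < z1 + r" "ev F t (g t) = 0" if "t \<in> {t1 - h..t1 + h}" for t
    using someI_ex[OF ex[OF that]] unfolding g_def by auto
  have uniq: "z = g t" if "t \<in> {t1 - h..t1 + h}" "z \<in> {z1 - r..z1 + r}" "ev F t z = 0" for t z
  proof (rule ccontr)
    assume "z \<noteq> g t"
    have "\<bar>t - t1\<bar> \<le> r" using that(1) h by auto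
    then show False using mono[of t z "g t"] mono[of t "g t" z] that g[OF that(1)] \<open>z \<noteq> g t\<close>
      by (cases "z < g t") auto
  qed
  have "continuous_on {t1 - h..t1 + h} g"
    unfolding continuous_on_iff
  proof (intro ballI allI impI)
    fix t \<epsilon> :: real assume t: "t \<in> {t1 - h..t1 + h}" and "\<epsilon> > 0"
    define k where "k = min (\<epsilon> / 2) (min (g t - (z1 - r)) (z1 + r - g t))"
    have k: "k > 0" "k < \<epsilon>" "z1 - r \<le> g t - k" "g t + k \<le> z1 + r" using \<open>\<epsilon> > 0\<close> g[OF t] by (auto simp: k_def)
    have tr: "\<bar>t - t1\<bar> \<le> r" using t h by auto
    have "ev F t (g t + k) > 0" "ev F t (g t - k) < 0"
      using mono[OF tr, of "g t" "g t + k"] mono[OF tr, of "g t - k" "g t"] k g[OF t] by auto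
    moreover have "open {s. ev F s (g t + k) > 0 \<and> ev F s (g t - k) < 0}"
      by (intro open_Collect_conj open_Collect_less continuous_on_ev continuous_intros)
    ultimately obtain d where d: "d > 0" "ball t d \<subseteq> {s. ev F s (g t + k) > 0 \<and> ev F s (g t - k) < 0}"
      unfolding open_contains_ball by blast
    show "\<exists>d>0. \<forall>s\<in>{t1 - h..t1 + h}. dist s t < d \<longrightarrow> dist (g s) (g t) < \<epsilon>"
    proof (intro exI[of _ d] conjI ballI impI d(1))
      fix s assume s: "s \<in> {t1 - h..t1 + h}" "dist s t < d"
      have sr: "\<bar>s - t1\<bar> \<le> r" using s h by auto
      have "s \<in> ball t d" using s by (simp add: dist_commute)
      then have s2: "ev F s (g t + k) > 0" "ev F s (g t - k) < 0" using d(2) by auto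
      have "g s < g t + k"
      proof (rule ccontr)
        assume "\<not> ?thesis"
        then have "ev F s (g t + k) \<le> ev F s (g s)"
          using mono[OF sr, of "g t + k" "g s"] g[OF s(1)] g[OF t] k by (cases "g s = g t + k") auto
        then show False using s2 g[OF s(1)] by simp
      qed
      moreover have "g s > g t - k"
      proof (rule ccontr)
        assume "\<not> ?thesis"
        then have "ev F s (g s) \<le> ev F s (g t - k)"
          using mono[OF sr, of "g s" "g t - k"] g[OF s(1)] g[OF t] k by (cases "g s = g t - k") auto
        then show False using s2 g[OF s(1)] by simp
      qed
      ultimately show "dist (g s) (g t) < \<epsilon>" using k by (simp add: dist_real_def abs_less_iff)
    qed
  qed
  moreover have "g t1 = z1" using uniq[of t1 z1] 0 r h by auto
  moreover have "\<forall>t\<in>{t1 - h..t1 + h}. \<forall>z\<in>{z1 - r..z1 + r}. ev F t z = 0 \<longleftrightarrow> z = g t"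
    using uniq g by blast
  moreover have "ev (pderiv F) t (g t) \<noteq> 0" if t: "t \<in> {t1 - h..t1 + h}" for t
    using D[of t "g t"] g[OF t] t h by (auto simp: abs_le_iff)
  ultimately show ?thesis using h(1) r g(3) by blast
qed

lemma implicit_local:
  assumes 0: "ev F t1 z1 = 0" and nz: "ev (pderiv F) t1 z1 \<noteq> 0"
  obtains h \<eta> g where "h > 0" "\<eta> > 0" "continuous_on {t1 - h..t1 + h} g" "g t1 = z1"
    "\<And>t z. t \<in> {t1 - h..t1 + h} \<Longrightarrow> z \<in> {z1 - \<eta>..z1 + \<eta>} \<Longrightarrow> ev F t z = 0 \<Longrightarrow> z = g t"
    "\<And>t. t \<in> {t1 - h..t1 + h} \<Longrightarrow> ev F t (g t) = 0 \<and> ev (pderiv F) t (g t) \<noteq> 0"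
proof (cases "ev (pderiv F) t1 z1 > 0")
  case True
  then show ?thesis using implicit_local_pos[OF 0 True] that by metis
next
  case False
  have neg: "ev (- G) t z = - ev G t z" for G t z using ev_diff[of 0 G t z] by simp
  have "ev (- F) t1 z1 = 0" "ev (pderiv (- F)) t1 z1 > 0"
    using False 0 nz by (auto simp: pderiv_minus neg)
  from implicit_local_pos[OF this] obtain h \<eta> g where *: "h > 0" "\<eta> > 0" "continuous_on {t1 - h..t1 + h} g" "g t1 = z1"
    "\<forall>t\<in>{t1 - h..t1 + h}. \<forall>z\<in>{z1 - \<eta>..z1 + \<eta>}. ev (- F) t z = 0 \<longleftrightarrow> z = g t"
    "\<forall>t\<in>{t1 - h..t1 + h}. ev (- F) t (g t) = 0 \<and> ev (pderiv (- F)) t (g t) \<noteq> 0" by blast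
  show ?thesis by (rule that[OF *(1-4)]) (use *(5,6) in \<open>auto simp: pderiv_minus neg\<close>)
qed

text \<open>The nonvanishing derivative belongs to the notion because it makes continuation unique,
  see \<open>arc_on_unique\<close>.\<close>

definition arc_on :: "real poly poly \<Rightarrow> real set \<Rightarrow> (real \<Rightarrow> real) \<Rightarrow> bool" where
  "arc_on F I g \<longleftrightarrow> continuous_on I g \<and> (\<forall>t\<in>I. ev F t (g t) = 0 \<and> ev (pderiv F) t (g t) \<noteq> 0)"

lemma arc_on_subset: "arc_on F I g \<Longrightarrow> J \<subseteq> I \<Longrightarrow> arc_on F J g"
  unfolding arc_on_def by (auto intro: continuous_on_subset)

text \<open>The set of agreement is closed by continuity and open by the local uniqueness in the
  implicit function theorem. It is applied forwards in t to glue branches, and backwards to identify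
  arcs that meet later.\<close>

lemma arc_on_unique:
  assumes g: "arc_on F I g" and k: "arc_on F I k" and I: "connected I"
    and t0: "t0 \<in> I" "g t0 = k t0" and t: "t \<in> I"
  shows "g t = k t"
proof -
  let ?E = "{t \<in> I. g t = k t}"
  have c: "continuous_on I g" "continuous_on I k" using g k by (auto simp: arc_on_def)
  have "closedin (top_of_set I) {t \<in> I. g t - k t = 0}"
    by (intro continuous_closedin_preimage_constant continuous_intros c)
  then have cl: "closedin (top_of_set I) ?E" by simp
  have "openin (top_of_set I) ?E"
    unfolding openin_euclidean_subtopology_iff
  proof (intro conjI ballI)
    fix x assume x: "x \<in> ?E"
    then have "ev F x (g x) = 0" "ev (pderiv F) x (g x) \<noteq> 0" using g by (auto simp: arc_on_def)
    then obtain h \<eta> u where u: "h > 0" "\<eta> > 0"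
      "\<And>t z. t \<in> {x - h..x + h} \<Longrightarrow> z \<in> {g x - \<eta>..g x + \<eta>} \<Longrightarrow> ev F t z = 0 \<Longrightarrow> z = u t"
      by (rule implicit_local) blast
    obtain d1 where d1: "d1 > 0" "\<And>y. y \<in> I \<Longrightarrow> dist y x < d1 \<Longrightarrow> dist (g y) (g x) < \<eta>"
      using c(1) x u(2) unfolding continuous_on_iff by blast
    obtain d2 where d2: "d2 > 0" "\<And>y. y \<in> I \<Longrightarrow> dist y x < d2 \<Longrightarrow> dist (k y) (k x) < \<eta>"
      using c(2) x u(2) unfolding continuous_on_iff by blast
    show "\<exists>e>0. \<forall>x'\<in>I. dist x' x < e \<longrightarrow> x' \<in> ?E"
    proof (intro exI[of _ "min h (min d1 d2)"] conjI ballI impI)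
      fix y assume y: "y \<in> I" "dist y x < min h (min d1 d2)"
      have "y \<in> {x - h..x + h}" using y by (auto simp: dist_real_def)
      moreover have "g y \<in> {g x - \<eta>..g x + \<eta>}" using d1(2)[of y] y by (auto simp: dist_real_def)
      moreover have "k y \<in> {g x - \<eta>..g x + \<eta>}" using d2(2)[of y] y x by (auto simp: dist_real_def)
      moreover have "ev F y (g y) = 0" "ev F y (k y) = 0" using g k y by (auto simp: arc_on_def)
      ultimately have "g y = u y" "k y = u y" using u(3) by blast+
      then show "y \<in> ?E" using y by simp
    qed (use u d1 d2 in auto)
  qed auto
  then have "?E = {} \<or> ?E = I" using cl I unfolding connected_clopen by blast
  then show ?thesis using t0 t by blast
qed

text \<open>At the supremum of the times to which the branch extends inside the region, a limit point in the
  interior would allow one more application of the implicit function theorem.\<close>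

lemma arc_exit:
  fixes F :: "real poly poly" and \<delta> R1 R2 R3 :: real
  defines "W \<equiv> \<lambda>t z. (ev (pderiv F) t z)\<^sup>2 > \<delta> \<and> z < R1 \<and> - R2 < z \<and> t < R3"
  assumes \<delta>: "\<delta> > 0" and F0: "ev F t0 z0 = 0" and W0: "W t0 z0"
  obtains T g where "t0 < T" "g t0 = z0" "arc_on F {t0..T} g"
    "(ev (pderiv F) T (g T))\<^sup>2 = \<delta> \<or> g T = R1 \<or> g T = - R2 \<or> T = R3"
proof -
  \<comment> \<open>The region W has no lower bound on t because the branch is followed to the right
    only; squaring the derivative treats both of its signs in one condition.\<close>
  define good where "good = (\<lambda>b g. g t0 = z0 \<and> arc_on F {t0..b} g \<and> (\<forall>t\<in>{t0..b}. W t (g t)))"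
  define B where "B = {b. t0 \<le> b \<and> (\<exists>g. good b g)}"
  have Wnz: "ev (pderiv F) t z \<noteq> 0" if "W t z" for t z using that \<delta> by (auto simp: W_def)
  have openW: "open {p. W (fst p) (snd p)}"
    unfolding W_def by (intro open_Collect_conj open_Collect_less continuous_on_ev continuous_intros)
  have extend: "\<exists>h'>0. \<forall>t\<in>{t1..t1 + h'}. W t (g t)"
    if gc: "continuous_on {t1 - h..t1 + h} g" and h: "h > 0" and W1: "W t1 (g t1)" for t1 h g
  proof -
    have "continuous_on {t1 - h..t1 + h} (\<lambda>t. (t, g t))" by (intro continuous_intros gc)
    moreover have "(t1, g t1) \<in> {p. W (fst p) (snd p)}" using W1 by simp
    then obtain e where e: "e > 0" "\<And>q. dist q (t1, g t1) < e \<Longrightarrow> q \<in> {p. W (fst p) (snd p)}"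
      using openW unfolding open_dist by meson
    moreover have "t1 \<in> {t1 - h..t1 + h}" using h by simp
    ultimately obtain d where d: "d > 0" "\<And>y. y \<in> {t1 - h..t1 + h} \<Longrightarrow> dist y t1 < d \<Longrightarrow> dist (y, g y) (t1, g t1) < e"
      unfolding continuous_on_iff by blast
    have dW: "W y (g y)" if "y \<in> {t1 - h..t1 + h}" "dist y t1 < d" for y
      using e(2)[OF d(2)[OF that]] by simp
    show ?thesis
      by (rule exI[of _ "min h (d / 2)"]) (use dW d(1) h in \<open>auto simp: dist_real_def\<close>)
  qed
  have t0B: "t0 \<in> B" unfolding B_def good_def arc_on_def
    using F0 W0 Wnz by (auto intro!: exI[of _ "\<lambda>_. z0"])
  have bB: "b \<le> R3" if "b \<in> B" for b
    using that unfolding B_def good_def W_def by (auto simp: less_imp_le)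
  have bdd: "bdd_above B" using bB by (rule bdd_aboveI)
  define T where "T = Sup B"
  have leT: "b \<le> T" if "b \<in> B" for b unfolding T_def using that bdd by (rule cSup_upper)
  have dc: "b \<in> B" if "t0 \<le> b" and bb: "b \<le> b'" "b' \<in> B" for b b'
  proof -
    obtain g where "good b' g" using bb(2) unfolding B_def by blast
    then have "good b g" using bb(1) unfolding good_def
      by (auto intro: arc_on_subset[of F "{t0..b'}" _ "{t0..b}"])
    then show ?thesis using that(1) unfolding B_def by blast
  qed
  have ltT: "b \<in> B" if "t0 \<le> b" "b < T" for b
    using that dc less_cSup_iff[OF _ bdd, of b] t0B unfolding T_def by (metis empty_iff less_imp_le)
  have T0: "t0 < T"
  proof -
    obtain h \<eta> g where g: "h > 0" "continuous_on {t0 - h..t0 + h} g" "g t0 = z0"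
      "\<And>t. t \<in> {t0 - h..t0 + h} \<Longrightarrow> ev F t (g t) = 0 \<and> ev (pderiv F) t (g t) \<noteq> 0"
      by (rule implicit_local[OF F0 Wnz[OF W0]]) (rule that)
    obtain h' where h': "h' > 0" "\<forall>t\<in>{t0..t0 + h'}. W t (g t)" using extend[OF g(2,1)] g(3) W0 by auto
    have "continuous_on {t0..t0 + min h h'} g" by (rule continuous_on_subset[OF g(2)]) (use g(1) in auto)
    then have "t0 + min h h' \<in> B" unfolding B_def good_def
      using g h' by (auto intro!: exI[of _ g] simp: arc_on_def)
    then show ?thesis using leT g(1) h'(1) by fastforce
  qed
  define G where "G = (\<lambda>b. SOME g. good b g)"
  have G: "good b (G b)" if "b \<in> B" for b
    using that unfolding G_def B_def by (metis (mono_tags, lifting) mem_Collect_eq someI_ex)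
  \<comment> \<open>The branches chosen for different end times agree, so their diagonal is a single
    branch up to, but not including, the supremum T.\<close>
  have coh: "G b t = G t t" if "b \<in> B" "t0 \<le> t" "t \<le> b" for b t
  proof -
    have tB: "t \<in> B" using dc that by blast
    have "arc_on F {t0..t} (G b)" using G[OF that(1)] that arc_on_subset unfolding good_def
      by (metis atLeastatMost_subset_iff order_refl)
    moreover have "arc_on F {t0..t} (G t)" using G[OF tB] unfolding good_def by blast
    moreover have "G b t0 = G t t0" using G[OF tB] G[OF that(1)] unfolding good_def by simp
    ultimately show ?thesis using that(2) by (intro arc_on_unique[of F "{t0..t}" "G b" "G t" t0 t]) auto
  qed
  define g where "g = (\<lambda>t. G t t)"
  have gW: "W t (g t)" "ev F t (g t) = 0" if "t0 \<le> t" "t < T" for t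
    using G[OF ltT[OF that]] that unfolding good_def g_def arc_on_def by auto
  define x where "x = (\<lambda>n. T - (T - t0) / real (n + 1))"
  have x: "t0 \<le> x n" "x n < T" for n :: nat
  proof -
    have "(T - t0) / real (n + 1) \<le> (T - t0) / 1" using T0 by (intro divide_left_mono) auto
    then show "t0 \<le> x n" unfolding x_def by simp
    have "(T - t0) / real (n + 1) > 0" using T0 by (intro divide_pos_pos) auto
    then show "x n < T" unfolding x_def by simp
  qed
  have xT: "x \<longlonglongrightarrow> T"
  proof -
    have "(\<lambda>n. T - (T - t0) * inverse (real (Suc n))) \<longlonglongrightarrow> T - (T - t0) * 0"
      by (intro tendsto_intros LIMSEQ_inverse_real_of_nat)
    then show ?thesis by (simp add: x_def field_simps)
  qed
  have "g (x n) \<in> {- R2..R1}" for n using gW(1)[OF x] unfolding W_def by (simp add: less_imp_le)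
  \<comment> \<open>The branch stays in a compact interval, so some subsequence of its values
    converges; a limit of the branch itself at T is not yet known.\<close>
  then obtain z' r where zr: "strict_mono r" "((\<lambda>n. g (x n)) \<circ> r) \<longlonglongrightarrow> z'" "z' \<in> {- R2..R1}"
    using seq_compactE[OF compact_imp_seq_compact[OF compact_Icc[of "- R2" R1]], of "\<lambda>n. g (x n)"] by metis
  have xr: "(x \<circ> r) \<longlonglongrightarrow> T" using LIMSEQ_subseq_LIMSEQ[OF xT zr(1)] .
  have evlim: "(\<lambda>n. ev K (x (r n)) (g (x (r n)))) \<longlonglongrightarrow> ev K T z'" for K
  proof -
    have "continuous_on UNIV (\<lambda>p. ev K (fst p) (snd p))" by (intro continuous_on_ev continuous_intros)
    then have "isCont (\<lambda>p. ev K (fst p) (snd p)) (T, z')" by (simp add: continuous_on_eq_continuous_at)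
    moreover have "(\<lambda>n. (x (r n), g (x (r n)))) \<longlonglongrightarrow> (T, z')"
      using tendsto_Pair[OF xr zr(2)] by (simp add: o_def)
    ultimately show ?thesis using isCont_tendsto_compose by fastforce
  qed
  have F1: "ev F T z' = 0"
    using evlim[of F] gW(2)[OF x] by (simp add: LIMSEQ_const_iff)
  have D1: "(ev (pderiv F) T z')\<^sup>2 \<ge> \<delta>"
    by (rule LIMSEQ_le_const[OF tendsto_power[OF evlim[of "pderiv F"]]])
      (use gW(1)[OF x] in \<open>auto simp: W_def less_imp_le\<close>)
  then have nz: "ev (pderiv F) T z' \<noteq> 0" using \<delta> by auto
  have TR: "T \<le> R3" unfolding T_def using t0B bB by (intro cSup_least) auto
  \<comment> \<open>Along the subsequence the branch comes close to z', so at some time b before T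
    it lies on the local branch u through (T, z'). Uniqueness then makes the two equal on the rest
    of the interval.\<close>
  obtain h \<eta> u where u: "h > 0" "\<eta> > 0" "continuous_on {T - h..T + h} u" "u T = z'"
    "\<And>t z. t \<in> {T - h..T + h} \<Longrightarrow> z \<in> {z' - \<eta>..z' + \<eta>} \<Longrightarrow> ev F t z = 0 \<Longrightarrow> z = u t"
    "\<And>t. t \<in> {T - h..T + h} \<Longrightarrow> ev F t (u t) = 0 \<and> ev (pderiv F) t (u t) \<noteq> 0"
    by (rule implicit_local[OF F1 nz]) (rule that)
  have "\<forall>\<^sub>F n in sequentially. dist (x (r n)) T < h" "\<forall>\<^sub>F n in sequentially. dist (g (x (r n))) z' < \<eta>"
    using tendstoD[OF xr u(1)] tendstoD[OF zr(2) u(2)] by (auto simp: o_def)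
  then have "\<forall>\<^sub>F n in sequentially. dist (x (r n)) T < h \<and> dist (g (x (r n))) z' < \<eta>" by (rule eventually_conj)
  then obtain n where n: "dist (x (r n)) T < h" "dist (g (x (r n))) z' < \<eta>"
    using eventually_happens'[OF sequentially_bot] by blast
  define b where "b = x (r n)"
  have b: "t0 \<le> b" "b < T" "b \<in> {T - h..T + h}" and gb: "g b = u b"
    using x n gW(2)[OF x] u(5)[of b "g b"] by (auto simp: b_def dist_real_def abs_less_iff)
  have bB': "b \<in> B" using ltT b by blast
  have gu: "g t = u t" if "b \<le> t" "t < T" for t
  proof -
    have tB: "t \<in> B" using ltT b that by auto
    have "arc_on F {b..t} (G t)" using G[OF tB] b unfolding good_def by (auto intro: arc_on_subset)
    moreover have "arc_on F {b..t} u" unfolding arc_on_def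
      using u(6) b that by (auto intro: continuous_on_subset[OF u(3)])
    moreover have "G t b = u b" using coh[OF tB] b that gb by (simp add: g_def)
    ultimately show ?thesis unfolding g_def using that by (intro arc_on_unique[of F "{b..t}" "G t" u b t]) auto
  qed
  define k where "k = (\<lambda>t. if t \<le> b then G b t else u t)"
  have karc: "arc_on F {t0..c} k" if c: "b \<le> c" "c \<le> T + h" for c
  proof -
    have Gb: "arc_on F {t0..b} (G b)" "G b b = u b" using G[OF bB'] gb unfolding good_def g_def by auto
    have "continuous_on ({t0..b} \<union> {b..c}) (\<lambda>t. if t \<le> b then G b t else u t)"
      by (rule continuous_on_cases)
        (use Gb c b in \<open>auto simp: arc_on_def intro: continuous_on_subset[OF u(3)]\<close>)
    moreover have "{t0..b} \<union> {b..c} = {t0..c}" using b c by auto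
    ultimately have "continuous_on {t0..c} k" by (simp add: k_def)
    moreover have "ev F t (k t) = 0 \<and> ev (pderiv F) t (k t) \<noteq> 0" if "t \<in> {t0..c}" for t
      using Gb(1) u(6)[of t] that b c unfolding k_def arc_on_def by auto
    ultimately show ?thesis unfolding arc_on_def by blast
  qed
  have k0: "k t0 = z0" using G[OF bB'] b by (simp add: k_def good_def)
  have kT: "k T = z'" using b u(4) by (simp add: k_def)
  have kW: "W t (k t)" if "t0 \<le> t" "t < T" for t
    using gW(1)[OF that] gu[of t] coh[OF bB', of t] that by (auto simp: k_def g_def)
  have "\<not> W T z'"
  proof
    assume "W T z'"
    then obtain h' where h': "h' > 0" "\<forall>t\<in>{T..T + h'}. W t (u t)" using extend[OF u(3,1)] u(4) by auto
    have "T + min h h' \<in> B" unfolding B_def good_def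
    proof (intro CollectI conjI exI[of _ k] k0 ballI)
      show "t0 \<le> T + min h h'" using T0 u(1) h'(1) by simp
      show "arc_on F {t0..T + min h h'} k" by (rule karc) (use b u(1) h'(1) in auto)
      fix t assume t: "t \<in> {t0..T + min h h'}"
      show "W t (k t)"
      proof (cases "t < T")
        case True
        then show ?thesis using kW t by simp
      next
        case False
        then show ?thesis using h' t b by (simp add: k_def)
      qed
    qed
    then show False using leT u(1) h'(1) by fastforce
  qed
  then have "(ev (pderiv F) T (k T))\<^sup>2 = \<delta> \<or> k T = R1 \<or> k T = - R2 \<or> T = R3"
    using D1 zr(3) TR unfolding kT W_def by auto
  then show ?thesis using that[of T k] T0 k0 karc[of T] b u(1) by auto
qed

text \<open>Points of \<^term>\<open>V\<close> are paired with the next point of \<^term>\<open>V\<close> on the same arc. A point without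
  successor lies on an arc that runs into the boundary of the region of \<open>arc_exit\<close>, and different such arcs end in
  different zeros of the polynomial \<open>Q\<close> cutting out the boundary.\<close>

lemma arcs_successor:
  fixes F :: "real poly poly" and V :: "(real^2) set"
  assumes F: "F \<noteq> 0" "coprime F (pderiv F)" "tdle F m" and m: "m \<ge> 1"
    and V: "finite V" "\<And>v. v \<in> V \<Longrightarrow> ev F (v $ 2) (v $ 1) = 0"
  obtains A s where "A \<subseteq> V" "card V \<le> card A + 12 * m\<^sup>2" "\<And>p. p \<in> A \<Longrightarrow> s p \<in> V \<and> p $ 2 < s p $ 2"
    "\<And>\<xi>. \<xi> $ 1 \<noteq> 0 \<Longrightarrow> poly F [:- \<xi> $ 3 / \<xi> $ 1, - \<xi> $ 2 / \<xi> $ 1:] \<noteq> 0 \<Longrightarrow> (\<forall>v\<in>V. lin \<xi> v \<noteq> 0) \<Longrightarrow>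
       card {p\<in>A. sep \<xi> p (s p)} \<le> m"
proof -
  let ?D = "\<lambda>v::real^2. ev (pderiv F) (v $ 2) (v $ 1)"
  have pt: "v = w" if "v $ 1 = w $ 1" "v $ 2 = w $ 2" for v w :: "real^2"
    using that by (simp add: vec_eq_iff forall_2)
  have injpt: "inj_on (\<lambda>v::real^2. (v $ 2, v $ 1)) X" for X by (auto intro!: inj_onI pt)
  define V0 where "V0 = {v\<in>V. ?D v \<noteq> 0}"
  have finV0: "finite V0" using V by (simp add: V0_def)
  \<comment> \<open>Points where the z derivative vanishes are set aside; F is coprime to its
    derivative, so Bezout bounds their number.\<close>
  have "card ((\<lambda>v. (v $ 2, v $ 1)) ` {v\<in>V. ?D v = 0}) \<le> 2 * m * m"
    by (rule bezout_bound[OF F(2) F(1) F(3) tdle_pderiv[OF F(3)] m]) (use V in auto)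
  then have crit: "card {v\<in>V. ?D v = 0} \<le> 2 * m * m" by (simp add: card_image[OF injpt])
  obtain \<delta>0 where \<delta>0: "\<delta>0 > 0" "\<And>v. v \<in> V0 \<Longrightarrow> \<delta>0 \<le> (?D v)\<^sup>2"
  \<comment> \<open>The inserted 1 keeps the minimum meaningful when \<open>V0\<close> is
    empty.\<close>
  proof (rule that[of "Min (insert 1 ((\<lambda>v. (?D v)\<^sup>2) ` V0))"])
    show "0 < Min (insert 1 ((\<lambda>v. (?D v)\<^sup>2) ` V0))" using finV0 by (auto simp: V0_def)
  qed (use finV0 in auto)
  obtain R0 where R0: "\<And>v. v \<in> V \<Longrightarrow> \<bar>v $ 1\<bar> \<le> R0 \<and> \<bar>v $ 2\<bar> \<le> R0"
  proof (rule that[of "Max (insert 0 ((\<lambda>v. max \<bar>v $ 1\<bar> \<bar>v $ 2\<bar>) ` V))"])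
    fix v assume "v \<in> V"
    then have "max \<bar>v $ 1\<bar> \<bar>v $ 2\<bar> \<le> Max (insert 0 ((\<lambda>v. max \<bar>v $ 1\<bar> \<bar>v $ 2\<bar>) ` V))"
      using V(1) by (intro Max_ge) auto
    then show "\<bar>v $ 1\<bar> \<le> Max (insert 0 ((\<lambda>v. max \<bar>v $ 1\<bar> \<bar>v $ 2\<bar>) ` V)) \<and>
        \<bar>v $ 2\<bar> \<le> Max (insert 0 ((\<lambda>v. max \<bar>v $ 1\<bar> \<bar>v $ 2\<bar>) ` V))" by simp
  qed
  \<comment> \<open>The four boundary parameters come from intervals that leave all points of
    \<open>V0\<close> strictly inside the region, and are generic there, so that no boundary curve
    shares a component with F.\<close>
  have "\<exists>c\<in>{0<..<\<delta>0}. coprime F (pderiv F * pderiv F - [:[:c:]:])"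
    by (rule ex_coprime_pencil[OF F(1)]) (use \<delta>0(1) in \<open>auto simp: is_unit_const_poly_iff dvd_field_iff\<close>)
  then obtain \<delta> where \<delta>: "0 < \<delta>" "\<delta> < \<delta>0" "coprime F (pderiv F * pderiv F - [:[:\<delta>:]:])" by auto
  have "\<exists>c\<in>{R0<..<R0+1}. coprime F [:[:-c:], 1:]"
    by (rule ex_coprime_pencil[OF F(1)]) (auto simp: is_unit_const_poly_iff dvd_field_iff)
  then obtain R1 where R1: "R0 < R1" "coprime F [:[:-R1:], 1:]" by auto
  have "\<exists>c\<in>{R0<..<R0+1}. coprime F [:[:c:], 1:]"
    by (rule ex_coprime_pencil[OF F(1)]) (auto simp: is_unit_const_poly_iff dvd_field_iff)
  then obtain R2 where R2: "R0 < R2" "coprime F [:[:R2:], 1:]" by auto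
  have "\<exists>c\<in>{R0<..<R0+1}. coprime F [:[:-c, 1:]:]"
    by (rule ex_coprime_pencil[OF F(1)]) (auto simp: is_unit_const_poly_iff dvd_field_iff)
  then obtain R3 where R3: "R0 < R3" "coprime F [:[:-R3, 1:]:]" by auto
  \<comment> \<open>The product of the boundary equations of the region in \<open>arc_exit\<close>:
    a factor of degree 2m and three linear ones.\<close>
  define Q where "Q = (pderiv F * pderiv F - [:[:\<delta>:]:]) * ([:[:-R1:], 1:] * ([:[:R2:], 1:] * [:[:-R3, 1:]:]))"
  have cQ: "coprime F Q" unfolding Q_def using \<delta>(3) R1(2) R2(2) R3(2) by (simp only: coprime_mult_right_iff)
  have tQ: "tdle Q (2 * m + 3)"
  proof -
    have "tdle (pderiv F * pderiv F - [:[:\<delta>:]:]) (m + m)"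
      by (intro tdle_diff tdle_mult tdle_pderiv F tdle_const) simp
    moreover have "tdle [:[:c:], 1:] 1" for c by (auto simp: tdle_def coeff_pCons split: nat.splits)
    moreover have "tdle [:[:-R3, 1:]:] 1" by (rule tdle_const) simp
    ultimately have "tdle Q ((m + m) + (1 + (1 + 1)))" unfolding Q_def by (intro tdle_mult)
    then show ?thesis by (simp add: mult_2 numeral_3_eq_3)
  qed
  have evQ: "ev Q t z = ((ev (pderiv F) t z)\<^sup>2 - \<delta>) * ((z - R1) * ((z + R2) * (t - R3)))" for t z
    by (simp add: Q_def power2_eq_square algebra_simps)
  \<comment> \<open>The arc is carried along as a witness, since several arcs may lie over the same
    t.\<close>
  define rel where "rel = (\<lambda>(p::real^2) (q::real^2) g. p $ 2 < q $ 2 \<and> g (p $ 2) = p $ 1 \<and> g (q $ 2) = q $ 1 \<and> arc_on F {p $ 2..q $ 2} g)"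
  define A where "A = {p\<in>V0. \<exists>q\<in>V. \<exists>g. rel p q g}"
  have AV: "A \<subseteq> V" by (auto simp: A_def V0_def)
  have "\<exists>T g. p $ 2 < T \<and> g (p $ 2) = p $ 1 \<and> arc_on F {p $ 2..T} g \<and> ev Q T (g T) = 0" if p: "p \<in> V0" for p
  proof -
    have pV: "p \<in> V" and "(?D p)\<^sup>2 > \<delta>" using p \<delta>0(2)[OF p] \<delta> by (auto simp: V0_def)
    then have "(?D p)\<^sup>2 > \<delta> \<and> p $ 1 < R1 \<and> - R2 < p $ 1 \<and> p $ 2 < R3"
      using R0[OF pV] R1(1) R2(1) R3(1) by auto
    from arc_exit[OF \<delta>(1) V(2)[OF pV] this] obtain T g where
      "p $ 2 < T" "g (p $ 2) = p $ 1" "arc_on F {p $ 2..T} g"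
      "(ev (pderiv F) T (g T))\<^sup>2 = \<delta> \<or> g T = R1 \<or> g T = - R2 \<or> T = R3" by metis
    then show ?thesis unfolding evQ by (intro exI[of _ T] exI[of _ g]) auto
  qed
  then have "\<forall>p\<in>V0. \<exists>Tg. p $ 2 < fst Tg \<and> snd Tg (p $ 2) = p $ 1 \<and> arc_on F {p $ 2..fst Tg} (snd Tg) \<and> ev Q (fst Tg) (snd Tg (fst Tg)) = 0"
    by fastforce
  from bchoice[OF this] obtain X where X: "\<forall>p\<in>V0. p $ 2 < fst (X p) \<and> snd (X p) (p $ 2) = p $ 1 \<and>
      arc_on F {p $ 2..fst (X p)} (snd (X p)) \<and> ev Q (fst (X p)) (snd (X p) (fst (X p))) = 0" by blast
  define e where "e = (\<lambda>p. (fst (X p), snd (X p) (fst (X p))))"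
  \<comment> \<open>Two points without successor and with a common exit point: continued back from
    the exit, the arc of p passes through q, so q would be a successor of p.\<close>
  have no: "\<not> p $ 2 < q $ 2" if pq: "p \<in> V0 - A" "q \<in> V0 - A" "e p = e q" for p q
  proof
    assume lt: "p $ 2 < q $ 2"
    define T where "T = fst (X q)"
    have T: "fst (X p) = T" "snd (X p) T = snd (X q) T" using pq(3) by (auto simp: e_def T_def)
    have Xp: "snd (X p) (p $ 2) = p $ 1" "arc_on F {p $ 2..T} (snd (X p))" using X pq(1) T by auto
    have Xq: "q $ 2 < T" "snd (X q) (q $ 2) = q $ 1" "arc_on F {q $ 2..T} (snd (X q))" using X pq(2) by (auto simp: T_def)
    have "snd (X p) (q $ 2) = snd (X q) (q $ 2)"
      by (rule arc_on_unique[of F "{q $ 2..T}" "snd (X p)" "snd (X q)" T "q $ 2"])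
        (use Xp Xq T lt in \<open>auto intro: arc_on_subset\<close>)
    then have "rel p q (snd (X p))" unfolding rel_def using lt Xp Xq by (auto intro: arc_on_subset)
    then show False using pq by (auto simp: A_def V0_def)
  qed
  have "inj_on e (V0 - A)"
  proof (rule inj_onI)
    fix p q assume pq: "p \<in> V0 - A" "q \<in> V0 - A" "e p = e q"
    have eq: "p $ 2 = q $ 2" using no[OF pq] no[OF pq(2,1) pq(3)[symmetric]] by simp
    define T where "T = fst (X q)"
    have T: "fst (X p) = T" "snd (X p) T = snd (X q) T" using pq(3) by (auto simp: e_def T_def)
    have Xp: "snd (X p) (p $ 2) = p $ 1" "arc_on F {p $ 2..T} (snd (X p))" using X pq(1) T by auto
    have Xq: "q $ 2 < T" "snd (X q) (q $ 2) = q $ 1" "arc_on F {q $ 2..T} (snd (X q))" using X pq(2) by (auto simp: T_def)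
    have "snd (X p) (q $ 2) = snd (X q) (q $ 2)"
      by (rule arc_on_unique[of F "{q $ 2..T}" "snd (X p)" "snd (X q)" T "q $ 2"])
        (use Xp Xq T eq in \<open>auto intro: arc_on_subset\<close>)
    then show "p = q" using Xp Xq eq by (intro pt) auto
  qed
  moreover have "card (e ` (V0 - A)) \<le> 2 * m * (2 * m + 3)"
  proof (rule bezout_bound[OF cQ F(1) F(3) tQ])
    fix t z assume "(t, z) \<in> e ` (V0 - A)"
    then show "ev F t z = 0 \<and> ev Q t z = 0" using X by (force simp: e_def arc_on_def)
  qed (use finV0 in auto)
  ultimately have trm: "card (V0 - A) \<le> 2 * m * (2 * m + 3)" by (simp add: card_image)
  have eV: "A \<union> (V0 - A) \<union> {v\<in>V. ?D v = 0} = V" using AV by (auto simp: V0_def)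
  have "card (A \<union> (V0 - A) \<union> {v\<in>V. ?D v = 0}) \<le> card (A \<union> (V0 - A)) + card {v\<in>V. ?D v = 0}" by (rule card_Un_le)
  moreover have "card (A \<union> (V0 - A)) \<le> card A + card (V0 - A)" by (rule card_Un_le)
  ultimately have "card V \<le> card A + card (V0 - A) + card {v\<in>V. ?D v = 0}" unfolding eV by linarith
  \<comment> \<open>Exit points contribute 2m(2m + 3), critical points 2 m^2, and the linear term is
    absorbed by m <= m^2.\<close>
  also have "card A + card (V0 - A) + card {v\<in>V. ?D v = 0} \<le> card A + 12 * m\<^sup>2"
  proof -
    have "2 * m * (2 * m + 3) + 2 * m * m \<le> 12 * m\<^sup>2"
    proof -
      have "m \<le> m * m" using m by simp
      then show ?thesis by (simp add: power2_eq_square algebra_simps)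
    qed
    then show ?thesis using trm crit by linarith
  qed
  finally have cardV: "card V \<le> card A + 12 * m\<^sup>2" .
  have "\<exists>q. q \<in> V \<and> (\<exists>g. rel p q g) \<and> (\<forall>q'\<in>V. (\<exists>g. rel p q' g) \<longrightarrow> q $ 2 \<le> q' $ 2)" if pA: "p \<in> A" for p
  proof -
    let ?N = "{q\<in>V. \<exists>g. rel p q g}"
    have N: "finite ?N" "?N \<noteq> {}" using V pA unfolding A_def by auto
    let ?q = "arg_min_on (\<lambda>q. q $ 2) ?N"
    have "?q \<in> ?N" using arg_min_if_finite(1)[OF N] .
    moreover have "?q $ 2 \<le> q' $ 2" if "q' \<in> ?N" for q' using arg_min_least[OF N that, of "\<lambda>q. q $ 2"] .
    ultimately show ?thesis by blast
  qed
  then have "\<forall>p\<in>A. \<exists>q. q \<in> V \<and> (\<exists>g. rel p q g) \<and> (\<forall>q'\<in>V. (\<exists>g. rel p q' g) \<longrightarrow> q $ 2 \<le> q' $ 2)" by blast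
  from bchoice[OF this] obtain s where s: "\<forall>p\<in>A. s p \<in> V \<and> (\<exists>g. rel p (s p) g) \<and> (\<forall>q'\<in>V. (\<exists>g. rel p q' g) \<longrightarrow> s p $ 2 \<le> q' $ 2)"
    by blast
  then have "\<forall>p\<in>A. \<exists>g. rel p (s p) g" by blast
  from bchoice[OF this] obtain g where g: "\<forall>p\<in>A. rel p (s p) (g p)" by blast
  have "card {p\<in>A. sep \<xi> p (s p)} \<le> m"
    if x1: "\<xi> $ 1 \<noteq> 0" and nz: "poly F [:- \<xi> $ 3 / \<xi> $ 1, - \<xi> $ 2 / \<xi> $ 1:] \<noteq> 0" and nv: "\<forall>v\<in>V. lin \<xi> v \<noteq> 0" for \<xi>
  proof -
    let ?b = "- \<xi> $ 3 / \<xi> $ 1" and ?a = "- \<xi> $ 2 / \<xi> $ 1"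
    \<comment> \<open>The intermediate value theorem along the arc from p to s p; as no point of V
      lies on the line, the crossing is strictly between the ends.\<close>
    have "\<exists>c. p $ 2 < c \<and> c < s p $ 2 \<and> g p c = ?b + ?a * c" if p: "p \<in> A" "sep \<xi> p (s p)" for p
    proof -
      define \<phi> where "\<phi> = (\<lambda>t. \<xi> $ 1 * g p t + \<xi> $ 2 * t + \<xi> $ 3)"
      have r: "p $ 2 < s p $ 2" "g p (p $ 2) = p $ 1" "g p (s p $ 2) = s p $ 1" "arc_on F {p $ 2..s p $ 2} (g p)"
        using g p unfolding rel_def by auto
      have c: "continuous_on {p $ 2..s p $ 2} \<phi>" unfolding \<phi>_def using r(4)
        by (intro continuous_intros) (simp add: arc_on_def)
      have ends: "\<phi> (p $ 2) = lin \<xi> p" "\<phi> (s p $ 2) = lin \<xi> (s p)" using r by (auto simp: \<phi>_def lin_eq)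
      have nn: "lin \<xi> p \<noteq> 0" "lin \<xi> (s p) \<noteq> 0" using nv s p AV by auto
      have "\<exists>c\<ge>p $ 2. c \<le> s p $ 2 \<and> \<phi> c = 0"
      proof (cases "lin \<xi> p > 0")
        case True
        then have "lin \<xi> (s p) < 0" using p nn by (auto simp: sep_def)
        then show ?thesis using True r ends c by (intro IVT2') auto
      next
        case False
        then have "lin \<xi> (s p) > 0" "lin \<xi> p < 0" using p nn by (auto simp: sep_def)
        then show ?thesis using r ends c by (intro IVT') auto
      qed
      then obtain c where c: "p $ 2 \<le> c" "c \<le> s p $ 2" "\<phi> c = 0" by blast
      then have "c \<noteq> p $ 2" "c \<noteq> s p $ 2" using ends nn by auto
      moreover have "g p c = ?b + ?a * c" using c(3) x1 by (simp add: \<phi>_def field_simps)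
      ultimately show ?thesis using c by (intro exI[of _ c]) auto
    qed
    then have "\<forall>p\<in>{p\<in>A. sep \<xi> p (s p)}. \<exists>c. p $ 2 < c \<and> c < s p $ 2 \<and> g p c = ?b + ?a * c" by blast
    from bchoice[OF this] obtain c where c: "\<And>p. p \<in> A \<Longrightarrow> sep \<xi> p (s p) \<Longrightarrow> p $ 2 < c p \<and> c p < s p $ 2 \<and> g p (c p) = ?b + ?a * c p"
      by blast
    \<comment> \<open>Different pairs cross at different parameters. Otherwise the two arcs coincide
      and q lies on this arc strictly between p and s p, although s p was chosen as the nearest
      later point.\<close>
    have notlt: "\<not> p $ 2 < q $ 2" if pq: "p \<in> A" "sep \<xi> p (s p)" "q \<in> A" "sep \<xi> q (s q)" "c p = c q" for p q
    proof
      assume lt: "p $ 2 < q $ 2"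
      have rp: "arc_on F {p $ 2..s p $ 2} (g p)" "g p (p $ 2) = p $ 1" using g pq unfolding rel_def by auto
      have rq: "arc_on F {q $ 2..s q $ 2} (g q)" "g q (q $ 2) = q $ 1" using g pq unfolding rel_def by auto
      note cp = c[OF pq(1,2)] and cq = c[OF pq(3,4)]
      have "g p (q $ 2) = g q (q $ 2)"
        by (rule arc_on_unique[of F "{q $ 2..c q}" "g p" "g q" "c q" "q $ 2"])
          (use rp rq lt cp cq pq(5) in \<open>auto intro: arc_on_subset\<close>)
      then have "rel p q (g p)" unfolding rel_def using lt rp rq cp cq pq(5) by (auto intro: arc_on_subset)
      then have "s p $ 2 \<le> q $ 2" using s pq AV by blast
      then show False using cp cq pq(5) by simp
    qed
    have "inj_on c {p\<in>A. sep \<xi> p (s p)}"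
    proof (rule inj_onI)
      fix p q assume "p \<in> {p\<in>A. sep \<xi> p (s p)}" "q \<in> {p\<in>A. sep \<xi> p (s p)}" and cc: "c p = c q"
      then have p: "p \<in> A" "sep \<xi> p (s p)" and q: "q \<in> A" "sep \<xi> q (s q)" by auto
      have eq: "p $ 2 = q $ 2" using notlt[OF p q cc] notlt[OF q p cc[symmetric]] by simp
      have rp: "arc_on F {p $ 2..s p $ 2} (g p)" "g p (p $ 2) = p $ 1" using g p unfolding rel_def by auto
      have rq: "arc_on F {q $ 2..s q $ 2} (g q)" "g q (q $ 2) = q $ 1" using g q unfolding rel_def by auto
      note cp = c[OF p] and cq = c[OF q]
      have "g p (q $ 2) = g q (q $ 2)"
        by (rule arc_on_unique[of F "{q $ 2..c q}" "g p" "g q" "c q" "q $ 2"])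
          (use rp rq eq cp cq cc in \<open>auto intro: arc_on_subset\<close>)
      then show "p = q" using rp rq eq by (intro pt) auto
    qed
    then have "card {p\<in>A. sep \<xi> p (s p)} = card (c ` {p\<in>A. sep \<xi> p (s p)})" by (simp add: card_image)
    \<comment> \<open>Every crossing parameter is a root of F restricted to the line, a nonzero
      polynomial of degree at most m.\<close>
    moreover have "c ` {p\<in>A. sep \<xi> p (s p)} \<subseteq> {t. poly (poly F [:?b, ?a:]) t = 0}"
    proof safe
      fix p assume p: "p \<in> A" "sep \<xi> p (s p)"
      have rp: "arc_on F {p $ 2..s p $ 2} (g p)" using g p unfolding rel_def by auto
      have eq: "g p (c p) = ?b + ?a * c p" using c[OF p] by blast
      have "ev F (c p) (g p (c p)) = 0" 
      proof -
        have "c p \<in> {p $ 2..s p $ 2}" using c[OF p] by (simp add: less_imp_le)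
        then show ?thesis using rp unfolding arc_on_def by blast
      qed
      then show "poly (poly F [:?b, ?a:]) (c p) = 0" unfolding ev_line eq .
    qed
    then have "card (c ` {p\<in>A. sep \<xi> p (s p)}) \<le> card {t. poly (poly F [:?b, ?a:]) t = 0}"
      by (intro card_mono poly_roots_finite nz)
    moreover have "card {t. poly (poly F [:?b, ?a:]) t = 0} \<le> degree (poly F [:?b, ?a:])" by (rule card_poly_roots_bound[OF nz])
    moreover have "degree (poly F [:?b, ?a:]) \<le> m" using degree_poly_line[OF F(3)] .
    ultimately show ?thesis by linarith
  qed
  moreover have "s p \<in> V \<and> p $ 2 < s p $ 2" if "p \<in> A" for p using s g that unfolding rel_def by blast
  ultimately show ?thesis using that[of A s] AV cardV by blast
qed

text \<open>Points are paired upwards on their own vertical line. Only the top point of each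
  vertical line lacks a successor, and a line with \<open>\<xi> $ 1\<close> nonzero meets each
  vertical line once, so it separates at most one consecutive pair there.\<close>

lemma vertical_successor:
  fixes V :: "(real^2) set"
  assumes V: "finite V" "\<And>v. v \<in> V \<Longrightarrow> v $ 2 \<in> \<tau>" and \<tau>: "finite \<tau>"
  obtains A s where "A \<subseteq> V" "card V \<le> card A + card \<tau>" "\<And>p. p \<in> A \<Longrightarrow> s p \<in> V \<and> p $ 1 < s p $ 1"
    "\<And>\<xi>. \<xi> $ 1 \<noteq> 0 \<Longrightarrow> (\<forall>v\<in>V. lin \<xi> v \<noteq> 0) \<Longrightarrow> card {p\<in>A. sep \<xi> p (s p)} \<le> card \<tau>"
proof -
  have pt: "v = w" if "v $ 1 = w $ 1" "v $ 2 = w $ 2" for v w :: "real^2"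
    using that by (simp add: vec_eq_iff forall_2)
  define N where "N = (\<lambda>p::real^2. {q\<in>V. q $ 2 = p $ 2 \<and> p $ 1 < q $ 1})"
  have finN: "finite (N p)" for p using V by (simp add: N_def)
  define A where "A = {p\<in>V. N p \<noteq> {}}"
  define s where "s = (\<lambda>p. arg_min_on (\<lambda>q. q $ 1) (N p))"
  have s: "s p \<in> N p" "\<And>q. q \<in> N p \<Longrightarrow> s p $ 1 \<le> q $ 1" if "p \<in> A" for p
    using that arg_min_if_finite(1)[OF finN[of p], of "\<lambda>q. q $ 1"] arg_min_least[OF finN[of p], of _ "\<lambda>q. q $ 1"] unfolding s_def A_def by auto
  have "inj_on (\<lambda>p. p $ 2) (V - A)"
  proof (rule inj_onI)
    fix p q assume pq: "p \<in> V - A" "q \<in> V - A" "p $ 2 = q $ 2"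
    then have "q \<notin> N p" "p \<notin> N q" by (auto simp: A_def)
    then show "p = q" using pq by (intro pt) (auto simp: N_def)
  qed
  then have "card (V - A) = card ((\<lambda>p. p $ 2) ` (V - A))" by (simp add: card_image)
  also have "\<dots> \<le> card \<tau>" using V \<tau> by (intro card_mono) auto
  finally have 1: "card (V - A) \<le> card \<tau>" .
  have "A \<subseteq> V" by (auto simp: A_def)
  then have "card V = card A + card (V - A)" using V(1) by (metis card_Diff_subset card_mono finite_subset le_add_diff_inverse)
  then have 2: "card V \<le> card A + card \<tau>" using 1 by simp
  have 3: "card {p\<in>A. sep \<xi> p (s p)} \<le> card \<tau>" if x1: "\<xi> $ 1 \<noteq> 0" and nv: "\<forall>v\<in>V. lin \<xi> v \<noteq> 0" for \<xi>
  proof -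
    define z where "z = (\<lambda>t. - (\<xi> $ 2 * t + \<xi> $ 3) / \<xi> $ 1)"
    have btw: "p $ 1 < z (p $ 2) \<and> z (p $ 2) < s p $ 1" if p: "p \<in> A" "sep \<xi> p (s p)" for p
    proof -
      have sp: "s p \<in> V" "s p $ 2 = p $ 2" "p $ 1 < s p $ 1" using s(1)[OF p(1)] by (auto simp: N_def)
      have e: "lin \<xi> p = \<xi> $ 1 * (p $ 1 - z (p $ 2))" "lin \<xi> (s p) = \<xi> $ 1 * (s p $ 1 - z (p $ 2))"
        using x1 sp(2) by (simp_all add: lin_eq z_def field_simps)
      have n: "lin \<xi> p \<noteq> 0" "lin \<xi> (s p) \<noteq> 0" using nv sp(1) p(1) \<open>A \<subseteq> V\<close> by auto
      have "lin \<xi> p * lin \<xi> (s p) < 0" using n p(2) unfolding sep_def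
        by (cases "lin \<xi> p > 0"; cases "lin \<xi> (s p) > 0") (auto simp: mult_less_0_iff)
      then have "(\<xi> $ 1)\<^sup>2 * ((p $ 1 - z (p $ 2)) * (s p $ 1 - z (p $ 2))) < 0"
        unfolding e by (simp add: power2_eq_square algebra_simps)
      then have "(p $ 1 - z (p $ 2)) * (s p $ 1 - z (p $ 2)) < 0"
        using x1 by (simp add: mult_less_0_iff)
      then show ?thesis using sp(3) by (auto simp: mult_less_0_iff)
    qed
    have "inj_on (\<lambda>p. p $ 2) {p\<in>A. sep \<xi> p (s p)}"
    proof (rule inj_onI)
      fix p q assume "p \<in> {p\<in>A. sep \<xi> p (s p)}" "q \<in> {p\<in>A. sep \<xi> p (s p)}" and e: "p $ 2 = q $ 2"
      then have p: "p \<in> A" "sep \<xi> p (s p)" and q: "q \<in> A" "sep \<xi> q (s q)" by auto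
      note bp = btw[OF p] and bq = btw[OF q]
      have "\<not> p $ 1 < q $ 1"
      proof
        assume "p $ 1 < q $ 1"
        then have "q \<in> N p" using e q(1) by (auto simp: N_def A_def)
        then show False using s(2)[OF p(1), of q] bp bq e by simp
      qed
      moreover have "\<not> q $ 1 < p $ 1"
      proof
        assume "q $ 1 < p $ 1"
        then have "p \<in> N q" using e p(1) by (auto simp: N_def A_def)
        then show False using s(2)[OF q(1), of p] bp bq e by simp
      qed
      ultimately show "p = q" using e by (intro pt) auto
    qed
    then have "card {p\<in>A. sep \<xi> p (s p)} = card ((\<lambda>p. p $ 2) ` {p\<in>A. sep \<xi> p (s p)})" by (simp add: card_image)
    also have "\<dots> \<le> card \<tau>" using V(2) \<tau> by (intro card_mono) (auto simp: A_def)
    finally show ?thesis .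
  qed
  have 4: "s p \<in> V \<and> p $ 1 < s p $ 1" if "p \<in> A" for p using s(1)[OF that] by (auto simp: N_def)
  show ?thesis by (rule that[OF \<open>A \<subseteq> V\<close> 2 4 3])
qed

section \<open>Moving a line into general position\<close>

lemma lin_add: "lin (\<xi> + s *\<^sub>R e) v = lin \<xi> v + s * lin e v"
  by (simp add: lin_eq algebra_simps)

lemma same_signs_nearby:
  assumes "finite V" "\<forall>v\<in>V. lin \<xi> v \<noteq> 0"
  shows "\<forall>\<^sub>F s in at_right 0. \<forall>v\<in>V. lin (\<xi> + s *\<^sub>R e) v \<noteq> 0 \<and> (lin (\<xi> + s *\<^sub>R e) v > 0 \<longleftrightarrow> lin \<xi> v > 0)"
proof (rule eventually_ball_finite[OF assms(1)], rule ballI)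
  fix v assume v: "v \<in> V"
  have "((\<lambda>s. lin \<xi> v + s * lin e v) \<longlongrightarrow> lin \<xi> v + 0 * lin e v) (at_right 0)" by (intro tendsto_intros)
  then have t: "((\<lambda>s. lin \<xi> v + s * lin e v) \<longlongrightarrow> lin \<xi> v) (at_right 0)" by simp
  show "\<forall>\<^sub>F s in at_right 0. lin (\<xi> + s *\<^sub>R e) v \<noteq> 0 \<and> (lin (\<xi> + s *\<^sub>R e) v > 0 \<longleftrightarrow> lin \<xi> v > 0)"
  proof (cases "lin \<xi> v > 0")
    case True
    then show ?thesis using order_tendstoD(1)[OF t True] by (auto simp: lin_add elim!: eventually_mono)
  next
    case False
    then have "lin \<xi> v < 0" using assms v by force
    then show ?thesis using order_tendstoD(2)[OF t, of 0] by (auto simp: lin_add elim!: eventually_mono)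
  qed
qed

lemma ex_same_signs:
  assumes "finite V" "\<forall>v\<in>V. lin \<xi> v \<noteq> 0" "finite B"
  obtains s where "s > 0" "s \<notin> B" "\<forall>v\<in>V. lin (\<xi> + s *\<^sub>R e) v \<noteq> 0 \<and> (lin (\<xi> + s *\<^sub>R e) v > 0 \<longleftrightarrow> lin \<xi> v > 0)"
proof -
  obtain b where b: "b > 0" "\<And>s. 0 < s \<Longrightarrow> s < b \<Longrightarrow> \<forall>v\<in>V. lin (\<xi> + s *\<^sub>R e) v \<noteq> 0 \<and> (lin (\<xi> + s *\<^sub>R e) v > 0 \<longleftrightarrow> lin \<xi> v > 0)"
    using same_signs_nearby[OF assms(1,2), of e] unfolding eventually_at_right_field by auto
  have "infinite ({0<..<b} - B)" using b(1) assms(3) by simp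
  then obtain s where "s \<in> {0<..<b} - B" using infinite_imp_nonempty by blast
  then show ?thesis using b that by auto
qed

text \<open>The counts of separated pairs are for generic lines only. A small perturbation keeps
  finitely many points on their sides: first the coefficient of $v_1$ is made nonzero, then the
  offset is moved away from the finitely many parallel lines inside the curve.\<close>

lemma generic_line:
  fixes F :: "real poly poly"
  assumes "finite V" "\<forall>v\<in>V. lin \<xi> v \<noteq> 0" "F \<noteq> 0"
  obtains \<xi>' where "\<xi>' $ 1 \<noteq> 0" "poly F [:- \<xi>' $ 3 / \<xi>' $ 1, - \<xi>' $ 2 / \<xi>' $ 1:] \<noteq> 0"
    "\<forall>v\<in>V. lin \<xi>' v \<noteq> 0 \<and> (lin \<xi>' v > 0 \<longleftrightarrow> lin \<xi> v > 0)"
proof -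
  obtain s where s: "s \<notin> {- \<xi> $ 1}"
    "\<forall>v\<in>V. lin (\<xi> + s *\<^sub>R axis 1 1) v \<noteq> 0 \<and> (lin (\<xi> + s *\<^sub>R axis 1 1) v > 0 \<longleftrightarrow> lin \<xi> v > 0)"
    by (rule ex_same_signs[OF assms(1,2), of "{- \<xi> $ 1}" "axis 1 1"]) auto
  define \<zeta> where "\<zeta> = \<xi> + s *\<^sub>R axis 1 1"
  have z1: "\<zeta> $ 1 \<noteq> 0" using s(1) by (auto simp: \<zeta>_def axis_def)
  have \<zeta>: "\<forall>v\<in>V. lin \<zeta> v \<noteq> 0" using s(2) by (simp add: \<zeta>_def)
  \<comment> \<open>The shifts of the third coordinate for which the translated line lies in the
    curve: b is its intercept.\<close>
  define B where "B = (\<lambda>b. - b * \<zeta> $ 1 - \<zeta> $ 3) ` {b. poly F [:b, - \<zeta> $ 2 / \<zeta> $ 1:] = 0}"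
  have "finite B" unfolding B_def using finite_lines_in_curve[OF assms(3)] by blast
  then obtain r where r: "r \<notin> B"
    "\<forall>v\<in>V. lin (\<zeta> + r *\<^sub>R axis 3 1) v \<noteq> 0 \<and> (lin (\<zeta> + r *\<^sub>R axis 3 1) v > 0 \<longleftrightarrow> lin \<zeta> v > 0)"
    by (rule ex_same_signs[OF assms(1) \<zeta>, of B "axis 3 1"]) auto
  have c: "(\<zeta> + r *\<^sub>R axis 3 1) $ 1 = \<zeta> $ 1" "(\<zeta> + r *\<^sub>R axis 3 1) $ 2 = \<zeta> $ 2" "(\<zeta> + r *\<^sub>R axis 3 1) $ 3 = \<zeta> $ 3 + r"
    by (auto simp: axis_def)
  have "poly F [:- (\<zeta> $ 3 + r) / \<zeta> $ 1, - \<zeta> $ 2 / \<zeta> $ 1:] \<noteq> 0"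
  proof
    assume "poly F [:- (\<zeta> $ 3 + r) / \<zeta> $ 1, - \<zeta> $ 2 / \<zeta> $ 1:] = 0"
    then have "- (- (\<zeta> $ 3 + r) / \<zeta> $ 1) * \<zeta> $ 1 - \<zeta> $ 3 \<in> B" unfolding B_def by blast
    then show False using r(1) z1 by simp
  qed
  moreover have "\<forall>v\<in>V. lin (\<zeta> + r *\<^sub>R axis 3 1) v \<noteq> 0 \<and> (lin (\<zeta> + r *\<^sub>R axis 3 1) v > 0 \<longleftrightarrow> lin \<xi> v > 0)"
    using r(2) s(2) by (simp add: \<zeta>_def[symmetric])
  ultimately show ?thesis by (intro that[of "\<zeta> + r *\<^sub>R axis 3 1"]) (simp_all only: c z1, simp_all)
qed

text \<open>Three losses of about a factor 2 make up the 8: the larger of the vertical part and the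
  rest, the points that have a successor, and an independent half of these.\<close>

lemma curve_pairing:
  fixes V :: "(real^2) set"
  assumes P: "P \<in> polys_deg_le d" and d: "d \<ge> 1" and V: "finite V" "V \<subseteq> real_zeros P" and big: "card V \<ge> 200 * d\<^sup>2"
  obtains L s where "L \<subseteq> V" "card V \<le> 8 * card L" "\<And>p. p \<in> L \<Longrightarrow> s p \<in> V - L"
    "\<And>\<xi>. (\<forall>v\<in>V. lin \<xi> v \<noteq> 0) \<Longrightarrow> card {p\<in>L. sep \<xi> p (s p)} \<le> 2 * d"
proof -
  have P0: "P \<noteq> 0" "tdle P d" using P by (auto simp: polys_deg_le_def tdle_def)
  obtain F where F: "F \<noteq> 0" "coprime F (pderiv F)" "tdle F (2 * d)"
    "\<And>t z. ev P t z = 0 \<Longrightarrow> ev F t z = 0 \<or> (\<forall>z. ev P t z = 0)" using squarefree_part[OF P0] by blast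
  define \<tau> where "\<tau> = {t. \<forall>z. ev P t z = 0}"
  have \<tau>: "finite \<tau>" "card \<tau> \<le> d" using finite_vertical[OF P0] by (auto simp: \<tau>_def)
  define V1 where "V1 = {v\<in>V. v $ 2 \<in> \<tau>}"
  define V2 where "V2 = V - V1"
  have V12: "finite V1" "finite V2" "V1 \<subseteq> V" "V2 \<subseteq> V" using V by (auto simp: V1_def V2_def)
  have "card V = card V1 + card V2" unfolding V2_def using V12 V(1) by (metis card_Diff_subset card_mono le_add_diff_inverse)
  then consider "card V \<le> 2 * card V1" | "card V \<le> 2 * card V2" by linarith
  then show ?thesis
  proof cases
    case 1
    obtain A s where A: "A \<subseteq> V1" "card V1 \<le> card A + card \<tau>" "\<And>p. p \<in> A \<Longrightarrow> s p \<in> V1 \<and> p $ 1 < s p $ 1"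
      "\<And>\<xi>. \<xi> $ 1 \<noteq> 0 \<Longrightarrow> (\<forall>v\<in>V1. lin \<xi> v \<noteq> 0) \<Longrightarrow> card {p\<in>A. sep \<xi> p (s p)} \<le> card \<tau>"
      using vertical_successor[OF V12(1) _ \<tau>(1)] unfolding V1_def by blast
    have finA: "finite A" using A(1) V12 finite_subset by blast
    obtain L where L: "L \<subseteq> A" "card A \<le> 2 * card L" "\<And>p. p \<in> L \<Longrightarrow> s p \<notin> L"
      using independent_half[of A "\<lambda>p. p $ 1" s] finA A(3) by blast
    show ?thesis
    proof (rule that[of L s])
      have "d \<le> d\<^sup>2" using d by (simp add: power2_eq_square)
      then show "card V \<le> 8 * card L" using 1 A(2) \<tau>(2) L(2) big by linarith
      fix \<xi> :: "real^3" assume nv: "\<forall>v\<in>V. lin \<xi> v \<noteq> 0"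
      obtain \<xi>' where \<xi>': "\<xi>' $ 1 \<noteq> 0" "\<forall>v\<in>V. lin \<xi>' v \<noteq> 0 \<and> (lin \<xi>' v > 0 \<longleftrightarrow> lin \<xi> v > 0)"
        using generic_line[OF V(1) nv F(1)] by metis
      have "{p\<in>L. sep \<xi> p (s p)} \<subseteq> {p\<in>A. sep \<xi>' p (s p)}"
        using \<xi>'(2) L(1) A(1,3) V12(3) unfolding sep_def by blast
      then have "card {p\<in>L. sep \<xi> p (s p)} \<le> card {p\<in>A. sep \<xi>' p (s p)}" using finA by (intro card_mono) auto
      also have "\<dots> \<le> card \<tau>" using \<xi>' V12(3) by (intro A(4)) auto
      finally show "card {p\<in>L. sep \<xi> p (s p)} \<le> 2 * d" using \<tau>(2) by simp
    qed (use L A V12 in blast)+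
  next
    case 2
    have zero: "ev F (v $ 2) (v $ 1) = 0" if "v \<in> V2" for v
    proof -
      have "ev P (v $ 2) (v $ 1) = 0" using that V(2) V12(4) by (auto simp: real_zeros_def eval2_eq_ev)
      then show ?thesis using F(4) that by (auto simp: V2_def V1_def \<tau>_def)
    qed
    have "2 * d \<ge> 1" using d by simp
    from arcs_successor[OF F(1-3) this V12(2) zero]
    obtain A s where A: "A \<subseteq> V2" "card V2 \<le> card A + 12 * (2 * d)\<^sup>2" "\<And>p. p \<in> A \<Longrightarrow> s p \<in> V2 \<and> p $ 2 < s p $ 2"
      "\<And>\<xi>. \<xi> $ 1 \<noteq> 0 \<Longrightarrow> poly F [:- \<xi> $ 3 / \<xi> $ 1, - \<xi> $ 2 / \<xi> $ 1:] \<noteq> 0 \<Longrightarrow> (\<forall>v\<in>V2. lin \<xi> v \<noteq> 0) \<Longrightarrow>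
       card {p\<in>A. sep \<xi> p (s p)} \<le> 2 * d" by blast
    have finA: "finite A" using A(1) V12 finite_subset by blast
    obtain L where L: "L \<subseteq> A" "card A \<le> 2 * card L" "\<And>p. p \<in> L \<Longrightarrow> s p \<notin> L"
      using independent_half[of A "\<lambda>p. p $ 2" s] finA A(3) by blast
    show ?thesis
    proof (rule that[of L s])
      \<comment> \<open>F has degree 2d, so at most 48 d^2 points lack a successor. Twice this
        number is less than half of the threshold 200 d^2, which is what the threshold is
        for.\<close>
      have "12 * (2 * d)\<^sup>2 = 48 * d\<^sup>2" by (simp add: power2_eq_square)
      then show "card V \<le> 8 * card L" using 2 A(2) L(2) big by linarith
      fix \<xi> :: "real^3" assume nv: "\<forall>v\<in>V. lin \<xi> v \<noteq> 0"
      obtain \<xi>' where \<xi>': "\<xi>' $ 1 \<noteq> 0" "poly F [:- \<xi>' $ 3 / \<xi>' $ 1, - \<xi>' $ 2 / \<xi>' $ 1:] \<noteq> 0"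
        "\<forall>v\<in>V. lin \<xi>' v \<noteq> 0 \<and> (lin \<xi>' v > 0 \<longleftrightarrow> lin \<xi> v > 0)"
        using generic_line[OF V(1) nv F(1)] by metis
      have "{p\<in>L. sep \<xi> p (s p)} \<subseteq> {p\<in>A. sep \<xi>' p (s p)}"
        using \<xi>'(3) L(1) A(1,3) V12(4) unfolding sep_def by blast
      then have "card {p\<in>L. sep \<xi> p (s p)} \<le> card {p\<in>A. sep \<xi>' p (s p)}" using finA by (intro card_mono) auto
      also have "\<dots> \<le> 2 * d" using \<xi>' V12(4) by (intro A(4)) auto
      finally show "card {p\<in>L. sep \<xi> p (s p)} \<le> 2 * d" .
    qed (use L A V12 in blast)+
  qed
qed

subsection \<open>The maximal inequality for a family of directions\<close>

lemma weighted_am_gm: assumes "0 < t" shows "2 * G * K \<le> t * G\<^sup>2 + (1 / t) * (K::real)\<^sup>2"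
proof -
  have "0 \<le> (t * G - K)\<^sup>2 / t" using assms by simp
  also have "\<dots> = t * G\<^sup>2 + (1 / t) * K\<^sup>2 - 2 * G * K"
    using assms by (simp add: power2_eq_square field_simps)
  finally show ?thesis by simp
qed

text \<open>Minkowski's inequality in squared form. With the weights b/a and a/b on the mixed term
  the bounds add up to exactly (a + b)^2; hence a and b are positive.\<close>

lemma nn_integral_square_le:
  assumes [measurable]: "g \<in> borel_measurable M" "k \<in> borel_measurable M"
    and fg: "\<And>x. x \<in> space M \<Longrightarrow> 0 \<le> f x \<and> f x \<le> g x + k x \<and> 0 \<le> g x \<and> 0 \<le> k x"
    and a: "a > 0" "(\<integral>\<^sup>+x. ennreal ((g x)\<^sup>2) \<partial>M) \<le> ennreal (a\<^sup>2)"
    and b: "b > 0" "(\<integral>\<^sup>+x. ennreal ((k x)\<^sup>2) \<partial>M) \<le> ennreal (b\<^sup>2)"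
  shows "(\<integral>\<^sup>+x. ennreal ((f x)\<^sup>2) \<partial>M) \<le> ennreal ((a + b)\<^sup>2)"
proof -
  define c where "c = 1 + b / a" define d where "d = 1 + a / b"
  have cd: "c \<ge> 0" "d \<ge> 0" using a b by (auto simp: c_def d_def)
  have "(f x)\<^sup>2 \<le> c * (g x)\<^sup>2 + d * (k x)\<^sup>2" if "x \<in> space M" for x
  proof -
    have "(f x)\<^sup>2 \<le> (g x + k x)\<^sup>2" using fg[OF that] by (intro power_mono) auto
    also have "\<dots> = (g x)\<^sup>2 + (k x)\<^sup>2 + 2 * g x * k x" by (simp add: power2_sum)
    also have "2 * g x * k x \<le> (b / a) * (g x)\<^sup>2 + (a / b) * (k x)\<^sup>2"
      using weighted_am_gm[of "b / a" "g x" "k x"] a b by simp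
    finally show ?thesis by (simp add: c_def d_def algebra_simps)
  qed
  then have "(\<integral>\<^sup>+x. ennreal ((f x)\<^sup>2) \<partial>M) \<le> (\<integral>\<^sup>+x. ennreal c * ennreal ((g x)\<^sup>2) + ennreal d * ennreal ((k x)\<^sup>2) \<partial>M)"
    using cd by (intro nn_integral_mono) (simp flip: ennreal_mult ennreal_plus add: ennreal_leI)
  also have "\<dots> = ennreal c * (\<integral>\<^sup>+x. ennreal ((g x)\<^sup>2) \<partial>M) + ennreal d * (\<integral>\<^sup>+x. ennreal ((k x)\<^sup>2) \<partial>M)"
    by (simp add: nn_integral_add nn_integral_cmult)
  also have "\<dots> \<le> ennreal c * ennreal (a\<^sup>2) + ennreal d * ennreal (b\<^sup>2)"
    using a b by (intro add_mono mult_left_mono) auto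
  also have "\<dots> = ennreal (c * a\<^sup>2 + d * b\<^sup>2)" using cd by (simp flip: ennreal_mult ennreal_plus)
  also have "c * a\<^sup>2 + d * b\<^sup>2 = (a + b)\<^sup>2"
    using a b by (simp add: c_def d_def power2_eq_square field_simps)
  finally show ?thesis .
qed

text \<open>The inserted 0 gives the empty family the value 0, in agreement with the supremum in
  \<open>hilbert_max\<close>.\<close>

definition max_modulus :: "('v \<Rightarrow> 'x \<Rightarrow> complex) \<Rightarrow> 'v set \<Rightarrow> 'x \<Rightarrow> real" where
  "max_modulus h V x = Max (insert 0 ((\<lambda>v. cmod (h v x)) ` V))"

lemma max_modulus_empty [simp]: "max_modulus h {} x = 0" by (simp add: max_modulus_def)

lemma max_modulus_insert: "finite V \<Longrightarrow> max_modulus h (insert v V) x = max (cmod (h v x)) (max_modulus h V x)"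
  by (simp add: max_modulus_def insert_commute[of 0])

lemma max_modulus_nonneg: "finite V \<Longrightarrow> 0 \<le> max_modulus h V x"
  by (simp add: max_modulus_def)

lemma max_modulus_ge: "finite V \<Longrightarrow> v \<in> V \<Longrightarrow> cmod (h v x) \<le> max_modulus h V x"
  by (simp add: max_modulus_def)

lemma max_modulus_le: "finite V \<Longrightarrow> 0 \<le> c \<Longrightarrow> (\<And>v. v \<in> V \<Longrightarrow> cmod (h v x) \<le> c) \<Longrightarrow> max_modulus h V x \<le> c"
  by (simp add: max_modulus_def)

lemma borel_measurable_max_modulus:
  "finite V \<Longrightarrow> (\<And>v. v \<in> V \<Longrightarrow> h v \<in> borel_measurable M) \<Longrightarrow> max_modulus h V \<in> borel_measurable M"
proof (induction V rule: finite_induct)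
  case empty
  then show ?case by (simp add: max_modulus_def[abs_def])
next
  case (insert v V)
  then have "max_modulus h (insert v V) = (\<lambda>x. max (cmod (h v x)) (max_modulus h V x))" by (auto simp: max_modulus_insert)
  then show ?case using insert by simp
qed

text \<open>All that the combinatorics knows about the operators at one fixed function: h stands for
  the normalised transforms, and D p q for the spectral mass of the frequencies whose line separates
  p and q. \<open>Davg\<close> is then an exchange of sum and integral; it asks only about generic
  \<xi>, the others being a null set.\<close>

locale direction_family =
  fixes \<Omega> :: "(real^2) set" and h :: "real^2 \<Rightarrow> 'x \<Rightarrow> complex" and M :: "'x measure" and D :: "real^2 \<Rightarrow> real^2 \<Rightarrow> real"
  assumes fin: "finite \<Omega>"
    and meas: "v \<in> \<Omega> \<Longrightarrow> h v \<in> borel_measurable M"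
    and bound: "v \<in> \<Omega> \<Longrightarrow> (\<integral>\<^sup>+x. ennreal ((cmod (h v x))\<^sup>2) \<partial>M) \<le> 1"
    and D0: "0 \<le> D p q" and Dsym: "D p q = D q p"
    and Dbound: "p \<in> \<Omega> \<Longrightarrow> q \<in> \<Omega> \<Longrightarrow> (\<integral>\<^sup>+x. ennreal ((cmod (h p x - h q x))\<^sup>2) \<partial>M) \<le> ennreal (D p q)"
    and Davg: "U \<subseteq> \<Omega> \<times> \<Omega> \<Longrightarrow> 0 \<le> k \<Longrightarrow>
      (\<And>\<xi>. (\<forall>v\<in>\<Omega>. lin \<xi> v \<noteq> 0) \<Longrightarrow> real (card {p\<in>U. sep \<xi> (fst p) (snd p)}) \<le> k) \<Longrightarrow>
      (\<Sum>p\<in>U. D (fst p) (snd p)) \<le> 4 * k"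
begin

definition E2 :: "(real^2) set \<Rightarrow> ennreal" where
  "E2 V = (\<integral>\<^sup>+x. ennreal ((max_modulus h V x)\<^sup>2) \<partial>M)"

lemma finV: "V \<subseteq> \<Omega> \<Longrightarrow> finite V" using fin finite_subset by blast

lemma E2_trivial: assumes V: "V \<subseteq> \<Omega>" shows "E2 V \<le> ennreal (real (card V))"
proof -
  have "(max_modulus h V x)\<^sup>2 \<le> (\<Sum>v\<in>V. (cmod (h v x))\<^sup>2)" for x
  proof -
    have "max_modulus h V x \<le> sqrt (\<Sum>v\<in>V. (cmod (h v x))\<^sup>2)"
    proof (rule max_modulus_le[OF finV[OF V]])
      fix v assume "v \<in> V"
      then have "(cmod (h v x))\<^sup>2 \<le> (\<Sum>v\<in>V. (cmod (h v x))\<^sup>2)"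
        using finV[OF V] by (intro member_le_sum) auto
      then show "cmod (h v x) \<le> sqrt (\<Sum>v\<in>V. (cmod (h v x))\<^sup>2)" by (rule real_le_rsqrt)
    qed (simp add: sum_nonneg)
    then have "(max_modulus h V x)\<^sup>2 \<le> (sqrt (\<Sum>v\<in>V. (cmod (h v x))\<^sup>2))\<^sup>2"
      using max_modulus_nonneg[OF finV[OF V]] by (intro power_mono)
    then show ?thesis by (simp add: sum_nonneg)
  qed
  then have "E2 V \<le> (\<integral>\<^sup>+x. (\<Sum>v\<in>V. ennreal ((cmod (h v x))\<^sup>2)) \<partial>M)"
    unfolding E2_def by (intro nn_integral_mono) (simp add: ennreal_leI)
  also have "\<dots> = (\<Sum>v\<in>V. \<integral>\<^sup>+x. ennreal ((cmod (h v x))\<^sup>2) \<partial>M)"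
    using meas V by (intro nn_integral_sum) auto
  also have "\<dots> \<le> (\<Sum>v\<in>V. 1)" using V bound by (intro sum_mono) auto
  finally show ?thesis by (simp add: ennreal_of_nat_eq_real_of_nat)
qed

text \<open>Pointwise, the modulus at p in L is at most the modulus at s p plus the square root of
  the sum over L of all squared differences. So discarding L costs b in norm.\<close>

lemma E2_step:
  assumes V: "V \<subseteq> \<Omega>" and L: "L \<subseteq> V" "\<And>p. p \<in> L \<Longrightarrow> s p \<in> V - L"
    and a: "a > 0" "E2 (V - L) \<le> ennreal (a\<^sup>2)"
    and b: "b > 0" "(\<Sum>p\<in>L. D p (s p)) \<le> b\<^sup>2"
  shows "E2 V \<le> ennreal ((a + b)\<^sup>2)"
proof -
  have f: "finite V" "finite L" "finite (V - L)" using finV[OF V] L(1) finite_subset by auto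
  have m: "h v \<in> borel_measurable M" if "v \<in> V" for v using meas V that by auto
  define k where "k = (\<lambda>x. sqrt (\<Sum>p\<in>L. (cmod (h p x - h (s p) x))\<^sup>2))"
  have ml: "h p \<in> borel_measurable M" "h (s p) \<in> borel_measurable M" if "p \<in> L" for p
    using m L that by auto
  have mk: "k \<in> borel_measurable M" unfolding k_def
    using ml by (intro measurable_compose[OF _ borel_measurable_sqrt] borel_measurable_sum) auto
  have "(\<integral>\<^sup>+x. ennreal ((k x)\<^sup>2) \<partial>M) = (\<integral>\<^sup>+x. (\<Sum>p\<in>L. ennreal ((cmod (h p x - h (s p) x))\<^sup>2)) \<partial>M)"
    by (simp add: k_def sum_nonneg)
  also have "\<dots> = (\<Sum>p\<in>L. \<integral>\<^sup>+x. ennreal ((cmod (h p x - h (s p) x))\<^sup>2) \<partial>M)"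
    using ml by (intro nn_integral_sum) auto
  also have "\<dots> \<le> (\<Sum>p\<in>L. ennreal (D p (s p)))"
  proof (rule sum_mono)
    fix p assume "p \<in> L"
    then have "p \<in> \<Omega>" "s p \<in> \<Omega>" using L V by auto
    then show "(\<integral>\<^sup>+x. ennreal ((cmod (h p x - h (s p) x))\<^sup>2) \<partial>M) \<le> ennreal (D p (s p))" by (rule Dbound)
  qed
  also have "\<dots> = ennreal (\<Sum>p\<in>L. D p (s p))" using D0 by simp
  also have "\<dots> \<le> ennreal (b\<^sup>2)" using b by (intro ennreal_leI)
  finally have k2: "(\<integral>\<^sup>+x. ennreal ((k x)\<^sup>2) \<partial>M) \<le> ennreal (b\<^sup>2)" .
  have le: "max_modulus h V x \<le> max_modulus h (V - L) x + k x" for x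
  proof (rule max_modulus_le[OF f(1)])
    have k0: "0 \<le> k x" by (simp add: k_def sum_nonneg)
    show "0 \<le> max_modulus h (V - L) x + k x" by (rule add_nonneg_nonneg[OF max_modulus_nonneg[OF f(3)] k0])
    fix v assume v: "v \<in> V"
    show "cmod (h v x) \<le> max_modulus h (V - L) x + k x"
    proof (cases "v \<in> L")
      case False
      then show ?thesis using max_modulus_ge[OF f(3), of v h x] v k0 by simp
    next
      case True
      have "(cmod (h v x - h (s v) x))\<^sup>2 \<le> (\<Sum>p\<in>L. (cmod (h p x - h (s p) x))\<^sup>2)"
        using True f(2) by (intro member_le_sum[of v L "\<lambda>p. (cmod (h p x - h (s p) x))\<^sup>2"]) auto
      then have "cmod (h v x - h (s v) x) \<le> k x" unfolding k_def by (rule real_le_rsqrt)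
      moreover have "cmod (h (s v) x) \<le> max_modulus h (V - L) x" using L(2)[OF True] by (intro max_modulus_ge[OF f(3)])
      moreover have "cmod (h v x) \<le> cmod (h (s v) x) + cmod (h v x - h (s v) x)"
        by (metis norm_triangle_sub)
      ultimately show ?thesis by linarith
    qed
  qed
  show ?thesis unfolding E2_def
  proof (rule nn_integral_square_le[OF _ mk _ a(1) _ b(1) k2])
    show "max_modulus h (V - L) \<in> borel_measurable M" using m by (intro borel_measurable_max_modulus f) auto
    show "(\<integral>\<^sup>+x. ennreal ((max_modulus h (V - L) x)\<^sup>2) \<partial>M) \<le> ennreal (a\<^sup>2)" using a(2) by (simp add: E2_def)
    fix x
    have "0 \<le> k x" by (simp add: k_def sum_nonneg)
    then show "0 \<le> max_modulus h V x \<and> max_modulus h V x \<le> max_modulus h (V - L) x + k x \<and> 0 \<le> max_modulus h (V - L) x \<and> 0 \<le> k x"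
      using le[of x] max_modulus_nonneg[OF f(1), of h x] max_modulus_nonneg[OF f(3), of h x] by simp
  qed
qed

text \<open>If every generic line separated less than the fraction \<sigma> of a family of pairs,
  \<open>Davg\<close> would bound the mean of D over it by 4 \<sigma>. So large distances produce
  the lines required by \<open>card_le_of_separating_lines\<close>.\<close>

lemma packing:
  assumes V: "V \<subseteq> \<Omega>" and \<sigma>: "0 \<le> \<sigma>" "\<sigma> \<le> 1"
    and s: "\<And>p q. p \<in> V \<Longrightarrow> q \<in> V \<Longrightarrow> p \<noteq> q \<Longrightarrow> D p q > 4 * \<sigma>"
    and r: "(1 - \<sigma>) ^ r * (real (card V))\<^sup>2 < 1"
  shows "card V \<le> 1 + r + r\<^sup>2"
proof (rule card_le_of_separating_lines[where G = "{\<xi>. \<forall>v\<in>\<Omega>. lin \<xi> v \<noteq> 0}", OF finV[OF V] \<sigma> _ _ r])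
  fix U assume U: "U \<subseteq> V \<times> V" "\<forall>p\<in>U. fst p \<noteq> snd p" "U \<noteq> {}"
  show "\<exists>\<xi>\<in>{\<xi>. \<forall>v\<in>\<Omega>. lin \<xi> v \<noteq> 0}. \<sigma> * real (card U) \<le> real (card {p\<in>U. sep \<xi> (fst p) (snd p)})"
  proof (rule ccontr)
    assume n: "\<not> ?thesis"
    have fU: "finite U" using U(1) finV[OF V] finite_subset by fastforce
    have "(\<Sum>p\<in>U. D (fst p) (snd p)) \<le> 4 * (\<sigma> * real (card U))"
      by (rule Davg) (use U V \<sigma> n in \<open>auto simp: not_le less_imp_le\<close>)
    moreover have "(\<Sum>p\<in>U. 4 * \<sigma>) < (\<Sum>p\<in>U. D (fst p) (snd p))"
    proof (rule sum_strict_mono[OF fU U(3)])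
      fix p assume "p \<in> U"
      then have "fst p \<in> V" "snd p \<in> V" "fst p \<noteq> snd p" using U(1,2) by auto
      then show "4 * \<sigma> < D (fst p) (snd p)" by (rule s)
    qed
    moreover have "(\<Sum>p\<in>U. 4 * \<sigma>) = 4 * (\<sigma> * real (card U))" by simp
    ultimately show False by linarith
  qed
qed (use V in auto)

text \<open>The constant 16 reproduces itself: at most n/16 points survive, which gives 8 n^(1/4),
  and discarding the others costs another 8 n^(1/4), both times sqrt (ln N).\<close>

lemma E2_general:
  assumes V: "V \<subseteq> \<Omega>" "V \<noteq> {}" and N: "N \<ge> 3" "card V \<le> N"
  shows "E2 V \<le> ennreal ((16 * sqrt (sqrt (real (card V))) * sqrt (ln (real N)))\<^sup>2)"
  using V N(2)
proof (induction "card V" arbitrary: V rule: less_induct)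
  case less
  define n where "n = real (card V)"
  define \<Lambda> where "\<Lambda> = ln (real N)"
  have "exp 1 \<le> real N" using e_less_272 N by linarith
  then have \<Lambda>: "\<Lambda> \<ge> 1" unfolding \<Lambda>_def using N by (subst ln_ge_iff) auto
  have n1: "n \<ge> 1" using less.prems finV[OF less.prems(1)] by (simp add: n_def Suc_le_eq card_gt_0_iff)
  show ?case
  proof (cases "sqrt n < 24 \<or> sqrt n < 16 * \<Lambda>")
    \<comment> \<open>For small n the trivial bound n is enough. The two thresholds are chosen to
      have \<sigma> <= 1 and to absorb the rounding of r in the other case.\<close>
    case True
    have "sqrt n \<le> 24 * \<Lambda>" using True \<Lambda> by linarith
    then have "n \<le> 24 * \<Lambda> * sqrt n" using n1 mult_right_mono[of "sqrt n" "24 * \<Lambda>" "sqrt n"] by simp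
    also have "\<dots> \<le> 256 * \<Lambda> * sqrt n" using \<Lambda> n1 by (intro mult_right_mono) auto
    also have "\<dots> = (16 * sqrt (sqrt n) * sqrt \<Lambda>)\<^sup>2" using n1 \<Lambda> by (simp add: power_mult_distrib)
    finally have "ennreal n \<le> ennreal ((16 * sqrt (sqrt n) * sqrt \<Lambda>)\<^sup>2)" by (rule ennreal_leI)
    with E2_trivial[OF less.prems(1)] show ?thesis unfolding n_def \<Lambda>_def by (rule order_trans)
  next
    case False
    \<comment> \<open>With this value 2 \<Lambda> / \<sigma> is sqrt n / 8; after rounding, r + 1 <=
      sqrt n / 4, and r lines give at most n/16 cells.\<close>
    define \<sigma> where "\<sigma> = 16 * \<Lambda> / sqrt n"
    have \<sigma>: "0 < \<sigma>" "\<sigma> \<le> 1" using False \<Lambda> n1 by (auto simp: \<sigma>_def field_simps)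
    let ?S = "{X. X \<subseteq> V \<and> (\<forall>p\<in>X. \<forall>q\<in>X. p \<noteq> q \<longrightarrow> D p q > 4 * \<sigma>)}"
    have finS: "finite ?S" using finV[OF less.prems(1)] by (intro finite_subset[of ?S "Pow V"]) auto
    have "{} \<in> ?S" by auto
    then obtain X where X: "X \<in> ?S" "\<And>Y. Y \<in> ?S \<Longrightarrow> card Y \<le> card X"
    proof -
      have "Max (card ` ?S) \<in> card ` ?S" using finS \<open>{} \<in> ?S\<close> by (intro Max_in) blast+
      then obtain X where "X \<in> ?S" "card X = Max (card ` ?S)" by (metis (no_types, lifting) imageE)
      then show ?thesis using finS by (intro that[of X]) (auto intro!: Max_ge)
    qed
    have XV: "X \<subseteq> V" "finite X" using X(1) finV[OF less.prems(1)] finite_subset by auto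
    have near: "\<exists>q\<in>X. D p q \<le> 4 * \<sigma>" if p: "p \<in> V - X" for p
    proof (rule ccontr)
      assume "\<not> ?thesis"
      then have "insert p X \<in> ?S" using X(1) p Dsym by (auto simp: not_le)
      then have "card (insert p X) \<le> card X" by (rule X(2))
      then show False using p XV by simp
    qed
    then obtain s where s: "\<And>p. p \<in> V - X \<Longrightarrow> s p \<in> X \<and> D p (s p) \<le> 4 * \<sigma>" by metis
    have X0: "X \<noteq> {}" using near less.prems(2) by (cases "X = {}") auto
    \<comment> \<open>An integer above 2 \<Lambda> / \<sigma>, so that (1 - \<sigma>)^r <= exp (-
      \<sigma> r) falls below N^(-2) and no pair remains unseparated.\<close>
    define r where "r = nat \<lfloor>2 * \<Lambda> / \<sigma>\<rfloor> + 1"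
    have r: "2 * \<Lambda> / \<sigma> < real r" "real r \<le> 2 * \<Lambda> / \<sigma> + 1" using \<sigma> \<Lambda> unfolding r_def by (auto simp: of_nat_nat) linarith+
    have "card X \<le> 1 + r + r\<^sup>2"
    proof (rule packing)
      have "(1 - \<sigma>) ^ r \<le> exp (- \<sigma>) ^ r" using \<sigma> exp_ge_add_one_self[of "- \<sigma>"] by (intro power_mono) auto
      also have "\<dots> = exp (- (\<sigma> * real r))" by (simp add: exp_of_nat_mult[symmetric] mult.commute)
      finally have e: "(1 - \<sigma>) ^ r \<le> exp (- (\<sigma> * real r))" .
      have "\<sigma> * real r > 2 * \<Lambda>" using r(1) \<sigma> by (simp add: field_simps)
      then have "exp (- (\<sigma> * real r)) < exp (- (2 * \<Lambda>))" by simp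
      also have "exp (- (2 * \<Lambda>)) = 1 / (real N)\<^sup>2"
        using N by (simp add: \<Lambda>_def exp_minus exp_double field_simps)
      finally have "(1 - \<sigma>) ^ r < 1 / (real N)\<^sup>2" using e by simp
      moreover have "(real (card X))\<^sup>2 \<le> (real N)\<^sup>2"
        using card_mono[OF finV[OF less.prems(1)] XV(1)] less.prems(3) by (intro power_mono) auto
      moreover have "(real (card X))\<^sup>2 > 0" using X0 XV by (simp add: card_gt_0_iff)
      ultimately have "(1 - \<sigma>) ^ r * (real (card X))\<^sup>2 < 1 / (real N)\<^sup>2 * (real N)\<^sup>2"
        by (intro mult_less_le_imp_less) (use \<sigma> in auto)
      then show "(1 - \<sigma>) ^ r * (real (card X))\<^sup>2 < 1" using N by simp
    qed (use X(1) XV less.prems \<sigma> in auto)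
    then have "real (card X) \<le> 1 + real r + (real r)\<^sup>2"
      by (metis (mono_tags, lifting) of_nat_1 of_nat_add of_nat_le_iff of_nat_power)
    also have "\<dots> \<le> (real r + 1)\<^sup>2" by (simp add: power2_eq_square algebra_simps)
    also have "\<dots> \<le> (sqrt n / 4)\<^sup>2"
    proof (rule power_mono)
      have "2 * \<Lambda> / \<sigma> = sqrt n / 8" using \<Lambda> n1 by (simp add: \<sigma>_def)
      then show "real r + 1 \<le> sqrt n / 4" using r(2) False by linarith
    qed auto
    also have "\<dots> = n / 16" using n1 by (simp add: power_divide)
    finally have cX: "real (card X) \<le> n / 16" .
    have "E2 (V - (V - X)) \<le> ennreal ((16 * sqrt (sqrt (n / 16)) * sqrt \<Lambda>)\<^sup>2)"
    proof -
      have "card X < card V" using cX n1 unfolding n_def by linarith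
      then have "E2 X \<le> ennreal ((16 * sqrt (sqrt (real (card X))) * sqrt (ln (real N)))\<^sup>2)"
        using less.hyps[of X] XV X0 less.prems by auto
      also have "\<dots> \<le> ennreal ((16 * sqrt (sqrt (n / 16)) * sqrt \<Lambda>)\<^sup>2)"
        using cX \<Lambda> unfolding \<Lambda>_def[symmetric] by (intro ennreal_leI power_mono mult_mono) auto
      also have "X = V - (V - X)" using XV by auto
      finally show ?thesis .
    qed
    moreover have "(\<Sum>p\<in>V - X. D p (s p)) \<le> (8 * sqrt (sqrt n) * sqrt \<Lambda>)\<^sup>2"
    proof -
      \<comment> \<open>Each discarded point costs at most 4 \<sigma>, by maximality of X; n times
        this is 64 \<Lambda> sqrt n, the square of 8 n^(1/4) sqrt \<Lambda>.\<close>
      have "(\<Sum>p\<in>V - X. D p (s p)) \<le> (\<Sum>p\<in>V - X. 4 * \<sigma>)" using s by (intro sum_mono) auto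
      also have "\<dots> = real (card (V - X)) * (4 * \<sigma>)" by simp
      also have "\<dots> \<le> n * (4 * \<sigma>)" using \<sigma> finV[OF less.prems(1)] unfolding n_def
        by (intro mult_right_mono) (auto intro: card_mono)
      also have "\<dots> = 64 * \<Lambda> * (n / sqrt n)" by (simp add: \<sigma>_def)
      also have "n / sqrt n = sqrt n" using n1 by (simp add: real_div_sqrt)
      also have "64 * \<Lambda> * sqrt n = (8 * sqrt (sqrt n) * sqrt \<Lambda>)\<^sup>2" using n1 \<Lambda> by (simp add: power_mult_distrib)
      finally show ?thesis .
    qed
    ultimately have "E2 V \<le> ennreal ((16 * sqrt (sqrt (n / 16)) * sqrt \<Lambda> + 8 * sqrt (sqrt n) * sqrt \<Lambda>)\<^sup>2)"
      using n1 \<Lambda> s XV by (intro E2_step[OF less.prems(1), of "V - X" s]) auto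
    also have "16 * sqrt (sqrt (n / 16)) * sqrt \<Lambda> + 8 * sqrt (sqrt n) * sqrt \<Lambda> = 16 * sqrt (sqrt n) * sqrt \<Lambda>"
    proof -
      have "sqrt (16::real) = 4" "sqrt (4::real) = 2" by (auto simp: real_sqrt_eq_iff intro: real_sqrt_unique)
      then have "sqrt (sqrt (n / 16)) = sqrt (sqrt n) / 2" by (simp add: real_sqrt_divide)
      then show ?thesis by simp
    qed
    finally show ?thesis unfolding n_def \<Lambda>_def .
  qed
qed

text \<open>The term 64 ln N is the cost of the last O(d^2) points; 24 ln (card V) is a potential
  that pays for the rounds before.\<close>

lemma E2_curve:
  assumes P: "P \<in> polys_deg_le d" and d: "d \<ge> 1" and V: "V \<subseteq> \<Omega>" "V \<noteq> {}" "V \<subseteq> real_zeros P"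
    and N: "N \<ge> 3" "card V \<le> N"
  shows "E2 V \<le> ennreal ((sqrt (real d) * (64 * ln (real N) + 24 * ln (real (card V))))\<^sup>2)"
  using V N(2)
proof (induction "card V" arbitrary: V rule: less_induct)
  case less
  define n where "n = real (card V)"
  define \<Lambda> where "\<Lambda> = ln (real N)"
  have "exp 1 \<le> real N" using e_less_272 N by linarith
  then have \<Lambda>: "\<Lambda> \<ge> 1" unfolding \<Lambda>_def using N by (subst ln_ge_iff) auto
  have n1: "n \<ge> 1" using less.prems finV[OF less.prems(1)] by (simp add: n_def Suc_le_eq card_gt_0_iff)
  have fV: "finite V" using finV less.prems by blast
  show ?case
  proof (cases "card V \<ge> 200 * d\<^sup>2")
    case False
    \<comment> \<open>Here n <= (16 d)^2, so n^(1/4) <= 4 sqrt d; and sqrt \<Lambda> <= \<Lambda>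
      because N >= 3 gives \<Lambda> >= 1.\<close>
    then have "card V \<le> 256 * d\<^sup>2" by linarith
    then have "n \<le> real (256 * d\<^sup>2)" unfolding n_def by (simp only: of_nat_le_iff)
    also have "\<dots> = (16 * real d)\<^sup>2" by (simp add: power_mult_distrib)
    finally have "sqrt n \<le> 16 * real d" by (simp add: real_le_lsqrt)
    then have "sqrt (sqrt n) \<le> sqrt (16 * real d)" by simp
    also have "sqrt (16 * real d) = 4 * sqrt (real d)"
      using real_sqrt_mult[of 16 "real d"] by (simp add: real_sqrt_unique[of 4 16])
    finally have a: "sqrt (sqrt n) \<le> 4 * sqrt (real d)" .
    have "sqrt \<Lambda> \<le> \<Lambda>" using \<Lambda> by (intro real_le_lsqrt) (auto simp: power2_eq_square)
    then have "16 * sqrt (sqrt n) * sqrt \<Lambda> \<le> 16 * (4 * sqrt (real d)) * \<Lambda>"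
      using a \<Lambda> n1 by (intro mult_mono) auto
    also have "\<dots> \<le> sqrt (real d) * (64 * \<Lambda> + 24 * ln n)" using n1 by (simp add: algebra_simps)
    finally have "(16 * sqrt (sqrt n) * sqrt \<Lambda>)\<^sup>2 \<le> (sqrt (real d) * (64 * \<Lambda> + 24 * ln n))\<^sup>2"
      using n1 \<Lambda> by (intro power_mono) auto
    then have "ennreal ((16 * sqrt (sqrt n) * sqrt \<Lambda>)\<^sup>2) \<le> ennreal ((sqrt (real d) * (64 * \<Lambda> + 24 * ln n))\<^sup>2)"
      by (rule ennreal_leI)
    with E2_general[OF less.prems(1,2) N(1) less.prems(4)] show ?thesis
      unfolding n_def \<Lambda>_def by (rule order_trans)
  next
    case True
    obtain L s where L: "L \<subseteq> V" "card V \<le> 8 * card L" "\<And>p. p \<in> L \<Longrightarrow> s p \<in> V - L"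
      "\<And>\<xi>. (\<forall>v\<in>V. lin \<xi> v \<noteq> 0) \<Longrightarrow> card {p\<in>L. sep \<xi> p (s p)} \<le> 2 * d"
      using curve_pairing[OF P d fV less.prems(3) True] by blast
    have fL: "finite L" using L(1) fV finite_subset by blast
    have L0: "L \<noteq> {}" using L(2) n1 unfolding n_def by auto
    then have VL: "V - L \<noteq> {}" using L(3) by blast
    have cVL: "card (V - L) = card V - card L" by (rule card_Diff_subset[OF fL L(1)])
    have "card L \<le> card V" by (rule card_mono[OF fV L(1)])
    then have c: "real (card (V - L)) \<le> 7 / 8 * n" using cVL L(2) unfolding n_def by (simp add: of_nat_diff)
    have c1: "real (card (V - L)) \<ge> 1" using VL fV by (simp add: Suc_le_eq card_gt_0_iff)
    \<comment> \<open>A round removes at least an eighth of the points, so 24 ln n drops by at least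
      3. This pays for the cost 3 sqrt d of the round, where the 3 comes from 4 times 2d being at
      most 9d.\<close>
    have ln78: "ln (real (card (V - L))) \<le> ln n - 1 / 8"
    proof -
      have "ln (real (card (V - L))) \<le> ln (7 / 8 * n)" using c c1 by simp
      also have "\<dots> = ln (7 / 8) + ln n" using n1 by (subst ln_mult) auto
      also have "ln (7 / 8 :: real) \<le> 7 / 8 - 1" by (rule ln_le_minus_one) simp
      finally show ?thesis by simp
    qed
    let ?U = "(\<lambda>p. (p, s p)) ` L"
    have inj: "inj_on (\<lambda>p. (p, s p)) L" by (auto simp: inj_on_def)
    have "(\<Sum>p\<in>?U. D (fst p) (snd p)) \<le> 4 * real (2 * d)"
    proof (rule Davg)
      show "?U \<subseteq> \<Omega> \<times> \<Omega>" using L(1,3) less.prems(1) by blast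
      fix \<xi> :: "real^3" assume g: "\<forall>v\<in>\<Omega>. lin \<xi> v \<noteq> 0"
      have "{p\<in>?U. sep \<xi> (fst p) (snd p)} = (\<lambda>p. (p, s p)) ` {p\<in>L. sep \<xi> p (s p)}" by auto
      then have "card {p\<in>?U. sep \<xi> (fst p) (snd p)} \<le> card {p\<in>L. sep \<xi> p (s p)}"
        using fL by (simp add: card_image_le)
      also have "\<dots> \<le> 2 * d" using g less.prems(1) by (intro L(4)) auto
      finally show "real (card {p\<in>?U. sep \<xi> (fst p) (snd p)}) \<le> real (2 * d)" by simp
    qed simp
    also have "(\<Sum>p\<in>?U. D (fst p) (snd p)) = (\<Sum>p\<in>L. D p (s p))" by (simp add: sum.reindex[OF inj])
    also have "4 * real (2 * d) \<le> (3 * sqrt (real d))\<^sup>2" by (simp add: power_mult_distrib)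
    finally have DL: "(\<Sum>p\<in>L. D p (s p)) \<le> (3 * sqrt (real d))\<^sup>2" .
    have "card (V - L) < card V" using c n1 unfolding n_def by linarith
    then have "E2 (V - L) \<le> ennreal ((sqrt (real d) * (64 * \<Lambda> + 24 * ln (real (card (V - L)))))\<^sup>2)"
      unfolding \<Lambda>_def using less.prems VL by (intro less.hyps) auto
    moreover have "sqrt (real d) * (64 * \<Lambda> + 24 * ln (real (card (V - L)))) > 0"
    proof -
      have "ln (real (card (V - L))) \<ge> 0" using c1 by simp
      then show ?thesis using d \<Lambda> by (simp add: add_pos_nonneg)
    qed
    ultimately have "E2 V \<le> ennreal ((sqrt (real d) * (64 * \<Lambda> + 24 * ln (real (card (V - L)))) + 3 * sqrt (real d))\<^sup>2)"
      using d by (intro E2_step[OF less.prems(1) L(1) L(3) _ _ _ DL]) auto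
    also have "\<dots> \<le> ennreal ((sqrt (real d) * (64 * \<Lambda> + 24 * ln n))\<^sup>2)"
    proof (intro ennreal_leI power_mono)
      have "sqrt (real d) * (24 * ln (real (card (V - L))) + 3) \<le> sqrt (real d) * (24 * ln n)"
        using ln78 by (intro mult_left_mono) auto
      then show "sqrt (real d) * (64 * \<Lambda> + 24 * ln (real (card (V - L)))) + 3 * sqrt (real d)
          \<le> sqrt (real d) * (64 * \<Lambda> + 24 * ln n)" by (simp add: algebra_simps)
      have "ln (real (card (V - L))) \<ge> 0" using c1 by simp
      then show "0 \<le> sqrt (real d) * (64 * \<Lambda> + 24 * ln (real (card (V - L)))) + 3 * sqrt (real d)"
        using \<Lambda> by simp
    qed
    finally show ?thesis unfolding n_def \<Lambda>_def .
  qed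
qed

lemma E2_bound:
  assumes P: "P \<in> polys_deg_le d" and d: "d \<ge> 1" and V: "\<Omega> \<subseteq> real_zeros P"
    and N: "N \<ge> 3" "card \<Omega> \<le> N"
  shows "E2 \<Omega> \<le> ennreal ((88 * sqrt (real d) * ln (real N))\<^sup>2)"
proof (cases "\<Omega> = {}")
  case True
  then show ?thesis by (simp add: E2_def)
next
  case False
  have "ln (real (card \<Omega>)) \<le> ln (real N)" using N False fin by (simp add: card_gt_0_iff)
  moreover have "0 \<le> ln (real (card \<Omega>))" using False fin by (simp add: Suc_le_eq card_gt_0_iff)
  ultimately have "sqrt (real d) * (64 * ln (real N) + 24 * ln (real (card \<Omega>))) \<le> sqrt (real d) * (88 * ln (real N))"
    and "0 \<le> sqrt (real d) * (64 * ln (real N) + 24 * ln (real (card \<Omega>)))"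
    by (auto intro!: mult_left_mono)
  then have "ennreal ((sqrt (real d) * (64 * ln (real N) + 24 * ln (real (card \<Omega>))))\<^sup>2) \<le> ennreal ((sqrt (real d) * (88 * ln (real N)))\<^sup>2)"
    by (intro ennreal_leI power_mono)
  with E2_curve[OF P d order_refl False V N]
  have "E2 \<Omega> \<le> ennreal ((sqrt (real d) * (88 * ln (real N)))\<^sup>2)" by (rule order_trans)
  then show ?thesis by (simp add: mult.left_commute mult.assoc)
qed

end

subsection \<open>Integration and translations\<close>

lemma nn_integral_shift:
  fixes f :: "'a::euclidean_space \<Rightarrow> ennreal"
  assumes [measurable]: "f \<in> borel_measurable lborel"
  shows "(\<integral>\<^sup>+x. f (c + x) \<partial>lborel) = (\<integral>\<^sup>+x. f x \<partial>lborel)"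
  by (subst (2) lborel_distr_plus[of c, symmetric]) (simp add: nn_integral_distr)

lemma integral_shift:
  fixes f :: "'a::euclidean_space \<Rightarrow> 'b::{banach, second_countable_topology}"
  assumes [measurable]: "f \<in> borel_measurable lborel"
  shows "(\<integral>x. f (c + x) \<partial>lborel) = (\<integral>x. f x \<partial>lborel)"
  by (subst (2) lborel_distr_plus[of c, symmetric]) (simp add: integral_distr)

lemma integrable_shift:
  fixes f :: "'a::euclidean_space \<Rightarrow> 'b::{banach, second_countable_topology}"
  assumes "integrable lborel f" shows "integrable lborel (\<lambda>x. f (c + x))"
proof -
  have [measurable]: "f \<in> borel_measurable lborel" using assms by simp
  have "integrable (distr lborel borel ((+) c)) f" using assms by (simp add: lborel_distr_plus)
  then show ?thesis by (subst (asm) integrable_distr_eq) auto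
qed

lemma integrable_pair_mult:
  fixes a :: "'a::euclidean_space \<Rightarrow> real" and b :: "'b::euclidean_space \<Rightarrow> real"
  assumes a: "integrable lborel a" and b: "integrable lborel b"
  shows "integrable (lborel \<Otimes>\<^sub>M lborel) (\<lambda>p. a (fst p) * b (snd p))"
proof (rule lborel_pair.Fubini_integrable)
  have [measurable]: "a \<in> borel_measurable lborel" "b \<in> borel_measurable lborel" using a b by auto
  show "(\<lambda>p. a (fst p) * b (snd p)) \<in> borel_measurable (lborel \<Otimes>\<^sub>M lborel)" by measurable
  have "integrable lborel (\<lambda>x. \<bar>a x\<bar> * (\<integral>y. \<bar>b y\<bar> \<partial>lborel))" using a by (intro integrable_mult_left integrable_abs)
  then show "integrable lborel (\<lambda>x. \<integral>y. norm (a (fst (x, y)) * b (snd (x, y))) \<partial>lborel)"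
    by (simp add: abs_mult)
  show "AE x in lborel. integrable lborel (\<lambda>y. a (fst (x, y)) * b (snd (x, y)))" using b by simp
qed

lemma integrable_pair_bound:
  fixes H :: "'a::euclidean_space \<Rightarrow> 'b::euclidean_space \<Rightarrow> complex"
  assumes [measurable]: "case_prod H \<in> borel_measurable (lborel \<Otimes>\<^sub>M lborel)"
    and a: "integrable lborel a" and b: "integrable lborel b"
    and le: "\<And>x y. norm (H x y) \<le> a x * b y"
  shows "integrable (lborel \<Otimes>\<^sub>M lborel) (case_prod H)"
  by (rule Bochner_Integration.integrable_bound[OF integrable_pair_mult[OF a b]])
    (auto intro!: AE_I2 order_trans[OF le] simp: abs_ge_self split: prod.splits)

subsection \<open>Translation is continuous in the mean\<close>

text \<open>Continuity of translation at 0, stated with sequences to suit dominated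
  convergence.\<close>

definition L1_cont :: "('a::euclidean_space \<Rightarrow> complex) \<Rightarrow> bool" where
  "L1_cont f \<longleftrightarrow> (\<forall>z. z \<longlonglongrightarrow> 0 \<longrightarrow> (\<lambda>n. \<integral>x. norm (f (z n + x) - f x) \<partial>lborel) \<longlonglongrightarrow> 0)"

lemma L1_dist_shift:
  fixes f g :: "'a::euclidean_space \<Rightarrow> complex"
  assumes f: "integrable lborel f" and g: "integrable lborel g"
  shows "(\<integral>x. norm (f (c + x) - f x) \<partial>lborel) \<le>
    2 * (\<integral>x. norm (f x - g x) \<partial>lborel) + (\<integral>x. norm (g (c + x) - g x) \<partial>lborel)"
proof -
  have [measurable]: "f \<in> borel_measurable lborel" "g \<in> borel_measurable lborel" using f g by auto
  note i = integrable_shift[OF f, of c] integrable_shift[OF g, of c] f g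
  have "(\<integral>x. norm (f (c + x) - f x) \<partial>lborel) \<le>
    (\<integral>x. norm (f (c + x) - g (c + x)) + norm (f x - g x) + norm (g (c + x) - g x) \<partial>lborel)"
  proof (rule integral_mono)
    fix x
    have "f (c + x) - f x = (f (c + x) - g (c + x)) - (f x - g x) + (g (c + x) - g x)" by simp
    then show "norm (f (c + x) - f x) \<le> norm (f (c + x) - g (c + x)) + norm (f x - g x) + norm (g (c + x) - g x)"
      by (metis norm_triangle_le norm_triangle_ineq4 add_mono_thms_linordered_semiring(3))
  qed (use i in auto)
  also have "\<dots> = (\<integral>x. norm (f (c + x) - g (c + x)) \<partial>lborel) + (\<integral>x. norm (f x - g x) \<partial>lborel) + (\<integral>x. norm (g (c + x) - g x) \<partial>lborel)"
    using i by simp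
  also have "(\<integral>x. norm (f (c + x) - g (c + x)) \<partial>lborel) = (\<integral>x. norm (f x - g x) \<partial>lborel)"
    by (rule integral_shift) measurable
  finally show ?thesis by simp
qed

text \<open>The property is closed under L1 limits: translation is an isometry of L1, so the error
  of approximation enters only twice.\<close>

lemma L1_cont_approx:
  fixes f :: "'a::euclidean_space \<Rightarrow> complex"
  assumes f: "integrable lborel f"
    and a: "\<And>e. e > 0 \<Longrightarrow> \<exists>g. integrable lborel g \<and> L1_cont g \<and> (\<integral>x. norm (f x - g x) \<partial>lborel) < e"
  shows "L1_cont f"
  unfolding L1_cont_def
proof (intro allI impI LIMSEQ_I)
  fix z :: "nat \<Rightarrow> 'a" and e :: real assume z: "z \<longlonglongrightarrow> 0" and e: "0 < e"
  obtain g where g: "integrable lborel g" "L1_cont g" "(\<integral>x. norm (f x - g x) \<partial>lborel) < e / 3"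
    using a[of "e / 3"] e by auto
  obtain N where N: "\<And>n. n \<ge> N \<Longrightarrow> norm ((\<integral>x. norm (g (z n + x) - g x) \<partial>lborel) - 0) < e / 3"
  proof -
    have "(\<lambda>n. \<integral>x. norm (g (z n + x) - g x) \<partial>lborel) \<longlonglongrightarrow> 0" using g(2) z unfolding L1_cont_def by blast
    from LIMSEQ_D[OF this, of "e / 3"] e show ?thesis using that by auto
  qed
  show "\<exists>N. \<forall>n\<ge>N. norm ((\<integral>x. norm (f (z n + x) - f x) \<partial>lborel) - 0) < e"
  proof (intro exI allI impI)
    fix n assume "n \<ge> N"
    from N[OF this] have "(\<integral>x. norm (g (z n + x) - g x) \<partial>lborel) < e / 3" by (simp add: abs_less_iff)
    moreover have "0 \<le> (\<integral>x. norm (f (z n + x) - f x) \<partial>lborel)" by simp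
    ultimately show "norm ((\<integral>x. norm (f (z n + x) - f x) \<partial>lborel) - 0) < e"
      using L1_dist_shift[OF f g(1), of "z n"] g(3) by simp
  qed
qed

text \<open>For x in the open set, z + x lies in it eventually, so the points of U leaving U under
  the shift have measure tending to 0. The other half of the symmetric difference has the same
  measure by translation invariance.\<close>

lemma L1_cont_open:
  fixes U :: "'a::euclidean_space set"
  assumes U: "open U" "emeasure lborel U < \<infinity>"
  shows "L1_cont (\<lambda>x. indicator U x *\<^sub>R c)"
  unfolding L1_cont_def
proof (intro allI impI)
  fix z :: "nat \<Rightarrow> 'a" assume z: "z \<longlonglongrightarrow> 0"
  have [measurable]: "U \<in> sets borel" using U by simp
  let ?i = "\<lambda>x. indicator U x :: real"
  have iU: "integrable lborel ?i" using U by simp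
  note iz = integrable_shift[OF iU]
  have "(\<lambda>n. \<integral>x. ?i x * (1 - ?i (z n + x)) \<partial>lborel) \<longlonglongrightarrow> (\<integral>x. (0::real) \<partial>(lborel::'a measure))"
  proof (rule integral_dominated_convergence[where w = ?i])
    show "AE x in lborel. (\<lambda>n. ?i x * (1 - ?i (z n + x))) \<longlonglongrightarrow> 0"
    proof (rule AE_I2)
      fix x :: 'a
      show "(\<lambda>n. ?i x * (1 - ?i (z n + x))) \<longlonglongrightarrow> 0"
      proof (cases "x \<in> U")
        case True
        have "(\<lambda>n. z n + x) \<longlonglongrightarrow> 0 + x" by (intro tendsto_intros z)
        then have "\<forall>\<^sub>F n in sequentially. z n + x \<in> U" using topological_tendstoD[OF _ U(1)] True by simp
        then have "\<forall>\<^sub>F n in sequentially. ?i x * (1 - ?i (z n + x)) = 0" by eventually_elim simp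
        then show ?thesis by (rule tendsto_eventually)
      qed simp
    qed
  qed (use iU in \<open>auto simp: indicator_def\<close>)
  then have l: "(\<lambda>n. 2 * norm c * (\<integral>x. ?i x * (1 - ?i (z n + x)) \<partial>lborel)) \<longlonglongrightarrow> 2 * norm c * 0"
    by (intro tendsto_intros) simp
  have "(\<integral>x. norm (indicator U (z n + x) *\<^sub>R c - indicator U x *\<^sub>R c) \<partial>lborel) = 2 * norm c * (\<integral>x. ?i x * (1 - ?i (z n + x)) \<partial>lborel)" for n
  proof -
    have "norm (indicator U (z n + x) *\<^sub>R c - indicator U x *\<^sub>R c) =
        norm c * (2 * (?i x * (1 - ?i (z n + x))) + (?i (z n + x) - ?i x))" for x
      by (simp add: indicator_def)
    moreover have "integrable lborel (\<lambda>x. ?i x * (1 - ?i (z n + x)))"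
      by (rule Bochner_Integration.integrable_bound[OF iU]) (auto simp: indicator_def)
    moreover have "(\<integral>x. ?i (z n + x) \<partial>lborel) = (\<integral>x. ?i x \<partial>lborel)" by (rule integral_shift) measurable
    ultimately show ?thesis using iU iz by simp
  qed
  then show "(\<lambda>n. \<integral>x. norm (indicator U (z n + x) *\<^sub>R c - indicator U x *\<^sub>R c) \<partial>lborel) \<longlonglongrightarrow> 0"
    using l by simp
qed

text \<open>Induction over integrable functions: the indicator of a measurable set is approximated
  by that of an open superset, through outer regularity, and sums and limits are handled by the
  triangle inequality and \<open>L1_cont_approx\<close>.\<close>

lemma integrable_imp_L1_cont:
  fixes f :: "'a::euclidean_space \<Rightarrow> complex"
  assumes "integrable lborel f" shows "L1_cont f"
  using assms
proof (induction rule: integrable_induct)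
  case (base A c)
  then have [measurable]: "A \<in> sets borel" by simp
  have iA: "integrable lborel (\<lambda>x. indicator A x *\<^sub>R c)" using base by simp
  show ?case
  proof (rule L1_cont_approx[OF iA])
    fix e :: real assume e: "e > 0"
    define e' where "e' = e / (norm c + 1)"
    have e': "e' > 0" using e by (simp add: e'_def add_nonneg_pos)
    obtain U where U: "open U" "A \<subseteq> U" "emeasure lborel (U - A) < e'"
      using outer_regular_lborel[of A e'] e' by auto
    have [measurable]: "U \<in> sets borel" using U by simp
    have fin: "emeasure lborel U < \<infinity>"
    proof -
      have "emeasure lborel U = emeasure lborel (A \<union> (U - A))" using U(2) by (simp add: Un_absorb1)
      also have "\<dots> \<le> emeasure lborel A + emeasure lborel (U - A)" by (intro emeasure_subadditive) auto
      also have "\<dots> < \<infinity>" using base(2) U(3) by (simp add: less_top[symmetric]) (metis ennreal_less_top neq_top_trans less_imp_le top.not_eq_extremum)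
      finally show ?thesis .
    qed
    have finD: "emeasure lborel (U - A) < \<infinity>" using U(3) by (metis ennreal_less_top infinity_ennreal_def less_trans)
    have "(\<integral>x. norm (indicator A x *\<^sub>R c - indicator U x *\<^sub>R c) \<partial>lborel) = (\<integral>x. norm c * indicator (U - A) x \<partial>lborel)"
      using U(2) by (intro Bochner_Integration.integral_cong) (auto simp: indicator_def)
    also have "\<dots> = norm c * measure lborel (U - A)" using finD by simp
    also have "\<dots> \<le> norm c * e'"
    proof (intro mult_left_mono)
      show "measure lborel (U - A) \<le> e'" using U(3) e' finD
        by (metis emeasure_eq_ennreal_measure ennreal_less_iff infinity_ennreal_def less_imp_le less_irrefl measure_nonneg)
    qed simp
    also have "\<dots> < e"
    proof -
      have "norm c * e' < (norm c + 1) * e'" using e' by (intro mult_strict_right_mono) auto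
      also have "\<dots> = e" using norm_ge_zero[of c] by (simp add: e'_def field_simps add_nonneg_eq_0_iff)
      finally show ?thesis .
    qed
    finally show "\<exists>g. integrable lborel g \<and> L1_cont g \<and> (\<integral>x. norm (indicator A x *\<^sub>R c - g x) \<partial>lborel) < e"
      using L1_cont_open[OF U(1) fin] fin by (intro exI[of _ "\<lambda>x. indicator U x *\<^sub>R c"]) auto
  qed
next
  case (add f g)
  show ?case unfolding L1_cont_def
  proof (intro allI impI)
    fix z :: "nat \<Rightarrow> 'a" assume z: "z \<longlonglongrightarrow> 0"
    note i = integrable_shift[OF add(1)] integrable_shift[OF add(2)] add(1,2)
    have "(\<lambda>n. (\<integral>x. norm (f (z n + x) - f x) \<partial>lborel) + (\<integral>x. norm (g (z n + x) - g x) \<partial>lborel)) \<longlonglongrightarrow> 0 + 0"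
      using add(3,4) z unfolding L1_cont_def by (intro tendsto_add) auto
    then have lim0: "(\<lambda>n. (\<integral>x. norm (f (z n + x) - f x) \<partial>lborel) + (\<integral>x. norm (g (z n + x) - g x) \<partial>lborel)) \<longlonglongrightarrow> 0" by simp
    show "(\<lambda>n. \<integral>x. norm (f (z n + x) + g (z n + x) - (f x + g x)) \<partial>lborel) \<longlonglongrightarrow> 0"
    proof (rule Lim_null_comparison[OF _ lim0], rule always_eventually, rule allI)
      fix n
      have "(\<integral>x. norm (f (z n + x) + g (z n + x) - (f x + g x)) \<partial>lborel) \<le>
          (\<integral>x. norm (f (z n + x) - f x) + norm (g (z n + x) - g x) \<partial>lborel)"
        using i by (intro integral_mono) (auto simp: norm_diff_triangle_ineq)
      then show "norm (\<integral>x. norm (f (z n + x) + g (z n + x) - (f x + g x)) \<partial>lborel) \<le>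
         (\<integral>x. norm (f (z n + x) - f x) \<partial>lborel) + (\<integral>x. norm (g (z n + x) - g x) \<partial>lborel)"
        using i by simp
    qed
  qed
next
  case (lim f s)
  show ?case
  proof (rule L1_cont_approx[OF lim(4)])
    fix e :: real assume e: "e > 0"
    have [measurable]: "\<And>i. s i \<in> borel_measurable lborel" "f \<in> borel_measurable lborel" using lim by auto
    have "(\<lambda>i. \<integral>x. norm (f x - s i x) \<partial>lborel) \<longlonglongrightarrow> (\<integral>x. (0::real) \<partial>(lborel::'a measure))"
    proof (rule integral_dominated_convergence[where w = "\<lambda>x. 3 * norm (f x)"])
      show "AE x in lborel. (\<lambda>i. norm (f x - s i x)) \<longlonglongrightarrow> 0"
      proof (rule AE_I2)
        fix x
        have "(\<lambda>i. norm (f x - s i x)) \<longlonglongrightarrow> norm (f x - f x)" using lim(2) by (intro tendsto_intros) auto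
        then show "(\<lambda>i. norm (f x - s i x)) \<longlonglongrightarrow> 0" by simp
      qed
      fix i
      show "AE x in lborel. norm (norm (f x - s i x)) \<le> 3 * norm (f x)"
      proof (rule AE_I2)
        fix x
        have "norm (f x - s i x) \<le> norm (f x) + norm (s i x)" by (rule norm_triangle_ineq4)
        then show "norm (norm (f x - s i x)) \<le> 3 * norm (f x)" using lim(3)[of x i] by simp
      qed
    qed (use lim in auto)
    then have "(\<lambda>i. \<integral>x. norm (f x - s i x) \<partial>lborel) \<longlonglongrightarrow> 0" by simp
    then have "\<forall>\<^sub>F i in sequentially. (\<integral>x. norm (f x - s i x) \<partial>lborel) < e" using e by (rule order_tendstoD)
    then obtain i where "(\<integral>x. norm (f x - s i x) \<partial>lborel) < e" using eventually_happens'[OF sequentially_bot] by blast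
    then show "\<exists>g. integrable lborel g \<and> L1_cont g \<and> (\<integral>x. norm (f x - g x) \<partial>lborel) < e" using lim(1,5) by blast
  qed
qed

subsection \<open>The Fourier transform of a Gaussian\<close>

text \<open>After the scaling t -> m t this is the characteristic function of the standard normal
  distribution.\<close>

lemma gaussian_1d:
  assumes m: "m > 0"
  shows "integrable lborel (\<lambda>t::real. complex_of_real (exp (- t\<^sup>2 / (2 * m\<^sup>2))) * cis (- t * s))"
    and "(\<integral>t. complex_of_real (exp (- t\<^sup>2 / (2 * m\<^sup>2))) * cis (- t * s) \<partial>lborel) = complex_of_real (m * sqrt (2 * pi) * exp (- m\<^sup>2 * s\<^sup>2 / 2))"
proof -
  let ?f = "\<lambda>t. complex_of_real (exp (- t\<^sup>2 / (2 * m\<^sup>2))) * cis (- t * s)"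
  have n: "exp (- t\<^sup>2 / (2 * m\<^sup>2)) = m * sqrt (2 * pi) * normal_density 0 m t" for t
    using m by (simp add: normal_density_def real_sqrt_mult)
  have "integrable lborel (\<lambda>t. exp (- t\<^sup>2 / (2 * m\<^sup>2)))" unfolding n using m by (intro integrable_mult_right integrable_normal_density)
  then show "integrable lborel ?f"
  proof (rule Bochner_Integration.integrable_bound)
    have "continuous_on UNIV (\<lambda>t. cis (- t * s))" by (intro continuous_intros)
    then have [measurable]: "(\<lambda>t. cis (- t * s)) \<in> borel_measurable borel" by (rule borel_measurable_continuous_onI)
    show "?f \<in> borel_measurable lborel" by measurable
  qed (auto simp: norm_mult)
  have "(\<integral>t. ?f t \<partial>lborel) = \<bar>m\<bar> *\<^sub>R (\<integral>t. ?f (0 + m * t) \<partial>lborel)"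
    using m by (intro lborel_integral_real_affine) auto
  also have "(\<integral>t. ?f (0 + m * t) \<partial>lborel) = (\<integral>t. sqrt (2 * pi) *\<^sub>R (std_normal_density t *\<^sub>R iexp ((- m * s) * t)) \<partial>lborel)"
  proof (rule Bochner_Integration.integral_cong[OF refl])
    fix t
    show "?f (0 + m * t) = sqrt (2 * pi) *\<^sub>R (std_normal_density t *\<^sub>R iexp ((- m * s) * t))"
      using m by (simp add: std_normal_density_def scaleR_conv_of_real power_mult_distrib cis_conv_exp mult_ac)
  qed
  also have "\<dots> = sqrt (2 * pi) *\<^sub>R (\<integral>t. std_normal_density t *\<^sub>R iexp ((- m * s) * t) \<partial>lborel)" by (rule integral_scaleR_right)
  also have "(\<integral>t. std_normal_density t *\<^sub>R iexp ((- m * s) * t) \<partial>lborel) = char std_normal_distribution (- m * s)"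
  proof -
    have "char std_normal_distribution (- m * s) = (\<integral>t. iexp ((- m * s) * t) \<partial>density lborel std_normal_density)"
      unfolding char_def by simp
    also have "\<dots> = (\<integral>t. std_normal_density t *\<^sub>R iexp ((- m * s) * t) \<partial>lborel)"
      by (rule integral_density) auto
    finally show ?thesis by simp
  qed
  also have "char std_normal_distribution (- m * s) = complex_of_real (exp (- m\<^sup>2 * s\<^sup>2 / 2))"
    unfolding char_std_normal_distribution by (simp add: power_mult_distrib)
  finally show "(\<integral>t. ?f t \<partial>lborel) = complex_of_real (m * sqrt (2 * pi) * exp (- m\<^sup>2 * s\<^sup>2 / 2))"
    using m by (simp add: scaleR_conv_of_real)
qed

text \<open>Lebesgue measure is the image of the product measure over the basis, so a product of
  functions of single coordinates integrates factor by factor.\<close>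

lemma lborel_prod_integral:
  fixes f :: "'a::euclidean_space \<Rightarrow> real \<Rightarrow> complex"
  assumes i: "\<And>b. b \<in> Basis \<Longrightarrow> integrable lborel (f b)"
  shows "integrable lborel (\<lambda>x::'a. \<Prod>b\<in>Basis. f b (x \<bullet> b))"
    and "(\<integral>x. (\<Prod>b\<in>Basis. f b (x \<bullet> b)) \<partial>(lborel::'a measure)) = (\<Prod>b\<in>Basis. \<integral>t. f b t \<partial>lborel)"
proof -
  interpret P: product_sigma_finite "\<lambda>_::'a. lborel :: real measure" by standard
  have [measurable]: "f b \<in> borel_measurable borel" if "b \<in> Basis" for b using i[OF that] by auto
  have coord: "(\<Sum>b\<in>Basis. p b *\<^sub>R b) \<bullet> c = p c" if "c \<in> Basis" for p :: "'a \<Rightarrow> real" and c :: 'a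
    using that by simp
  have m: "(\<lambda>x::'a. \<Prod>b\<in>Basis. f b (x \<bullet> b)) \<in> borel_measurable borel" by measurable
  have e: "(\<Prod>b\<in>Basis. f b ((\<Sum>b\<in>Basis. p b *\<^sub>R b) \<bullet> b)) = (\<Prod>b\<in>Basis. f b (p b))" for p :: "'a \<Rightarrow> real"
    by (intro prod.cong) (auto simp: coord)
  have d: "(\<lambda>p. \<Sum>b\<in>Basis. p b *\<^sub>R b) \<in> (\<Pi>\<^sub>M b\<in>(Basis::'a set). lborel) \<rightarrow>\<^sub>M (borel :: 'a measure)" by measurable
  show "integrable lborel (\<lambda>x::'a. \<Prod>b\<in>Basis. f b (x \<bullet> b))"
    unfolding lborel_eq[where 'a='a] integrable_distr_eq[OF d m] e
    using i by (intro P.product_integrable_prod) auto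
  show "(\<integral>x. (\<Prod>b\<in>Basis. f b (x \<bullet> b)) \<partial>(lborel::'a measure)) = (\<Prod>b\<in>Basis. \<integral>t. f b t \<partial>lborel)"
    unfolding lborel_eq[where 'a='a] integral_distr[OF d m] e
    using i by (intro P.product_integral_prod) auto
qed

lemma gaussian_transform:
  fixes z :: "'a::euclidean_space"
  assumes m: "m > 0"
  shows "integrable lborel (\<lambda>\<xi>::'a. complex_of_real (exp (- (norm \<xi>)\<^sup>2 / (2 * m\<^sup>2))) * cis (- (\<xi> \<bullet> z)))"
    and "(\<integral>\<xi>. complex_of_real (exp (- (norm \<xi>)\<^sup>2 / (2 * m\<^sup>2))) * cis (- (\<xi> \<bullet> z)) \<partial>lborel) =
      complex_of_real ((m * sqrt (2 * pi)) ^ DIM('a) * exp (- m\<^sup>2 * (norm z)\<^sup>2 / 2))"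
proof -
  let ?f = "\<lambda>b t. complex_of_real (exp (- t\<^sup>2 / (2 * m\<^sup>2))) * cis (- t * (z \<bullet> b))"
  have nrm: "(norm x)\<^sup>2 = (\<Sum>b\<in>Basis. (x \<bullet> b)\<^sup>2)" for x :: 'a
    by (subst power2_norm_eq_inner, subst euclidean_inner) (simp add: power2_eq_square)
  have cis_sum: "cis (\<Sum>b\<in>B. g b) = (\<Prod>b\<in>B. cis (g b))" if "finite B" for B :: "'a set" and g
    using that by (induction B rule: finite_induct) (auto simp flip: cis_mult)
  have e: "(\<Prod>b\<in>Basis. ?f b (\<xi> \<bullet> b)) = complex_of_real (exp (- (norm \<xi>)\<^sup>2 / (2 * m\<^sup>2))) * cis (- (\<xi> \<bullet> z))" for \<xi> :: 'a
  proof -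
    have "cis (- (\<xi> \<bullet> z)) = (\<Prod>b\<in>Basis. cis (- (\<xi> \<bullet> b) * (z \<bullet> b)))"
      by (subst euclidean_inner, subst cis_sum[symmetric]) (auto simp: sum_negf)
    moreover have "exp (- (norm \<xi>)\<^sup>2 / (2 * m\<^sup>2)) = (\<Prod>b\<in>Basis. exp (- (\<xi> \<bullet> b)\<^sup>2 / (2 * m\<^sup>2)))"
      by (subst exp_sum[symmetric]) (auto simp: nrm sum_negf sum_divide_distrib)
    ultimately show ?thesis by (simp add: prod.distrib)
  qed
  show "integrable lborel (\<lambda>\<xi>::'a. complex_of_real (exp (- (norm \<xi>)\<^sup>2 / (2 * m\<^sup>2))) * cis (- (\<xi> \<bullet> z)))"
    using lborel_prod_integral(1)[of ?f] gaussian_1d(1)[OF m] unfolding e by blast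
  have "(\<integral>\<xi>. (\<Prod>b\<in>Basis. ?f b (\<xi> \<bullet> b)) \<partial>(lborel::'a measure)) = (\<Prod>b\<in>Basis. \<integral>t. ?f b t \<partial>lborel)"
    using gaussian_1d(1)[OF m] by (intro lborel_prod_integral(2)) auto
  also have "\<dots> = (\<Prod>b\<in>(Basis::'a set). complex_of_real (m * sqrt (2 * pi) * exp (- m\<^sup>2 * (z \<bullet> b)\<^sup>2 / 2)))"
    using gaussian_1d(2)[OF m] by (intro prod.cong) auto
  also have "\<dots> = complex_of_real (\<Prod>b\<in>(Basis::'a set). m * sqrt (2 * pi) * exp (- m\<^sup>2 * (z \<bullet> b)\<^sup>2 / 2))" by simp
  also have "(\<Prod>b\<in>(Basis::'a set). m * sqrt (2 * pi) * exp (- m\<^sup>2 * (z \<bullet> b)\<^sup>2 / 2)) =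
     (m * sqrt (2 * pi)) ^ DIM('a) * (\<Prod>b\<in>(Basis::'a set). exp (- m\<^sup>2 * (z \<bullet> b)\<^sup>2 / 2))"
    by (simp add: prod.distrib)
  also have "(\<Prod>b\<in>(Basis::'a set). exp (- m\<^sup>2 * (z \<bullet> b)\<^sup>2 / 2)) = exp (- m\<^sup>2 * (norm z)\<^sup>2 / 2)"
    by (subst exp_sum[symmetric]) (auto simp: nrm sum_negf sum_divide_distrib sum_distrib_left)
  finally show "(\<integral>\<xi>. complex_of_real (exp (- (norm \<xi>)\<^sup>2 / (2 * m\<^sup>2))) * cis (- (\<xi> \<bullet> z)) \<partial>lborel) =
      complex_of_real ((m * sqrt (2 * pi)) ^ DIM('a) * exp (- m\<^sup>2 * (norm z)\<^sup>2 / 2))" unfolding e .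
qed

subsection \<open>Plancherel's identity for bounded integrable functions\<close>

text \<open>On this class the Fourier integral and the autocorrelation converge absolutely
  everywhere, and it is dense in L2 by \<open>sq_norm_trunc_lim\<close>.\<close>

definition bdd_integrable :: "('a::euclidean_space \<Rightarrow> complex) \<Rightarrow> bool" where
  "bdd_integrable f \<longleftrightarrow> integrable lborel f \<and> (\<exists>B. \<forall>x. norm (f x) \<le> B)"

lemma bdd_integrableD: "bdd_integrable f \<Longrightarrow> integrable lborel f" "bdd_integrable f \<Longrightarrow> f \<in> borel_measurable borel"
  by (auto simp: bdd_integrable_def)

lemma bdd_integrableE: assumes "bdd_integrable f" obtains B where "B \<ge> 0" "\<And>x. norm (f x) \<le> B"
  using assms unfolding bdd_integrable_def by (meson norm_ge_zero order_trans)

lemma bdd_integrable_diff: assumes "bdd_integrable f" "bdd_integrable g" shows "bdd_integrable (\<lambda>x. f x - g x)"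
proof -
  obtain A B where "\<And>x. norm (f x) \<le> A" "\<And>x. norm (g x) \<le> B" using assms by (metis bdd_integrableE)
  then have "\<forall>x. norm (f x - g x) \<le> A + B" by (meson add_mono norm_triangle_ineq4 order_trans)
  then show ?thesis using assms unfolding bdd_integrable_def by auto
qed

lemma measurable_cis [measurable]: "cis \<in> borel_measurable borel"
  by (intro borel_measurable_continuous_onI continuous_intros)

lemma measurable_cnj [measurable]: "cnj \<in> borel_measurable borel"
  by (intro borel_measurable_continuous_onI continuous_intros)

lemma mult_le_swap: "0 \<le> a \<Longrightarrow> b \<le> B \<Longrightarrow> a * b \<le> B * (a::real)"
  by (simp add: mult.commute[of B] mult_left_mono)

lemma norm_mult_cis [simp]: "norm (a * cis b) = norm a"
  by (simp add: norm_mult)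

text \<open>Angular frequency and no normalising factor, which puts (2 pi)^n into
  \<open>plancherel\<close>.\<close>

definition FT :: "('a::euclidean_space \<Rightarrow> complex) \<Rightarrow> 'a \<Rightarrow> complex" where
  "FT f \<xi> = (\<integral>x. f x * cis (- (\<xi> \<bullet> x)) \<partial>lborel)"

lemma integrable_mult_cis:
  assumes "integrable lborel f" shows "integrable lborel (\<lambda>x. f x * cis (- (\<xi> \<bullet> x)))"
proof -
  have [measurable]: "f \<in> borel_measurable borel" using assms by auto
  show ?thesis by (rule Bochner_Integration.integrable_bound[OF assms]) auto
qed

lemma measurable_FT [measurable]:
  assumes [measurable]: "f \<in> borel_measurable borel" shows "FT f \<in> borel_measurable borel"
  unfolding FT_def by measurable

lemma norm_FT_le: "norm (FT f \<xi>) \<le> (\<integral>x. norm (f x) \<partial>lborel)"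
  unfolding FT_def by (rule order_trans[OF integral_norm_bound]) simp

lemma FT_diff: "integrable lborel f \<Longrightarrow> integrable lborel g \<Longrightarrow> FT (\<lambda>x. f x - g x) \<xi> = FT f \<xi> - FT g \<xi>"
  unfolding FT_def by (simp add: left_diff_distrib integrable_mult_cis)

definition autocorr :: "('a::euclidean_space \<Rightarrow> complex) \<Rightarrow> 'a \<Rightarrow> complex" where
  "autocorr g z = (\<integral>y. cnj (g y) * g (z + y) \<partial>lborel)"

definition gauss :: "real \<Rightarrow> 'a::euclidean_space \<Rightarrow> real" where
  "gauss m \<xi> = exp (- (norm \<xi>)\<^sup>2 / (2 * m\<^sup>2))"

definition gauss_hat :: "real \<Rightarrow> 'a::euclidean_space \<Rightarrow> real" where
  "gauss_hat m z = (m * sqrt (2 * pi)) ^ DIM('a) * exp (- m\<^sup>2 * (norm z)\<^sup>2 / 2)"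

lemma measurable_gauss [measurable]: "gauss m \<in> borel_measurable borel" "gauss_hat m \<in> borel_measurable borel"
  unfolding gauss_def gauss_hat_def by measurable

lemma integrable_gauss: "m > 0 \<Longrightarrow> integrable lborel (gauss m :: 'a::euclidean_space \<Rightarrow> real)"
  using gaussian_transform(1)[of m "0::'a"] by (simp add: gauss_def[abs_def] complex_of_real_integrable_eq)

lemma integral_gauss_cis: "m > 0 \<Longrightarrow> (\<integral>\<xi>. complex_of_real (gauss m \<xi>) * cis (- (\<xi> \<bullet> z)) \<partial>lborel) = complex_of_real (gauss_hat m z)"
  using gaussian_transform(2)[of m z] by (simp add: gauss_def gauss_hat_def)

lemma gauss_hat_alt: "m > 0 \<Longrightarrow> gauss_hat m (z::'a::euclidean_space) = (m * sqrt (2 * pi)) ^ DIM('a) * gauss (1 / m) z"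
  by (simp add: gauss_hat_def gauss_def power_divide)

lemma integrable_gauss_hat: "m > 0 \<Longrightarrow> integrable lborel (gauss_hat m :: 'a::euclidean_space \<Rightarrow> real)"
proof -
  assume m: "m > 0"
  have "gauss_hat m = (\<lambda>z::'a. (m * sqrt (2 * pi)) ^ DIM('a) * gauss (1 / m) z)" by (rule ext) (rule gauss_hat_alt[OF m])
  then show ?thesis using integrable_gauss[of "1 / m", where 'a='a] m by simp
qed

lemma gauss_hat_nonneg: "m > 0 \<Longrightarrow> 0 \<le> gauss_hat m z"
  by (simp add: gauss_hat_def)

text \<open>The Gaussian weight makes the triple integral absolutely convergent. Integrating over
  \<xi> first yields \<open>gauss_hat\<close> at x - y, and the substitution x = y + z leaves the
  autocorrelation.\<close>

lemma FT_gauss_pairing: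
  fixes g :: "'a::euclidean_space \<Rightarrow> complex"
  assumes g: "bdd_integrable g" and m: "m > 0"
  shows "(\<integral>\<xi>. complex_of_real (gauss m \<xi> * (norm (FT g \<xi>))\<^sup>2) \<partial>lborel) =
    (\<integral>z. complex_of_real (gauss_hat m z) * autocorr g z \<partial>lborel)"
proof -
  have [measurable]: "g \<in> borel_measurable borel" and ig: "integrable lborel g" using bdd_integrableD g by auto
  have ing: "integrable lborel (\<lambda>x. norm (g x))" using ig by simp
  obtain B where B: "B \<ge> 0" "\<And>x. norm (g x) \<le> B" using g by (rule bdd_integrableE) blast
  note iw = integrable_gauss[OF m, where 'a='a]
  have step1: "(\<integral>\<xi>. complex_of_real (gauss m \<xi>) * FT g \<xi> * cis (\<xi> \<bullet> y) \<partial>lborel) = (\<integral>x. g x * complex_of_real (gauss_hat m (x - y)) \<partial>lborel)" for y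
  proof -
    have "(\<integral>\<xi>. complex_of_real (gauss m \<xi>) * FT g \<xi> * cis (\<xi> \<bullet> y) \<partial>lborel) =
        (\<integral>\<xi>. (\<integral>x. g x * (complex_of_real (gauss m \<xi>) * cis (- (\<xi> \<bullet> (x - y)))) \<partial>lborel) \<partial>lborel)"
    proof (rule Bochner_Integration.integral_cong[OF refl])
      fix \<xi> :: 'a
      have "complex_of_real (gauss m \<xi>) * FT g \<xi> * cis (\<xi> \<bullet> y) = (\<integral>x. g x * cis (- (\<xi> \<bullet> x)) * (complex_of_real (gauss m \<xi>) * cis (\<xi> \<bullet> y)) \<partial>lborel)"
        unfolding FT_def using integrable_mult_cis[OF ig] by (subst integral_mult_left_zero) (simp add: mult_ac)
      also have "\<dots> = (\<integral>x. g x * (complex_of_real (gauss m \<xi>) * cis (- (\<xi> \<bullet> (x - y)))) \<partial>lborel)"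
      proof (rule Bochner_Integration.integral_cong[OF refl])
        fix x
        have "cis (- (\<xi> \<bullet> x)) * cis (\<xi> \<bullet> y) = cis (- (\<xi> \<bullet> (x - y)))" by (simp add: cis_mult inner_diff_right)
        then show "g x * cis (- (\<xi> \<bullet> x)) * (complex_of_real (gauss m \<xi>) * cis (\<xi> \<bullet> y)) = g x * (complex_of_real (gauss m \<xi>) * cis (- (\<xi> \<bullet> (x - y))))"
          by (metis mult.assoc mult.left_commute)
      qed
      finally show "complex_of_real (gauss m \<xi>) * FT g \<xi> * cis (\<xi> \<bullet> y) = (\<integral>x. g x * (complex_of_real (gauss m \<xi>) * cis (- (\<xi> \<bullet> (x - y)))) \<partial>lborel)" .
    qed
    also have "\<dots> = (\<integral>x. (\<integral>\<xi>. g x * (complex_of_real (gauss m \<xi>) * cis (- (\<xi> \<bullet> (x - y)))) \<partial>lborel) \<partial>lborel)"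
    proof (rule lborel_pair.Fubini_integral)
      show "integrable (lborel \<Otimes>\<^sub>M lborel) (\<lambda>(x, \<xi>). g x * (complex_of_real (gauss m \<xi>) * cis (- (\<xi> \<bullet> (x - y)))))"
      proof (rule integrable_pair_bound[OF _ ing iw])
        show "(\<lambda>(x, \<xi>). g x * (complex_of_real (gauss m \<xi>) * cis (- (\<xi> \<bullet> (x - y))))) \<in> borel_measurable (lborel \<Otimes>\<^sub>M lborel)"
          by measurable
      qed (simp add: norm_mult gauss_def)
    qed
    also have "\<dots> = (\<integral>x. g x * complex_of_real (gauss_hat m (x - y)) \<partial>lborel)"
      by (simp only: integral_mult_right_zero integral_gauss_cis[OF m])
    finally show ?thesis .
  qed
  define C where "C = (\<integral>x. norm (g x) \<partial>lborel)"
  have C: "norm (FT g \<xi>) \<le> C" for \<xi> unfolding C_def by (rule norm_FT_le)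
  have C0: "C \<ge> 0" unfolding C_def by simp
  have "(\<integral>\<xi>. complex_of_real (gauss m \<xi> * (norm (FT g \<xi>))\<^sup>2) \<partial>lborel) =
     (\<integral>\<xi>. (\<integral>y. cnj (g y) * (complex_of_real (gauss m \<xi>) * FT g \<xi> * cis (\<xi> \<bullet> y)) \<partial>lborel) \<partial>lborel)"
  proof (rule Bochner_Integration.integral_cong[OF refl])
    fix \<xi> :: 'a
    have "cnj (FT g \<xi>) = (\<integral>y. cnj (g y * cis (- (\<xi> \<bullet> y))) \<partial>lborel)" unfolding FT_def by (rule Bochner_Integration.integral_cnj[symmetric])
    also have "\<dots> = (\<integral>y. cnj (g y) * cis (\<xi> \<bullet> y) \<partial>lborel)" by (simp add: cis_cnj)
    finally have c: "cnj (FT g \<xi>) = (\<integral>y. cnj (g y) * cis (\<xi> \<bullet> y) \<partial>lborel)" .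
    have "complex_of_real (gauss m \<xi> * (norm (FT g \<xi>))\<^sup>2) = cnj (FT g \<xi>) * (complex_of_real (gauss m \<xi>) * FT g \<xi>)"
      by (simp add: complex_norm_square[symmetric] mult_ac flip: of_real_power)
    also have "\<dots> = (\<integral>y. cnj (g y) * cis (\<xi> \<bullet> y) * (complex_of_real (gauss m \<xi>) * FT g \<xi>) \<partial>lborel)"
      unfolding c by (rule integral_mult_left_zero[symmetric])
    finally show "complex_of_real (gauss m \<xi> * (norm (FT g \<xi>))\<^sup>2) = (\<integral>y. cnj (g y) * (complex_of_real (gauss m \<xi>) * FT g \<xi> * cis (\<xi> \<bullet> y)) \<partial>lborel)"
      by (simp add: mult_ac)
  qed
  also have "\<dots> = (\<integral>y. (\<integral>\<xi>. cnj (g y) * (complex_of_real (gauss m \<xi>) * FT g \<xi> * cis (\<xi> \<bullet> y)) \<partial>lborel) \<partial>lborel)"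
  proof (rule lborel_pair.Fubini_integral)
    have iwC: "integrable lborel (\<lambda>\<xi>::'a. gauss m \<xi> * C)" using iw by simp
    show "integrable (lborel \<Otimes>\<^sub>M lborel) (\<lambda>(y, \<xi>). cnj (g y) * (complex_of_real (gauss m \<xi>) * FT g \<xi> * cis (\<xi> \<bullet> y)))"
    proof (rule integrable_pair_bound[OF _ ing iwC])
      show "(\<lambda>(y, \<xi>). cnj (g y) * (complex_of_real (gauss m \<xi>) * FT g \<xi> * cis (\<xi> \<bullet> y))) \<in> borel_measurable (lborel \<Otimes>\<^sub>M lborel)"
        by measurable
      show "norm (cnj (g y) * (complex_of_real (gauss m \<xi>) * FT g \<xi> * cis (\<xi> \<bullet> y))) \<le> norm (g y) * (gauss m \<xi> * C)" for y \<xi>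
        using C[of \<xi>] by (simp add: norm_mult gauss_def mult_left_mono)
    qed
  qed
  also have "\<dots> = (\<integral>y. cnj (g y) * (\<integral>x. g x * complex_of_real (gauss_hat m (x - y)) \<partial>lborel) \<partial>lborel)"
    using step1 by simp
  also have "\<dots> = (\<integral>y. (\<integral>z. complex_of_real (gauss_hat m z) * (cnj (g y) * g (z + y)) \<partial>lborel) \<partial>lborel)"
  proof (rule Bochner_Integration.integral_cong[OF refl])
    fix y :: 'a
    have "(\<integral>x. g x * complex_of_real (gauss_hat m (x - y)) \<partial>lborel) = (\<integral>z. g (y + z) * complex_of_real (gauss_hat m ((y + z) - y)) \<partial>lborel)"
      by (rule integral_shift[symmetric]) measurable
    then have "cnj (g y) * (\<integral>x. g x * complex_of_real (gauss_hat m (x - y)) \<partial>lborel) = (\<integral>z. cnj (g y) * (g (y + z) * complex_of_real (gauss_hat m z)) \<partial>lborel)"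
      by (simp only: add_diff_cancel_left' integral_mult_right_zero)
    then show "cnj (g y) * (\<integral>x. g x * complex_of_real (gauss_hat m (x - y)) \<partial>lborel) = (\<integral>z. complex_of_real (gauss_hat m z) * (cnj (g y) * g (z + y)) \<partial>lborel)"
      by (simp add: mult_ac add.commute)
  qed
  also have "\<dots> = (\<integral>z. (\<integral>y. complex_of_real (gauss_hat m z) * (cnj (g y) * g (z + y)) \<partial>lborel) \<partial>lborel)"
  proof (rule lborel_pair.Fubini_integral)
    have ib: "integrable lborel (\<lambda>y. B * norm (g y))" using ing by simp
    show "integrable (lborel \<Otimes>\<^sub>M lborel) (\<lambda>(z, y). complex_of_real (gauss_hat m z) * (cnj (g y) * g (z + y)))"
    proof (rule integrable_pair_bound[OF _ integrable_gauss_hat[OF m] ib])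
      show "(\<lambda>(z, y). complex_of_real (gauss_hat m z) * (cnj (g y) * g (z + y))) \<in> borel_measurable (lborel \<Otimes>\<^sub>M lborel)"
        by measurable
      show "norm (complex_of_real (gauss_hat m z) * (cnj (g y) * g (z + y))) \<le> gauss_hat m z * (B * norm (g y))" for z y
      proof -
        have "norm (g y) * norm (g (z + y)) \<le> B * norm (g y)" by (rule mult_le_swap[OF norm_ge_zero B(2)])
        then show ?thesis by (simp only: norm_mult norm_of_real complex_mod_cnj abs_of_nonneg[OF gauss_hat_nonneg[OF m]] mult_left_mono[OF _ gauss_hat_nonneg[OF m]])
      qed
    qed
  qed
  also have "\<dots> = (\<integral>z. complex_of_real (gauss_hat m z) * autocorr g z \<partial>lborel)"
    by (simp add: autocorr_def)
  finally show ?thesis .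
qed

text \<open>Moves the scale from the kernel into the argument of h, so that a limit in m is
  dominated by one fixed integrable function.\<close>

lemma gauss_hat_scale:
  fixes h :: "'a::euclidean_space \<Rightarrow> complex"
  assumes m: "m > 0" and [measurable]: "h \<in> borel_measurable borel"
  shows "(\<integral>z. complex_of_real (gauss_hat m z) * h z \<partial>lborel) = (\<integral>u. complex_of_real (gauss_hat 1 u) * h ((1 / m) *\<^sub>R u) \<partial>lborel)"
proof -
  define k where "k = (\<lambda>z. complex_of_real (gauss_hat m z) * h z)"
  have [measurable]: "k \<in> borel_measurable borel" unfolding k_def by measurable
  have "(\<integral>z. k z \<partial>lborel) = (\<integral>z. k z \<partial>density (distr lborel borel (\<lambda>x::'a. 0 + (1 / m) *\<^sub>R x)) (\<lambda>_. \<bar>1 / m\<bar> ^ DIM('a)))"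
    using m by (subst lborel_affine[of "1 / m" 0]) auto
  also have "\<dots> = (\<integral>u. \<bar>1 / m\<bar> ^ DIM('a) *\<^sub>R k ((1 / m) *\<^sub>R u) \<partial>lborel)"
    by (subst integral_density) (auto simp: integral_distr)
  also have "\<dots> = (\<integral>u. complex_of_real (gauss_hat 1 u) * h ((1 / m) *\<^sub>R u) \<partial>lborel)"
  proof (rule Bochner_Integration.integral_cong[OF refl])
    fix u :: 'a
    have "\<bar>1 / m\<bar> ^ DIM('a) * gauss_hat m ((1 / m) *\<^sub>R u) = gauss_hat 1 u"
      using m by (simp add: gauss_hat_def power_mult_distrib power_divide)
    then show "\<bar>1 / m\<bar> ^ DIM('a) *\<^sub>R k ((1 / m) *\<^sub>R u) = complex_of_real (gauss_hat 1 u) * h ((1 / m) *\<^sub>R u)"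
      by (simp add: k_def scaleR_conv_of_real flip: of_real_mult mult.assoc of_real_power)
  qed
  finally show ?thesis by (simp add: k_def)
qed

text \<open>The transform at 0 is the integral of \<open>gauss 1\<close>, and
  \<open>gauss_hat 1\<close> is a multiple of \<open>gauss 1\<close>.\<close>

lemma gauss_hat_total: "(\<integral>u. gauss_hat 1 u \<partial>(lborel :: 'a::euclidean_space measure)) = (2 * pi) ^ DIM('a)"
proof -
  have "complex_of_real (\<integral>u. gauss 1 u \<partial>(lborel :: 'a measure)) = complex_of_real (gauss_hat 1 (0::'a))"
    using integral_gauss_cis[of 1 "0::'a"] by (simp flip: integral_complex_of_real)
  then have "(\<integral>u. gauss 1 u \<partial>(lborel :: 'a measure)) = sqrt (2 * pi) ^ DIM('a)"
    by (simp add: gauss_hat_def flip: of_real_power)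
  then have "(\<integral>u. gauss_hat 1 u \<partial>(lborel :: 'a measure)) = sqrt (2 * pi) ^ DIM('a) * sqrt (2 * pi) ^ DIM('a)"
    by (simp add: gauss_hat_alt)
  also have "\<dots> = (sqrt (2 * pi) * sqrt (2 * pi)) ^ DIM('a)" by (rule power_mult_distrib[symmetric])
  finally show ?thesis by simp
qed

lemma autocorr_props:
  fixes g :: "'a::euclidean_space \<Rightarrow> complex"
  assumes g: "bdd_integrable g"
  shows "autocorr g \<in> borel_measurable borel"
    and "\<exists>K. \<forall>z. norm (autocorr g z) \<le> K"
    and "\<And>z. z \<longlonglongrightarrow> 0 \<Longrightarrow> (\<lambda>n. autocorr g (z n)) \<longlonglongrightarrow> autocorr g 0"
proof -
  have [measurable]: "g \<in> borel_measurable borel" and ig: "integrable lborel g" using bdd_integrableD g by auto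
  obtain B where B: "B \<ge> 0" "\<And>x. norm (g x) \<le> B" using g by (rule bdd_integrableE) blast
  show "autocorr g \<in> borel_measurable borel" unfolding autocorr_def by measurable
  have int: "integrable lborel (\<lambda>y. cnj (g y) * k y)" if [measurable]: "k \<in> borel_measurable borel" and k: "\<And>y. norm (k y) \<le> B" for k
  proof (rule Bochner_Integration.integrable_bound[OF integrable_mult_right[OF integrable_norm[OF ig], of B]])
    show "AE x in lborel. norm (cnj (g x) * k x) \<le> norm (B * norm (g x))"
      using B(1) by (auto intro!: AE_I2 mult_le_swap k simp: norm_mult abs_mult)
  qed measurable
  have "norm (autocorr g z) \<le> (\<integral>y. B * norm (g y) \<partial>lborel)" for z
    unfolding autocorr_def
  proof (rule order_trans[OF integral_norm_bound integral_mono])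
    show "integrable lborel (\<lambda>y. norm (cnj (g y) * g (z + y)))" by (intro integrable_norm int B) measurable
    show "norm (cnj (g y) * g (z + y)) \<le> B * norm (g y)" for y
      by (simp add: norm_mult mult_le_swap B(2))
  qed (use ig in simp)
  then show "\<exists>K. \<forall>z. norm (autocorr g z) \<le> K" by blast
  fix z :: "nat \<Rightarrow> 'a" assume z: "z \<longlonglongrightarrow> 0"
  have "(\<lambda>n. \<integral>x. norm (g (z n + x) - g x) \<partial>lborel) \<longlonglongrightarrow> 0"
    using integrable_imp_L1_cont[OF ig] z unfolding L1_cont_def by blast
  then have l: "(\<lambda>n. B * (\<integral>x. norm (g (z n + x) - g x) \<partial>lborel)) \<longlonglongrightarrow> 0" by (rule tendsto_mult_right_zero)
  have "(\<lambda>n. autocorr g (z n) - autocorr g 0) \<longlonglongrightarrow> 0"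
  proof (rule Lim_null_comparison[OF _ l], rule always_eventually, rule allI)
    fix n
    have "autocorr g (z n) - autocorr g 0 = (\<integral>y. cnj (g y) * g (z n + y) - cnj (g y) * g (0 + y) \<partial>lborel)"
      unfolding autocorr_def by (rule Bochner_Integration.integral_diff[symmetric]) (intro int B; measurable)+
    also have "norm \<dots> \<le> (\<integral>y. B * norm (g (z n + y) - g y) \<partial>lborel)"
    proof (rule order_trans[OF integral_norm_bound integral_mono])
      show "integrable lborel (\<lambda>y. norm (cnj (g y) * g (z n + y) - cnj (g y) * g (0 + y)))"
        by (intro integrable_norm Bochner_Integration.integrable_diff int B; measurable)
      show "norm (cnj (g y) * g (z n + y) - cnj (g y) * g (0 + y)) \<le> B * norm (g (z n + y) - g y)" for y
        using B(2)[of y] by (simp add: norm_mult mult_right_mono flip: right_diff_distrib)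
    qed (use integrable_shift[OF ig] ig in simp)
    finally show "norm (autocorr g (z n) - autocorr g 0) \<le> B * (\<integral>x. norm (g (z n + x) - g x) \<partial>lborel)" by simp
  qed
  then show "(\<lambda>n. autocorr g (z n)) \<longlonglongrightarrow> autocorr g 0" by (simp add: LIM_zero_iff)
qed

lemma autocorr_0: "autocorr g 0 = complex_of_real (\<integral>y. (norm (g y))\<^sup>2 \<partial>lborel)"
proof -
  have "autocorr g 0 = (\<integral>y. complex_of_real ((norm (g y))\<^sup>2) \<partial>lborel)"
    unfolding autocorr_def by (intro Bochner_Integration.integral_cong) (simp_all add: complex_norm_square[symmetric] mult.commute flip: of_real_power)
  then show ?thesis by (simp only: integral_complex_of_real)
qed

lemma bdd_integrable_square_integrable:
  assumes g: "bdd_integrable g" shows "integrable lborel (\<lambda>y. (norm (g y))\<^sup>2)"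
proof -
  have [measurable]: "g \<in> borel_measurable borel" and ig: "integrable lborel g" using bdd_integrableD g by auto
  obtain B where B: "B \<ge> 0" "\<And>x. norm (g x) \<le> B" using g by (rule bdd_integrableE) blast
  show ?thesis
    by (rule Bochner_Integration.integrable_bound[OF integrable_mult_right[OF integrable_norm[OF ig], of B]])
      (use B in \<open>auto simp: power2_eq_square abs_mult intro!: mult_right_mono AE_I2\<close>)
qed

text \<open>\<open>FT_gauss_pairing\<close> as the Gaussian weight tends to 1. The frequency side
  uses monotone convergence, since square integrability of the transform is not known beforehand;
  the other side is an approximate identity applied to the autocorrelation, which is continuous at
  0.\<close>

theorem plancherel:
  fixes g :: "'a::euclidean_space \<Rightarrow> complex"
  assumes g: "bdd_integrable g"
  shows "(\<integral>\<^sup>+\<xi>. ennreal ((norm (FT g \<xi>))\<^sup>2) \<partial>lborel) = ennreal ((2 * pi) ^ DIM('a)) * (\<integral>\<^sup>+x. ennreal ((norm (g x))\<^sup>2) \<partial>lborel)"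
proof -
  have [measurable]: "g \<in> borel_measurable borel" and ig: "integrable lborel g" using bdd_integrableD g by auto
  obtain K where K: "\<And>z. norm (autocorr g z) \<le> K" using autocorr_props(2)[OF g] by blast
  note [measurable] = autocorr_props(1)[OF g]
  define m where "m = (\<lambda>n. real (Suc n))"
  have m: "m n > 0" for n by (simp add: m_def)
  define C where "C = (\<integral>x. norm (g x) \<partial>lborel)"
  have C: "norm (FT g \<xi>) \<le> C" for \<xi> unfolding C_def by (rule norm_FT_le)
  have int: "integrable lborel (\<lambda>\<xi>. gauss (m n) \<xi> * (norm (FT g \<xi>))\<^sup>2)" for n
  proof (rule Bochner_Integration.integrable_bound[OF integrable_mult_right[OF integrable_gauss[OF m], of "C\<^sup>2"]])
    show "AE x in lborel. norm (gauss (m n) x * (norm (FT g x))\<^sup>2) \<le> norm (C\<^sup>2 * gauss (m n) x)"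
      using C by (auto intro!: AE_I2 mult_right_mono power_mono simp: abs_mult mult.commute[of "gauss (m n) _"])
  qed measurable
  have "(\<lambda>n. \<integral>u. complex_of_real (gauss_hat 1 u) * autocorr g ((1 / m n) *\<^sub>R u) \<partial>(lborel::'a measure)) \<longlonglongrightarrow>
      (\<integral>u. complex_of_real (gauss_hat 1 u) * autocorr g 0 \<partial>(lborel::'a measure))"
  proof (rule integral_dominated_convergence[where w = "\<lambda>u. gauss_hat 1 u * K"])
    show "integrable lborel (\<lambda>u::'a. gauss_hat 1 u * K)" using integrable_gauss_hat[of 1, where 'a='a] by simp
    show "AE u::'a in lborel. (\<lambda>n. complex_of_real (gauss_hat 1 u) * autocorr g ((1 / m n) *\<^sub>R u)) \<longlonglongrightarrow> complex_of_real (gauss_hat 1 u) * autocorr g 0"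
    proof (rule AE_I2, intro tendsto_mult tendsto_const autocorr_props(3)[OF g])
      fix u :: 'a
      have "(\<lambda>n. inverse (real (Suc n)) *\<^sub>R u) \<longlonglongrightarrow> 0 *\<^sub>R u"
        by (intro tendsto_scaleR LIMSEQ_inverse_real_of_nat tendsto_const)
      then show "(\<lambda>n. (1 / m n) *\<^sub>R u) \<longlonglongrightarrow> 0" by (simp add: m_def inverse_eq_divide)
    qed
    show "AE u::'a in lborel. norm (complex_of_real (gauss_hat 1 u) * autocorr g ((1 / m n) *\<^sub>R u)) \<le> gauss_hat 1 u * K" for n
    proof (rule AE_I2)
      fix u :: 'a
      have "gauss_hat 1 u * norm (autocorr g ((1 / m n) *\<^sub>R u)) \<le> gauss_hat 1 u * K"
        by (intro mult_left_mono K gauss_hat_nonneg) simp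
      then show "norm (complex_of_real (gauss_hat 1 u) * autocorr g ((1 / m n) *\<^sub>R u)) \<le> gauss_hat 1 u * K"
        by (simp only: norm_mult norm_of_real abs_of_nonneg[OF gauss_hat_nonneg[OF zero_less_one]])
    qed
  qed measurable
  also have "(\<integral>u. complex_of_real (gauss_hat 1 u) * autocorr g 0 \<partial>(lborel::'a measure)) = complex_of_real ((2 * pi) ^ DIM('a)) * autocorr g 0"
    by (simp only: integral_mult_left_zero integral_complex_of_real gauss_hat_total)
  also have "\<dots> = complex_of_real ((2 * pi) ^ DIM('a) * (\<integral>y. (norm (g y))\<^sup>2 \<partial>lborel))"
    by (simp add: autocorr_0)
  finally have "(\<lambda>n. complex_of_real (\<integral>\<xi>. gauss (m n) \<xi> * (norm (FT g \<xi>))\<^sup>2 \<partial>lborel)) \<longlonglongrightarrow> complex_of_real ((2 * pi) ^ DIM('a) * (\<integral>y. (norm (g y))\<^sup>2 \<partial>lborel))"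
    by (simp only: gauss_hat_scale[OF m autocorr_props(1)[OF g], symmetric] FT_gauss_pairing[OF g m, symmetric] integral_complex_of_real)
  then have lim: "(\<lambda>n. \<integral>\<xi>. gauss (m n) \<xi> * (norm (FT g \<xi>))\<^sup>2 \<partial>lborel) \<longlonglongrightarrow> (2 * pi) ^ DIM('a) * (\<integral>y. (norm (g y))\<^sup>2 \<partial>lborel)"
    by (simp only: tendsto_of_real_iff)
  have mono: "incseq (\<lambda>n. ennreal (gauss (m n) \<xi> * (norm (FT g \<xi>))\<^sup>2))" for \<xi> :: 'a
  proof (rule incseq_SucI, intro ennreal_leI mult_right_mono)
    fix n
    have "(norm \<xi>)\<^sup>2 / (2 * (m (Suc n))\<^sup>2) \<le> (norm \<xi>)\<^sup>2 / (2 * (m n)\<^sup>2)"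
      by (intro divide_left_mono) (auto simp: m_def intro!: power_mono mult_pos_pos)
    then show "gauss (m n) \<xi> \<le> gauss (m (Suc n)) \<xi>" by (simp add: gauss_def)
  qed auto
  have "(\<lambda>n. \<integral>\<^sup>+\<xi>. ennreal (gauss (m n) \<xi> * (norm (FT g \<xi>))\<^sup>2) \<partial>lborel) \<longlonglongrightarrow> (\<integral>\<^sup>+\<xi>. ennreal ((norm (FT g \<xi>))\<^sup>2) \<partial>lborel)"
  proof (rule nn_integral_LIMSEQ)
    show "incseq (\<lambda>n \<xi>. ennreal (gauss (m n) \<xi> * (norm (FT g \<xi>))\<^sup>2))" using mono by (auto simp: incseq_def le_fun_def)
    fix \<xi> :: 'a
    have "(\<lambda>n. inverse (real (Suc n)) * inverse (real (Suc n))) \<longlonglongrightarrow> 0 * 0" by (intro tendsto_mult LIMSEQ_inverse_real_of_nat)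
    then have "(\<lambda>n. exp (- ((norm \<xi>)\<^sup>2 / 2 * (inverse (real (Suc n)) * inverse (real (Suc n))))) * (norm (FT g \<xi>))\<^sup>2) \<longlonglongrightarrow> exp (- ((norm \<xi>)\<^sup>2 / 2 * 0)) * (norm (FT g \<xi>))\<^sup>2"
      by (intro tendsto_intros) simp
    moreover have "gauss (m n) \<xi> = exp (- ((norm \<xi>)\<^sup>2 / 2 * (inverse (real (Suc n)) * inverse (real (Suc n)))))" for n
      by (simp add: gauss_def m_def power2_eq_square inverse_eq_divide)
    ultimately show "(\<lambda>n. ennreal (gauss (m n) \<xi> * (norm (FT g \<xi>))\<^sup>2)) \<longlonglongrightarrow> ennreal ((norm (FT g \<xi>))\<^sup>2)"
      by (intro tendsto_ennrealI) simp
  qed measurable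
  moreover have "(\<integral>\<^sup>+\<xi>. ennreal (gauss (m n) \<xi> * (norm (FT g \<xi>))\<^sup>2) \<partial>lborel) = ennreal (\<integral>\<xi>. gauss (m n) \<xi> * (norm (FT g \<xi>))\<^sup>2 \<partial>lborel)" for n
    by (rule nn_integral_eq_integral[OF int]) (simp add: gauss_def)
  ultimately have "(\<lambda>n. ennreal (\<integral>\<xi>. gauss (m n) \<xi> * (norm (FT g \<xi>))\<^sup>2 \<partial>lborel)) \<longlonglongrightarrow> (\<integral>\<^sup>+\<xi>. ennreal ((norm (FT g \<xi>))\<^sup>2) \<partial>lborel)" by simp
  moreover have "(\<lambda>n. ennreal (\<integral>\<xi>. gauss (m n) \<xi> * (norm (FT g \<xi>))\<^sup>2 \<partial>lborel)) \<longlonglongrightarrow> ennreal ((2 * pi) ^ DIM('a) * (\<integral>y. (norm (g y))\<^sup>2 \<partial>lborel))"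
    by (rule tendsto_ennrealI[OF lim])
  ultimately have "(\<integral>\<^sup>+\<xi>. ennreal ((norm (FT g \<xi>))\<^sup>2) \<partial>lborel) = ennreal ((2 * pi) ^ DIM('a) * (\<integral>y. (norm (g y))\<^sup>2 \<partial>lborel))"
    by (rule LIMSEQ_unique)
  also have "\<dots> = ennreal ((2 * pi) ^ DIM('a)) * ennreal (\<integral>y. (norm (g y))\<^sup>2 \<partial>lborel)"
    by (simp add: ennreal_mult)
  also have "ennreal (\<integral>y. (norm (g y))\<^sup>2 \<partial>lborel) = (\<integral>\<^sup>+x. ennreal ((norm (g x))\<^sup>2) \<partial>lborel)"
    by (rule nn_integral_eq_integral[OF bdd_integrable_square_integrable[OF g], symmetric]) simp
  finally show ?thesis .
qed

subsection \<open>Lebesgue points on the line\<close>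

lemma L1_cont_uniform:
  fixes g :: "'a::euclidean_space \<Rightarrow> complex"
  assumes g: "integrable lborel g" and e: "e > 0"
  obtains d where "d > 0" "\<And>z. norm z \<le> d \<Longrightarrow> (\<integral>x. norm (g (z + x) - g x) \<partial>lborel) < e"
proof -
  have "((\<lambda>z. \<integral>x. norm (g (z + x) - g x) \<partial>lborel) \<longlongrightarrow> 0) (at 0)"
    unfolding tendsto_at_iff_sequentially using integrable_imp_L1_cont[OF g] by (auto simp: L1_cont_def o_def)
  then have "\<forall>\<^sub>F z in at 0. (\<integral>x. norm (g (z + x) - g x) \<partial>lborel) < e" using e by (rule order_tendstoD)
  then obtain d where d: "d > 0" "\<And>z. z \<noteq> 0 \<Longrightarrow> dist z 0 < d \<Longrightarrow> (\<integral>x. norm (g (z + x) - g x) \<partial>lborel) < e"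
    unfolding eventually_at by auto
  show ?thesis
  proof (rule that[of "d / 2"])
    fix z :: 'a assume "norm z \<le> d / 2"
    then show "(\<integral>x. norm (g (z + x) - g x) \<partial>lborel) < e" using d e by (cases "z = 0") auto
  qed (use d in simp)
qed

definition avg :: "real \<Rightarrow> (real \<Rightarrow> real) \<Rightarrow> real" where
  "avg \<eta> u = (\<integral>t. indicator {-\<eta>..\<eta>} t * u t \<partial>lborel) / (2 * \<eta>)"

lemma avg_const: "\<eta> > 0 \<Longrightarrow> avg \<eta> (\<lambda>_. c) = c"
  by (simp add: avg_def)

lemma integrable_reflect:
  fixes g :: "real \<Rightarrow> 'b::{banach, second_countable_topology}"
  assumes "integrable lborel g" shows "integrable lborel (\<lambda>t. g (s - t))"
  using lborel_integrable_real_affine[OF assms, of "-1" s] by simp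

lemma integrable_indicator_mult:
  fixes u :: "real \<Rightarrow> real"
  assumes "integrable lborel u" shows "integrable lborel (\<lambda>t. indicator {a..b} t * u t)"
  using integrable_mult_indicator[OF _ assms, of "{a..b}"] by simp

lemma avg_mono:
  assumes "\<eta> > 0" "integrable lborel (\<lambda>t. indicator {-\<eta>..\<eta>} t * u t)" "integrable lborel (\<lambda>t. indicator {-\<eta>..\<eta>} t * v t)"
    and "\<And>t. \<bar>t\<bar> \<le> \<eta> \<Longrightarrow> u t \<le> v t"
  shows "avg \<eta> u \<le> avg \<eta> v"
  unfolding avg_def using assms by (intro divide_right_mono integral_mono) (auto simp: indicator_def abs_le_iff)

text \<open>Vitali covering: the bad centres lie in the 5-fold dilates of countably many disjoint
  bad intervals, and each bad interval is at most 1/l times the integral of u over it. Radii are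
  bounded by 1 as the covering lemma requires a bound.\<close>

lemma maximal_weak_type:
  fixes u :: "real \<Rightarrow> real"
  assumes u: "integrable lborel u" "\<And>t. 0 \<le> u t" and l: "l > 0"
  obtains E where "E \<in> sets borel" "emeasure lborel E \<le> ennreal (5 / l * (\<integral>t. u t \<partial>lborel))"
    "\<And>s \<eta>. 0 < \<eta> \<Longrightarrow> \<eta> \<le> 1 \<Longrightarrow> s \<notin> E \<Longrightarrow> avg \<eta> (\<lambda>t. u (s - t)) \<le> l"
proof -
  have [measurable]: "u \<in> borel_measurable borel" using u by auto
  define K where "K = {(s, \<eta>). 0 < \<eta> \<and> \<eta> \<le> 1 \<and> avg \<eta> (\<lambda>t. u (s - t)) > l}"
  define S where "S = fst ` K"
  have S: "S \<subseteq> (\<Union>i\<in>K. cball (fst i) (snd i))" unfolding S_def K_def by force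
  have K01: "\<And>i. i \<in> K \<Longrightarrow> 0 < snd i \<and> snd i \<le> 1" unfolding K_def by auto
  obtain C where C: "countable C" "C \<subseteq> K"
    "pairwise (\<lambda>i j. disjnt (cball (fst i) (snd i)) (cball (fst j) (snd j))) C"
    "S \<subseteq> (\<Union>i\<in>C. cball (fst i) (5 * snd i))"
    by (rule Vitali_covering_lemma_cballs[OF S K01]) auto
  define E where "E = (\<Union>i\<in>C. cball (fst i) (5 * snd i))"
  have E: "E \<in> sets borel" unfolding E_def using C(1) by (intro sets.countable_UN') auto
  have int: "ennreal (2 * snd i * l) \<le> (\<integral>\<^sup>+t. ennreal (u t) * indicator (cball (fst i) (snd i)) t \<partial>lborel)" if "i \<in> K" for i
  proof -
    define s \<eta> where "s = fst i" and "\<eta> = snd i"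
    have i: "i = (s, \<eta>)" "0 < \<eta>" "avg \<eta> (\<lambda>t. u (s - t)) > l"
      using that unfolding K_def s_def \<eta>_def by auto
    have "2 * \<eta> * l \<le> (\<integral>t. indicator {-\<eta>..\<eta>} t * u (s - t) \<partial>lborel)"
      using i by (simp add: avg_def field_simps)
    also have "\<dots> = (\<integral>t. indicator {-\<eta>..\<eta>} (s - t) * u t \<partial>lborel)"
      using lborel_integral_real_affine[of "-1" "\<lambda>t. indicator {-\<eta>..\<eta>} (s - t) * u t" s] by simp
    finally have "ennreal (2 * \<eta> * l) \<le> ennreal (\<integral>t. indicator {-\<eta>..\<eta>} (s - t) * u t \<partial>lborel)" by (rule ennreal_leI)
    also have "\<dots> = (\<integral>\<^sup>+t. ennreal (indicator {-\<eta>..\<eta>} (s - t) * u t) \<partial>lborel)"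
    proof (rule nn_integral_eq_integral[symmetric])
      show "integrable lborel (\<lambda>t. indicator {-\<eta>..\<eta>} (s - t) * u t)"
        by (rule Bochner_Integration.integrable_bound[OF u(1)]) (use u(2) in \<open>auto simp: indicator_def\<close>)
    qed (use u(2) in auto)
    also have "\<dots> \<le> (\<integral>\<^sup>+t. ennreal (u t) * indicator (cball s \<eta>) t \<partial>lborel)"
      by (intro nn_integral_mono) (auto simp: indicator_def dist_real_def)
    finally show ?thesis using i by simp
  qed
  have sub: "emeasure lborel E \<le> (\<integral>\<^sup>+i. emeasure lborel (cball (fst i) (5 * snd i)) \<partial>count_space C)"
  proof -
    have "emeasure lborel E = (\<integral>\<^sup>+t. indicator E t \<partial>lborel)" using E by simp
    also have "\<dots> \<le> (\<integral>\<^sup>+t. (\<integral>\<^sup>+i. indicator (cball (fst i) (5 * snd i)) t \<partial>count_space C) \<partial>lborel)"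
    proof (rule nn_integral_mono)
      fix t
      show "indicator E t \<le> (\<integral>\<^sup>+i. indicator (cball (fst i) (5 * snd i)) t \<partial>count_space C)"
      proof (cases "t \<in> E")
        case True
        then obtain i where i: "i \<in> C" "t \<in> cball (fst i) (5 * snd i)" unfolding E_def by blast
        then show ?thesis using nn_integral_ge_point[of i C "\<lambda>i. indicator (cball (fst i) (5 * snd i)) t"] by (simp add: indicator_def)
      qed simp
    qed
    also have "\<dots> = (\<integral>\<^sup>+i. (\<integral>\<^sup>+t. indicator (cball (fst i) (5 * snd i)) t \<partial>lborel) \<partial>count_space C)"
      by (intro nn_integral_count_space_nn_integral borel_measurable_indicator C(1)) simp
    finally show ?thesis by simp
  qed
  have "(\<integral>\<^sup>+i. emeasure lborel (cball (fst i) (5 * snd i)) \<partial>count_space C) \<le> (\<integral>\<^sup>+i. ennreal (5 / l) * (\<integral>\<^sup>+t. ennreal (u t) * indicator (cball (fst i) (snd i)) t \<partial>lborel) \<partial>count_space C)"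
  proof (rule nn_integral_mono)
    fix i assume "i \<in> space (count_space C)"
    then have i: "i \<in> K" using C(2) by auto
    have "cball (fst i) (5 * snd i) = {fst i - 5 * snd i..fst i + 5 * snd i}" by (auto simp: dist_real_def)
    then have "emeasure lborel (cball (fst i) (5 * snd i)) = ennreal (10 * snd i)" using K01[OF i] by simp
    also have "\<dots> = ennreal (5 / l) * ennreal (2 * snd i * l)" using l K01[OF i] by (simp flip: ennreal_mult)
    also have "\<dots> \<le> ennreal (5 / l) * (\<integral>\<^sup>+t. ennreal (u t) * indicator (cball (fst i) (snd i)) t \<partial>lborel)"
      by (intro mult_left_mono int i) simp
    finally show "emeasure lborel (cball (fst i) (5 * snd i)) \<le> ennreal (5 / l) * (\<integral>\<^sup>+t. ennreal (u t) * indicator (cball (fst i) (snd i)) t \<partial>lborel)" .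
  qed
  also have "\<dots> = ennreal (5 / l) * (\<integral>\<^sup>+i. (\<integral>\<^sup>+t. ennreal (u t) * indicator (cball (fst i) (snd i)) t \<partial>lborel) \<partial>count_space C)"
    by (rule nn_integral_cmult) simp
  also have "(\<integral>\<^sup>+i. (\<integral>\<^sup>+t. ennreal (u t) * indicator (cball (fst i) (snd i)) t \<partial>lborel) \<partial>count_space C) =
      (\<integral>\<^sup>+t. ennreal (u t) * indicator (\<Union>i\<in>C. cball (fst i) (snd i)) t \<partial>lborel)"
  proof -
    let ?D = "density lborel (\<lambda>t. ennreal (u t))"
    have dj: "disjoint_family_on (\<lambda>i. cball (fst i) (snd i)) C"
      using C(3) by (auto simp: disjoint_family_on_def pairwise_def disjnt_def)
    have "emeasure ?D (\<Union>i\<in>C. cball (fst i) (snd i)) = (\<integral>\<^sup>+i. emeasure ?D (cball (fst i) (snd i)) \<partial>count_space C)"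
      using C(1) dj by (intro emeasure_UN_countable) auto
    moreover have "(\<Union>i\<in>C. cball (fst i) (snd i)) \<in> sets lborel" using C(1) by (intro sets.countable_UN') auto
    ultimately show ?thesis by (simp add: emeasure_density)
  qed
  also have "\<dots> \<le> (\<integral>\<^sup>+t. ennreal (u t) \<partial>lborel)" by (intro nn_integral_mono) (auto simp: indicator_def)
  also have "\<dots> = ennreal (\<integral>t. u t \<partial>lborel)" using u by (intro nn_integral_eq_integral) auto
  finally have "(\<integral>\<^sup>+i. emeasure lborel (cball (fst i) (5 * snd i)) \<partial>count_space C) \<le> ennreal (5 / l) * ennreal (\<integral>t. u t \<partial>lborel)"
    by (simp add: mult_left_mono)
  then have "emeasure lborel E \<le> ennreal (5 / l * (\<integral>t. u t \<partial>lborel))"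
    using sub l u(2) by (subst ennreal_mult) (auto intro: order_trans)
  moreover have "avg \<eta> (\<lambda>t. u (s - t)) \<le> l" if "0 < \<eta>" "\<eta> \<le> 1" "s \<notin> E" for s \<eta>
  proof (rule ccontr)
    assume "\<not> ?thesis"
    then have "(s, \<eta>) \<in> K" using that by (auto simp: K_def)
    then have "s \<in> E" using C(4) unfolding S_def E_def by force
    then show False using that by simp
  qed
  ultimately show ?thesis using E that by blast
qed

text \<open>The approximant is the mean of the translates of g by |t| <= d. It is continuous because
  translation is continuous in L1, and close to g because the L1 distance is at most a mean of
  distances between g and its small translates.\<close>

lemma continuous_L1_approx:
  fixes g :: "real \<Rightarrow> complex"
  assumes g: "integrable lborel g" and e: "e > 0"
  obtains k where "integrable lborel k" "continuous_on UNIV k" "(\<integral>x. norm (g x - k x) \<partial>lborel) < e"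
proof -
  have [measurable]: "g \<in> borel_measurable borel" using g by auto
  obtain d where d: "d > 0" "\<And>z. norm z \<le> d \<Longrightarrow> (\<integral>x. norm (g (z + x) - g x) \<partial>lborel) < e / 2"
    using L1_cont_uniform[OF g, of "e / 2"] e by auto
  define k where "k = (\<lambda>s. (\<integral>t. indicator {-d..d} t *\<^sub>R g (t + s) \<partial>lborel) /\<^sub>R (2 * d))"
  have int: "integrable lborel (\<lambda>t. indicator {-d..d} t *\<^sub>R g (t + s))" for s
    using integrable_mult_indicator[OF _ integrable_shift[OF g, of s], of "{-d..d}"] by (simp add: add.commute)
  have kdiff: "norm (k s' - k s) \<le> (\<integral>t. norm (g ((s' - s) + t) - g t) \<partial>lborel) / (2 * d)" for s s'
  proof -
    have ks: "k s' - k s = (\<integral>t. indicator {-d..d} t *\<^sub>R g (t + s') - indicator {-d..d} t *\<^sub>R g (t + s) \<partial>lborel) /\<^sub>R (2 * d)"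
      unfolding k_def by (simp only: Bochner_Integration.integral_diff[OF int int] scaleR_diff_right)
    have ad: "\<bar>inverse (2 * d)\<bar> = inverse (2 * d)" using d(1) by simp
    have "norm (k s' - k s) = norm (\<integral>t. indicator {-d..d} t *\<^sub>R g (t + s') - indicator {-d..d} t *\<^sub>R g (t + s) \<partial>lborel) / (2 * d)"
      unfolding ks norm_scaleR ad divide_inverse by (rule mult.commute)
    also have "\<dots> \<le> (\<integral>t. norm (g ((s' - s) + (s + t)) - g (s + t)) \<partial>lborel) / (2 * d)"
    proof (rule divide_right_mono, rule order_trans[OF integral_norm_bound], rule integral_mono)
      show "integrable lborel (\<lambda>t. norm (g ((s' - s) + (s + t)) - g (s + t)))"
        using integrable_shift[OF g, of s'] integrable_shift[OF g, of s] by simp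
      show "integrable lborel (\<lambda>t. norm (indicator {-d..d} t *\<^sub>R g (t + s') - indicator {-d..d} t *\<^sub>R g (t + s)))"
        using int by (intro integrable_norm Bochner_Integration.integrable_diff)
      show "norm (indicator {-d..d} t *\<^sub>R g (t + s') - indicator {-d..d} t *\<^sub>R g (t + s)) \<le> norm (g ((s' - s) + (s + t)) - g (s + t))" for t
        by (cases "t \<in> {-d..d}") (simp_all add: add.commute[of t])
      show "0 \<le> 2 * d" using d(1) by simp
    qed
    also have "(\<integral>t. norm (g ((s' - s) + (s + t)) - g (s + t)) \<partial>lborel) = (\<integral>t. norm (g ((s' - s) + t) - g t) \<partial>lborel)"
      by (rule integral_shift[of "\<lambda>t. norm (g ((s' - s) + t) - g t)"]) measurable
    finally show ?thesis .
  qed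
  have "continuous_on UNIV k" unfolding continuous_on_iff
  proof (intro ballI allI impI)
    fix s e' :: real assume e': "e' > 0"
    obtain d' where d': "d' > 0" "\<And>z. norm z \<le> d' \<Longrightarrow> (\<integral>x. norm (g (z + x) - g x) \<partial>lborel) < e' * (2 * d)"
      using L1_cont_uniform[OF g, of "e' * (2 * d)"] e' d(1) by auto
    show "\<exists>d>0. \<forall>s'\<in>UNIV. dist s' s < d \<longrightarrow> dist (k s') (k s) < e'"
    proof (intro exI[of _ d'] conjI d' ballI impI)
      fix s' assume "dist s' s < d'"
      then have "(\<integral>x. norm (g ((s' - s) + x) - g x) \<partial>lborel) < e' * (2 * d)" by (intro d') (simp add: dist_real_def)
      then have "(\<integral>t. norm (g ((s' - s) + t) - g t) \<partial>lborel) / (2 * d) < e'" using d(1) by (simp add: field_simps)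
      then show "dist (k s') (k s) < e'" using kdiff[of s' s] by (simp add: dist_norm)
    qed
  qed
  then have [measurable]: "k \<in> borel_measurable borel" by (rule borel_measurable_continuous_onI)
  define I where "I = (\<lambda>s t. indicator {-d..d} t *\<^sub>R (g s - g (t + s)))"
  have i1: "integrable lborel (\<lambda>t. indicator {-d..d} t *\<^sub>R g s)" for s
    using d(1) by (intro integrable_scaleR_left integrable_real_indicator) simp_all
  have gk: "g s - k s = (\<integral>t. I s t \<partial>lborel) /\<^sub>R (2 * d)" for s
  proof -
    have "(\<integral>t. I s t \<partial>lborel) = (\<integral>t. indicator {-d..d} t *\<^sub>R g s - indicator {-d..d} t *\<^sub>R g (t + s) \<partial>lborel)"
      by (simp add: I_def scaleR_diff_right)
    also have "\<dots> = (\<integral>t. indicator {-d..d} t *\<^sub>R g s \<partial>lborel) - (\<integral>t. indicator {-d..d} t *\<^sub>R g (t + s) \<partial>lborel)"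
      by (rule Bochner_Integration.integral_diff[OF i1 int])
    also have "(\<integral>t. indicator {-d..d} t *\<^sub>R g s \<partial>lborel) = (2 * d) *\<^sub>R g s" using d(1) by simp
    finally show ?thesis using d(1) by (simp add: k_def scaleR_diff_right)
  qed
  have nn: "(\<integral>\<^sup>+s. ennreal (norm (g s - k s)) \<partial>lborel) \<le> ennreal (e / 2)"
  proof -
    have "(\<integral>\<^sup>+s. ennreal (norm (g s - k s)) \<partial>lborel) \<le> (\<integral>\<^sup>+s. ennreal (1 / (2 * d)) * (\<integral>\<^sup>+t. ennreal (norm (I s t)) \<partial>lborel) \<partial>lborel)"
    proof (rule nn_integral_mono)
      fix s
      have iI: "integrable lborel (I s)" unfolding I_def scaleR_diff_right by (rule Bochner_Integration.integrable_diff[OF i1 int])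
      have ad: "\<bar>inverse (2 * d)\<bar> = 1 / (2 * d)" using d(1) by (simp add: inverse_eq_divide)
      have "ennreal (norm (g s - k s)) = ennreal (1 / (2 * d)) * ennreal (norm (\<integral>t. I s t \<partial>lborel))"
        unfolding gk norm_scaleR ad by (rule ennreal_mult[OF _ norm_ge_zero]) (use d(1) in simp)
      also have "\<dots> \<le> ennreal (1 / (2 * d)) * (\<integral>\<^sup>+t. ennreal (norm (I s t)) \<partial>lborel)"
        by (intro mult_left_mono integral_norm_bound_ennreal iI) simp
      finally show "ennreal (norm (g s - k s)) \<le> ennreal (1 / (2 * d)) * (\<integral>\<^sup>+t. ennreal (norm (I s t)) \<partial>lborel)" .
    qed
    also have "\<dots> = ennreal (1 / (2 * d)) * (\<integral>\<^sup>+s. (\<integral>\<^sup>+t. ennreal (norm (I s t)) \<partial>lborel) \<partial>lborel)"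
      unfolding I_def by (rule nn_integral_cmult) measurable
    also have "(\<integral>\<^sup>+s. (\<integral>\<^sup>+t. ennreal (norm (I s t)) \<partial>lborel) \<partial>lborel) = (\<integral>\<^sup>+t. (\<integral>\<^sup>+s. ennreal (norm (I s t)) \<partial>lborel) \<partial>lborel)"
      unfolding I_def by (rule lborel_pair.Fubini'[symmetric]) measurable
    also have "\<dots> \<le> (\<integral>\<^sup>+t. ennreal (e / 2) * indicator {-d..d} t \<partial>lborel)"
    proof (rule nn_integral_mono)
      fix t :: real
      show "(\<integral>\<^sup>+s. ennreal (norm (I s t)) \<partial>lborel) \<le> ennreal (e / 2) * indicator {-d..d} t"
      proof (cases "t \<in> {-d..d}")
        case True
        have "(\<integral>\<^sup>+s. ennreal (norm (I s t)) \<partial>lborel) = (\<integral>\<^sup>+s. ennreal (norm (g (t + s) - g s)) \<partial>lborel)"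
          using True by (simp add: I_def norm_minus_commute)
        also have "\<dots> = ennreal (\<integral>s. norm (g (t + s) - g s) \<partial>lborel)"
          using integrable_shift[OF g, of t] g by (intro nn_integral_eq_integral) auto
        also have "\<dots> \<le> ennreal (e / 2)" using d(2)[of t] True by (intro ennreal_leI) (auto simp: abs_le_iff)
        finally show ?thesis using True by simp
      qed (simp add: I_def)
    qed
    also have "\<dots> = ennreal (e / 2) * ennreal (2 * d)" using d(1) by (simp add: nn_integral_cmult_indicator)
    finally have "(\<integral>\<^sup>+s. ennreal (norm (g s - k s)) \<partial>lborel) \<le> ennreal (1 / (2 * d)) * (ennreal (e / 2) * ennreal (2 * d))"
      by (simp add: mult_left_mono)
    also have "\<dots> = ennreal (e / 2)" using d(1) e by (simp flip: ennreal_mult)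
    finally show ?thesis .
  qed
  have igk: "integrable lborel (\<lambda>s. g s - k s)"
    using nn by (intro integrableI_bounded) (auto simp: less_top[symmetric] top_unique intro: le_less_trans)
  have ik: "integrable lborel k" using Bochner_Integration.integrable_diff[OF g igk] by simp
  have "ennreal (\<integral>x. norm (g x - k x) \<partial>lborel) = (\<integral>\<^sup>+s. ennreal (norm (g s - k s)) \<partial>lborel)"
    using igk by (intro nn_integral_eq_integral[symmetric]) auto
  then have "ennreal (\<integral>x. norm (g x - k x) \<partial>lborel) \<le> ennreal (e / 2)" using nn by (simp only:)
  then have "(\<integral>x. norm (g x - k x) \<partial>lborel) \<le> e / 2" using e by (subst (asm) ennreal_le_iff) auto
  then show ?thesis using that[OF ik] \<open>continuous_on UNIV k\<close> e by simp
qed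

text \<open>Dyadic radii suffice for \<open>truncation_change\<close> and
  \<open>line_mean_tendsto\<close>, and make the limit one of a sequence.\<close>

theorem lebesgue_points:
  fixes g :: "real \<Rightarrow> complex"
  assumes g: "integrable lborel g"
  shows "AE s in lborel. (\<lambda>j. avg ((1/2)^j) (\<lambda>t. norm (g (s - t) - g s))) \<longlonglongrightarrow> 0"
proof -
  have [measurable]: "g \<in> borel_measurable borel" using g by auto
  define a where "a = (\<lambda>j s. avg ((1/2)^j) (\<lambda>t. norm (g (s - t) - g s)))"
  have pos: "(0::real) < (1/2)^j" "(1/2::real)^j \<le> 1" for j by (auto simp: power_le_one)
  have a0: "0 \<le> a j s" for j s unfolding a_def avg_def by (intro divide_nonneg_nonneg integral_nonneg) auto
  \<comment> \<open>With k continuous and u = |g - k|, the three l come from the maximal averages of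
    u, the oscillation of k, and u at s itself. The 6 is 5 from the weak type bound plus 1 from
    Markov's inequality.\<close>
  have key: "\<exists>N. N \<in> sets borel \<and> emeasure lborel N \<le> ennreal (6 / l * e) \<and> (\<forall>s. s \<notin> N \<longrightarrow> (\<forall>\<^sub>F j in sequentially. a j s \<le> 3 * l))"
    if l: "l > 0" and e: "e > 0" for l e
  proof -
    obtain k where k: "integrable lborel k" "continuous_on UNIV k" "(\<integral>x. norm (g x - k x) \<partial>lborel) < e"
      using continuous_L1_approx[OF g e] by blast
    have [measurable]: "k \<in> borel_measurable borel" using k by auto
    define u where "u = (\<lambda>x. norm (g x - k x))"
    have iu: "integrable lborel u" using g k unfolding u_def by simp
    have [measurable]: "u \<in> borel_measurable borel" unfolding u_def by measurable
    have iue: "(\<integral>x. u x \<partial>lborel) < e" "0 \<le> (\<integral>x. u x \<partial>lborel)" using k(3) by (auto simp: u_def)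
    obtain E where E: "E \<in> sets borel" "emeasure lborel E \<le> ennreal (5 / l * (\<integral>t. u t \<partial>lborel))"
      "\<And>s \<eta>. 0 < \<eta> \<Longrightarrow> \<eta> \<le> 1 \<Longrightarrow> s \<notin> E \<Longrightarrow> avg \<eta> (\<lambda>t. u (s - t)) \<le> l"
      using maximal_weak_type[OF iu _ l] unfolding u_def by auto
    define G where "G = {s. u s \<ge> l}"
    have G: "G \<in> sets borel" unfolding G_def by measurable
    have "emeasure lborel G \<le> ennreal (1 / l * (\<integral>t. u t \<partial>lborel))"
      using integral_Markov_inequality[OF iu _ l] by (simp add: G_def u_def)
    then have "emeasure lborel (E \<union> G) \<le> ennreal (5 / l * (\<integral>t. u t \<partial>lborel)) + ennreal (1 / l * (\<integral>t. u t \<partial>lborel))"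
      using E G by (intro order_trans[OF emeasure_subadditive] add_mono) auto
    also have "\<dots> = ennreal (6 / l * (\<integral>t. u t \<partial>lborel))" using l iue by (simp flip: ennreal_plus add: field_simps)
    also have "\<dots> \<le> ennreal (6 / l * e)" using l iue by (intro ennreal_leI mult_left_mono) auto
    finally have m: "emeasure lborel (E \<union> G) \<le> ennreal (6 / l * e)" .
    have "\<forall>\<^sub>F j in sequentially. a j s \<le> 3 * l" if s: "s \<notin> E \<union> G" for s
    proof -
      have us: "u s < l" using s by (auto simp: G_def)
      obtain d where d: "d > 0" "\<And>y. dist y s < d \<Longrightarrow> dist (k y) (k s) < l"
        using k(2) l unfolding continuous_on_iff by (metis UNIV_I)
      have "(\<lambda>j. (1/2::real)^j) \<longlonglongrightarrow> 0" by (intro LIMSEQ_power_zero) auto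
      then have "\<forall>\<^sub>F j in sequentially. (1/2::real)^j < d" using d(1) by (rule order_tendstoD)
      then show ?thesis
      proof eventually_elim
        case (elim j)
        let ?\<eta> = "(1/2::real)^j"
        have i1: "integrable lborel (\<lambda>t. indicator {-?\<eta>..?\<eta>} t * u (s - t))"
          by (intro integrable_indicator_mult integrable_reflect iu)
        have i2: "integrable lborel (\<lambda>t. indicator {-?\<eta>..?\<eta>} t * (l + l))" by simp
        have i3: "integrable lborel (\<lambda>t. indicator {-?\<eta>..?\<eta>} t * (u (s - t) + (l + l)))"
        proof -
          have "(\<lambda>t. indicator {-?\<eta>..?\<eta>} t * (u (s - t) + (l + l))) = (\<lambda>t. indicator {-?\<eta>..?\<eta>} t * u (s - t) + indicator {-?\<eta>..?\<eta>} t * (l + l))"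
            by (rule ext) (rule distrib_left)
          then show ?thesis using Bochner_Integration.integrable_add[OF i1 i2] by (simp only:)
        qed
        have "a j s \<le> avg ?\<eta> (\<lambda>t. u (s - t) + (l + l))"
          unfolding a_def
        proof (rule avg_mono[OF pos(1) _ i3])
          show "norm (g (s - t) - g s) \<le> u (s - t) + (l + l)" if "\<bar>t\<bar> \<le> ?\<eta>" for t
          proof -
            have "norm (g (s - t) - g s) \<le> norm (g (s - t) - k (s - t)) + norm (k (s - t) - k s) + norm (g s - k s)"
              by (smt (verit) norm_diff_triangle_le norm_minus_commute order_refl)
            moreover have "norm (k (s - t) - k s) < l" using d(2)[of "s - t"] that elim by (simp add: dist_norm)
            ultimately show ?thesis using us by (simp add: u_def)
          qed
          show "integrable lborel (\<lambda>t. indicator {-?\<eta>..?\<eta>} t * norm (g (s - t) - g s))"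
          proof -
            have "integrable lborel (\<lambda>t. indicator {-?\<eta>..?\<eta>} t * norm (g (s - t)) + indicator {-?\<eta>..?\<eta>} t * norm (g s))"
            proof (rule Bochner_Integration.integrable_add)
              show "integrable lborel (\<lambda>t. indicator {-?\<eta>..?\<eta>} t * norm (g (s - t)))"
                by (rule integrable_indicator_mult[OF integrable_norm[OF integrable_reflect[OF g]]])
            qed simp
            then show ?thesis
            proof (rule Bochner_Integration.integrable_bound)
              show "AE t in lborel. norm (indicator {-?\<eta>..?\<eta>} t * norm (g (s - t) - g s)) \<le>
                norm (indicator {-?\<eta>..?\<eta>} t * norm (g (s - t)) + indicator {-?\<eta>..?\<eta>} t * norm (g s))"
              proof (rule AE_I2)
                fix t
                show "norm (indicator {-?\<eta>..?\<eta>} t * norm (g (s - t) - g s)) \<le> norm (indicator {-?\<eta>..?\<eta>} t * norm (g (s - t)) + indicator {-?\<eta>..?\<eta>} t * norm (g s))"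
                  using norm_triangle_ineq4[of "g (s - t)" "g s"] by (cases "t \<in> {-?\<eta>..?\<eta>}") simp_all
              qed
            qed measurable
          qed
        qed
        also have "\<dots> = avg ?\<eta> (\<lambda>t. u (s - t)) + avg ?\<eta> (\<lambda>t. l + l)"
          unfolding avg_def distrib_left by (subst Bochner_Integration.integral_add[OF i1]) (use i2 in \<open>auto simp: distrib_left add_divide_distrib\<close>)
        also have "\<dots> \<le> l + (l + l)" using E(3)[OF pos, of s j] s by (simp add: avg_const[OF pos(1)])
        finally show ?case by simp
      qed
    qed
    then show ?thesis using E G m by (intro exI[of _ "E \<union> G"]) auto
  qed
  \<comment> \<open>The conclusion of \<open>key\<close> does not mention the approximation, so
    exceptional sets of arbitrarily small measure can be intersected to a null set.\<close>
  have nul: "\<exists>N. N \<in> null_sets lborel \<and> (\<forall>s. s \<notin> N \<longrightarrow> (\<forall>\<^sub>F j in sequentially. a j s \<le> 3 * l))" if l: "l > 0" for l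
  proof -
    have "\<forall>n. \<exists>N. N \<in> sets borel \<and> emeasure lborel N \<le> ennreal (6 / l * (1 / real (Suc n))) \<and> (\<forall>s. s \<notin> N \<longrightarrow> (\<forall>\<^sub>F j in sequentially. a j s \<le> 3 * l))"
      by (intro allI key l) simp
    then obtain N where N: "\<And>n. N n \<in> sets borel" "\<And>n. emeasure lborel (N n) \<le> ennreal (6 / l * (1 / real (Suc n)))"
      "\<And>n s. s \<notin> N n \<Longrightarrow> (\<forall>\<^sub>F j in sequentially. a j s \<le> 3 * l)" by metis
    have "emeasure lborel (\<Inter>n. N n) \<le> 0"
    proof (rule LIMSEQ_le_const)
      have "(\<lambda>n. 6 / l * inverse (real (Suc n))) \<longlonglongrightarrow> 6 / l * 0" by (intro tendsto_intros LIMSEQ_inverse_real_of_nat)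
      then show "(\<lambda>n. ennreal (6 / l * (1 / real (Suc n)))) \<longlonglongrightarrow> 0"
        using tendsto_ennrealI by (fastforce simp: inverse_eq_divide)
      have "emeasure lborel (\<Inter>n. N n) \<le> ennreal (6 / l * (1 / real (Suc n)))" for n
        by (rule order_trans[OF emeasure_mono N(2)]) (use N(1) in auto)
      then show "\<exists>M. \<forall>n\<ge>M. emeasure lborel (\<Inter>n. N n) \<le> ennreal (6 / l * (1 / real (Suc n)))" by blast
    qed
    then have "(\<Inter>n. N n) \<in> null_sets lborel" using N(1) by (auto intro!: null_setsI sets.countable_INT)
    then show ?thesis using N(3) by blast
  qed
  have "\<forall>n. \<exists>N. N \<in> null_sets lborel \<and> (\<forall>s. s \<notin> N \<longrightarrow> (\<forall>\<^sub>F j in sequentially. a j s \<le> 3 * (1 / real (Suc n))))"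
    by (intro allI nul) simp
  then obtain N where N: "\<And>n. N n \<in> null_sets lborel" "\<And>n s. s \<notin> N n \<Longrightarrow> (\<forall>\<^sub>F j in sequentially. a j s \<le> 3 * (1 / real (Suc n)))" by metis
  have "AE s in lborel. \<forall>n. s \<notin> N n" unfolding AE_all_countable using N(1) AE_not_in by blast
  then show ?thesis
  proof eventually_elim
    case (elim s)
    have "(\<lambda>j. a j s) \<longlonglongrightarrow> 0"
    proof (rule LIMSEQ_I)
      fix r :: real assume r: "r > 0"
      obtain n where n: "inverse (real (Suc n)) < r / 3" using reals_Archimedean[of "r / 3"] r by auto
      then have "3 * (1 / real (Suc n)) < r" by (simp add: inverse_eq_divide)
      moreover have "\<forall>\<^sub>F j in sequentially. a j s \<le> 3 * (1 / real (Suc n))" using N(2) elim by blast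
      ultimately show "\<exists>no. \<forall>j\<ge>no. norm (a j s - 0) < r"
        unfolding eventually_sequentially using a0 by (metis abs_of_nonneg diff_zero le_less_trans real_norm_def)
    qed
    then show ?case by (simp add: a_def)
  qed
qed

subsection \<open>Square integrable functions\<close>

text \<open>The square of the L2 norm, with values in \<open>ennreal\<close>. Avoiding roots, the
  triangle inequality appears with factors 2, as in \<open>sq_norm_diff\<close>.\<close>

definition sq_norm :: "('a::euclidean_space \<Rightarrow> complex) \<Rightarrow> ennreal" where
  "sq_norm f = (\<integral>\<^sup>+x. ennreal ((norm (f x))\<^sup>2) \<partial>lborel)"

definition sq_integrable :: "('a::euclidean_space \<Rightarrow> complex) \<Rightarrow> bool" where
  "sq_integrable f \<longleftrightarrow> f \<in> borel_measurable borel \<and> sq_norm f < \<infinity>"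

lemma sq_integrableD: "sq_integrable f \<Longrightarrow> f \<in> borel_measurable borel" "sq_integrable f \<Longrightarrow> sq_norm f < \<infinity>"
  by (auto simp: sq_integrable_def)

lemma sq_norm_cong_AE:
  assumes "f \<in> borel_measurable borel" "g \<in> borel_measurable borel" "AE x in lborel. f x = g x"
  shows "sq_norm f = sq_norm g"
  unfolding sq_norm_def using assms(3) by (intro nn_integral_cong_AE) auto

lemma sq_norm_mono_AE:
  assumes "AE x in lborel. norm (f x) \<le> norm (g x)"
  shows "sq_norm f \<le> sq_norm g"
  unfolding sq_norm_def using assms by (intro nn_integral_mono_AE) (auto intro!: ennreal_leI power_mono)

lemma sq_norm_diff:
  assumes [measurable]: "f \<in> borel_measurable borel" "g \<in> borel_measurable borel"
  shows "sq_norm (\<lambda>x. f x - g x) \<le> 2 * sq_norm f + 2 * sq_norm g"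
proof -
  have "sq_norm (\<lambda>x. f x - g x) \<le> (\<integral>\<^sup>+x. 2 * ennreal ((norm (f x))\<^sup>2) + 2 * ennreal ((norm (g x))\<^sup>2) \<partial>lborel)"
    unfolding sq_norm_def
  proof (rule nn_integral_mono)
    fix x
    have "(norm (f x - g x))\<^sup>2 \<le> (norm (f x) + norm (g x))\<^sup>2" by (intro power_mono norm_triangle_ineq4) simp
    also have "\<dots> \<le> 2 * (norm (f x))\<^sup>2 + 2 * (norm (g x))\<^sup>2"
      using sum_squares_bound[of "norm (f x)" "norm (g x)"] by (simp add: power2_sum)
    finally have "ennreal ((norm (f x - g x))\<^sup>2) \<le> ennreal (2 * (norm (f x))\<^sup>2 + 2 * (norm (g x))\<^sup>2)" by (rule ennreal_leI)
    also have "\<dots> = 2 * ennreal ((norm (f x))\<^sup>2) + 2 * ennreal ((norm (g x))\<^sup>2)" by (simp add: ennreal_mult)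
    finally show "ennreal ((norm (f x - g x))\<^sup>2) \<le> 2 * ennreal ((norm (f x))\<^sup>2) + 2 * ennreal ((norm (g x))\<^sup>2)" .
  qed
  also have "\<dots> = 2 * sq_norm f + 2 * sq_norm g" unfolding sq_norm_def by (simp add: nn_integral_add nn_integral_cmult)
  finally show ?thesis .
qed

lemma sq_norm_minus: "sq_norm (\<lambda>x. - f x) = sq_norm f" by (simp add: sq_norm_def)

lemma sq_norm_commute: "sq_norm (\<lambda>x. f x - g x) = sq_norm (\<lambda>x. g x - f x)"
  by (simp add: sq_norm_def norm_minus_commute)

lemma sq_norm_triangle:
  assumes [measurable]: "f \<in> borel_measurable borel" "g \<in> borel_measurable borel" "h \<in> borel_measurable borel"
  shows "sq_norm (\<lambda>x. f x - h x) \<le> 2 * sq_norm (\<lambda>x. f x - g x) + 2 * sq_norm (\<lambda>x. g x - h x)"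
  using sq_norm_diff[of "\<lambda>x. f x - g x" "\<lambda>x. h x - g x"] sq_norm_commute[of h g] by simp

lemma sq_norm_le:
  assumes [measurable]: "f \<in> borel_measurable borel" "g \<in> borel_measurable borel"
  shows "sq_norm f \<le> 2 * sq_norm g + 2 * sq_norm (\<lambda>x. f x - g x)"
  using sq_norm_diff[of "\<lambda>x. f x - g x" "\<lambda>x. - g x"] by (simp add: sq_norm_minus add.commute)

lemma sq_norm_0_AE:
  assumes [measurable]: "f \<in> borel_measurable borel" and "sq_norm f = 0"
  shows "AE x in lborel. f x = 0"
  using assms(2) unfolding sq_norm_def by (simp add: nn_integral_0_iff_AE)

lemma sq_integrable_diff: assumes "sq_integrable f" "sq_integrable g" shows "sq_integrable (\<lambda>x. f x - g x)"
proof -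
  have [measurable]: "f \<in> borel_measurable borel" "g \<in> borel_measurable borel" using assms by (auto simp: sq_integrable_def)
  have "2 * sq_norm f + 2 * sq_norm g < \<infinity>" using assms by (simp add: sq_integrable_def ennreal_mult_less_top)
  then show ?thesis using sq_norm_diff[of f g] unfolding sq_integrable_def by (auto intro: le_less_trans)
qed

lemma bdd_integrable_sq_integrable: assumes "bdd_integrable f" shows "sq_integrable f"
  using bdd_integrable_square_integrable[OF assms] bdd_integrableD[OF assms]
  by (auto simp: sq_integrable_def sq_norm_def nn_integral_eq_integral)

text \<open>Cutting both argument and value puts every measurable function into
  \<open>bdd_integrable\<close>.\<close>

definition trunc :: "nat \<Rightarrow> ('a::euclidean_space \<Rightarrow> complex) \<Rightarrow> 'a \<Rightarrow> complex" where
  "trunc m f x = (if norm x \<le> real m \<and> norm (f x) \<le> real m then f x else 0)"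

lemma measurable_trunc [measurable]:
  assumes [measurable]: "f \<in> borel_measurable borel" shows "trunc m f \<in> borel_measurable borel"
  unfolding trunc_def[abs_def] by measurable

lemma norm_trunc_le: "norm (trunc m f x) \<le> norm (f x)" by (simp add: trunc_def)

lemma bdd_integrable_trunc: assumes [measurable]: "f \<in> borel_measurable borel" shows "bdd_integrable (trunc m f)"
  unfolding bdd_integrable_def
proof
  show "\<exists>B. \<forall>x. norm (trunc m f x) \<le> B" by (intro exI[of _ "real m"]) (auto simp: trunc_def)
  show "integrable lborel (trunc m f)"
  proof (rule Bochner_Integration.integrable_bound)
    show "integrable lborel (\<lambda>x. indicator (cball 0 (real m)) x *\<^sub>R real m)"
      using emeasure_lborel_cball_finite[of 0 "real m"] by (intro integrable_scaleR_left integrable_real_indicator) simp_all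
    show "AE x in lborel. norm (trunc m f x) \<le> norm (indicator (cball 0 (real m)) x *\<^sub>R real m)"
      by (intro AE_I2) (simp add: trunc_def indicator_def)
  qed simp
qed

lemma sq_norm_trunc_le: "sq_norm (trunc m f) \<le> sq_norm f"
  by (intro sq_norm_mono_AE AE_I2 norm_trunc_le)

lemma sq_norm_trunc_lim:
  assumes "sq_integrable f" shows "(\<lambda>m. sq_norm (\<lambda>x. f x - trunc m f x)) \<longlonglongrightarrow> 0"
proof -
  have [measurable]: "f \<in> borel_measurable borel" and fin: "sq_norm f < \<infinity>" using assms by (auto simp: sq_integrable_def)
  have "(\<lambda>m. \<integral>\<^sup>+x. ennreal ((norm (f x - trunc m f x))\<^sup>2) \<partial>lborel) \<longlonglongrightarrow> (\<integral>\<^sup>+x. 0 \<partial>(lborel :: 'a measure))"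
  proof (rule nn_integral_dominated_convergence[where w = "\<lambda>x. ennreal ((norm (f x))\<^sup>2)"])
    show "AE x in lborel. ennreal ((norm (f x - trunc m f x))\<^sup>2) \<le> ennreal ((norm (f x))\<^sup>2)" for m
      by (intro AE_I2) (simp add: trunc_def)
    show "AE x in lborel. (\<lambda>m. ennreal ((norm (f x - trunc m f x))\<^sup>2)) \<longlonglongrightarrow> 0"
    proof (rule AE_I2, rule tendsto_eventually)
      fix x
      obtain m0 where m0: "norm x + norm (f x) \<le> real m0" using real_arch_simple by blast
      show "\<forall>\<^sub>F m in sequentially. ennreal ((norm (f x - trunc m f x))\<^sup>2) = 0"
        unfolding eventually_sequentially
      proof (intro exI[of _ m0] allI impI)
        fix m assume "m0 \<le> m"
        then have "real m0 \<le> real m" by simp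
        then have "norm x \<le> real m \<and> norm (f x) \<le> real m" using m0 norm_ge_zero[of x] norm_ge_zero[of "f x"] by linarith
        then show "ennreal ((norm (f x - trunc m f x))\<^sup>2) = 0" by (simp add: trunc_def)
      qed
    qed
  qed (use fin in \<open>simp_all add: sq_norm_def\<close>)
  then show ?thesis by (simp add: sq_norm_def)
qed

text \<open>Bounded operators on L2; c bounds the square of the operator norm. Additivity is asked
  only almost everywhere, because the convolution integrals may diverge on null sets that depend on
  the function.\<close>

definition lip :: "real \<Rightarrow> (('a::euclidean_space \<Rightarrow> complex) \<Rightarrow> 'a \<Rightarrow> complex) \<Rightarrow> bool" where
  "lip c L \<longleftrightarrow> 0 \<le> c \<and> (\<forall>f. f \<in> borel_measurable borel \<longrightarrow> L f \<in> borel_measurable borel) \<and> (\<forall>f. sq_integrable f \<longrightarrow> sq_norm (L f) \<le> ennreal c * sq_norm f) \<and>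
    (\<forall>f g. sq_integrable f \<longrightarrow> sq_integrable g \<longrightarrow> (AE x in lborel. L (\<lambda>x. f x - g x) x = L f x - L g x))"

lemma lip_measurable: "lip c L \<Longrightarrow> f \<in> borel_measurable borel \<Longrightarrow> L f \<in> borel_measurable borel"
  by (auto simp: lip_def)

lemma lip_bound: "lip c L \<Longrightarrow> sq_integrable f \<Longrightarrow> sq_norm (L f) \<le> ennreal c * sq_norm f"
  by (auto simp: lip_def)

lemma lip_sq_integrable: assumes "lip c L" "sq_integrable f" shows "sq_integrable (L f)"
  unfolding sq_integrable_def
proof
  show "L f \<in> borel_measurable borel" using assms by (auto simp: lip_def sq_integrable_def)
  have "ennreal c * sq_norm f < \<infinity>" using sq_integrableD(2)[OF assms(2)] by (simp add: ennreal_mult_less_top)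
  then show "sq_norm (L f) < \<infinity>" using lip_bound[OF assms] by (rule le_less_trans[rotated])
qed

lemma lip_linear: "lip c L \<Longrightarrow> sq_integrable f \<Longrightarrow> sq_integrable g \<Longrightarrow> AE x in lborel. L (\<lambda>x. f x - g x) x = L f x - L g x"
  unfolding lip_def by blast

lemma lip_dist:
  assumes L: "lip c L" and f: "sq_integrable f" and g: "sq_integrable g"
  shows "sq_norm (\<lambda>x. L f x - L g x) = sq_norm (L (\<lambda>x. f x - g x))"
proof (rule sq_norm_cong_AE)
  note [measurable] = sq_integrableD(1)[OF lip_sq_integrable[OF L f]] sq_integrableD(1)[OF lip_sq_integrable[OF L g]]
  show "(\<lambda>x. L f x - L g x) \<in> borel_measurable borel" by measurable
  show "L (\<lambda>x. f x - g x) \<in> borel_measurable borel" using sq_integrableD(1)[OF lip_sq_integrable[OF L sq_integrable_diff[OF f g]]] .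
  show "AE x in lborel. L f x - L g x = L (\<lambda>x. f x - g x) x"
    using lip_linear[OF L f g] by eventually_elim simp
qed

lemma lip_compose:
  fixes L :: "('a::euclidean_space \<Rightarrow> complex) \<Rightarrow> 'a \<Rightarrow> complex"
  assumes L: "lip c L" and K: "lip d K" shows "lip (c * d) (\<lambda>f. L (K f))"
  unfolding lip_def
proof (intro conjI allI impI)
  show "0 \<le> c * d" using L K by (simp add: lip_def)
  show "L (K f) \<in> borel_measurable borel" if "f \<in> borel_measurable borel" for f using that L K by (auto simp: lip_def)
  show "sq_norm (L (K f)) \<le> ennreal (c * d) * sq_norm f" if f: "sq_integrable f" for f
  proof -
    have "sq_norm (L (K f)) \<le> ennreal c * sq_norm (K f)" by (rule lip_bound[OF L lip_sq_integrable[OF K f]])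
    also have "\<dots> \<le> ennreal c * (ennreal d * sq_norm f)" by (intro mult_left_mono lip_bound[OF K f]) simp
    finally show ?thesis using L K by (simp add: ennreal_mult lip_def mult.assoc)
  qed
  show "AE x in lborel. L (K (\<lambda>x. f x - g x)) x = L (K f) x - L (K g) x" if f: "sq_integrable f" and g: "sq_integrable g" for f g
  proof -
    \<comment> \<open>K is additive only off a null set. Since L is bounded, it sends a function
      that vanishes almost everywhere to one that does so too, and the defect of K disappears under
      L.\<close>
    let ?u = "\<lambda>x. K (\<lambda>x. f x - g x) x - (K f x - K g x)"
    have l: "sq_integrable (K (\<lambda>x. f x - g x))" "sq_integrable (\<lambda>x. K f x - K g x)"
      using lip_sq_integrable[OF K] sq_integrable_diff f g by blast+
    have "AE x in lborel. ?u x = 0" using lip_linear[OF K f g] by eventually_elim simp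
    then have "sq_norm ?u = sq_norm (\<lambda>x::'a. 0)" using sq_integrableD(1)[OF sq_integrable_diff[OF l]] by (intro sq_norm_cong_AE) simp_all
    then have "sq_norm ?u = 0" by (simp add: sq_norm_def)
    then have "sq_norm (L ?u) = 0" using lip_bound[OF L sq_integrable_diff[OF l]] by simp
    then have "AE x in lborel. L ?u x = 0" by (intro sq_norm_0_AE sq_integrableD(1) lip_sq_integrable[OF L sq_integrable_diff[OF l]])
    moreover have "AE x in lborel. L ?u x = L (K (\<lambda>x. f x - g x)) x - L (\<lambda>x. K f x - K g x) x"
      by (rule lip_linear[OF L l])
    moreover have "AE x in lborel. L (\<lambda>x. K f x - K g x) x = L (K f) x - L (K g) x"
      by (rule lip_linear[OF L lip_sq_integrable[OF K f] lip_sq_integrable[OF K g]])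
    ultimately show ?thesis by eventually_elim simp
  qed
qed

lemma lip_minus:
  assumes L: "lip c L" and K: "lip d K" shows "lip (2 * c + 2 * d) (\<lambda>f x. L f x - K f x)"
  unfolding lip_def
proof (intro conjI allI impI)
  show "0 \<le> 2 * c + 2 * d" using L K by (simp add: lip_def)
  show "(\<lambda>x. L f x - K f x) \<in> borel_measurable borel" if "f \<in> borel_measurable borel" for f
    using lip_measurable[OF L that] lip_measurable[OF K that] by measurable
  show "sq_norm (\<lambda>x. L f x - K f x) \<le> ennreal (2 * c + 2 * d) * sq_norm f" if f: "sq_integrable f" for f
  proof -
    have "sq_norm (\<lambda>x. L f x - K f x) \<le> 2 * sq_norm (L f) + 2 * sq_norm (K f)"
      by (intro sq_norm_diff sq_integrableD(1)[OF lip_sq_integrable[OF L f]] sq_integrableD(1)[OF lip_sq_integrable[OF K f]])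
    also have "\<dots> \<le> 2 * (ennreal c * sq_norm f) + 2 * (ennreal d * sq_norm f)"
      by (intro add_mono mult_left_mono lip_bound[OF K f] lip_bound[OF L f]) simp_all
    also have "\<dots> = ennreal (2 * c + 2 * d) * sq_norm f"
      using L K by (simp add: lip_def ennreal_mult distrib_right mult.assoc)
    finally show ?thesis .
  qed
  show "AE x in lborel. L (\<lambda>x. f x - g x) x - K (\<lambda>x. f x - g x) x = L f x - K f x - (L g x - K g x)"
    if f: "sq_integrable f" and g: "sq_integrable g" for f g
    using lip_linear[OF K f g] lip_linear[OF L f g] by eventually_elim simp
qed

text \<open>The truncations of a square integrable function converge in the mean, so the individual
  Lipschitz constants do not enter the bound.\<close>

lemma sum_sq_norm_extend:
  assumes I: "finite I" and L: "\<And>i. i \<in> I \<Longrightarrow> lip (c i) (L i)"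
    and bdd_integrable: "\<And>g. bdd_integrable g \<Longrightarrow> (\<Sum>i\<in>I. sq_norm (L i g)) \<le> ennreal K * sq_norm g" and K: "0 \<le> K" and f: "sq_integrable f"
  shows "(\<Sum>i\<in>I. sq_norm (L i f)) \<le> ennreal (2 * K) * sq_norm f"
proof (rule LIMSEQ_le_const)
  let ?g = "\<lambda>m. trunc m f"
  have ng: "bdd_integrable (?g m)" and lg: "sq_integrable (?g m)" for m using bdd_integrable_trunc[OF sq_integrableD(1)[OF f]] bdd_integrable_sq_integrable by blast+
  have "(\<lambda>m. 2 * (ennreal K * sq_norm f) + (\<Sum>i\<in>I. 2 * (ennreal (c i) * sq_norm (\<lambda>x. f x - ?g m x)))) \<longlonglongrightarrow>
     2 * (ennreal K * sq_norm f) + (\<Sum>i\<in>I. 2 * (ennreal (c i) * 0))"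
    by (intro tendsto_add tendsto_const tendsto_sum ennreal_tendsto_cmult sq_norm_trunc_lim[OF f]) (simp_all add: ennreal_mult_less_top)
  then show "(\<lambda>m. 2 * (ennreal K * sq_norm f) + (\<Sum>i\<in>I. 2 * (ennreal (c i) * sq_norm (\<lambda>x. f x - ?g m x)))) \<longlonglongrightarrow> ennreal (2 * K) * sq_norm f"
    using K by (simp add: ennreal_mult mult.assoc)
  show "\<exists>N. \<forall>m\<ge>N. (\<Sum>i\<in>I. sq_norm (L i f)) \<le> 2 * (ennreal K * sq_norm f) + (\<Sum>i\<in>I. 2 * (ennreal (c i) * sq_norm (\<lambda>x. f x - ?g m x)))"
  proof (intro exI allI impI)
    fix m
    have "(\<Sum>i\<in>I. sq_norm (L i f)) \<le> (\<Sum>i\<in>I. 2 * sq_norm (L i (?g m)) + 2 * (ennreal (c i) * sq_norm (\<lambda>x. f x - ?g m x)))"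
    proof (rule sum_mono)
      fix i assume i: "i \<in> I"
      have "sq_norm (L i f) \<le> 2 * sq_norm (L i (?g m)) + 2 * sq_norm (\<lambda>x. L i f x - L i (?g m) x)"
        by (intro sq_norm_le sq_integrableD(1)[OF lip_sq_integrable[OF L[OF i]]] f lg)
      also have "sq_norm (\<lambda>x. L i f x - L i (?g m) x) = sq_norm (L i (\<lambda>x. f x - ?g m x))" by (rule lip_dist[OF L[OF i] f lg])
      also have "\<dots> \<le> ennreal (c i) * sq_norm (\<lambda>x. f x - ?g m x)" by (rule lip_bound[OF L[OF i] sq_integrable_diff[OF f lg]])
      finally show "sq_norm (L i f) \<le> 2 * sq_norm (L i (?g m)) + 2 * (ennreal (c i) * sq_norm (\<lambda>x. f x - ?g m x))" by (simp add: mult_left_mono)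
    qed
    also have "\<dots> = 2 * (\<Sum>i\<in>I. sq_norm (L i (?g m))) + (\<Sum>i\<in>I. 2 * (ennreal (c i) * sq_norm (\<lambda>x. f x - ?g m x)))"
      by (simp add: sum.distrib sum_distrib_left)
    also have "\<dots> \<le> 2 * (ennreal K * sq_norm f) + (\<Sum>i\<in>I. 2 * (ennreal (c i) * sq_norm (\<lambda>x. f x - ?g m x)))"
      by (intro add_mono mult_left_mono order_trans[OF bdd_integrable[OF ng]] sq_norm_trunc_le) simp_all
    finally show "(\<Sum>i\<in>I. sq_norm (L i f)) \<le> 2 * (ennreal K * sq_norm f) + (\<Sum>i\<in>I. 2 * (ennreal (c i) * sq_norm (\<lambda>x. f x - ?g m x)))" .
  qed
qed

subsection \<open>Convolution along a line\<close>

definition dconv :: "(real \<Rightarrow> real) \<Rightarrow> 'a::euclidean_space \<Rightarrow> ('a \<Rightarrow> complex) \<Rightarrow> 'a \<Rightarrow> complex" where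
  "dconv \<kappa> w f x = (\<integral>t. \<kappa> t *\<^sub>R f (x - t *\<^sub>R w) \<partial>lborel)"

lemma measurable_dconv [measurable]:
  assumes [measurable]: "\<kappa> \<in> borel_measurable borel" "f \<in> borel_measurable borel"
  shows "dconv \<kappa> w f \<in> borel_measurable borel"
  unfolding dconv_def[abs_def] by measurable

lemma nn_integral_shift_line:
  fixes w :: "'a::euclidean_space"
  assumes [measurable]: "u \<in> borel_measurable borel"
  shows "(\<integral>\<^sup>+x. u (x - t *\<^sub>R w) \<partial>lborel) = (\<integral>\<^sup>+x. u x \<partial>lborel)"
  using nn_integral_shift[of u "- t *\<^sub>R w"] by simp

text \<open>Cauchy-Schwarz with |\<kappa>| split into two square roots, then Tonelli and translation
  invariance. The form with nonnegative integrals also gives convergence of the convolution for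
  almost every x.\<close>

lemma young:
  fixes f :: "'a::euclidean_space \<Rightarrow> complex"
  assumes k: "integrable lborel \<kappa>" and [measurable]: "f \<in> borel_measurable borel"
  shows "(\<integral>\<^sup>+x. (\<integral>\<^sup>+t. ennreal (norm (\<kappa> t *\<^sub>R f (x - t *\<^sub>R w))) \<partial>lborel)\<^sup>2 \<partial>lborel) \<le> ennreal ((\<integral>t. \<bar>\<kappa> t\<bar> \<partial>lborel)\<^sup>2) * sq_norm f"
proof -
  have [measurable]: "\<kappa> \<in> borel_measurable borel" using k by auto
  define C where "C = (\<integral>t. \<bar>\<kappa> t\<bar> \<partial>lborel)"
  have C0: "0 \<le> C" unfolding C_def by simp
  have C: "(\<integral>\<^sup>+t. ennreal \<bar>\<kappa> t\<bar> \<partial>lborel) = ennreal C"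
    unfolding C_def using k by (intro nn_integral_eq_integral) auto
  have "(\<integral>\<^sup>+t. ennreal (norm (\<kappa> t *\<^sub>R f (x - t *\<^sub>R w))) \<partial>lborel)\<^sup>2 \<le> ennreal C * (\<integral>\<^sup>+t. ennreal \<bar>\<kappa> t\<bar> * ennreal ((norm (f (x - t *\<^sub>R w)))\<^sup>2) \<partial>lborel)" for x
  proof -
    let ?a = "\<lambda>t. ennreal (sqrt \<bar>\<kappa> t\<bar>)" and ?b = "\<lambda>t. ennreal (sqrt \<bar>\<kappa> t\<bar> * norm (f (x - t *\<^sub>R w)))"
    have 1: "ennreal (norm (\<kappa> t *\<^sub>R f (x - t *\<^sub>R w))) = ?a t * ?b t" for t
      by (simp add: mult.assoc[symmetric] flip: ennreal_mult)
    have 2: "(?a t)\<^sup>2 = ennreal \<bar>\<kappa> t\<bar>" for t by (simp add: ennreal_power)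
    have 3: "(?b t)\<^sup>2 = ennreal \<bar>\<kappa> t\<bar> * ennreal ((norm (f (x - t *\<^sub>R w)))\<^sup>2)" for t
      by (simp add: ennreal_power power_mult_distrib ennreal_mult)
    have "(\<integral>\<^sup>+t. ?a t * ?b t \<partial>lborel)\<^sup>2 \<le> (\<integral>\<^sup>+t. (?a t)\<^sup>2 \<partial>lborel) * (\<integral>\<^sup>+t. (?b t)\<^sup>2 \<partial>lborel)"
      by (rule Cauchy_Schwarz_nn_integral) measurable
    then show ?thesis by (simp only: 1 2 3 C)
  qed
  then have "(\<integral>\<^sup>+x. (\<integral>\<^sup>+t. ennreal (norm (\<kappa> t *\<^sub>R f (x - t *\<^sub>R w))) \<partial>lborel)\<^sup>2 \<partial>lborel) \<le>
      (\<integral>\<^sup>+x. ennreal C * (\<integral>\<^sup>+t. ennreal \<bar>\<kappa> t\<bar> * ennreal ((norm (f (x - t *\<^sub>R w)))\<^sup>2) \<partial>lborel) \<partial>lborel)"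
    by (rule nn_integral_mono)
  also have "\<dots> = ennreal C * (\<integral>\<^sup>+x. (\<integral>\<^sup>+t. ennreal \<bar>\<kappa> t\<bar> * ennreal ((norm (f (x - t *\<^sub>R w)))\<^sup>2) \<partial>lborel) \<partial>lborel)"
    by (rule nn_integral_cmult) measurable
  also have "(\<integral>\<^sup>+x. (\<integral>\<^sup>+t. ennreal \<bar>\<kappa> t\<bar> * ennreal ((norm (f (x - t *\<^sub>R w)))\<^sup>2) \<partial>lborel) \<partial>lborel) =
      (\<integral>\<^sup>+t. (\<integral>\<^sup>+x. ennreal \<bar>\<kappa> t\<bar> * ennreal ((norm (f (x - t *\<^sub>R w)))\<^sup>2) \<partial>lborel) \<partial>lborel)"
    by (rule lborel_pair.Fubini'[symmetric]) measurable
  also have "\<dots> = (\<integral>\<^sup>+t. ennreal \<bar>\<kappa> t\<bar> * sq_norm f \<partial>lborel)"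
  proof (rule nn_integral_cong)
    fix t
    have "(\<integral>\<^sup>+x. ennreal \<bar>\<kappa> t\<bar> * ennreal ((norm (f (x - t *\<^sub>R w)))\<^sup>2) \<partial>lborel) = ennreal \<bar>\<kappa> t\<bar> * (\<integral>\<^sup>+x. ennreal ((norm (f (x - t *\<^sub>R w)))\<^sup>2) \<partial>lborel)"
      by (rule nn_integral_cmult) measurable
    also have "(\<integral>\<^sup>+x. ennreal ((norm (f (x - t *\<^sub>R w)))\<^sup>2) \<partial>lborel) = sq_norm f"
      unfolding sq_norm_def by (rule nn_integral_shift_line[of "\<lambda>x. ennreal ((norm (f x))\<^sup>2)"]) measurable
    finally show "(\<integral>\<^sup>+x. ennreal \<bar>\<kappa> t\<bar> * ennreal ((norm (f (x - t *\<^sub>R w)))\<^sup>2) \<partial>lborel) = ennreal \<bar>\<kappa> t\<bar> * sq_norm f" .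
  qed
  also have "\<dots> = ennreal C * sq_norm f" by (subst nn_integral_multc) (simp_all add: C)
  also have "ennreal C * (ennreal C * sq_norm f) = ennreal (C\<^sup>2) * sq_norm f"
    using C0 by (simp add: power2_eq_square ennreal_mult mult.assoc)
  finally show ?thesis unfolding C_def .
qed

lemma dconv_integrable_AE:
  fixes f :: "'a::euclidean_space \<Rightarrow> complex"
  assumes k: "integrable lborel \<kappa>" and f: "sq_integrable f"
  shows "AE x in lborel. integrable lborel (\<lambda>t. \<kappa> t *\<^sub>R f (x - t *\<^sub>R w))"
proof -
  have [measurable]: "\<kappa> \<in> borel_measurable borel" "f \<in> borel_measurable borel" using k sq_integrableD[OF f] by auto
  have "ennreal ((\<integral>t. \<bar>\<kappa> t\<bar> \<partial>lborel)\<^sup>2) * sq_norm f < \<infinity>" using sq_integrableD(2)[OF f] by (simp add: ennreal_mult_less_top)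
  then have "(\<integral>\<^sup>+x. (\<integral>\<^sup>+t. ennreal (norm (\<kappa> t *\<^sub>R f (x - t *\<^sub>R w))) \<partial>lborel)\<^sup>2 \<partial>lborel) \<noteq> \<infinity>"
    using young[OF k, of f w] by (auto simp: top_unique)
  then have "AE x in lborel. (\<integral>\<^sup>+t. ennreal (norm (\<kappa> t *\<^sub>R f (x - t *\<^sub>R w))) \<partial>lborel)\<^sup>2 \<noteq> \<infinity>"
    by (intro nn_integral_noteq_infinite) measurable
  then show ?thesis
  proof eventually_elim
    case (elim x)
    then have "(\<integral>\<^sup>+t. ennreal (norm (\<kappa> t *\<^sub>R f (x - t *\<^sub>R w))) \<partial>lborel) < \<infinity>" by (auto simp: power2_eq_square ennreal_mult_eq_top_iff less_top)
    then show ?case by (intro integrableI_bounded) measurable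
  qed
qed

lemma lip_dconv:
  assumes k: "integrable lborel \<kappa>"
  shows "lip ((\<integral>t. \<bar>\<kappa> t\<bar> \<partial>lborel)\<^sup>2) (dconv \<kappa> (w :: 'a::euclidean_space))"
  unfolding lip_def
proof (intro conjI allI impI)
  have [measurable]: "\<kappa> \<in> borel_measurable borel" using k by auto
  show "dconv \<kappa> w f \<in> borel_measurable borel" if "f \<in> borel_measurable borel" for f using that by measurable
  show "sq_norm (dconv \<kappa> w f) \<le> ennreal ((\<integral>t. \<bar>\<kappa> t\<bar> \<partial>lborel)\<^sup>2) * sq_norm f" if f: "sq_integrable f" for f
  proof (rule order_trans[OF _ young[OF k sq_integrableD(1)[OF f]]])
    have [measurable]: "f \<in> borel_measurable borel" using sq_integrableD[OF f] by auto
    show "sq_norm (dconv \<kappa> w f) \<le> (\<integral>\<^sup>+x. (\<integral>\<^sup>+t. ennreal (norm (\<kappa> t *\<^sub>R f (x - t *\<^sub>R w))) \<partial>lborel)\<^sup>2 \<partial>lborel)"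
      unfolding sq_norm_def
    proof (rule nn_integral_mono_AE)
      show "AE x in lborel. ennreal ((norm (dconv \<kappa> w f x))\<^sup>2) \<le> (\<integral>\<^sup>+t. ennreal (norm (\<kappa> t *\<^sub>R f (x - t *\<^sub>R w))) \<partial>lborel)\<^sup>2"
        using dconv_integrable_AE[OF k f, of w]
      proof eventually_elim
        case (elim x)
        have "ennreal (norm (dconv \<kappa> w f x)) \<le> (\<integral>\<^sup>+t. ennreal (norm (\<kappa> t *\<^sub>R f (x - t *\<^sub>R w))) \<partial>lborel)"
          unfolding dconv_def by (rule integral_norm_bound_ennreal[OF elim])
        from power_mono[OF this, of 2] show ?case by (simp add: ennreal_power)
      qed
    qed
  qed
  show "AE x in lborel. dconv \<kappa> w (\<lambda>x. f x - g x) x = dconv \<kappa> w f x - dconv \<kappa> w g x" if f: "sq_integrable f" and g: "sq_integrable g" for f g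
    using dconv_integrable_AE[OF k f, of w] dconv_integrable_AE[OF k g, of w]
  proof eventually_elim
    case (elim x)
    show ?case unfolding dconv_def scaleR_diff_right by (rule Bochner_Integration.integral_diff[OF elim])
  qed
qed simp

definition khat :: "(real \<Rightarrow> real) \<Rightarrow> real \<Rightarrow> complex" where
  "khat \<kappa> s = (\<integral>t. \<kappa> t *\<^sub>R cis (- (t * s)) \<partial>lborel)"

lemma dconv_pair_integrable:
  fixes f :: "'a::euclidean_space \<Rightarrow> complex"
  assumes k: "integrable lborel \<kappa>" and f: "integrable lborel f"
  shows "integrable (lborel \<Otimes>\<^sub>M lborel) (\<lambda>(x, t). \<kappa> t *\<^sub>R f (x - t *\<^sub>R w))"
proof -
  have [measurable]: "\<kappa> \<in> borel_measurable borel" "f \<in> borel_measurable borel" using k f by auto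
  have "integrable (lborel \<Otimes>\<^sub>M lborel) (\<lambda>(t, x). \<kappa> t *\<^sub>R f (x - t *\<^sub>R w))"
  proof (rule lborel_pair.Fubini_integrable)
    have n: "(\<integral>x. norm (f (x - t *\<^sub>R w)) \<partial>lborel) = (\<integral>x. norm (f x) \<partial>lborel)" for t
      using integral_shift[of "\<lambda>x. norm (f x)" "- t *\<^sub>R w"] by simp
    have "(\<integral>x. norm (\<kappa> t *\<^sub>R f (x - t *\<^sub>R w)) \<partial>lborel) = \<bar>\<kappa> t\<bar> * (\<integral>x. norm (f x) \<partial>lborel)" for t
      by (simp only: norm_scaleR integral_mult_right_zero n)
    then show "integrable lborel (\<lambda>t. \<integral>x. norm (case (t, x) of (t, x) \<Rightarrow> \<kappa> t *\<^sub>R f (x - t *\<^sub>R w)) \<partial>lborel)"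
      using integrable_mult_left[OF integrable_abs[OF k], of "\<integral>x. norm (f x) \<partial>lborel"] by (simp only: prod.case)
    show "AE t in lborel. integrable lborel (\<lambda>x. case (t, x) of (t, x) \<Rightarrow> \<kappa> t *\<^sub>R f (x - t *\<^sub>R w))"
    proof (rule AE_I2)
      fix t :: real
      show "integrable lborel (\<lambda>x. case (t, x) of (t, x) \<Rightarrow> \<kappa> t *\<^sub>R f (x - t *\<^sub>R w))"
        using integrable_shift[OF f, of "- t *\<^sub>R w"] by (simp add: integrable_scaleR_right)
    qed
  qed measurable
  from lborel_pair.integrable_product_swap[OF this] show ?thesis by (simp add: case_prod_unfold)
qed

lemma bdd_integrable_dconv:
  assumes k: "integrable lborel \<kappa>" and f: "bdd_integrable f"
  shows "bdd_integrable (dconv \<kappa> w f)"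
  unfolding bdd_integrable_def
proof
  obtain B where B: "B \<ge> 0" "\<And>x. norm (f x) \<le> B" using f by (rule bdd_integrableE) blast
  have [measurable]: "\<kappa> \<in> borel_measurable borel" "f \<in> borel_measurable borel" using k bdd_integrableD[OF f] by auto
  show "integrable lborel (dconv \<kappa> w f)"
    using lborel_pair.integrable_fst'[OF dconv_pair_integrable[OF k bdd_integrableD(1)[OF f], of w]] by (simp add: dconv_def[abs_def])
  show "\<exists>B. \<forall>x. norm (dconv \<kappa> w f x) \<le> B"
  proof (intro exI allI)
    fix x
    have "norm (dconv \<kappa> w f x) \<le> (\<integral>t. norm (\<kappa> t *\<^sub>R f (x - t *\<^sub>R w)) \<partial>lborel)" unfolding dconv_def by (rule integral_norm_bound)
    also have "\<dots> \<le> (\<integral>t. \<bar>\<kappa> t\<bar> * B \<partial>lborel)"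
    proof (rule integral_mono')
      show "integrable lborel (\<lambda>t. \<bar>\<kappa> t\<bar> * B)" using k by simp
      show "norm (\<kappa> t *\<^sub>R f (x - t *\<^sub>R w)) \<le> \<bar>\<kappa> t\<bar> * B" for t using B by (simp add: mult_left_mono)
    qed (use B in simp)
    finally show "norm (dconv \<kappa> w f x) \<le> (\<integral>t. \<bar>\<kappa> t\<bar> * B \<partial>lborel)" .
  qed
qed

text \<open>Translation by t w multiplies the transform by exp (-i t (\<xi> \<bullet> w)), and
  Fubini integrates this against \<kappa>. So the multiplier depends on \<xi> through \<xi>
  \<bullet> w alone.\<close>

lemma FT_dconv:
  fixes f :: "'a::euclidean_space \<Rightarrow> complex"
  assumes k: "integrable lborel \<kappa>" and f: "bdd_integrable f"
  shows "FT (dconv \<kappa> w f) \<xi> = khat \<kappa> (\<xi> \<bullet> w) * FT f \<xi>"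
proof -
  have [measurable]: "\<kappa> \<in> borel_measurable borel" "f \<in> borel_measurable borel" using k bdd_integrableD[OF f] by auto
  let ?F = "\<lambda>x t. \<kappa> t *\<^sub>R f (x - t *\<^sub>R w) * cis (- (\<xi> \<bullet> x))"
  have "integrable (lborel \<Otimes>\<^sub>M lborel) (\<lambda>(x, t). ?F x t)"
    by (rule Bochner_Integration.integrable_bound[OF dconv_pair_integrable[OF k bdd_integrableD(1)[OF f], of w]])
      (auto simp: norm_mult case_prod_unfold)
  then have fub: "(\<integral>t. (\<integral>x. ?F x t \<partial>lborel) \<partial>lborel) = (\<integral>x. (\<integral>t. ?F x t \<partial>lborel) \<partial>lborel)"
    by (rule lborel_pair.Fubini_integral)
  have "FT (dconv \<kappa> w f) \<xi> = (\<integral>x. (\<integral>t. ?F x t \<partial>lborel) \<partial>lborel)"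
    unfolding FT_def dconv_def by (simp only: integral_mult_left_zero)
  also have "\<dots> = (\<integral>t. (\<integral>x. ?F x t \<partial>lborel) \<partial>lborel)" by (rule fub[symmetric])
  also have "(\<lambda>t. \<integral>x. ?F x t \<partial>lborel) = (\<lambda>t. (\<kappa> t *\<^sub>R cis (- (t * (\<xi> \<bullet> w)))) * FT f \<xi>)"
  proof (rule ext)
    fix t
    have "(\<integral>x. ?F x t \<partial>lborel) = (\<integral>x. ?F (t *\<^sub>R w + x) t \<partial>lborel)"
      by (rule integral_shift[symmetric]) measurable
    also have "(\<lambda>x. ?F (t *\<^sub>R w + x) t) = (\<lambda>x. (\<kappa> t *\<^sub>R cis (- (t * (\<xi> \<bullet> w)))) * (f x * cis (- (\<xi> \<bullet> x))))"
    proof (rule ext)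
      fix x
      have "cis (- (\<xi> \<bullet> (t *\<^sub>R w + x))) = cis (- (t * (\<xi> \<bullet> w))) * cis (- (\<xi> \<bullet> x))"
        by (simp add: inner_right_distrib cis_mult)
      then show "?F (t *\<^sub>R w + x) t = (\<kappa> t *\<^sub>R cis (- (t * (\<xi> \<bullet> w)))) * (f x * cis (- (\<xi> \<bullet> x)))" by simp
    qed
    finally show "(\<integral>x. ?F x t \<partial>lborel) = (\<kappa> t *\<^sub>R cis (- (t * (\<xi> \<bullet> w)))) * FT f \<xi>"
      unfolding FT_def by (simp only: integral_mult_right_zero)
  qed
  finally show ?thesis unfolding khat_def by (simp only: integral_mult_left_zero)
qed

lemma sq_norm_FT: "bdd_integrable g \<Longrightarrow> sq_norm g = ennreal (1 / (2 * pi) ^ DIM('a)) * (\<integral>\<^sup>+\<xi>. ennreal ((norm (FT g \<xi>))\<^sup>2) \<partial>lborel)" for g :: "'a::euclidean_space \<Rightarrow> complex"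
  unfolding plancherel sq_norm_def by (simp add: mult.assoc[symmetric] flip: ennreal_mult)

text \<open>The sum is taken under the frequency integral, so the constant is the pointwise square
  sum of the multipliers and is independent of their number.\<close>

lemma sum_sq_norm_multiplier:
  fixes g :: "'a::euclidean_space \<Rightarrow> complex"
  assumes g: "bdd_integrable g" and L: "\<And>i. i \<in> I \<Longrightarrow> bdd_integrable (L i)" "\<And>i \<xi>. i \<in> I \<Longrightarrow> FT (L i) \<xi> = m i \<xi> * FT g \<xi>"
    and m: "\<And>\<xi>. (\<Sum>i\<in>I. (norm (m i \<xi>))\<^sup>2) \<le> K" and I: "finite I"
  shows "(\<Sum>i\<in>I. sq_norm (L i)) \<le> ennreal K * sq_norm g"
proof -
  have [measurable]: "g \<in> borel_measurable borel" "\<And>i. i \<in> I \<Longrightarrow> L i \<in> borel_measurable borel" using g L(1) bdd_integrableD by auto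
  have K0: "0 \<le> K" using m[of 0] by (rule order_trans[rotated]) (simp add: sum_nonneg)
  let ?c = "ennreal (1 / (2 * pi) ^ DIM('a))"
  have "(\<Sum>i\<in>I. sq_norm (L i)) = ?c * (\<Sum>i\<in>I. \<integral>\<^sup>+\<xi>. ennreal ((norm (FT (L i) \<xi>))\<^sup>2) \<partial>lborel)"
    by (simp add: sq_norm_FT[OF L(1)] sum_distrib_left)
  also have "(\<Sum>i\<in>I. \<integral>\<^sup>+\<xi>. ennreal ((norm (FT (L i) \<xi>))\<^sup>2) \<partial>lborel) = (\<integral>\<^sup>+\<xi>. (\<Sum>i\<in>I. ennreal ((norm (FT (L i) \<xi>))\<^sup>2)) \<partial>lborel)"
    by (rule nn_integral_sum[symmetric]) measurable
  also have "\<dots> \<le> (\<integral>\<^sup>+\<xi>. ennreal K * ennreal ((norm (FT g \<xi>))\<^sup>2) \<partial>lborel)"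
  proof (rule nn_integral_mono)
    fix \<xi>
    have "(\<Sum>i\<in>I. ennreal ((norm (FT (L i) \<xi>))\<^sup>2)) = ennreal ((\<Sum>i\<in>I. (norm (m i \<xi>))\<^sup>2) * (norm (FT g \<xi>))\<^sup>2)"
      by (simp add: L(2) norm_mult power_mult_distrib sum_distrib_right)
    also have "\<dots> \<le> ennreal (K * (norm (FT g \<xi>))\<^sup>2)" by (intro ennreal_leI mult_right_mono m) simp
    finally show "(\<Sum>i\<in>I. ennreal ((norm (FT (L i) \<xi>))\<^sup>2)) \<le> ennreal K * ennreal ((norm (FT g \<xi>))\<^sup>2)"
      using K0 by (simp add: ennreal_mult)
  qed
  also have "\<dots> = ennreal K * (\<integral>\<^sup>+\<xi>. ennreal ((norm (FT g \<xi>))\<^sup>2) \<partial>lborel)" by (rule nn_integral_cmult) measurable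
  finally have "(\<Sum>i\<in>I. sq_norm (L i)) \<le> ?c * (ennreal K * (\<integral>\<^sup>+\<xi>. ennreal ((norm (FT g \<xi>))\<^sup>2) \<partial>lborel))" by (simp add: mult_left_mono)
  then show ?thesis by (simp add: sq_norm_FT[OF g] mult.left_commute)
qed

subsection \<open>Convergence in the mean\<close>

text \<open>Fatou's lemma for the whole finite sum at once, so that a bound of the sum survives the
  limit undivided.\<close>

lemma sum_sq_norm_fatou:
  assumes [measurable]: "\<And>k j. G k j \<in> borel_measurable borel" and lim: "AE x in lborel. \<forall>j\<in>I. (\<lambda>k. G k j x) \<longlonglongrightarrow> g j x"
    and I: "finite I" and le: "\<forall>\<^sub>F k in sequentially. (\<Sum>j\<in>I. sq_norm (G k j)) \<le> c"
  shows "(\<Sum>j\<in>I. sq_norm (g j)) \<le> c"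
proof -
  have sumN: "(\<Sum>j\<in>I. sq_norm (G k j)) = (\<integral>\<^sup>+x. (\<Sum>j\<in>I. ennreal ((norm (G k j x))\<^sup>2)) \<partial>lborel)" for k
    unfolding sq_norm_def by (rule nn_integral_sum[symmetric]) measurable
  \<comment> \<open>g is known only as an almost everywhere limit and may fail to be measurable; it
    is replaced by the measurable function given by \<open>lim\<close>.\<close>
  have N2lim: "sq_norm (g j) = sq_norm (\<lambda>x. lim (\<lambda>k. G k j x))" if "j \<in> I" for j
    unfolding sq_norm_def
  proof (rule nn_integral_cong_AE)
    show "AE x in lborel. ennreal ((norm (g j x))\<^sup>2) = ennreal ((norm (lim (\<lambda>k. G k j x)))\<^sup>2)"
      using lim by eventually_elim (use that limI in metis)
  qed
  have "(\<Sum>j\<in>I. sq_norm (g j)) = (\<Sum>j\<in>I. sq_norm (\<lambda>x. lim (\<lambda>k. G k j x)))" by (intro sum.cong N2lim refl)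
  also have "\<dots> = (\<integral>\<^sup>+x. (\<Sum>j\<in>I. ennreal ((norm (lim (\<lambda>k. G k j x)))\<^sup>2)) \<partial>lborel)"
    unfolding sq_norm_def by (rule nn_integral_sum[symmetric]) measurable
  also have "\<dots> \<le> (\<integral>\<^sup>+x. liminf (\<lambda>k. \<Sum>j\<in>I. ennreal ((norm (G k j x))\<^sup>2)) \<partial>lborel)"
  proof (rule nn_integral_mono_AE)
    show "AE x in lborel. (\<Sum>j\<in>I. ennreal ((norm (lim (\<lambda>k. G k j x)))\<^sup>2)) \<le> liminf (\<lambda>k. \<Sum>j\<in>I. ennreal ((norm (G k j x))\<^sup>2))"
      using lim
    proof eventually_elim
      case (elim x)
      have "(\<lambda>k. \<Sum>j\<in>I. ennreal ((norm (G k j x))\<^sup>2)) \<longlonglongrightarrow> (\<Sum>j\<in>I. ennreal ((norm (lim (\<lambda>k. G k j x)))\<^sup>2))"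
      proof (rule tendsto_sum)
        fix j assume "j \<in> I"
        then have t: "(\<lambda>k. G k j x) \<longlonglongrightarrow> lim (\<lambda>k. G k j x)" using elim limI by metis
        show "(\<lambda>k. ennreal ((norm (G k j x))\<^sup>2)) \<longlonglongrightarrow> ennreal ((norm (lim (\<lambda>k. G k j x)))\<^sup>2)"
          by (intro tendsto_ennrealI tendsto_power tendsto_norm t)
      qed
      then show ?case using lim_imp_Liminf[OF sequentially_bot] by (metis order_refl)
    qed
  qed
  also have "\<dots> \<le> liminf (\<lambda>k. \<integral>\<^sup>+x. (\<Sum>j\<in>I. ennreal ((norm (G k j x))\<^sup>2)) \<partial>lborel)"
    by (rule nn_integral_liminf) measurable
  also have "\<dots> = liminf (\<lambda>k. \<Sum>j\<in>I. sq_norm (G k j))" by (simp only: sumN)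
  also have "\<dots> \<le> limsup (\<lambda>k. \<Sum>j\<in>I. sq_norm (G k j))" by (rule Liminf_le_Limsup) simp
  also have "\<dots> \<le> c" using le by (rule Limsup_bounded)
  finally show ?thesis .
qed

lemma sq_norm_fatou:
  assumes [measurable]: "\<And>k. G k \<in> borel_measurable borel" and lim: "AE x in lborel. (\<lambda>k. G k x) \<longlonglongrightarrow> g x"
    and le: "\<forall>\<^sub>F k in sequentially. sq_norm (G k) \<le> c"
  shows "sq_norm g \<le> c"
  using sum_sq_norm_fatou[of "\<lambda>k _. G k" "{()}" "\<lambda>_. g" c] assms by simp

lemma AE_suminf_finite:
  assumes [measurable]: "\<And>j. u j \<in> borel_measurable lborel" and "\<And>j x. 0 \<le> u j x"
    and fin: "(\<Sum>j. \<integral>\<^sup>+x. ennreal (u j x) \<partial>lborel) < \<infinity>"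
  shows "AE x in (lborel :: 'a::euclidean_space measure). summable (\<lambda>j. u j x :: real)"
proof -
  have "(\<integral>\<^sup>+x. (\<Sum>j. ennreal (u j x)) \<partial>lborel) \<noteq> \<infinity>"
    using fin by (subst nn_integral_suminf) auto
  then have "AE x in lborel. (\<Sum>j. ennreal (u j x)) \<noteq> \<infinity>" by (intro nn_integral_noteq_infinite) measurable
  then show ?thesis by eventually_elim (use assms(2) in \<open>auto intro: summable_suminf_not_top\<close>)
qed

text \<open>A finite sum of squared norms makes the squares summable at almost every point, hence
  null sequences there. This turns the square function into pointwise convergence.\<close>

lemma sum_sq_norm_finite_imp_tendsto_0:
  assumes [measurable]: "\<And>j. g j \<in> borel_measurable borel" and le: "\<And>J. (\<Sum>j<J. sq_norm (g j)) \<le> c" and c: "c < \<infinity>"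
  shows "AE x in lborel. (\<lambda>j. g j x) \<longlonglongrightarrow> 0"
proof -
  have "(\<Sum>j. sq_norm (g j)) \<le> c" by (rule suminf_le_const) (auto simp: le)
  then have "(\<Sum>j. \<integral>\<^sup>+x. ennreal ((norm (g j x))\<^sup>2) \<partial>lborel) < \<infinity>" using c by (simp add: sq_norm_def)
  from AE_suminf_finite[OF _ _ this] have "AE x in lborel. summable (\<lambda>j. (norm (g j x))\<^sup>2)" by simp
  then show ?thesis
  proof eventually_elim
    case (elim x)
    have "(\<lambda>j. (norm (g j x))\<^sup>2) \<longlonglongrightarrow> 0" by (rule summable_LIMSEQ_zero[OF elim])
    from tendsto_real_sqrt[OF this] have "(\<lambda>j. norm (g j x)) \<longlonglongrightarrow> 0" by simp
    then show ?case by (simp add: tendsto_norm_zero_iff)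
  qed
qed

text \<open>Riesz-Fischer: a fast subsequence converges almost everywhere, and Fatou's lemma carries
  the Cauchy bound over to its limit.\<close>

lemma sq_norm_complete:
  fixes F :: "nat \<Rightarrow> 'a::euclidean_space \<Rightarrow> complex"
  assumes [measurable]: "\<And>n. F n \<in> borel_measurable borel"
    and cauchy: "\<And>e. e > 0 \<Longrightarrow> \<exists>M. \<forall>m\<ge>M. \<forall>n\<ge>M. sq_norm (\<lambda>x. F m x - F n x) \<le> ennreal e"
  obtains h where "h \<in> borel_measurable borel" "(\<lambda>n. sq_norm (\<lambda>x. F n x - h x)) \<longlonglongrightarrow> 0"
proof -
  have "\<forall>k. \<exists>M. \<forall>m\<ge>M. \<forall>n\<ge>M. sq_norm (\<lambda>x. F m x - F n x) \<le> ennreal ((1/4)^k)" using cauchy by simp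
  then obtain M where M: "\<And>k m n. M k \<le> m \<Longrightarrow> M k \<le> n \<Longrightarrow> sq_norm (\<lambda>x. F m x - F n x) \<le> ennreal ((1/4)^k)" by metis
  \<comment> \<open>Increasing, at least \<open>M k\<close>, and at least k, so that it also tends
    to infinity.\<close>
  define r where "r k = (\<Sum>i\<le>k. M i) + k" for k
  have rM: "M k \<le> r k" for k unfolding r_def by (simp add: member_le_sum trans_le_add1)
  have rS: "r k \<le> r (Suc k)" for k by (simp add: r_def)
  have rk: "k \<le> r k" for k by (simp add: r_def)
  define d where "d k x = F (r (Suc k)) x - F (r k) x" for k x
  have [measurable]: "d k \<in> borel_measurable borel" for k unfolding d_def[abs_def] by measurable
  have dk: "sq_norm (d k) \<le> ennreal ((1/4)^k)" for k unfolding d_def[abs_def] by (intro M order_trans[OF rM rS] rM)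
  \<comment> \<open>The weight 2^k leaves the series summable, and |d| <= 2^(-k) + 2^k |d|^2 then
    compares the increments with two convergent series.\<close>
  have "(\<Sum>k. \<integral>\<^sup>+x. ennreal (2^k * (norm (d k x))\<^sup>2) \<partial>lborel) \<le> (\<Sum>k. ennreal ((1/2)^k))"
  proof (rule suminf_le)
    fix k
    have "(\<integral>\<^sup>+x. ennreal (2^k * (norm (d k x))\<^sup>2) \<partial>lborel) = ennreal (2^k) * sq_norm (d k)"
      unfolding sq_norm_def ennreal_mult[OF zero_le_power[OF zero_le_numeral] zero_le_power2] by (rule nn_integral_cmult) measurable
    also have "\<dots> \<le> ennreal (2^k) * ennreal ((1/4)^k)" by (intro mult_left_mono dk) simp
    also have "\<dots> = ennreal ((1/2)^k)" by (simp flip: ennreal_mult power_mult_distrib)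
    finally show "(\<integral>\<^sup>+x. ennreal (2^k * (norm (d k x))\<^sup>2) \<partial>lborel) \<le> ennreal ((1/2)^k)" .
  qed simp_all
  also have "\<dots> < \<infinity>"
  proof -
    have "(\<Sum>k. ennreal ((1/2)^k)) = ennreal (\<Sum>k. (1/2)^k)" by (rule suminf_ennreal2) (auto intro: summable_geometric)
    then show ?thesis by simp
  qed
  finally have "AE x in lborel. summable (\<lambda>k. 2^k * (norm (d k x))\<^sup>2)" by (intro AE_suminf_finite) auto
  then have conv: "AE x in lborel. convergent (\<lambda>k. F (r k) x)"
  proof eventually_elim
    case (elim x)
    have le: "norm (d k x) \<le> (1/2)^k + 2^k * (norm (d k x))\<^sup>2" for k
    proof (cases "norm (d k x) \<le> (1/2)^k")
      case True then show ?thesis by (simp add: add_increasing2)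
    next
      case False
      then have "1 \<le> 2^k * norm (d k x)" by (simp add: power_divide field_simps)
      then have "norm (d k x) * 1 \<le> norm (d k x) * (2^k * norm (d k x))" by (intro mult_left_mono) auto
      then show ?thesis by (simp add: power2_eq_square mult_ac add_increasing)
    qed
    have "summable (\<lambda>k. d k x)"
    proof (rule summable_comparison_test[OF exI[of _ 0]])
      show "summable (\<lambda>k. (1/2)^k + 2^k * (norm (d k x))\<^sup>2)" by (intro summable_add elim summable_geometric) simp
    qed (use le in auto)
    then have "convergent (\<lambda>n. \<Sum>k<n. d k x)" by (simp add: summable_iff_convergent)
    moreover have "(\<Sum>k<n. d k x) = F (r n) x - F (r 0) x" for n unfolding d_def by (rule sum_lessThan_telescope)
    ultimately show ?case using convergent_diff_const_right_iff[of "\<lambda>n. F (r n) x" "F (r 0) x"] by simp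
  qed
  define h where "h x = lim (\<lambda>k. F (r k) x)" for x
  have hm: "h \<in> borel_measurable borel" unfolding h_def[abs_def] by measurable
  have lim: "AE x in lborel. (\<lambda>k. F (r k) x) \<longlonglongrightarrow> h x"
    using conv by eventually_elim (simp add: h_def convergent_LIMSEQ_iff)
  have "(\<lambda>n. sq_norm (\<lambda>x. F n x - h x)) \<longlonglongrightarrow> 0"
  proof (rule order_tendstoI)
    fix a :: ennreal assume "0 < a"
    then obtain e :: real where e: "0 < e" "ennreal e < a"
      by (metis dense ennreal_cases ennreal_less_zero_iff ennreal_neq_top infinity_ennreal_def not_less_iff_gr_or_eq order_less_imp_not_eq2 top.not_eq_extremum)
    obtain N where N: "\<And>m n. N \<le> m \<Longrightarrow> N \<le> n \<Longrightarrow> sq_norm (\<lambda>x. F m x - F n x) \<le> ennreal e" using cauchy[OF e(1)] by blast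
    show "\<forall>\<^sub>F n in sequentially. sq_norm (\<lambda>x. F n x - h x) < a"
      unfolding eventually_sequentially
    proof (intro exI[of _ N] allI impI)
      fix n assume n: "N \<le> n"
      have "sq_norm (\<lambda>x. F n x - h x) \<le> ennreal e"
      proof (rule sq_norm_fatou[of "\<lambda>k x. F n x - F (r k) x"])
        show "AE x in lborel. (\<lambda>k. F n x - F (r k) x) \<longlonglongrightarrow> F n x - h x"
          using lim by eventually_elim (intro tendsto_diff tendsto_const)
        show "\<forall>\<^sub>F k in sequentially. sq_norm (\<lambda>x. F n x - F (r k) x) \<le> ennreal e"
          unfolding eventually_sequentially using N n rk order_trans by blast
      qed measurable
      then show "sq_norm (\<lambda>x. F n x - h x) < a" using e(2) by (rule le_less_trans)
    qed
  qed simp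
  then show ?thesis using hm that by blast
qed

subsection \<open>The sine integral\<close>

lemma Si_odd: "Si (- x) = - Si x"
  using Si_neg[of x] Si_neg[of "- x"] by (cases "0 \<le> x") auto

lemma Si_0: "Si 0 = 0" using Si_odd[of 0] by simp

lemma abs_sinc_le_1: "\<bar>sinc x\<bar> \<le> 1"
  using abs_sin_x_le_abs_x[of x] by (auto simp: divide_le_eq)

lemma abs_Si_le: "\<bar>Si x\<bar> \<le> \<bar>x\<bar>"
proof -
  have *: "\<bar>Si y\<bar> \<le> y" if y: "0 \<le> y" for y
  proof -
    have "norm (Si y - Si 0) \<le> 1 * norm (y - 0)"
    proof (rule field_differentiable_bound[of UNIV Si sinc])
      show "(Si has_field_derivative sinc z) (at z within UNIV)" for z by (rule DERIV_Si)
      show "norm (sinc z) \<le> 1" for z using abs_sinc_le_1[of z] by simp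
    qed auto
    then show ?thesis using y by (simp add: Si_0)
  qed
  show ?thesis using *[of x] *[of "- x"] by (cases "0 \<le> x") (auto simp: Si_odd)
qed

text \<open>Integration by parts in disguise: Si t + (cos t - 1)/t increases and Si t + (cos t +
  1)/t decreases, their derivatives being -(cos t - 1)/t^2 and -(cos t + 1)/t^2.\<close>

lemma Si_diff_le:
  assumes x: "0 < x" "x \<le> y" shows "\<bar>Si y - Si x\<bar> \<le> 2 / x"
proof -
  have der: "((\<lambda>t. Si t + (cos t + c) / t) has_real_derivative - (cos t + c) / t\<^sup>2) (at t)" if "t > 0" for t c :: real
  proof -
    have "((\<lambda>t. Si t + (cos t + c) / t) has_real_derivative sinc t + ((- sin t) * t - (cos t + c) * 1) / (t * t)) (at t)"
      using that by (auto intro!: derivative_eq_intros DERIV_Si)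
    moreover have "sinc t + ((- sin t) * t - (cos t + c) * 1) / (t * t) = - (cos t + c) / t\<^sup>2"
      using that by (simp add: field_simps power2_eq_square)
    ultimately show ?thesis by simp
  qed
  have 1: "Si x + (cos x + (-1)) / x \<le> Si y + (cos y + (-1)) / y"
  proof (rule DERIV_nonneg_imp_nondecreasing[OF x(2)])
    fix t assume "x \<le> t"
    then have "t > 0" using x by simp
    show "\<exists>D. ((\<lambda>t. Si t + (cos t + (-1)) / t) has_real_derivative D) (at t) \<and> 0 \<le> D"
      by (rule exI, rule conjI, rule der[OF \<open>t > 0\<close>]) simp
  qed
  have 2: "Si y + (cos y + 1) / y \<le> Si x + (cos x + 1) / x"
  proof (rule DERIV_nonpos_imp_nonincreasing[OF x(2)])
    fix t assume "x \<le> t"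
    then have "t > 0" using x by simp
    have "0 \<le> cos t + 1" using cos_ge_minus_one[of t] by linarith
    then show "\<exists>D. ((\<lambda>t. Si t + (cos t + 1) / t) has_real_derivative D) (at t) \<and> D \<le> 0"
      by (intro exI conjI, rule_tac der[OF \<open>t > 0\<close>]) (simp add: divide_nonpos_nonneg)
  qed
  have "y > 0" using x by simp
  have "(cos y + (-1)) / y \<le> 0" using \<open>y > 0\<close> by (simp add: divide_nonpos_pos)
  moreover have "0 \<le> (cos y + 1) / y" using \<open>y > 0\<close> cos_ge_minus_one[of y] by (intro divide_nonneg_pos) linarith+
  moreover have "- (2 / x) \<le> (cos x + (-1)) / x"
  proof -
    have "(-2) / x \<le> (cos x + (-1)) / x" using x(1) cos_ge_minus_one[of x] by (intro divide_right_mono) linarith+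
    then show ?thesis by simp
  qed
  moreover have "(cos x + 1) / x \<le> 2 / x" using x(1) cos_le_one[of x] by (intro divide_right_mono) linarith+
  ultimately show ?thesis using 1 2 by (simp add: abs_le_iff)
qed

definition Si_bound :: real where "Si_bound = (SOME B. \<forall>T. \<bar>Si T\<bar> \<le> B)"

lemma Si_bound: "\<bar>Si T\<bar> \<le> Si_bound"
  using someI_ex[OF bounded_Si] unfolding Si_bound_def by blast

lemma Si_bound_nonneg: "0 \<le> Si_bound" using Si_bound[of 0] by simp

text \<open>The outer cut makes the kernel integrable; it is removed in
  \<open>trunc_hilbert_tendsto\<close>.\<close>

definition cut_kernel :: "real \<Rightarrow> real \<Rightarrow> real \<Rightarrow> real" where
  "cut_kernel a b t = (if a \<le> \<bar>t\<bar> \<and> \<bar>t\<bar> \<le> b then 1 / (pi * t) else 0)"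

definition box_kernel :: "real \<Rightarrow> real \<Rightarrow> real" where
  "box_kernel \<eta> t = indicator {-\<eta>..\<eta>} t / (2 * \<eta>)"

lemma measurable_cut_kernel [measurable]: "cut_kernel a b \<in> borel_measurable borel" unfolding cut_kernel_def[abs_def] by measurable

lemma measurable_box_kernel [measurable]: "box_kernel \<eta> \<in> borel_measurable borel" unfolding box_kernel_def[abs_def] by measurable

lemma integrable_Icc: "integrable lborel (\<lambda>t::real. indicator {a..b} t * (c::real))"
  by (cases "a \<le> b") auto

lemma integrable_cut_kernel: assumes "a > 0" shows "integrable lborel (cut_kernel a b)"
proof (rule Bochner_Integration.integrable_bound[OF integrable_Icc])
  show "AE t in lborel. norm (cut_kernel a b t) \<le> norm (indicator {-b..b} t * (1 / (pi * a)))"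
  proof (rule AE_I2)
    fix t
    have "1 / (pi * \<bar>t\<bar>) \<le> 1 / (pi * a)" if "a \<le> \<bar>t\<bar>" using assms that by (intro divide_left_mono mult_pos_pos mult_left_mono) auto
    then show "norm (cut_kernel a b t) \<le> norm (indicator {-b..b} t * (1 / (pi * a)))"
    proof (cases "a \<le> \<bar>t\<bar> \<and> \<bar>t\<bar> \<le> b")
      case True
      then have "t \<in> {-b..b}" by auto
      moreover have "norm (cut_kernel a b t) = 1 / (pi * \<bar>t\<bar>)" using True by (simp add: cut_kernel_def abs_mult)
      ultimately show ?thesis using True assms \<open>a \<le> \<bar>t\<bar> \<Longrightarrow> 1 / (pi * \<bar>t\<bar>) \<le> 1 / (pi * a)\<close> by simp
    next
      case False
      then have "cut_kernel a b t = 0" unfolding cut_kernel_def by (rule if_not_P)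
      then show ?thesis by simp
    qed
  qed
qed measurable

lemma integrable_box_kernel: "integrable lborel (box_kernel \<eta>)"
  unfolding box_kernel_def[abs_def] using integrable_Icc[of "-\<eta>" \<eta> "1 / (2 * \<eta>)"] by simp

lemma khat_cut_kernel:
  assumes a: "0 < a" "a \<le> b"
  shows "khat (cut_kernel a b) s = - (\<i> * complex_of_real (2 / pi * (Si (b * s) - Si (a * s))))"
proof -
  \<comment> \<open>The positive half of the kernel against an exponential; reflecting the negative
    half onto it leaves only the sine.\<close>
  define p where "p \<sigma> t = (indicator {a..b} t / (pi * t)) *\<^sub>R cis (- (t * \<sigma>))" for \<sigma> t :: real
  have ip: "integrable lborel (p \<sigma>)" for \<sigma>
  proof (rule Bochner_Integration.integrable_bound[OF integrable_norm[OF integrable_cut_kernel[OF a(1), of b]]])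
    show "p \<sigma> \<in> borel_measurable lborel" unfolding p_def[abs_def] by measurable
    show "AE t in lborel. norm (p \<sigma> t) \<le> norm (norm (cut_kernel a b t))"
      using a by (auto intro!: AE_I2 simp: p_def cut_kernel_def indicator_def)
  qed
  have ip': "integrable lborel (\<lambda>t. p \<sigma> (- t))" "(\<integral>t. p \<sigma> (- t) \<partial>lborel) = (\<integral>t. p \<sigma> t \<partial>lborel)" for \<sigma>
    using lborel_integrable_real_affine[OF ip[of \<sigma>], of "-1" 0] lborel_integral_real_affine[of "-1" "p \<sigma>" 0] by simp_all
  have hkp: "cut_kernel a b t *\<^sub>R cis (- (t * s)) = p s t - p (- s) (- t)" for t
    using a by (auto simp: cut_kernel_def p_def indicator_def)
  have "khat (cut_kernel a b) s = (\<integral>t. p s t \<partial>lborel) - (\<integral>t. p (- s) (- t) \<partial>lborel)"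
    unfolding khat_def hkp by (rule Bochner_Integration.integral_diff[OF ip ip'(1)])
  also have "\<dots> = (\<integral>t. p s t - p (- s) t \<partial>lborel)"
    unfolding ip'(2) by (rule Bochner_Integration.integral_diff[OF ip ip, symmetric])
  also have "(\<lambda>t. p s t - p (- s) t) = (\<lambda>t. (- (2 * \<i> / complex_of_real pi)) * complex_of_real (sin (t * s) / t * indicator {a..b} t))"
    by (rule ext) (use a in \<open>auto simp: p_def indicator_def complex_eq_iff\<close>)
  also have "(\<integral>t. (- (2 * \<i> / complex_of_real pi)) * complex_of_real (sin (t * s) / t * indicator {a..b} t) \<partial>lborel) =
      (- (2 * \<i> / complex_of_real pi)) * complex_of_real (\<integral>t. sin (t * s) / t * indicator {a..b} t \<partial>lborel)"
    by (simp only: integral_mult_right_zero integral_complex_of_real)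
  also have "(\<integral>t. sin (t * s) / t * indicator {a..b} t \<partial>lborel) = Si (b * s) - Si (a * s)"
  proof (rule integral_FTC_Icc_real[OF a(2)])
    fix t assume "a \<le> t" "t \<le> b"
    then have t: "t \<noteq> 0" using a by simp
    have "((\<lambda>t. Si (t * s)) has_real_derivative sinc (t * s) * s) (at t)"
      by (rule DERIV_chain2[OF DERIV_Si]) (auto intro!: derivative_eq_intros)
    moreover have "sinc (t * s) * s = sin (t * s) / t" using t by simp
    ultimately show "((\<lambda>t. Si (t * s)) has_real_derivative sin (t * s) / t) (at t)" by simp
    show "isCont (\<lambda>t. sin (t * s) / t) t" using t by (intro continuous_intros) auto
  qed
  finally show ?thesis by (simp add: field_simps)
qed

lemma khat_box_kernel:
  assumes e: "0 < \<eta>" shows "khat (box_kernel \<eta>) s = complex_of_real (sinc (\<eta> * s))"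
proof -
  have c: "has_bochner_integral lborel (\<lambda>t. cos (t * s) * indicator {-\<eta>..\<eta>} t) (2 * \<eta> * sinc (\<eta> * s))"
  proof (cases "s = 0")
    case True
    have "has_bochner_integral lborel (\<lambda>t. 1 * indicator {-\<eta>..\<eta>} t) (\<eta> - (-\<eta>))"
      by (rule has_bochner_integral_FTC_Icc_real) (use e in \<open>auto intro!: derivative_eq_intros\<close>)
    then show ?thesis using True by simp
  next
    case False
    have "has_bochner_integral lborel (\<lambda>t. cos (t * s) * indicator {-\<eta>..\<eta>} t) (sin (\<eta> * s) / s - sin (- \<eta> * s) / s)"
      by (rule has_bochner_integral_FTC_Icc_real) (use e False in \<open>auto intro!: derivative_eq_intros continuous_intros\<close>)
    moreover have "sin (\<eta> * s) / s - sin (- \<eta> * s) / s = 2 * \<eta> * sinc (\<eta> * s)" using False e by simp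
    ultimately show ?thesis by simp
  qed
  have s: "has_bochner_integral lborel (\<lambda>t. sin (t * s) * indicator {-\<eta>..\<eta>} t) 0"
  proof (cases "s = 0")
    case False
    have "has_bochner_integral lborel (\<lambda>t. sin (t * s) * indicator {-\<eta>..\<eta>} t) (- cos (\<eta> * s) / s - (- cos (- \<eta> * s) / s))"
      by (rule has_bochner_integral_FTC_Icc_real) (use e False in \<open>auto intro!: derivative_eq_intros continuous_intros\<close>)
    then show ?thesis by simp
  next
    case True
    show ?thesis unfolding True by (simp add: has_bochner_integral_zero)
  qed
  note i = has_bochner_integral_integral_eq[OF c] has_bochner_integral_integral_eq[OF s]
    integrable.intros[OF c] integrable.intros[OF s]
  have "box_kernel \<eta> t *\<^sub>R cis (- (t * s)) = complex_of_real (1 / (2 * \<eta>)) * (complex_of_real (cos (t * s) * indicator {-\<eta>..\<eta>} t) - \<i> * complex_of_real (sin (t * s) * indicator {-\<eta>..\<eta>} t))" for t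
    by (simp add: box_kernel_def complex_eq_iff indicator_def)
  then have "khat (box_kernel \<eta>) s = complex_of_real (1 / (2 * \<eta>)) * (\<integral>t. complex_of_real (cos (t * s) * indicator {-\<eta>..\<eta>} t) - \<i> * complex_of_real (sin (t * s) * indicator {-\<eta>..\<eta>} t) \<partial>lborel)"
    unfolding khat_def by (simp only: integral_mult_right_zero)
  also have "(\<integral>t. complex_of_real (cos (t * s) * indicator {-\<eta>..\<eta>} t) - \<i> * complex_of_real (sin (t * s) * indicator {-\<eta>..\<eta>} t) \<partial>lborel) =
    (\<integral>t. complex_of_real (cos (t * s) * indicator {-\<eta>..\<eta>} t) \<partial>lborel) - (\<integral>t. \<i> * complex_of_real (sin (t * s) * indicator {-\<eta>..\<eta>} t) \<partial>lborel)"
    by (rule Bochner_Integration.integral_diff) (intro integrable_mult_right integrable_of_real i)+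
  also have "\<dots> = complex_of_real (2 * \<eta> * sinc (\<eta> * s)) - \<i> * complex_of_real 0"
    by (simp only: integral_mult_right_zero integral_complex_of_real i)
  finally show ?thesis using e by simp
qed

subsection \<open>The square function\<close>

definition trunc_hilbert :: "nat \<Rightarrow> nat \<Rightarrow> 'a::euclidean_space \<Rightarrow> ('a \<Rightarrow> complex) \<Rightarrow> 'a \<Rightarrow> complex" where
  "trunc_hilbert j n = dconv (cut_kernel ((1/2)^j) (2^n))"

definition line_mean :: "nat \<Rightarrow> 'a::euclidean_space \<Rightarrow> ('a \<Rightarrow> complex) \<Rightarrow> 'a \<Rightarrow> complex" where
  "line_mean j = dconv (box_kernel ((1/2)^j))"

definition trunc_symbol :: "nat \<Rightarrow> nat \<Rightarrow> real \<Rightarrow> complex" where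
  "trunc_symbol j n = khat (cut_kernel ((1/2)^j) (2^n))"

lemma half_le_two: "(1/2::real)^j \<le> 2^n"
  by (rule order_trans[of _ 1]) (simp_all add: power_le_one)

lemma trunc_symbol_eq: "trunc_symbol j n s = - (\<i> * complex_of_real (2 / pi * (Si (2^n * s) - Si ((1/2)^j * s))))"
  unfolding trunc_symbol_def by (rule khat_cut_kernel) (simp_all add: half_le_two)

lemma two_div_pi: "0 < 2 / pi" "2 / pi \<le> 1" using pi_ge_two by (auto simp: divide_le_eq)

lemma norm_trunc_symbol_le: "norm (trunc_symbol j n s) \<le> 2 * Si_bound"
proof -
  have "norm (trunc_symbol j n s) = 2 / pi * \<bar>Si (2^n * s) - Si ((1/2)^j * s)\<bar>"
    unfolding trunc_symbol_eq norm_minus_cancel norm_mult norm_ii norm_of_real abs_mult using two_div_pi by simp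
  also have "\<dots> \<le> 1 * (Si_bound + Si_bound)"
    using Si_bound[of "2^n * s"] Si_bound[of "(1/2)^j * s"] two_div_pi Si_bound_nonneg by (intro mult_mono) auto
  finally show ?thesis by simp
qed

lemma measurable_trunc_symbol [measurable]: "trunc_symbol j n \<in> borel_measurable borel"
  unfolding trunc_symbol_eq[abs_def] by measurable

lemma cut_kernel_integrable [simp]: "integrable lborel (cut_kernel ((1/2)^j) (2^n))"
  by (rule integrable_cut_kernel) simp

lemma FT_trunc_hilbert: "bdd_integrable f \<Longrightarrow> FT (trunc_hilbert j n w f) \<xi> = trunc_symbol j n (\<xi> \<bullet> w) * FT f \<xi>"
  unfolding trunc_hilbert_def trunc_symbol_def by (rule FT_dconv) simp_all

lemma bdd_integrable_trunc_hilbert: "bdd_integrable f \<Longrightarrow> bdd_integrable (trunc_hilbert j n w f)"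
  unfolding trunc_hilbert_def by (rule bdd_integrable_dconv) simp_all

lemma FT_line_mean: "bdd_integrable f \<Longrightarrow> FT (line_mean j w f) \<xi> = complex_of_real (sinc ((1/2)^j * (\<xi> \<bullet> w))) * FT f \<xi>"
  unfolding line_mean_def by (subst FT_dconv[OF integrable_box_kernel]) (simp_all only: khat_box_kernel zero_less_power zero_less_divide_1_iff zero_less_numeral)

lemma bdd_integrable_line_mean: "bdd_integrable f \<Longrightarrow> bdd_integrable (line_mean j w f)"
  unfolding line_mean_def by (rule bdd_integrable_dconv[OF integrable_box_kernel])

definition line_mean_c :: "nat \<Rightarrow> real" where "line_mean_c j = (\<integral>t. \<bar>box_kernel ((1/2)^j) t\<bar> \<partial>lborel)\<^sup>2"

definition trunc_hilbert_c :: "nat \<Rightarrow> nat \<Rightarrow> real" where "trunc_hilbert_c j n = (\<integral>t. \<bar>cut_kernel ((1/2)^j) (2^n) t\<bar> \<partial>lborel)\<^sup>2"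

lemma lip_line_mean: "lip (line_mean_c j) (line_mean j w)" unfolding line_mean_def line_mean_c_def by (rule lip_dconv[OF integrable_box_kernel])

lemma lip_trunc_hilbert: "lip (trunc_hilbert_c j n) (trunc_hilbert j n w)" unfolding trunc_hilbert_def trunc_hilbert_c_def by (rule lip_dconv) simp

lemma sq_norm_trunc_hilbert_le:
  assumes f: "sq_integrable f" shows "sq_norm (trunc_hilbert j n w f) \<le> ennreal (8 * Si_bound\<^sup>2) * sq_norm f"
proof -
  have "(\<Sum>i\<in>{()}. sq_norm (trunc_hilbert j n w f)) \<le> ennreal (2 * (2 * Si_bound)\<^sup>2) * sq_norm f"
  proof (rule sum_sq_norm_extend[where c = "\<lambda>_. trunc_hilbert_c j n"])
    show "(\<Sum>i\<in>{()}. sq_norm (trunc_hilbert j n w g)) \<le> ennreal ((2 * Si_bound)\<^sup>2) * sq_norm g" if g: "bdd_integrable g" for g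
    proof (rule sum_sq_norm_multiplier[OF g bdd_integrable_trunc_hilbert[OF g] FT_trunc_hilbert[OF g]])
      show "(\<Sum>i\<in>{()}. (norm (trunc_symbol j n (\<xi> \<bullet> w)))\<^sup>2) \<le> (2 * Si_bound)\<^sup>2" for \<xi>
        using power_mono[OF norm_trunc_symbol_le norm_ge_zero, of j n "\<xi> \<bullet> w" 2] by simp
    qed simp
  qed (use f lip_trunc_hilbert in auto)
  then show ?thesis by (simp add: power_mult_distrib)
qed

lemma one_minus_sinc_le:
  assumes "0 < x" shows "\<bar>1 - sinc x\<bar> \<le> x"
proof -
  have "norm ((sin x - x) - (sin 0 - 0)) \<le> x * norm (x - 0)"
  proof (rule field_differentiable_bound[of "{0..x}" "\<lambda>t. sin t - t" "\<lambda>t. cos t - 1"])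
    show "((\<lambda>t. sin t - t) has_field_derivative cos t - 1) (at t within {0..x})" for t
      by (auto intro!: derivative_eq_intros)
    show "norm (cos t - 1) \<le> x" if "t \<in> {0..x}" for t
    proof -
      have "1 - cos t = 2 * (sin (t / 2))\<^sup>2" using cos_double_sin[of "t / 2"] by simp
      also have "\<dots> \<le> 2 * (\<bar>sin (t / 2)\<bar> * 1)"
        unfolding power2_eq_square by (subst abs_mult_self_eq[symmetric]) (intro mult_left_mono abs_sin_le_one, auto)
      also have "\<dots> \<le> 2 * (t / 2)" using abs_sin_x_le_abs_x[of "t / 2"] that by simp
      finally show ?thesis using that cos_le_one[of t] by simp
    qed
  qed (use assms in auto)
  then have "\<bar>sin x - x\<bar> \<le> x * x" using assms by simp
  moreover have "1 - sinc x = - ((sin x - x) / x)" using assms by (simp add: field_simps)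
  ultimately show ?thesis using assms by (simp add: abs_divide divide_le_eq)
qed

definition min_inverse :: "real \<Rightarrow> real" where "min_inverse x = min x (1 / x)"

text \<open>Put x = a s. For small x the expression is regrouped as Si(bs)(1 - sinc x) - Si x + sinc
  x Si(cs), where every term is O(x) because cs <= x. For large x both Si(bs) - Si x and sinc x are
  O(1/x).\<close>

lemma square_multiplier_core:
  assumes c: "0 < c" "c \<le> a" "a \<le> b" and s: "0 < s"
  shows "\<bar>Si (b * s) - Si (a * s) - sinc (a * s) * (Si (b * s) - Si (c * s))\<bar> \<le> (4 + 2 * Si_bound) * min_inverse (a * s)"
proof -
  define x where "x = a * s"
  have x: "0 < x" "x \<le> b * s" "c * s \<le> x" "0 < c * s" using c s by (simp_all add: x_def)
  have sx: "\<bar>sinc x\<bar> \<le> 1" by (rule abs_sinc_le_1)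
  have "\<bar>Si (b * s) - Si x - sinc x * (Si (b * s) - Si (c * s))\<bar> = \<bar>Si (b * s) * (1 - sinc x) - Si x + sinc x * Si (c * s)\<bar>"
  proof -
    have "B - X - c * (B - C) = B * (1 - c) - X + c * C" for B X c C :: real by (simp add: algebra_simps)
    then show ?thesis by (rule arg_cong)
  qed
  also have "\<dots> \<le> \<bar>Si (b * s) * (1 - sinc x)\<bar> + \<bar>Si x\<bar> + \<bar>sinc x * Si (c * s)\<bar>" by linarith
  also have "\<dots> \<le> Si_bound * x + x + 1 * x"
  proof (intro add_mono)
    show "\<bar>Si (b * s) * (1 - sinc x)\<bar> \<le> Si_bound * x" unfolding abs_mult using Si_bound one_minus_sinc_le[OF x(1)] Si_bound_nonneg by (intro mult_mono) auto
    show "\<bar>Si x\<bar> \<le> x" using abs_Si_le[of x] x by simp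
    show "\<bar>sinc x * Si (c * s)\<bar> \<le> 1 * x" unfolding abs_mult
      using sx abs_Si_le[of "c * s"] x by (intro mult_mono) auto
  qed
  finally have 1: "\<bar>Si (b * s) - Si x - sinc x * (Si (b * s) - Si (c * s))\<bar> \<le> (Si_bound + 2) * x" by (simp add: algebra_simps)
  have "\<bar>Si (b * s) - Si x - sinc x * (Si (b * s) - Si (c * s))\<bar> \<le> \<bar>Si (b * s) - Si x\<bar> + \<bar>sinc x * (Si (b * s) - Si (c * s))\<bar>" by linarith
  also have "\<dots> \<le> 2 / x + (1 / x) * (Si_bound + Si_bound)"
  proof (intro add_mono)
    show "\<bar>Si (b * s) - Si x\<bar> \<le> 2 / x" by (rule Si_diff_le[OF x(1,2)])
    have "\<bar>sinc x\<bar> \<le> 1 / x" using x(1) by (simp add: divide_right_mono)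
    moreover have "\<bar>Si (b * s) - Si (c * s)\<bar> \<le> Si_bound + Si_bound" using Si_bound[of "b * s"] Si_bound[of "c * s"] by linarith
    ultimately show "\<bar>sinc x * (Si (b * s) - Si (c * s))\<bar> \<le> (1 / x) * (Si_bound + Si_bound)" unfolding abs_mult using x(1) by (intro mult_mono) auto
  qed
  also have "\<dots> = (2 + 2 * Si_bound) * (1 / x)" using x(1) by (simp add: field_simps)
  finally have 2: "\<bar>Si (b * s) - Si x - sinc x * (Si (b * s) - Si (c * s))\<bar> \<le> (2 + 2 * Si_bound) * (1 / x)" .
  have "(Si_bound + 2) * x \<le> (4 + 2 * Si_bound) * x" "(2 + 2 * Si_bound) * (1 / x) \<le> (4 + 2 * Si_bound) * (1 / x)"
    using x(1) Si_bound_nonneg by (intro mult_right_mono; simp)+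
  then have "\<bar>Si (b * s) - Si x - sinc x * (Si (b * s) - Si (c * s))\<bar> \<le> (4 + 2 * Si_bound) * min_inverse x"
    using 1 2 unfolding min_inverse_def min_def by (auto intro: order_trans)
  then show ?thesis unfolding x_def .
qed

lemma square_multiplier:
  assumes "j \<le> n"
  shows "norm (trunc_symbol j n s - complex_of_real (sinc ((1/2)^j * s)) * trunc_symbol n n s) \<le> (4 + 2 * Si_bound) * min_inverse ((1/2)^j * \<bar>s\<bar>)"
proof -
  let ?a = "(1/2::real)^j" and ?b = "2^n :: real" and ?c = "(1/2::real)^n"
  let ?E = "\<lambda>s. Si (?b * s) - Si (?a * s) - sinc (?a * s) * (Si (?b * s) - Si (?c * s))"
  have c: "0 < ?c" "?c \<le> ?a" "?a \<le> ?b" using assms by (auto simp: half_le_two intro: power_decreasing)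
  have E: "\<bar>?E s\<bar> \<le> (4 + 2 * Si_bound) * min_inverse (?a * \<bar>s\<bar>)"
  proof (cases "s = 0")
    case True then show ?thesis by (simp add: Si_0 min_inverse_def)
  next
    case False
    have "\<bar>?E s\<bar> = \<bar>?E \<bar>s\<bar>\<bar>"
    proof (cases "0 \<le> s")
      case neg: False
      then have e: "sinc (?a * \<bar>s\<bar>) = sinc (?a * s)" "\<And>c. Si (c * \<bar>s\<bar>) = - Si (c * s)" by (simp_all add: Si_odd)
      have "- B - - X - c * (- B - - C) = - (B - X - c * (B - C))" for B X c C :: real by (simp add: algebra_simps)
      then have "?E \<bar>s\<bar> = - ?E s" unfolding e .
      then show ?thesis by (simp only: abs_minus_cancel)
    qed simp
    then show ?thesis using square_multiplier_core[OF c, of "\<bar>s\<bar>"] False by simp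
  qed
  have "trunc_symbol j n s - complex_of_real (sinc (?a * s)) * trunc_symbol n n s = - (\<i> * complex_of_real (2 / pi * ?E s))"
    unfolding trunc_symbol_eq by (simp add: algebra_simps del: of_real_power)
  then have "norm (trunc_symbol j n s - complex_of_real (sinc (?a * s)) * trunc_symbol n n s) = 2 / pi * \<bar>?E s\<bar>"
    by (simp only: norm_minus_cancel norm_mult norm_ii norm_of_real abs_mult) (use two_div_pi in simp)
  also have "\<dots> \<le> 1 * \<bar>?E s\<bar>" using two_div_pi by (intro mult_right_mono) auto
  finally have "norm (trunc_symbol j n s - complex_of_real (sinc (?a * s)) * trunc_symbol n n s) \<le> \<bar>?E s\<bar>" by (simp only: mult_1)
  then show ?thesis using E by (rule order_trans)
qed

lemma sum_min_inverse_small: "0 \<le> y \<Longrightarrow> (\<Sum>j<J. (min_inverse ((1/2)^j * y))\<^sup>2) \<le> 4 / 3 * y\<^sup>2"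
proof (induction J arbitrary: y)
  case (Suc J)
  have min_inverse: "(min_inverse y)\<^sup>2 \<le> y\<^sup>2" using Suc.prems by (intro power_mono) (auto simp: min_inverse_def)
  have "(\<Sum>j<Suc J. (min_inverse ((1/2)^j * y))\<^sup>2) = (min_inverse y)\<^sup>2 + (\<Sum>j<J. (min_inverse ((1/2)^j * (y / 2)))\<^sup>2)"
    by (subst sum.lessThan_Suc_shift) (simp add: mult.commute mult.left_commute)
  also have "\<dots> \<le> y\<^sup>2 + 4 / 3 * (y / 2)\<^sup>2" using Suc.prems min_inverse by (intro add_mono Suc.IH) auto
  finally show ?case by (simp add: power_divide)
qed simp

text \<open>The subtracted term closes the induction from y/2 to y: 1/y^2 - 4/(3 y^2) = -1/(3 y^2).
  For y < 2 the halved argument is left to \<open>sum_min_inverse_small\<close>.\<close>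

lemma sum_min_inverse_large: "1 \<le> y \<Longrightarrow> (\<Sum>j<J. (min_inverse ((1/2)^j * y))\<^sup>2) \<le> 5 / 3 - 1 / (3 * y\<^sup>2)"
proof (induction J arbitrary: y)
  case 0
  have "1 / (3 * y\<^sup>2) \<le> 1 / 3" using 0 by (simp add: divide_le_eq one_le_power)
  then show ?case by simp
next
  case (Suc J)
  have min_inverse: "(min_inverse y)\<^sup>2 \<le> (1 / y)\<^sup>2" using Suc.prems by (intro power_mono) (auto simp: min_inverse_def)
  have eq: "(\<Sum>j<Suc J. (min_inverse ((1/2)^j * y))\<^sup>2) = (min_inverse y)\<^sup>2 + (\<Sum>j<J. (min_inverse ((1/2)^j * (y / 2)))\<^sup>2)"
    by (subst sum.lessThan_Suc_shift) (simp add: mult.commute mult.left_commute)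
  show ?case
  proof (cases "2 \<le> y")
    case True
    have "(\<Sum>j<Suc J. (min_inverse ((1/2)^j * y))\<^sup>2) \<le> (1 / y)\<^sup>2 + (5 / 3 - 1 / (3 * (y / 2)\<^sup>2))"
      unfolding eq using True by (intro add_mono min_inverse Suc.IH) auto
    also have "\<dots> = 5 / 3 - 1 / (3 * y\<^sup>2)" using Suc.prems by (simp add: field_simps power2_eq_square)
    finally show ?thesis .
  next
    case False
    have "(\<Sum>j<Suc J. (min_inverse ((1/2)^j * y))\<^sup>2) \<le> (1 / y)\<^sup>2 + 4 / 3 * (y / 2)\<^sup>2"
      unfolding eq using Suc.prems by (intro add_mono min_inverse sum_min_inverse_small) auto
    \<comment> \<open>With u = y^2 between 1 and 4 this is (u - 1)(4 - u) >= 0.\<close>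
    also have "\<dots> \<le> 5 / 3 - 1 / (3 * y\<^sup>2)"
    proof -
      have y2: "1 \<le> y\<^sup>2" "y\<^sup>2 \<le> 4" using Suc.prems False power_mono[of y 2 2] by (auto simp: one_le_power)
      have "1 / u + u / 3 \<le> 5 / 3 - 1 / (3 * u)" if u: "1 \<le> u" "u \<le> 4" for u :: real
      proof -
        have "0 \<le> (u - 1) * (4 - u)" using u by (intro mult_nonneg_nonneg) auto
        then have "(4 + u * u) / (3 * u) \<le> 5 * u / (3 * u)" using u by (intro divide_right_mono) (auto simp: algebra_simps)
        moreover have "(4 + u * u) / (3 * u) = 1 / u + 1 / (3 * u) + u / 3" "5 * u / (3 * u) = 5 / 3" using u by (simp_all add: field_simps)
        ultimately show ?thesis by linarith
      qed
      from this[OF y2] show ?thesis by (simp add: power_divide)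
    qed
    finally show ?thesis .
  qed
qed

lemma sum_min_inverse: assumes "0 \<le> y" shows "(\<Sum>j<J. (min_inverse ((1/2)^j * y))\<^sup>2) \<le> 2"
proof (cases "1 \<le> y")
  case True
  have "0 \<le> 1 / (3 * y\<^sup>2)" by simp
  then show ?thesis using sum_min_inverse_large[OF True, of J] by linarith
next
  case False
  then have "y\<^sup>2 \<le> 1" using assms by (simp add: power_le_one)
  then show ?thesis using sum_min_inverse_small[OF assms, of J] by linarith
qed

text \<open>The outer 2 is the loss in \<open>sum_sq_norm_extend\<close>, the last 2 the bound of
  \<open>sum_min_inverse\<close>.\<close>

definition square_const :: real where "square_const = 2 * ((4 + 2 * Si_bound)\<^sup>2 * 2)"

text \<open>The truncation at scale $2^{-j}$ and the average at scale $2^{-j}$ of the full transform differ by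
  a multiplier of size $\min(x,1/x)$ at $x=2^{-j}|\xi\cdot w|$, whose squares are summable in $j$.\<close>

lemma square_function:
  assumes f: "sq_integrable f" and J: "J \<le> n"
  shows "(\<Sum>j<J. sq_norm (\<lambda>x. trunc_hilbert j n w f x - line_mean j w (trunc_hilbert n n w f) x)) \<le> ennreal square_const * sq_norm f"
  unfolding square_const_def
proof (rule sum_sq_norm_extend[where c = "\<lambda>j. 2 * trunc_hilbert_c j n + 2 * (line_mean_c j * trunc_hilbert_c n n)"])
  show "lip (2 * trunc_hilbert_c j n + 2 * (line_mean_c j * trunc_hilbert_c n n)) (\<lambda>f x. trunc_hilbert j n w f x - line_mean j w (trunc_hilbert n n w f) x)" for j
    by (rule lip_minus[OF lip_trunc_hilbert lip_compose[OF lip_line_mean lip_trunc_hilbert]])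
  fix g :: "'a \<Rightarrow> complex" assume g: "bdd_integrable g"
  let ?m = "\<lambda>j s. trunc_symbol j n s - complex_of_real (sinc ((1/2)^j * s)) * trunc_symbol n n s"
  show "(\<Sum>j<J. sq_norm (\<lambda>x. trunc_hilbert j n w g x - line_mean j w (trunc_hilbert n n w g) x)) \<le> ennreal ((4 + 2 * Si_bound)\<^sup>2 * 2) * sq_norm g"
  proof (rule sum_sq_norm_multiplier[OF g])
    show "bdd_integrable (\<lambda>x. trunc_hilbert j n w g x - line_mean j w (trunc_hilbert n n w g) x)" for j
      by (intro bdd_integrable_diff bdd_integrable_trunc_hilbert bdd_integrable_line_mean g)
    show "FT (\<lambda>x. trunc_hilbert j n w g x - line_mean j w (trunc_hilbert n n w g) x) \<xi> = ?m j (\<xi> \<bullet> w) * FT g \<xi>" for j \<xi>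
    proof -
      have "FT (\<lambda>x. trunc_hilbert j n w g x - line_mean j w (trunc_hilbert n n w g) x) \<xi> = FT (trunc_hilbert j n w g) \<xi> - FT (line_mean j w (trunc_hilbert n n w g)) \<xi>"
        by (rule FT_diff) (intro bdd_integrableD(1) bdd_integrable_trunc_hilbert bdd_integrable_line_mean g)+
      then show ?thesis by (simp only: FT_trunc_hilbert[OF g] FT_line_mean[OF bdd_integrable_trunc_hilbert[OF g]] left_diff_distrib mult.assoc)
    qed
    fix \<xi>
    have "(\<Sum>j<J. (norm (?m j (\<xi> \<bullet> w)))\<^sup>2) \<le> (\<Sum>j<J. (4 + 2 * Si_bound)\<^sup>2 * (min_inverse ((1/2)^j * \<bar>\<xi> \<bullet> w\<bar>))\<^sup>2)"
    proof (rule sum_mono)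
      fix j assume "j \<in> {..<J}"
      then have "j \<le> n" using J by simp
      from power_mono[OF square_multiplier[OF this] norm_ge_zero, of "\<xi> \<bullet> w" 2]
      show "(norm (?m j (\<xi> \<bullet> w)))\<^sup>2 \<le> (4 + 2 * Si_bound)\<^sup>2 * (min_inverse ((1/2)^j * \<bar>\<xi> \<bullet> w\<bar>))\<^sup>2" by (simp only: power_mult_distrib)
    qed
    also have "\<dots> = (4 + 2 * Si_bound)\<^sup>2 * (\<Sum>j<J. (min_inverse ((1/2)^j * \<bar>\<xi> \<bullet> w\<bar>))\<^sup>2)" by (rule sum_distrib_left[symmetric])
    also have "\<dots> \<le> (4 + 2 * Si_bound)\<^sup>2 * 2" by (intro mult_left_mono sum_min_inverse) auto
    finally show "(\<Sum>j<J. (norm (?m j (\<xi> \<bullet> w)))\<^sup>2) \<le> (4 + 2 * Si_bound)\<^sup>2 * 2" .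
  qed simp
qed (use f in auto)

subsection \<open>The directional Hilbert transform as a limit in the mean\<close>

definition hilbert_symbol :: "real \<Rightarrow> complex" where "hilbert_symbol s = - (\<i> * complex_of_real (sgn s))"

lemma measurable_hilbert_symbol [measurable]: "hilbert_symbol \<in> borel_measurable borel" unfolding hilbert_symbol_def[abs_def] by measurable

lemma trunc_symbol_tendsto: "(\<lambda>n. trunc_symbol n n s) \<longlonglongrightarrow> hilbert_symbol s"
proof -
  have inf: "filterlim (\<lambda>n. 2^n * t :: real) at_top sequentially" if "t > 0" for t
    unfolding mult.commute[of _ t]
  proof (rule filterlim_tendsto_pos_mult_at_top[OF tendsto_const that])
    show "filterlim (\<lambda>n. 2^n :: real) at_top sequentially"
      by (rule filterlim_at_top_mono[OF filterlim_real_sequentially]) (auto intro!: always_eventually less_imp_le of_nat_less_two_power)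
  qed
  have a: "(\<lambda>n. Si (2^n * s)) \<longlonglongrightarrow> sgn s * (pi / 2)"
  proof (cases s "0::real" rule: linorder_cases)
    case less
    have "(\<lambda>n. - Si (2^n * (- s))) \<longlonglongrightarrow> - (pi / 2)"
      using less by (intro tendsto_minus filterlim_compose[OF Si_at_top inf]) simp
    then show ?thesis using less by (simp add: Si_odd)
  next
    case greater
    then show ?thesis using filterlim_compose[OF Si_at_top inf[OF greater]] by simp
  qed (simp add: Si_0)
  have "(\<lambda>n. (1/2::real)^n * s) \<longlonglongrightarrow> 0 * s" by (intro tendsto_mult tendsto_const LIMSEQ_power_zero) simp
  then have b: "(\<lambda>n. Si ((1/2)^n * s)) \<longlonglongrightarrow> 0" using isCont_tendsto_compose[OF isCont_Si, of _ 0] by (simp add: Si_0)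
  have "(\<lambda>n. - (\<i> * complex_of_real (2 / pi * (Si (2^n * s) - Si ((1/2)^n * s))))) \<longlonglongrightarrow> - (\<i> * complex_of_real (2 / pi * (sgn s * (pi / 2) - 0)))"
    by (intro tendsto_intros a b)
  then show ?thesis unfolding trunc_symbol_eq hilbert_symbol_def by simp
qed

lemma norm_hilbert_symbol_le: "norm (hilbert_symbol s) \<le> 1" by (simp add: hilbert_symbol_def norm_mult sgn_if)

lemma sq_norm_FT': "bdd_integrable g \<Longrightarrow> sq_norm g = ennreal (1 / (2 * pi) ^ DIM('a)) * sq_norm (FT g)" for g :: "'a::euclidean_space \<Rightarrow> complex"
  unfolding sq_norm_FT by (simp add: sq_norm_def)

lemma sq_integrable_FT: assumes g: "bdd_integrable g" shows "sq_integrable (FT g)"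
  unfolding sq_integrable_def
proof
  note [measurable] = bdd_integrableD(2)[OF g]
  show "FT g \<in> borel_measurable borel" by measurable
  have "ennreal (1 / (2 * pi) ^ DIM('a)) * sq_norm (FT g) < \<infinity>" using sq_integrableD(2)[OF bdd_integrable_sq_integrable[OF g]] by (simp only: sq_norm_FT'[OF g, symmetric])
  then show "sq_norm (FT g) < \<infinity>" by (auto simp: ennreal_mult_less_top)
qed

text \<open>The error is measured on the frequency side, where the limiting symbol makes sense
  before a limit operator exists.\<close>

definition defect :: "'a::euclidean_space \<Rightarrow> ('a \<Rightarrow> complex) \<Rightarrow> nat \<Rightarrow> ennreal" where
  "defect w g n = sq_norm (\<lambda>\<xi>. trunc_symbol n n (\<xi> \<bullet> w) * FT g \<xi> - hilbert_symbol (\<xi> \<bullet> w) * FT g \<xi>)"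

lemma defect_tendsto:
  assumes g: "bdd_integrable g" shows "defect w g \<longlonglongrightarrow> 0"
proof -
  note [measurable] = sq_integrableD(1)[OF sq_integrable_FT[OF g]]
  have "(\<lambda>n. \<integral>\<^sup>+\<xi>. ennreal ((norm (trunc_symbol n n (\<xi> \<bullet> w) * FT g \<xi> - hilbert_symbol (\<xi> \<bullet> w) * FT g \<xi>))\<^sup>2) \<partial>lborel) \<longlonglongrightarrow> (\<integral>\<^sup>+\<xi>. 0 \<partial>(lborel :: 'a measure))"
  proof (rule nn_integral_dominated_convergence[where w = "\<lambda>\<xi>. ennreal ((2 * Si_bound + 1)\<^sup>2) * ennreal ((norm (FT g \<xi>))\<^sup>2)"])
    show "AE \<xi> in lborel. ennreal ((norm (trunc_symbol n n (\<xi> \<bullet> w) * FT g \<xi> - hilbert_symbol (\<xi> \<bullet> w) * FT g \<xi>))\<^sup>2) \<le> ennreal ((2 * Si_bound + 1)\<^sup>2) * ennreal ((norm (FT g \<xi>))\<^sup>2)" for n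
    proof (rule AE_I2)
      fix \<xi>
      have "norm (trunc_symbol n n (\<xi> \<bullet> w) - hilbert_symbol (\<xi> \<bullet> w)) \<le> 2 * Si_bound + 1"
        using norm_triangle_ineq4[of "trunc_symbol n n (\<xi> \<bullet> w)" "hilbert_symbol (\<xi> \<bullet> w)"] norm_trunc_symbol_le[of n n "\<xi> \<bullet> w"] norm_hilbert_symbol_le[of "\<xi> \<bullet> w"] by linarith
      then have "norm (trunc_symbol n n (\<xi> \<bullet> w) * FT g \<xi> - hilbert_symbol (\<xi> \<bullet> w) * FT g \<xi>) \<le> (2 * Si_bound + 1) * norm (FT g \<xi>)"
        unfolding left_diff_distrib[symmetric] norm_mult by (intro mult_right_mono) auto
      from power_mono[OF this norm_ge_zero, of 2]
      show "ennreal ((norm (trunc_symbol n n (\<xi> \<bullet> w) * FT g \<xi> - hilbert_symbol (\<xi> \<bullet> w) * FT g \<xi>))\<^sup>2) \<le> ennreal ((2 * Si_bound + 1)\<^sup>2) * ennreal ((norm (FT g \<xi>))\<^sup>2)"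
        by (simp add: power_mult_distrib ennreal_leI flip: ennreal_mult)
    qed
    show "(\<integral>\<^sup>+\<xi>. ennreal ((2 * Si_bound + 1)\<^sup>2) * ennreal ((norm (FT g \<xi>))\<^sup>2) \<partial>lborel) < \<infinity>"
      using sq_integrableD(2)[OF sq_integrable_FT[OF g]] by (subst nn_integral_cmult) (auto simp: sq_norm_def ennreal_mult_less_top)
    show "AE \<xi> in lborel. (\<lambda>n. ennreal ((norm (trunc_symbol n n (\<xi> \<bullet> w) * FT g \<xi> - hilbert_symbol (\<xi> \<bullet> w) * FT g \<xi>))\<^sup>2)) \<longlonglongrightarrow> 0"
    proof (rule AE_I2)
      fix \<xi>
      have "(\<lambda>n. ennreal ((norm (trunc_symbol n n (\<xi> \<bullet> w) * FT g \<xi> - hilbert_symbol (\<xi> \<bullet> w) * FT g \<xi>))\<^sup>2)) \<longlonglongrightarrow> ennreal ((norm (hilbert_symbol (\<xi> \<bullet> w) * FT g \<xi> - hilbert_symbol (\<xi> \<bullet> w) * FT g \<xi>))\<^sup>2)"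
        by (intro tendsto_ennrealI tendsto_intros trunc_symbol_tendsto)
      then show "(\<lambda>n. ennreal ((norm (trunc_symbol n n (\<xi> \<bullet> w) * FT g \<xi> - hilbert_symbol (\<xi> \<bullet> w) * FT g \<xi>))\<^sup>2)) \<longlonglongrightarrow> 0" by simp
    qed
  qed measurable
  then show ?thesis by (simp add: defect_def[abs_def] sq_norm_def)
qed

text \<open>Serves twice: with p = q it gives the Cauchy property in the truncation, with different
  p and q it compares two directions through their symbols.\<close>

lemma sq_norm_trunc_hilbert_diff:
  fixes g :: "'a::euclidean_space \<Rightarrow> complex"
  assumes g: "bdd_integrable g"
  shows "sq_norm (\<lambda>x. trunc_hilbert m m p g x - trunc_hilbert n n q g x) \<le>
    ennreal (1 / (2 * pi) ^ DIM('a)) * (2 * defect p g m + 4 * sq_norm (\<lambda>\<xi>. (hilbert_symbol (\<xi> \<bullet> p) - hilbert_symbol (\<xi> \<bullet> q)) * FT g \<xi>) + 4 * defect q g n)"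
proof -
  note [measurable] = sq_integrableD(1)[OF sq_integrable_FT[OF g]]
  have FT: "FT (\<lambda>x. trunc_hilbert m m p g x - trunc_hilbert n n q g x) = (\<lambda>\<xi>. trunc_symbol m m (\<xi> \<bullet> p) * FT g \<xi> - trunc_symbol n n (\<xi> \<bullet> q) * FT g \<xi>)"
  proof
    fix \<xi>
    have "FT (\<lambda>x. trunc_hilbert m m p g x - trunc_hilbert n n q g x) \<xi> = FT (trunc_hilbert m m p g) \<xi> - FT (trunc_hilbert n n q g) \<xi>"
      by (rule FT_diff) (intro bdd_integrableD(1) bdd_integrable_trunc_hilbert g)+
    then show "FT (\<lambda>x. trunc_hilbert m m p g x - trunc_hilbert n n q g x) \<xi> = trunc_symbol m m (\<xi> \<bullet> p) * FT g \<xi> - trunc_symbol n n (\<xi> \<bullet> q) * FT g \<xi>" by (simp only: FT_trunc_hilbert[OF g])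
  qed
  have "sq_norm (\<lambda>x. trunc_hilbert m m p g x - trunc_hilbert n n q g x) = ennreal (1 / (2 * pi) ^ DIM('a)) * sq_norm (\<lambda>\<xi>. trunc_symbol m m (\<xi> \<bullet> p) * FT g \<xi> - trunc_symbol n n (\<xi> \<bullet> q) * FT g \<xi>)"
    unfolding FT[symmetric] by (intro sq_norm_FT' bdd_integrable_diff bdd_integrable_trunc_hilbert g)
  also have "\<dots> \<le> ennreal (1 / (2 * pi) ^ DIM('a)) * (2 * defect p g m + 2 * (2 * sq_norm (\<lambda>\<xi>. hilbert_symbol (\<xi> \<bullet> p) * FT g \<xi> - hilbert_symbol (\<xi> \<bullet> q) * FT g \<xi>) + 2 * defect q g n))"
  proof (rule mult_left_mono)
    have "sq_norm (\<lambda>\<xi>. trunc_symbol m m (\<xi> \<bullet> p) * FT g \<xi> - trunc_symbol n n (\<xi> \<bullet> q) * FT g \<xi>) \<le> 2 * defect p g m + 2 * sq_norm (\<lambda>\<xi>. hilbert_symbol (\<xi> \<bullet> p) * FT g \<xi> - trunc_symbol n n (\<xi> \<bullet> q) * FT g \<xi>)"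
      unfolding defect_def by (rule sq_norm_triangle) measurable
    also have "sq_norm (\<lambda>\<xi>. hilbert_symbol (\<xi> \<bullet> p) * FT g \<xi> - trunc_symbol n n (\<xi> \<bullet> q) * FT g \<xi>) \<le> 2 * sq_norm (\<lambda>\<xi>. hilbert_symbol (\<xi> \<bullet> p) * FT g \<xi> - hilbert_symbol (\<xi> \<bullet> q) * FT g \<xi>) + 2 * defect q g n"
      unfolding defect_def by (subst (3) sq_norm_commute) (rule sq_norm_triangle, measurable)
    finally show "sq_norm (\<lambda>\<xi>. trunc_symbol m m (\<xi> \<bullet> p) * FT g \<xi> - trunc_symbol n n (\<xi> \<bullet> q) * FT g \<xi>) \<le> 2 * defect p g m + 2 * (2 * sq_norm (\<lambda>\<xi>. hilbert_symbol (\<xi> \<bullet> p) * FT g \<xi> - hilbert_symbol (\<xi> \<bullet> q) * FT g \<xi>) + 2 * defect q g n)"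
      by (simp add: mult_left_mono)
  qed simp
  finally show ?thesis by (simp add: distrib_left mult.assoc[symmetric] left_diff_distrib add.assoc)
qed

text \<open>f is replaced by a truncation g, to which Plancherel applies; the error is controlled by
  \<open>sq_norm_trunc_hilbert_le\<close>, which is uniform in the cuts.\<close>

lemma trunc_hilbert_cauchy:
  fixes f :: "'a::euclidean_space \<Rightarrow> complex"
  assumes f: "sq_integrable f" and e: "0 < e"
  shows "\<exists>M. \<forall>m\<ge>M. \<forall>n\<ge>M. sq_norm (\<lambda>x. trunc_hilbert m m w f x - trunc_hilbert n n w f x) \<le> ennreal e"
proof -
  let ?c = "ennreal (1 / (2 * pi) ^ DIM('a))" and ?K = "ennreal (8 * Si_bound\<^sup>2)"
  have "(\<lambda>k. 6 * (?K * sq_norm (\<lambda>x. f x - trunc k f x))) \<longlonglongrightarrow> 6 * (?K * 0)"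
    by (intro ennreal_tendsto_cmult sq_norm_trunc_lim[OF f]) (simp_all add: ennreal_mult_less_top)
  then have "(\<lambda>k. 6 * (?K * sq_norm (\<lambda>x. f x - trunc k f x))) \<longlonglongrightarrow> 0" by simp
  then have "\<forall>\<^sub>F k in sequentially. 6 * (?K * sq_norm (\<lambda>x. f x - trunc k f x)) < ennreal (e / 2)" using e by (intro order_tendstoD) auto
  then obtain k where k: "6 * (?K * sq_norm (\<lambda>x. f x - trunc k f x)) < ennreal (e / 2)"
    using eventually_happens'[OF sequentially_bot] by blast
  define g where "g = trunc k f"
  have ng: "bdd_integrable g" and g: "sq_integrable g" unfolding g_def using bdd_integrable_trunc[OF sq_integrableD(1)[OF f]] bdd_integrable_sq_integrable by blast+
  have "(\<lambda>n. 4 * (?c * (8 * defect w g n))) \<longlonglongrightarrow> 4 * (?c * (8 * 0))"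
    by (intro ennreal_tendsto_cmult defect_tendsto[OF ng]) (simp_all add: ennreal_mult_less_top)
  then have "(\<lambda>n. 4 * (?c * (8 * defect w g n))) \<longlonglongrightarrow> 0" by simp
  then have "\<forall>\<^sub>F n in sequentially. 4 * (?c * (8 * defect w g n)) < ennreal (e / 2)" using e by (intro order_tendstoD) auto
  then obtain M where M: "\<And>n. n \<ge> M \<Longrightarrow> 4 * (?c * (8 * defect w g n)) < ennreal (e / 2)" unfolding eventually_sequentially by blast
  show ?thesis
  proof (intro exI[of _ M] allI impI)
    fix m n assume ge: "M \<le> m" "M \<le> n"
    note [measurable] = sq_integrableD(1)[OF lip_sq_integrable[OF lip_trunc_hilbert f]] sq_integrableD(1)[OF lip_sq_integrable[OF lip_trunc_hilbert g]]
    have ap: "sq_norm (\<lambda>x. trunc_hilbert m m w f x - trunc_hilbert m m w g x) \<le> ?K * sq_norm (\<lambda>x. f x - g x)" for m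
      unfolding lip_dist[OF lip_trunc_hilbert f g] by (rule sq_norm_trunc_hilbert_le[OF sq_integrable_diff[OF f g]])
    have d0: "4 * sq_norm (\<lambda>x. trunc_hilbert m m w g x - trunc_hilbert n n w g x) \<le> ennreal (e / 2)"
    proof -
      have z: "sq_norm (\<lambda>\<xi>. (hilbert_symbol (\<xi> \<bullet> w) - hilbert_symbol (\<xi> \<bullet> w)) * FT g \<xi>) = 0" by (simp add: sq_norm_def)
      have "sq_norm (\<lambda>x. trunc_hilbert m m w g x - trunc_hilbert n n w g x) \<le> ?c * (2 * defect w g m + 4 * defect w g n)"
        using sq_norm_trunc_hilbert_diff[OF ng, of m w n w] unfolding z by simp
      also have "\<dots> \<le> ?c * (4 * max (defect w g m) (defect w g n) + 4 * max (defect w g m) (defect w g n))"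
        by (intro mult_left_mono add_mono mult_mono) auto
      also have "\<dots> = ?c * (8 * max (defect w g m) (defect w g n))" by (simp flip: distrib_right)
      finally have "4 * sq_norm (\<lambda>x. trunc_hilbert m m w g x - trunc_hilbert n n w g x) \<le> 4 * (?c * (8 * max (defect w g m) (defect w g n)))" by (simp add: mult_left_mono)
      also have "\<dots> \<le> ennreal (e / 2)" using M[OF ge(1)] M[OF ge(2)] by (cases "defect w g m \<le> defect w g n") (simp_all add: max_def less_imp_le)
      finally show ?thesis .
    qed
    have "sq_norm (\<lambda>x. trunc_hilbert m m w f x - trunc_hilbert n n w f x) \<le> 2 * sq_norm (\<lambda>x. trunc_hilbert m m w f x - trunc_hilbert m m w g x) + 2 * sq_norm (\<lambda>x. trunc_hilbert m m w g x - trunc_hilbert n n w f x)"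
      by (rule sq_norm_triangle) measurable
    also have "sq_norm (\<lambda>x. trunc_hilbert m m w g x - trunc_hilbert n n w f x) \<le> 2 * sq_norm (\<lambda>x. trunc_hilbert m m w g x - trunc_hilbert n n w g x) + 2 * sq_norm (\<lambda>x. trunc_hilbert n n w f x - trunc_hilbert n n w g x)"
      by (subst (3) sq_norm_commute) (rule sq_norm_triangle, measurable)
    finally have "sq_norm (\<lambda>x. trunc_hilbert m m w f x - trunc_hilbert n n w f x) \<le> 2 * sq_norm (\<lambda>x. trunc_hilbert m m w f x - trunc_hilbert m m w g x) + 2 * (2 * sq_norm (\<lambda>x. trunc_hilbert m m w g x - trunc_hilbert n n w g x) + 2 * sq_norm (\<lambda>x. trunc_hilbert n n w f x - trunc_hilbert n n w g x))"
      by (simp add: mult_left_mono)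
    also have "\<dots> \<le> 2 * (?K * sq_norm (\<lambda>x. f x - g x)) + 2 * (2 * sq_norm (\<lambda>x. trunc_hilbert m m w g x - trunc_hilbert n n w g x) + 2 * (?K * sq_norm (\<lambda>x. f x - g x)))"
      by (intro add_mono mult_left_mono ap) auto
    also have "\<dots> = 6 * (?K * sq_norm (\<lambda>x. f x - g x)) + 4 * sq_norm (\<lambda>x. trunc_hilbert m m w g x - trunc_hilbert n n w g x)"
    proof -
      have "2 * a + 2 * (2 * b + 2 * a) = 6 * a + 4 * b" for a b :: ennreal
      proof -
        have "2 * a + 2 * (2 * b + 2 * a) = (2 * a + 4 * a) + 4 * b" by (simp add: distrib_left mult.assoc[symmetric] add_ac)
        then show ?thesis by (simp flip: distrib_right)
      qed
      then show ?thesis .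
    qed
    also have "\<dots> \<le> ennreal (e / 2) + ennreal (e / 2)" using k d0 unfolding g_def by (intro add_mono) auto
    also have "\<dots> = ennreal e" using e by (simp flip: ennreal_plus)
    finally show "sq_norm (\<lambda>x. trunc_hilbert m m w f x - trunc_hilbert n n w f x) \<le> ennreal e" .
  qed
qed

text \<open>An L2 limit, hence determined only almost everywhere. In place of additivity in f the
  estimate \<open>sq_norm_hilbert_limit_diff_le\<close> is used.\<close>

definition hilbert_limit :: "'a::euclidean_space \<Rightarrow> ('a \<Rightarrow> complex) \<Rightarrow> 'a \<Rightarrow> complex" where
  "hilbert_limit w f = (SOME h. h \<in> borel_measurable borel \<and> (\<lambda>n. sq_norm (\<lambda>x. trunc_hilbert n n w f x - h x)) \<longlonglongrightarrow> 0)"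

lemma hilbert_limit:
  assumes f: "sq_integrable f"
  shows "hilbert_limit w f \<in> borel_measurable borel" "(\<lambda>n. sq_norm (\<lambda>x. trunc_hilbert n n w f x - hilbert_limit w f x)) \<longlonglongrightarrow> 0"
proof -
  obtain h where "h \<in> borel_measurable borel" "(\<lambda>n. sq_norm (\<lambda>x. trunc_hilbert n n w f x - h x)) \<longlonglongrightarrow> 0"
    by (rule sq_norm_complete[of "\<lambda>n. trunc_hilbert n n w f"]) (use sq_integrableD(1)[OF lip_sq_integrable[OF lip_trunc_hilbert f]] trunc_hilbert_cauchy[OF f] in auto)
  then have "\<exists>h. h \<in> borel_measurable borel \<and> (\<lambda>n. sq_norm (\<lambda>x. trunc_hilbert n n w f x - h x)) \<longlonglongrightarrow> 0" by blast
  from someI_ex[OF this] show "hilbert_limit w f \<in> borel_measurable borel" "(\<lambda>n. sq_norm (\<lambda>x. trunc_hilbert n n w f x - hilbert_limit w f x)) \<longlonglongrightarrow> 0"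
    unfolding hilbert_limit_def by blast+
qed

lemma sq_norm_hilbert_limit_le:
  assumes f: "sq_integrable f" shows "sq_norm (hilbert_limit w f) \<le> ennreal (16 * Si_bound\<^sup>2) * sq_norm f"
proof (rule LIMSEQ_le_const)
  note [measurable] = hilbert_limit(1)[OF f] sq_integrableD(1)[OF lip_sq_integrable[OF lip_trunc_hilbert f]]
  have "(\<lambda>n. ennreal (16 * Si_bound\<^sup>2) * sq_norm f + 2 * sq_norm (\<lambda>x. trunc_hilbert n n w f x - hilbert_limit w f x)) \<longlonglongrightarrow> ennreal (16 * Si_bound\<^sup>2) * sq_norm f + 2 * 0"
    by (intro tendsto_add tendsto_const ennreal_tendsto_cmult hilbert_limit(2)[OF f]) simp
  then show "(\<lambda>n. ennreal (16 * Si_bound\<^sup>2) * sq_norm f + 2 * sq_norm (\<lambda>x. trunc_hilbert n n w f x - hilbert_limit w f x)) \<longlonglongrightarrow> ennreal (16 * Si_bound\<^sup>2) * sq_norm f" by simp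
  show "\<exists>N. \<forall>n\<ge>N. sq_norm (hilbert_limit w f) \<le> ennreal (16 * Si_bound\<^sup>2) * sq_norm f + 2 * sq_norm (\<lambda>x. trunc_hilbert n n w f x - hilbert_limit w f x)"
  proof (intro exI allI impI)
    fix n
    have "sq_norm (hilbert_limit w f) \<le> 2 * sq_norm (trunc_hilbert n n w f) + 2 * sq_norm (\<lambda>x. hilbert_limit w f x - trunc_hilbert n n w f x)" by (rule sq_norm_le) measurable
    also have "\<dots> \<le> 2 * (ennreal (8 * Si_bound\<^sup>2) * sq_norm f) + 2 * sq_norm (\<lambda>x. trunc_hilbert n n w f x - hilbert_limit w f x)"
      unfolding sq_norm_commute[of "hilbert_limit w f"] by (intro add_mono mult_left_mono sq_norm_trunc_hilbert_le[OF f]) auto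
    also have "2 * (ennreal (8 * Si_bound\<^sup>2) * sq_norm f) = ennreal (16 * Si_bound\<^sup>2) * sq_norm f"
      using ennreal_mult[of 2 "8 * Si_bound\<^sup>2"] by (simp add: mult.assoc)
    finally show "sq_norm (hilbert_limit w f) \<le> ennreal (16 * Si_bound\<^sup>2) * sq_norm f + 2 * sq_norm (\<lambda>x. trunc_hilbert n n w f x - hilbert_limit w f x)" .
  qed
qed

lemma sq_integrable_hilbert_limit: assumes f: "sq_integrable f" shows "sq_integrable (hilbert_limit w f)"
  using sq_norm_hilbert_limit_le[OF f, of w] sq_integrableD(2)[OF f] hilbert_limit(1)[OF f]
  by (auto simp: sq_integrable_def ennreal_mult_less_top intro: le_less_trans)

lemma sq_norm_hilbert_limit_diff_le:
  assumes f: "sq_integrable f" and g: "sq_integrable g"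
  shows "sq_norm (\<lambda>x. hilbert_limit w f x - hilbert_limit w g x) \<le> ennreal (32 * Si_bound\<^sup>2) * sq_norm (\<lambda>x. f x - g x)"
proof (rule LIMSEQ_le_const)
  note [measurable] = hilbert_limit(1)[OF f] sq_integrableD(1)[OF lip_sq_integrable[OF lip_trunc_hilbert f]] hilbert_limit(1)[OF g] sq_integrableD(1)[OF lip_sq_integrable[OF lip_trunc_hilbert g]]
  let ?a = "ennreal (32 * Si_bound\<^sup>2) * sq_norm (\<lambda>x. f x - g x)"
  let ?r = "\<lambda>n. 2 * sq_norm (\<lambda>x. trunc_hilbert n n w f x - hilbert_limit w f x) + (?a + 4 * sq_norm (\<lambda>x. trunc_hilbert n n w g x - hilbert_limit w g x))"
  have "?r \<longlonglongrightarrow> 2 * 0 + (?a + 4 * 0)"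
    by (intro tendsto_add tendsto_const ennreal_tendsto_cmult hilbert_limit(2)[OF f] hilbert_limit(2)[OF g]) simp_all
  then show "?r \<longlonglongrightarrow> ?a" by simp
  show "\<exists>N. \<forall>n\<ge>N. sq_norm (\<lambda>x. hilbert_limit w f x - hilbert_limit w g x) \<le> ?r n"
  proof (intro exI allI impI)
    fix n
    have "sq_norm (\<lambda>x. hilbert_limit w f x - hilbert_limit w g x) \<le> 2 * sq_norm (\<lambda>x. hilbert_limit w f x - trunc_hilbert n n w f x) + 2 * sq_norm (\<lambda>x. trunc_hilbert n n w f x - hilbert_limit w g x)"
      by (rule sq_norm_triangle) measurable
    also have "\<dots> \<le> 2 * sq_norm (\<lambda>x. hilbert_limit w f x - trunc_hilbert n n w f x) + 2 * (2 * sq_norm (\<lambda>x. trunc_hilbert n n w f x - trunc_hilbert n n w g x) + 2 * sq_norm (\<lambda>x. trunc_hilbert n n w g x - hilbert_limit w g x))"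
      by (intro add_mono mult_left_mono sq_norm_triangle order_refl) measurable
    also have "sq_norm (\<lambda>x. trunc_hilbert n n w f x - trunc_hilbert n n w g x) = sq_norm (trunc_hilbert n n w (\<lambda>x. f x - g x))" by (rule lip_dist[OF lip_trunc_hilbert f g])
    also have "2 * sq_norm (\<lambda>x. hilbert_limit w f x - trunc_hilbert n n w f x) + 2 * (2 * sq_norm (trunc_hilbert n n w (\<lambda>x. f x - g x)) + 2 * sq_norm (\<lambda>x. trunc_hilbert n n w g x - hilbert_limit w g x)) \<le>
       2 * sq_norm (\<lambda>x. hilbert_limit w f x - trunc_hilbert n n w f x) + 2 * (2 * (ennreal (8 * Si_bound\<^sup>2) * sq_norm (\<lambda>x. f x - g x)) + 2 * sq_norm (\<lambda>x. trunc_hilbert n n w g x - hilbert_limit w g x))"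
      by (intro add_mono mult_left_mono sq_norm_trunc_hilbert_le sq_integrable_diff f g order_refl) simp_all
    also have "\<dots> = ?r n"
      unfolding sq_norm_commute[of "hilbert_limit w f"] using ennreal_mult[of 4 "8 * Si_bound\<^sup>2"] by (simp add: distrib_left mult.assoc[symmetric])
    finally show "sq_norm (\<lambda>x. hilbert_limit w f x - hilbert_limit w g x) \<le> ?r n" .
  qed
qed

text \<open>This brings the separating lines in, as the two symbols differ exactly where the signs
  do. Of the factor 16, a 4 is due to two triangle inequalities and a 4 to
  \<open>sq_norm_trunc_hilbert_diff\<close>.\<close>

lemma sq_norm_hilbert_limit_dir_diff:
  fixes g :: "'a::euclidean_space \<Rightarrow> complex"
  assumes g: "bdd_integrable g"
  shows "sq_norm (\<lambda>x. hilbert_limit p g x - hilbert_limit q g x) \<le>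
    ennreal (16 / (2 * pi) ^ DIM('a)) * sq_norm (\<lambda>\<xi>. (hilbert_symbol (\<xi> \<bullet> p) - hilbert_symbol (\<xi> \<bullet> q)) * FT g \<xi>)"
proof (rule LIMSEQ_le_const)
  note f = bdd_integrable_sq_integrable[OF g]
  note [measurable] = hilbert_limit(1)[OF f] sq_integrableD(1)[OF lip_sq_integrable[OF lip_trunc_hilbert f]]
  let ?c = "ennreal (1 / (2 * pi) ^ DIM('a))"
  let ?s = "sq_norm (\<lambda>\<xi>. (hilbert_symbol (\<xi> \<bullet> p) - hilbert_symbol (\<xi> \<bullet> q)) * FT g \<xi>)"
  let ?r = "\<lambda>n. 2 * sq_norm (\<lambda>x. trunc_hilbert n n p g x - hilbert_limit p g x) + (4 * (?c * (2 * defect p g n + 4 * ?s + 4 * defect q g n)) + 4 * sq_norm (\<lambda>x. trunc_hilbert n n q g x - hilbert_limit q g x))"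
  have "?r \<longlonglongrightarrow> 2 * 0 + (4 * (?c * (2 * 0 + 4 * ?s + 4 * 0)) + 4 * 0)"
    by (intro tendsto_add tendsto_const ennreal_tendsto_cmult hilbert_limit(2)[OF f] defect_tendsto[OF g]) (simp_all add: ennreal_mult_less_top)
  also have "2 * 0 + (4 * (?c * (2 * 0 + 4 * ?s + 4 * 0)) + 4 * 0) = ennreal (16 / (2 * pi) ^ DIM('a)) * ?s"
    using ennreal_mult[of 16 "1 / (2 * pi) ^ DIM('a)"] by (simp add: mult.left_commute mult.assoc[symmetric])
  finally show "?r \<longlonglongrightarrow> ennreal (16 / (2 * pi) ^ DIM('a)) * ?s" .
  show "\<exists>N. \<forall>n\<ge>N. sq_norm (\<lambda>x. hilbert_limit p g x - hilbert_limit q g x) \<le> ?r n"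
  proof (intro exI allI impI)
    fix n
    have "sq_norm (\<lambda>x. hilbert_limit p g x - hilbert_limit q g x) \<le> 2 * sq_norm (\<lambda>x. hilbert_limit p g x - trunc_hilbert n n p g x) + 2 * sq_norm (\<lambda>x. trunc_hilbert n n p g x - hilbert_limit q g x)"
      by (rule sq_norm_triangle) measurable
    also have "\<dots> \<le> 2 * sq_norm (\<lambda>x. hilbert_limit p g x - trunc_hilbert n n p g x) + 2 * (2 * sq_norm (\<lambda>x. trunc_hilbert n n p g x - trunc_hilbert n n q g x) + 2 * sq_norm (\<lambda>x. trunc_hilbert n n q g x - hilbert_limit q g x))"
      by (intro add_mono mult_left_mono sq_norm_triangle order_refl) measurable
    also have "\<dots> \<le> 2 * sq_norm (\<lambda>x. hilbert_limit p g x - trunc_hilbert n n p g x) + 2 * (2 * (?c * (2 * defect p g n + 4 * ?s + 4 * defect q g n)) + 2 * sq_norm (\<lambda>x. trunc_hilbert n n q g x - hilbert_limit q g x))"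
      by (intro add_mono mult_left_mono sq_norm_trunc_hilbert_diff g order_refl) simp_all
    also have "\<dots> = ?r n"
      unfolding sq_norm_commute[of "hilbert_limit p g"] by (simp add: distrib_left mult.assoc[symmetric])
    finally show "sq_norm (\<lambda>x. hilbert_limit p g x - hilbert_limit q g x) \<le> ?r n" .
  qed
qed

subsection \<open>Almost everywhere convergence\<close>

definition line_L2 :: "'a::euclidean_space \<Rightarrow> ('a \<Rightarrow> complex) \<Rightarrow> 'a \<Rightarrow> bool" where
  "line_L2 w f x \<longleftrightarrow> f \<in> borel_measurable borel \<and> (\<integral>\<^sup>+t. ennreal ((norm (f (x - t *\<^sub>R w)))\<^sup>2) \<partial>(lborel :: real measure)) < \<infinity>"

text \<open>Integrate over the slab |x \<bullet> e| <= N. As e \<bullet> w = 1, each line in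
  direction w stays in it for time 2N, so the double integral is 2N times
  \<open>sq_norm f\<close>.\<close>

lemma AE_line_L2:
  fixes w :: "'a::euclidean_space"
  assumes f: "sq_integrable f" and e: "e \<bullet> w = 1"
  shows "AE x in lborel. line_L2 w f x"
proof -
  note [measurable] = sq_integrableD(1)[OF f]
  let ?F = "\<lambda>x t. ennreal ((norm (f (x - t *\<^sub>R w)))\<^sup>2)"
  have bnd: "AE x in lborel. \<bar>x \<bullet> e\<bar> \<le> real N \<longrightarrow> (\<integral>\<^sup>+t. ?F x t \<partial>lborel) \<noteq> \<infinity>" for N
  proof -
    let ?i = "\<lambda>x. indicator {x. \<bar>x \<bullet> e\<bar> \<le> real N} x :: ennreal"
    have [measurable]: "{x. \<bar>x \<bullet> e\<bar> \<le> real N} \<in> sets borel" by measurable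
    have "(\<integral>\<^sup>+x. (\<integral>\<^sup>+t. ?i x * ?F x t \<partial>lborel) \<partial>lborel) = (\<integral>\<^sup>+t. (\<integral>\<^sup>+x. ?i x * ?F x t \<partial>lborel) \<partial>lborel)"
      by (rule lborel_pair.Fubini'[symmetric]) measurable
    also have "\<dots> = (\<integral>\<^sup>+t. (\<integral>\<^sup>+y. ?i (t *\<^sub>R w + y) * ennreal ((norm (f y))\<^sup>2) \<partial>lborel) \<partial>lborel)"
    proof (rule nn_integral_cong)
      fix t
      show "(\<integral>\<^sup>+x. ?i x * ?F x t \<partial>lborel) = (\<integral>\<^sup>+y. ?i (t *\<^sub>R w + y) * ennreal ((norm (f y))\<^sup>2) \<partial>lborel)"
        by (subst nn_integral_shift[of "\<lambda>x. ?i x * ?F x t" "t *\<^sub>R w", symmetric]) simp_all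
    qed
    also have "\<dots> = (\<integral>\<^sup>+y. (\<integral>\<^sup>+t. ?i (t *\<^sub>R w + y) * ennreal ((norm (f y))\<^sup>2) \<partial>lborel) \<partial>lborel)"
      by (rule lborel_pair.Fubini') measurable
    also have "\<dots> = (\<integral>\<^sup>+y. ennreal (2 * real N) * ennreal ((norm (f y))\<^sup>2) \<partial>lborel)"
    proof (rule nn_integral_cong)
      fix y :: 'a
      have "?i (t *\<^sub>R w + y) = indicator {- real N - y \<bullet> e..real N - y \<bullet> e} t" for t
        using e by (auto simp: indicator_def inner_add_left inner_commute[of w e])
      then have "(\<integral>\<^sup>+t. ?i (t *\<^sub>R w + y) \<partial>lborel) = emeasure lborel {- real N - y \<bullet> e..real N - y \<bullet> e}" by simp
      also have "\<dots> = ennreal (2 * real N)" by simp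
      finally show "(\<integral>\<^sup>+t. ?i (t *\<^sub>R w + y) * ennreal ((norm (f y))\<^sup>2) \<partial>lborel) = ennreal (2 * real N) * ennreal ((norm (f y))\<^sup>2)"
        by (subst nn_integral_multc) auto
    qed
    also have "\<dots> = ennreal (2 * real N) * sq_norm f" unfolding sq_norm_def by (rule nn_integral_cmult) measurable
    also have "\<dots> \<noteq> \<infinity>" using sq_integrableD(2)[OF f] by (auto simp: ennreal_mult_eq_top_iff)
    finally have "AE x in lborel. (\<integral>\<^sup>+t. ?i x * ?F x t \<partial>lborel) \<noteq> \<infinity>" by (intro nn_integral_noteq_infinite) measurable
    then show ?thesis by eventually_elim auto
  qed
  have "AE x in lborel. \<forall>N. \<bar>x \<bullet> e\<bar> \<le> real N \<longrightarrow> (\<integral>\<^sup>+t. ?F x t \<partial>lborel) \<noteq> \<infinity>"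
    unfolding AE_all_countable by (intro allI bnd)
  then show ?thesis
  proof eventually_elim
    case (elim x)
    obtain N where "\<bar>x \<bullet> e\<bar> \<le> real N" using real_arch_simple by blast
    then show ?case using elim by (auto simp: line_L2_def less_top)
  qed
qed

lemma line_L2_measurable: "line_L2 w f x \<Longrightarrow> f \<in> borel_measurable borel" by (simp add: line_L2_def)

lemma line_L2_square_integrable:
  assumes g: "line_L2 w f x" shows "integrable lborel (\<lambda>t. (norm (f (x - t *\<^sub>R w)))\<^sup>2)"
proof -
  note [measurable] = line_L2_measurable[OF g]
  show ?thesis using g by (intro integrableI_bounded) (auto simp: line_L2_def)
qed

lemma line_L2_integrable:
  assumes g: "line_L2 w f x" and k: "\<kappa> \<in> borel_measurable borel" "integrable lborel (\<lambda>t. (\<kappa> t)\<^sup>2)"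
  shows "integrable lborel (\<lambda>t. \<kappa> t *\<^sub>R f (x - t *\<^sub>R w))"
proof (rule Bochner_Integration.integrable_bound[OF Bochner_Integration.integrable_add[OF k(2) line_L2_square_integrable[OF g]]])
  note [measurable] = line_L2_measurable[OF g] k(1)
  show "(\<lambda>t. \<kappa> t *\<^sub>R f (x - t *\<^sub>R w)) \<in> borel_measurable lborel" by measurable
  show "AE t in lborel. norm (\<kappa> t *\<^sub>R f (x - t *\<^sub>R w)) \<le> norm ((\<kappa> t)\<^sup>2 + (norm (f (x - t *\<^sub>R w)))\<^sup>2)"
  proof (rule AE_I2)
    fix t
    have "2 * (\<bar>\<kappa> t\<bar> * norm (f (x - t *\<^sub>R w))) \<le> (\<kappa> t)\<^sup>2 + (norm (f (x - t *\<^sub>R w)))\<^sup>2"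
      using sum_squares_bound[of "\<bar>\<kappa> t\<bar>" "norm (f (x - t *\<^sub>R w))"] by simp
    moreover have "0 \<le> \<bar>\<kappa> t\<bar> * norm (f (x - t *\<^sub>R w))" by simp
    ultimately show "norm (\<kappa> t *\<^sub>R f (x - t *\<^sub>R w)) \<le> norm ((\<kappa> t)\<^sup>2 + (norm (f (x - t *\<^sub>R w)))\<^sup>2)"
      unfolding norm_scaleR real_norm_def using abs_ge_self[of "(\<kappa> t)\<^sup>2 + (norm (f (x - t *\<^sub>R w)))\<^sup>2"] by linarith
  qed
qed

definition tail_kernel :: "real \<Rightarrow> real \<Rightarrow> real" where "tail_kernel a t = (if a < \<bar>t\<bar> then 1 / (pi * t) else 0)"

lemma measurable_tail_kernel [measurable]: "tail_kernel a \<in> borel_measurable borel" unfolding tail_kernel_def[abs_def] by measurable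

lemma tail_kernel_square_integrable:
  assumes a: "0 < a" shows "integrable lborel (\<lambda>t. (tail_kernel a t)\<^sup>2)"
proof (rule Bochner_Integration.integrable_bound)
  show "integrable lborel (\<lambda>t::real. (1 + 1 / a\<^sup>2) * inverse (1 + t\<^sup>2))"
    using integrable_inverse_1_plus_square by (intro integrable_mult_right) (simp add: set_integrable_def)
  show "AE t in lborel. norm ((tail_kernel a t)\<^sup>2) \<le> norm ((1 + 1 / a\<^sup>2) * inverse (1 + t\<^sup>2))"
  proof (rule AE_I2)
    fix t :: real
    show "norm ((tail_kernel a t)\<^sup>2) \<le> norm ((1 + 1 / a\<^sup>2) * inverse (1 + t\<^sup>2))"
    proof (cases "a < \<bar>t\<bar>")
      case True
      then have t0: "0 < \<bar>t\<bar>" "0 < t\<^sup>2" using a by auto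
      have "a\<^sup>2 \<le> t\<^sup>2" using True a power_mono[of a "\<bar>t\<bar>" 2] by simp
      then have "1 \<le> (1 / a\<^sup>2) * t\<^sup>2" using a by (simp add: field_simps)
      then have "1 + t\<^sup>2 \<le> (1 + 1 / a\<^sup>2) * t\<^sup>2" by (simp add: distrib_right)
      then have "1 / t\<^sup>2 \<le> (1 + 1 / a\<^sup>2) * inverse (1 + t\<^sup>2)"
        using t0 by (simp add: field_simps add_pos_pos)
      moreover have "(tail_kernel a t)\<^sup>2 \<le> 1 / t\<^sup>2"
      proof -
        have "1 \<le> pi\<^sup>2" using pi_ge_two by (intro one_le_power) simp
        then have "t\<^sup>2 \<le> pi\<^sup>2 * t\<^sup>2" using t0 by simp
        then have "1 / (pi\<^sup>2 * t\<^sup>2) \<le> 1 / t\<^sup>2" using t0 by (intro divide_left_mono) auto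
        then show ?thesis using True by (simp add: tail_kernel_def power_divide power_mult_distrib)
      qed
      moreover have "0 \<le> (1 + 1 / a\<^sup>2) * inverse (1 + t\<^sup>2)" by (intro mult_nonneg_nonneg add_nonneg_nonneg) auto
      ultimately show ?thesis by simp
    qed (simp add: tail_kernel_def)
  qed
qed measurable

lemma line_L2_tail_kernel_integrable: "line_L2 w f x \<Longrightarrow> 0 < a \<Longrightarrow> integrable lborel (\<lambda>t. tail_kernel a t *\<^sub>R f (x - t *\<^sub>R w))"
  by (rule line_L2_integrable) (auto intro: tail_kernel_square_integrable)

text \<open>The outer cut tends to infinity at fixed inner scale; the tail of 1/t is square
  integrable, hence integrable against f along the line.\<close>

lemma trunc_hilbert_tendsto:
  assumes g: "line_L2 w f x"
  shows "(\<lambda>n. trunc_hilbert j n w f x) \<longlonglongrightarrow> dconv (tail_kernel ((1/2)^j)) w f x"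
proof -
  note [measurable] = line_L2_measurable[OF g]
  let ?a = "(1/2::real)^j"
  \<comment> \<open>\<open>cut_kernel\<close> includes the inner cut points and
    \<open>tail_kernel\<close> does not.\<close>
  have ae: "AE t in lborel. \<bar>t\<bar> \<noteq> ?a"
    using AE_lborel_singleton[of ?a] AE_lborel_singleton[of "- ?a"] by eventually_elim auto
  have "(\<lambda>n. \<integral>t. cut_kernel ?a (2^n) t *\<^sub>R f (x - t *\<^sub>R w) \<partial>lborel) \<longlonglongrightarrow> (\<integral>t. tail_kernel ?a t *\<^sub>R f (x - t *\<^sub>R w) \<partial>lborel)"
  proof (rule integral_dominated_convergence)
    show "integrable lborel (\<lambda>t. norm (tail_kernel ?a t *\<^sub>R f (x - t *\<^sub>R w)))"
      by (intro integrable_norm line_L2_tail_kernel_integrable[OF g]) simp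
    show "AE t in lborel. norm (cut_kernel ?a (2^n) t *\<^sub>R f (x - t *\<^sub>R w)) \<le> norm (tail_kernel ?a t *\<^sub>R f (x - t *\<^sub>R w))" for n
      using ae by eventually_elim (auto simp: cut_kernel_def tail_kernel_def)
    show "AE t in lborel. (\<lambda>n. cut_kernel ?a (2^n) t *\<^sub>R f (x - t *\<^sub>R w)) \<longlonglongrightarrow> tail_kernel ?a t *\<^sub>R f (x - t *\<^sub>R w)"
      using ae
    proof eventually_elim
      case (elim t)
      show ?case
      proof (rule tendsto_eventually)
        obtain n0 where n0: "\<bar>t\<bar> \<le> real n0" using real_arch_simple by blast
        have "cut_kernel ?a (2^n) t = tail_kernel ?a t" if "n0 \<le> n" for n
        proof -
          have "\<bar>t\<bar> \<le> 2^n" using n0 that of_nat_less_two_power[of n, where 'a=real] by linarith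
          then show ?thesis using elim by (auto simp: cut_kernel_def tail_kernel_def)
        qed
        then show "\<forall>\<^sub>F n in sequentially. cut_kernel ?a (2^n) t *\<^sub>R f (x - t *\<^sub>R w) = tail_kernel ?a t *\<^sub>R f (x - t *\<^sub>R w)"
          unfolding eventually_sequentially by auto
      qed
    qed
  qed measurable
  then show ?thesis by (simp add: trunc_hilbert_def dconv_def)
qed

text \<open>\<open>square_function\<close> as the outer cut tends to infinity, by Fatou at fixed J;
  then J is arbitrary. Inside the line mean the truncated transform is replaced by its L2 limit, and
  the summand 1 in the bound absorbs the resulting error, which vanishes in the limit.\<close>

lemma square_function_limit:
  fixes w :: "'a::euclidean_space"
  assumes f: "sq_integrable f" and e: "e \<bullet> w = 1"
  shows "AE x in lborel. (\<lambda>j. dconv (tail_kernel ((1/2)^j)) w f x - line_mean j w (hilbert_limit w f) x) \<longlonglongrightarrow> 0"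
proof (rule sum_sq_norm_finite_imp_tendsto_0)
  note h = sq_integrable_hilbert_limit[OF f, of w]
  note [measurable] = sq_integrableD(1)[OF f] sq_integrableD(1)[OF h] sq_integrableD(1)[OF lip_sq_integrable[OF lip_trunc_hilbert f]] sq_integrableD(1)[OF lip_sq_integrable[OF lip_line_mean h]]
  show "(\<lambda>x. dconv (tail_kernel ((1/2)^j)) w f x - line_mean j w (hilbert_limit w f) x) \<in> borel_measurable borel" for j by measurable
  show "2 * (ennreal square_const * sq_norm f) + 1 < \<infinity>" using sq_integrableD(2)[OF f] by (simp add: ennreal_mult_less_top)
  fix J
  show "(\<Sum>j<J. sq_norm (\<lambda>x. dconv (tail_kernel ((1/2)^j)) w f x - line_mean j w (hilbert_limit w f) x)) \<le> 2 * (ennreal square_const * sq_norm f) + 1"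
  proof (rule sum_sq_norm_fatou[of "\<lambda>n j x. trunc_hilbert j n w f x - line_mean j w (hilbert_limit w f) x"])
    show "AE x in lborel. \<forall>j\<in>{..<J}. (\<lambda>n. trunc_hilbert j n w f x - line_mean j w (hilbert_limit w f) x) \<longlonglongrightarrow> dconv (tail_kernel ((1/2)^j)) w f x - line_mean j w (hilbert_limit w f) x"
      using AE_line_L2[OF f e] by eventually_elim (intro ballI tendsto_diff tendsto_const trunc_hilbert_tendsto)
    let ?r = "\<lambda>n. \<Sum>j<J. 2 * (ennreal (line_mean_c j) * sq_norm (\<lambda>x. trunc_hilbert n n w f x - hilbert_limit w f x))"
    have "?r \<longlonglongrightarrow> (\<Sum>j<J. 2 * (ennreal (line_mean_c j) * 0))"
      by (intro tendsto_sum ennreal_tendsto_cmult hilbert_limit(2)[OF f]) simp_all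
    then have "?r \<longlonglongrightarrow> 0" by simp
    then have "\<forall>\<^sub>F n in sequentially. ?r n < 1" by (intro order_tendstoD) auto
    with eventually_ge_at_top[of J]
    show "\<forall>\<^sub>F n in sequentially. (\<Sum>j<J. sq_norm (\<lambda>x. trunc_hilbert j n w f x - line_mean j w (hilbert_limit w f) x)) \<le> 2 * (ennreal square_const * sq_norm f) + 1"
    proof eventually_elim
      case (elim n)
      note T = lip_sq_integrable[OF lip_trunc_hilbert f, of n n w]
      note [measurable] = sq_integrableD(1)[OF lip_sq_integrable[OF lip_line_mean T]]
      have "(\<Sum>j<J. sq_norm (\<lambda>x. trunc_hilbert j n w f x - line_mean j w (hilbert_limit w f) x)) \<le>
          (\<Sum>j<J. 2 * sq_norm (\<lambda>x. trunc_hilbert j n w f x - line_mean j w (trunc_hilbert n n w f) x) + 2 * (ennreal (line_mean_c j) * sq_norm (\<lambda>x. trunc_hilbert n n w f x - hilbert_limit w f x)))"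
      proof (rule sum_mono)
        fix j
        have "sq_norm (\<lambda>x. trunc_hilbert j n w f x - line_mean j w (hilbert_limit w f) x) \<le> 2 * sq_norm (\<lambda>x. trunc_hilbert j n w f x - line_mean j w (trunc_hilbert n n w f) x) + 2 * sq_norm (\<lambda>x. line_mean j w (trunc_hilbert n n w f) x - line_mean j w (hilbert_limit w f) x)"
          by (rule sq_norm_triangle) measurable
        also have "sq_norm (\<lambda>x. line_mean j w (trunc_hilbert n n w f) x - line_mean j w (hilbert_limit w f) x) = sq_norm (line_mean j w (\<lambda>x. trunc_hilbert n n w f x - hilbert_limit w f x))" by (rule lip_dist[OF lip_line_mean T h])
        also have "\<dots> \<le> ennreal (line_mean_c j) * sq_norm (\<lambda>x. trunc_hilbert n n w f x - hilbert_limit w f x)" by (rule lip_bound[OF lip_line_mean sq_integrable_diff[OF T h]])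
        finally show "sq_norm (\<lambda>x. trunc_hilbert j n w f x - line_mean j w (hilbert_limit w f) x) \<le> 2 * sq_norm (\<lambda>x. trunc_hilbert j n w f x - line_mean j w (trunc_hilbert n n w f) x) + 2 * (ennreal (line_mean_c j) * sq_norm (\<lambda>x. trunc_hilbert n n w f x - hilbert_limit w f x))"
          by (simp add: mult_left_mono)
      qed
      also have "\<dots> = 2 * (\<Sum>j<J. sq_norm (\<lambda>x. trunc_hilbert j n w f x - line_mean j w (trunc_hilbert n n w f) x)) + ?r n" by (simp add: sum.distrib sum_distrib_left)
      also have "\<dots> \<le> 2 * (ennreal square_const * sq_norm f) + 1"
        by (intro add_mono mult_left_mono square_function f elim less_imp_le) simp_all
      finally show ?case .
    qed
  qed simp_all
qed

subsection \<open>Lebesgue points along a direction\<close>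

lemma line_L2_avg_integrable:
  assumes g: "line_L2 w h x"
  shows "integrable lborel (\<lambda>t. indicator {a..b} t *\<^sub>R h (x - t *\<^sub>R w))"
    and "integrable lborel (\<lambda>t. indicator {a..b} t * norm (h (x - t *\<^sub>R w) - c))"
proof -
  note [measurable] = line_L2_measurable[OF g]
  have "(indicator {a..b} t :: real)\<^sup>2 = indicator {a..b} t * 1" for t by (simp add: indicator_def)
  then show 1: "integrable lborel (\<lambda>t. indicator {a..b} t *\<^sub>R h (x - t *\<^sub>R w))"
    using integrable_Icc[of a b 1] by (intro line_L2_integrable[OF g]) simp_all
  have 2: "integrable lborel (\<lambda>t. indicator {a..b} t *\<^sub>R c)"
    by (rule Bochner_Integration.integrable_bound[OF integrable_Icc[of a b "norm c"]]) (simp_all add: indicator_def)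
  show "integrable lborel (\<lambda>t. indicator {a..b} t * norm (h (x - t *\<^sub>R w) - c))"
    by (rule Bochner_Integration.integrable_bound[OF Bochner_Integration.integrable_diff[OF 1 2]]) (simp_all add: indicator_def)
qed

definition osc :: "'a::euclidean_space \<Rightarrow> ('a \<Rightarrow> complex) \<Rightarrow> nat \<Rightarrow> 'a \<Rightarrow> real" where
  "osc w h j x = avg ((1/2)^j) (\<lambda>t. norm (h (x - t *\<^sub>R w) - h x))"

text \<open>One-dimensional Lebesgue points combined by Tonelli: for almost every x the bad set
  meets the segment x + s w, |s| < 1, in measure 0, and integrating over x gives twice the measure
  of the bad set.\<close>

lemma AE_osc_tendsto:
  fixes w :: "'a::euclidean_space"
  assumes h: "sq_integrable h" and e: "e \<bullet> w = 1"
  shows "AE x in lborel. (\<lambda>j. osc w h j x) \<longlonglongrightarrow> 0"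
proof -
  note [measurable] = sq_integrableD(1)[OF h]
  have [measurable]: "osc w h j \<in> borel_measurable borel" for j unfolding osc_def[abs_def] avg_def by measurable
  define N where "N = {x. \<not> (\<lambda>j. osc w h j x) \<longlonglongrightarrow> 0}"
  have N [measurable]: "N \<in> sets borel" unfolding N_def by measurable
  have "AE x in lborel. (\<integral>\<^sup>+s. indicator {-1<..<1} s * indicator N (s *\<^sub>R w + x) \<partial>(lborel :: real measure)) = 0"
    using AE_line_L2[OF h e]
  proof eventually_elim
    case (elim x)
    \<comment> \<open>Cut off to [-2, 2] for integrability. The radii are at most 1, so averages at
      |s| < 1 do not see the cut.\<close>
    define g where "g s = indicator {-2..2} s *\<^sub>R h (x + s *\<^sub>R w)" for s :: real
    have "integrable lborel (\<lambda>s. indicator {-2..2} (0 + -1 * s) *\<^sub>R h (x - (0 + -1 * s) *\<^sub>R w))"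
      by (rule lborel_integrable_real_affine[OF line_L2_avg_integrable(1)[OF elim]]) simp
    moreover have "(\<lambda>s. indicator {-2..2} (0 + -1 * s) *\<^sub>R h (x - (0 + -1 * s) *\<^sub>R w)) = g"
    proof
      fix s :: real
      have "indicator {-2..2} (0 + -1 * s) = (indicator {-2..2} s :: real)" by (auto simp: indicator_def)
      then show "indicator {-2..2} (0 + -1 * s) *\<^sub>R h (x - (0 + -1 * s) *\<^sub>R w) = g s" by (simp add: g_def)
    qed
    ultimately have "integrable lborel g" by simp
    from lebesgue_points[OF this]
    have "AE s in lborel. indicator {-1<..<1} s * indicator N (s *\<^sub>R w + x) = (0 :: ennreal)"
    proof eventually_elim
      case (elim s)
      show ?case
      proof (cases "s \<in> {-1<..<1}")
        case True
        have "avg ((1/2)^j) (\<lambda>t. norm (g (s - t) - g s)) = osc w h j (s *\<^sub>R w + x)" for j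
          unfolding avg_def osc_def
        proof (rule arg_cong[of _ _ "\<lambda>z. z / _"], rule Bochner_Integration.integral_cong[OF refl])
          fix t :: real
          show "indicator {-((1/2)^j)..(1/2)^j} t * norm (g (s - t) - g s) = indicator {-((1/2)^j)..(1/2)^j} t * norm (h (s *\<^sub>R w + x - t *\<^sub>R w) - h (s *\<^sub>R w + x))"
          proof (cases "t \<in> {-((1/2)^j)..(1/2)^j}")
            case t: True
            have "(1/2::real)^j \<le> 1" by (simp add: power_le_one)
            then have "s - t \<in> {-2..2}" "s \<in> {-2..2}" using t True by auto
            then show ?thesis by (simp add: g_def algebra_simps)
          qed simp
        qed
        then have "(\<lambda>j. osc w h j (s *\<^sub>R w + x)) \<longlonglongrightarrow> 0" using elim by simp
        then show ?thesis by (simp add: N_def)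
      qed simp
    qed
    then show "(\<integral>\<^sup>+s. indicator {-1<..<1} s * indicator N (s *\<^sub>R w + x) \<partial>(lborel :: real measure)) = 0"
      by (subst nn_integral_0_iff_AE) simp_all
  qed
  then have "0 = (\<integral>\<^sup>+x. (\<integral>\<^sup>+s. indicator {-1<..<1} s * indicator N (s *\<^sub>R w + x) \<partial>(lborel :: real measure)) \<partial>lborel)"
    by (subst nn_integral_0_iff_AE[THEN iffD2]) simp_all
  also have "\<dots> = (\<integral>\<^sup>+s. (\<integral>\<^sup>+x. indicator {-1<..<1} s * indicator N (s *\<^sub>R w + x) \<partial>lborel) \<partial>(lborel :: real measure))"
    by (rule lborel_pair.Fubini'[symmetric]) measurable
  also have "\<dots> = (\<integral>\<^sup>+s. indicator {-1<..<1} s * emeasure lborel N \<partial>(lborel :: real measure))"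
  proof (rule nn_integral_cong)
    fix s :: real
    have "(\<integral>\<^sup>+x. indicator N (s *\<^sub>R w + x) \<partial>lborel) = emeasure lborel N"
      using nn_integral_shift[of "indicator N" "s *\<^sub>R w"] by simp
    then show "(\<integral>\<^sup>+x. indicator {-1<..<1} s * indicator N (s *\<^sub>R w + x) \<partial>lborel) = indicator {-1<..<1} s * emeasure lborel N"
      by (subst nn_integral_cmult) simp_all
  qed
  also have "\<dots> = 2 * emeasure lborel N" by (subst nn_integral_multc) simp_all
  finally have "emeasure lborel N = 0" by simp
  then have "N \<in> null_sets lborel" by (simp add: null_setsI)
  from AE_not_in[OF this] show ?thesis by (simp add: N_def)
qed

lemma line_mean_tendsto:
  assumes g: "line_L2 w h x" and o: "(\<lambda>j. osc w h j x) \<longlonglongrightarrow> 0"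
  shows "(\<lambda>j. line_mean j w h x) \<longlonglongrightarrow> h x"
proof -
  have "norm (line_mean j w h x - h x) \<le> osc w h j x" for j
  proof -
    let ?\<eta> = "(1/2::real)^j"
    let ?i = "\<lambda>t. indicator {-?\<eta>..?\<eta>} t :: real"
    have ic: "integrable lborel (\<lambda>t. ?i t *\<^sub>R h x)"
      by (rule Bochner_Integration.integrable_bound[OF integrable_Icc[of "-?\<eta>" ?\<eta> "norm (h x)"]]) (simp_all add: indicator_def)
    have A: "line_mean j w h x = (1 / (2 * ?\<eta>)) *\<^sub>R (\<integral>t. ?i t *\<^sub>R h (x - t *\<^sub>R w) \<partial>lborel)"
      unfolding line_mean_def dconv_def box_kernel_def integral_scaleR_right[symmetric] by (simp add: mult.commute)
    have H: "h x = (1 / (2 * ?\<eta>)) *\<^sub>R (\<integral>t. ?i t *\<^sub>R h x \<partial>lborel)"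
    proof -
      have "(\<integral>t. ?i t *\<^sub>R h x \<partial>lborel) = (\<integral>t. ?i t \<partial>lborel) *\<^sub>R h x" by (rule integral_scaleR_left) (simp add: integrable_real_indicator)
      then show ?thesis by simp
    qed
    have "line_mean j w h x - h x = (1 / (2 * ?\<eta>)) *\<^sub>R (\<integral>t. ?i t *\<^sub>R h (x - t *\<^sub>R w) - ?i t *\<^sub>R h x \<partial>lborel)"
      by (subst H, subst A, subst Bochner_Integration.integral_diff[OF line_L2_avg_integrable(1)[OF g] ic]) (simp only: scaleR_diff_right)
    then have "norm (line_mean j w h x - h x) = (1 / (2 * ?\<eta>)) * norm (\<integral>t. ?i t *\<^sub>R h (x - t *\<^sub>R w) - ?i t *\<^sub>R h x \<partial>lborel)"
      by simp
    also have "\<dots> \<le> (1 / (2 * ?\<eta>)) * (\<integral>t. norm (?i t *\<^sub>R h (x - t *\<^sub>R w) - ?i t *\<^sub>R h x) \<partial>lborel)"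
      by (intro mult_left_mono integral_norm_bound) simp
    also have "(\<lambda>t. norm (?i t *\<^sub>R h (x - t *\<^sub>R w) - ?i t *\<^sub>R h x)) = (\<lambda>t. ?i t * norm (h (x - t *\<^sub>R w) - h x))"
      by (rule ext) (simp add: indicator_def)
    finally show ?thesis by (simp add: osc_def avg_def)
  qed
  then have "(\<lambda>j. line_mean j w h x - h x) \<longlonglongrightarrow> 0" by (intro Lim_null_comparison[OF _ o] always_eventually allI)
  then show ?thesis by (simp add: LIM_zero_iff)
qed

lemma dyadic_scale:
  assumes "0 < e" "e < (1/2::real)^J"
  obtains j where "J \<le> j" "(1/2)^Suc j < e" "e \<le> (1/2)^j"
proof -
  have ex: "\<exists>n. (1/2::real)^n < e" using assms(1) by (intro real_arch_pow_inv) auto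
  define n where "n = (LEAST n. (1/2::real)^n < e)"
  have n: "(1/2::real)^n < e" unfolding n_def using ex by (rule LeastI_ex)
  have "(1/2::real)^n < (1/2)^J" using n assms(2) by linarith
  then have "J < n" by (metis linorder_not_le power_decreasing zero_le_divide_1_iff zero_le_numeral half_gt_zero_iff less_le_not_le divide_le_eq_1_pos one_le_numeral zero_less_numeral)
  then obtain j where j: "n = Suc j" "J \<le> j" by (cases n) auto
  have "\<not> (1/2::real)^j < e" using not_less_Least[of j "\<lambda>n. (1/2::real)^n < e"] j unfolding n_def by auto
  then show ?thesis using that j n by auto
qed

text \<open>The difference of the two kernels is odd, so f x may be subtracted under the integral,
  and bounded by 2/\<eta> on [-\<eta>, \<eta>] with \<eta> = 2^(-j). The mean over this interval has
  denominator 2 \<eta>, whence the 4.\<close>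

lemma truncation_change:
  assumes g: "line_L2 w f x" and e: "(1/2)^Suc j < e" "e \<le> (1/2)^j"
  shows "norm (dconv (tail_kernel e) w f x - dconv (tail_kernel ((1/2)^j)) w f x) \<le> 4 * osc w f j x"
proof -
  note [measurable] = line_L2_measurable[OF g]
  let ?\<eta> = "(1/2::real)^j"
  have eta: "0 < ?\<eta>" by simp
  have e0: "0 < e" using e(1) by (rule less_trans[rotated]) simp
  define k where "k t = tail_kernel e t - tail_kernel ?\<eta> t" for t
  have [measurable]: "k \<in> borel_measurable borel" unfolding k_def[abs_def] by measurable
  have k_abs: "\<bar>k t\<bar> \<le> (2 / ?\<eta>) * indicator {-?\<eta>..?\<eta>} t" for t
  proof (cases "e < \<bar>t\<bar> \<and> \<bar>t\<bar> \<le> ?\<eta>")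
    case True
    then have t: "0 < \<bar>t\<bar>" "t \<in> {-?\<eta>..?\<eta>}" using e0 by auto
    have "?\<eta> / 2 \<le> pi * \<bar>t\<bar>"
    proof -
      have "?\<eta> / 2 \<le> 1 * \<bar>t\<bar>" using True e by simp
      also have "\<dots> \<le> pi * \<bar>t\<bar>" using pi_ge_two by (intro mult_right_mono) auto
      finally show ?thesis .
    qed
    then have "1 / (pi * \<bar>t\<bar>) \<le> 1 / (?\<eta> / 2)" using eta t by (intro divide_left_mono mult_pos_pos) auto
    moreover have "\<bar>k t\<bar> = 1 / (pi * \<bar>t\<bar>)" using True by (simp add: k_def tail_kernel_def abs_mult)
    ultimately show ?thesis using t by simp
  next
    case False
    then have "k t = 0" using e(2) by (auto simp: k_def tail_kernel_def)
    then show ?thesis by simp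
  qed
  have ik: "integrable lborel k"
    by (rule Bochner_Integration.integrable_bound[OF integrable_mult_right[OF integrable_Icc[of "-?\<eta>" ?\<eta> 1], of "2 / ?\<eta>"]])
      (use k_abs in \<open>auto simp: abs_mult\<close>)
  have "(\<integral>t. k t \<partial>lborel) = (\<integral>t. k (- t) \<partial>lborel)"
    using lborel_integral_real_affine[of "-1" k 0] by simp
  also have "\<dots> = - (\<integral>t. k t \<partial>lborel)"
  proof -
    have "k (- t) = - k t" for t by (simp add: k_def tail_kernel_def)
    then show ?thesis by simp
  qed
  finally have k0: "(\<integral>t. k t \<partial>lborel) = 0" by simp
  have ikf: "integrable lborel (\<lambda>t. k t *\<^sub>R f (x - t *\<^sub>R w))"
    unfolding k_def scaleR_diff_left by (intro Bochner_Integration.integrable_diff line_L2_tail_kernel_integrable[OF g] e0 eta)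
  have ikc: "integrable lborel (\<lambda>t. k t *\<^sub>R f x)" by (intro integrable_scaleR_left) (rule ik)
  have "dconv (tail_kernel e) w f x - dconv (tail_kernel ?\<eta>) w f x = (\<integral>t. k t *\<^sub>R f (x - t *\<^sub>R w) \<partial>lborel)"
    unfolding dconv_def k_def scaleR_diff_left by (rule Bochner_Integration.integral_diff[OF line_L2_tail_kernel_integrable[OF g e0] line_L2_tail_kernel_integrable[OF g eta], symmetric])
  also have "\<dots> = (\<integral>t. k t *\<^sub>R f (x - t *\<^sub>R w) \<partial>lborel) - (\<integral>t. k t *\<^sub>R f x \<partial>lborel)"
  proof -
    have "(\<integral>t. k t *\<^sub>R f x \<partial>lborel) = 0" by (subst integral_scaleR_left) (use ik k0 in auto)
    then show ?thesis by simp
  qed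
  also have "\<dots> = (\<integral>t. k t *\<^sub>R f (x - t *\<^sub>R w) - k t *\<^sub>R f x \<partial>lborel)"
    by (rule Bochner_Integration.integral_diff[OF ikf ikc, symmetric])
  finally have eq: "dconv (tail_kernel e) w f x - dconv (tail_kernel ?\<eta>) w f x = (\<integral>t. k t *\<^sub>R f (x - t *\<^sub>R w) - k t *\<^sub>R f x \<partial>lborel)" .
  have "norm (dconv (tail_kernel e) w f x - dconv (tail_kernel ?\<eta>) w f x) \<le> (\<integral>t. norm (k t *\<^sub>R f (x - t *\<^sub>R w) - k t *\<^sub>R f x) \<partial>lborel)"
    unfolding eq by (rule integral_norm_bound)
  also have "\<dots> \<le> (\<integral>t. (2 / ?\<eta>) * (indicator {-?\<eta>..?\<eta>} t * norm (f (x - t *\<^sub>R w) - f x)) \<partial>lborel)"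
  proof (rule integral_mono)
    show "integrable lborel (\<lambda>t. norm (k t *\<^sub>R f (x - t *\<^sub>R w) - k t *\<^sub>R f x))"
      by (intro integrable_norm Bochner_Integration.integrable_diff ikf ikc)
    show "integrable lborel (\<lambda>t. (2 / ?\<eta>) * (indicator {-?\<eta>..?\<eta>} t * norm (f (x - t *\<^sub>R w) - f x)))"
      by (rule integrable_mult_right[OF line_L2_avg_integrable(2)[OF g]])
    show "norm (k t *\<^sub>R f (x - t *\<^sub>R w) - k t *\<^sub>R f x) \<le> (2 / ?\<eta>) * (indicator {-?\<eta>..?\<eta>} t * norm (f (x - t *\<^sub>R w) - f x))" for t
      using mult_right_mono[OF k_abs[of t] norm_ge_zero[of "f (x - t *\<^sub>R w) - f x"]]
      by (simp only: scaleR_diff_right[symmetric] norm_scaleR mult.assoc)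
  qed
  also have "\<dots> = (2 / ?\<eta>) * (\<integral>t. indicator {-?\<eta>..?\<eta>} t * norm (f (x - t *\<^sub>R w) - f x) \<partial>lborel)" by (rule integral_mult_right_zero)
  also have "\<dots> = 4 * osc w f j x" by (simp add: osc_def avg_def)
  finally show ?thesis .
qed

text \<open>Dyadic truncations differ by a null sequence from line means of the L2 limit, which
  converge at its Lebesgue points. Any other truncation differs from a dyadic one by the oscillation
  of f, small at the Lebesgue points of f.\<close>

theorem hilbert_limit_pointwise:
  fixes w :: "'a::euclidean_space"
  assumes f: "sq_integrable f" and e: "e \<bullet> w = 1"
  shows "AE x in lborel. ((\<lambda>\<epsilon>. dconv (tail_kernel \<epsilon>) w f x) \<longlongrightarrow> hilbert_limit w f x) (at_right 0)"
  using square_function_limit[OF f e] AE_line_L2[OF f e] AE_line_L2[OF sq_integrable_hilbert_limit[OF f, of w] e]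
    AE_osc_tendsto[OF f e] AE_osc_tendsto[OF sq_integrable_hilbert_limit[OF f, of w] e]
proof eventually_elim
  case (elim x)
  have "(\<lambda>j. (dconv (tail_kernel ((1/2)^j)) w f x - line_mean j w (hilbert_limit w f) x) + line_mean j w (hilbert_limit w f) x) \<longlonglongrightarrow> 0 + hilbert_limit w f x"
    by (intro tendsto_add elim(1) line_mean_tendsto elim)
  then have lim: "(\<lambda>j. dconv (tail_kernel ((1/2)^j)) w f x) \<longlonglongrightarrow> hilbert_limit w f x" by simp
  show ?case
  proof (rule tendstoI)
    fix r :: real assume r: "0 < r"
    have "\<forall>\<^sub>F j in sequentially. osc w f j x < r / 8" using elim(4) r by (intro order_tendstoD) auto
    moreover have "\<forall>\<^sub>F j in sequentially. dist (dconv (tail_kernel ((1/2)^j)) w f x) (hilbert_limit w f x) < r / 2"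
      using lim r by (intro tendstoD) auto
    ultimately have "\<forall>\<^sub>F j in sequentially. osc w f j x < r / 8 \<and> dist (dconv (tail_kernel ((1/2)^j)) w f x) (hilbert_limit w f x) < r / 2" by eventually_elim simp
    then obtain J where J: "\<And>j. j \<ge> J \<Longrightarrow> osc w f j x < r / 8 \<and> dist (dconv (tail_kernel ((1/2)^j)) w f x) (hilbert_limit w f x) < r / 2"
      unfolding eventually_sequentially by blast
    have "\<forall>\<^sub>F \<epsilon> in at_right (0::real). 0 < \<epsilon> \<and> \<epsilon> < (1/2)^J" 
      unfolding eventually_at_right_field by (intro exI[of _ "(1/2)^J"]) auto
    then show "\<forall>\<^sub>F \<epsilon> in at_right 0. dist (dconv (tail_kernel \<epsilon>) w f x) (hilbert_limit w f x) < r"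
    proof eventually_elim
      case (elim \<epsilon>)
      obtain j where j: "J \<le> j" "(1/2)^Suc j < \<epsilon>" "\<epsilon> \<le> (1/2)^j" using dyadic_scale elim by blast
      have "dist (dconv (tail_kernel \<epsilon>) w f x) (dconv (tail_kernel ((1/2)^j)) w f x) \<le> 4 * osc w f j x"
        unfolding dist_norm using truncation_change[OF \<open>line_L2 w f x\<close> j(2,3)] .
      then show ?case using J[OF j(1)] dist_triangle[of "dconv (tail_kernel \<epsilon>) w f x" "hilbert_limit w f x" "dconv (tail_kernel ((1/2)^j)) w f x"] by linarith
    qed
  qed
qed

subsection \<open>The maximal directional Hilbert transform\<close>

lemma hyperplane_null: assumes "w \<noteq> (0::'a::euclidean_space)" shows "AE \<xi> in lborel. \<xi> \<bullet> w \<noteq> 0"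
proof -
  have "negligible {\<xi>. w \<bullet> \<xi> = 0}" using assms by (intro negligible_hyperplane) auto
  moreover have "{\<xi>. w \<bullet> \<xi> = 0} \<in> sets lborel" by simp
  ultimately have "{\<xi>. w \<bullet> \<xi> = 0} \<in> null_sets lborel" unfolding negligible_iff_null_sets by (simp add: null_sets_completion_iff)
  from AE_not_in[OF this] show ?thesis by (simp add: inner_commute)
qed

text \<open>The third coordinate is a functional equal to 1 on all directions at once, as the lemmas
  on lines in direction w demand.\<close>

lemma lift_dir_e: "axis 3 1 \<bullet> lift_dir v = 1"
  using lin_eq[of "axis 3 1" v] by (simp add: lin_def axis_def)

lemma lift_dir_nonzero: "lift_dir v \<noteq> 0" using lift_dir_e[of v] by auto

lemma sq_norm_divide:
  assumes [measurable]: "f \<in> borel_measurable borel" and "0 < c"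
  shows "sq_norm (\<lambda>x. f x / complex_of_real c) = ennreal (1 / c\<^sup>2) * sq_norm f"
proof -
  have "ennreal ((norm (f x / complex_of_real c))\<^sup>2) = ennreal (1 / c\<^sup>2) * ennreal ((norm (f x))\<^sup>2)" for x
    using assms(2) by (simp add: norm_divide power_divide flip: ennreal_mult)
  then show ?thesis unfolding sq_norm_def by (simp add: nn_integral_cmult)
qed

definition dir_hilbert :: "(real^3 \<Rightarrow> complex) \<Rightarrow> real^2 \<Rightarrow> real^3 \<Rightarrow> complex" where "dir_hilbert f v = hilbert_limit (lift_dir v) f"

text \<open>The first summand normalises each transform to norm at most 1; the second makes 64 /
  \<open>norm_const\<close> at most 4, the constant in \<open>Davg\<close>.\<close>

definition norm_const :: real where "norm_const = 16 * Si_bound\<^sup>2 + 16"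

lemma norm_const: "0 < norm_const" "16 * Si_bound\<^sup>2 \<le> norm_const" "16 \<le> norm_const" by (auto simp: norm_const_def add_nonneg_pos)

lemma hilbert_symbol_diff_le:
  assumes "lin \<xi> p \<noteq> 0" "lin \<xi> q \<noteq> 0"
  shows "(norm ((hilbert_symbol (\<xi> \<bullet> lift_dir p) - hilbert_symbol (\<xi> \<bullet> lift_dir q)) * z))\<^sup>2 \<le> 4 * indicator {\<xi>. sep \<xi> p q} \<xi> * (norm z)\<^sup>2"
proof (cases "sep \<xi> p q")
  case True
  have "norm (hilbert_symbol (\<xi> \<bullet> lift_dir p) - hilbert_symbol (\<xi> \<bullet> lift_dir q)) \<le> 2"
    using norm_triangle_ineq4[of "hilbert_symbol (\<xi> \<bullet> lift_dir p)" "hilbert_symbol (\<xi> \<bullet> lift_dir q)"] norm_hilbert_symbol_le[of "\<xi> \<bullet> lift_dir p"] norm_hilbert_symbol_le[of "\<xi> \<bullet> lift_dir q"] by linarith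
  then have "norm ((hilbert_symbol (\<xi> \<bullet> lift_dir p) - hilbert_symbol (\<xi> \<bullet> lift_dir q)) * z) \<le> 2 * norm z" unfolding norm_mult by (rule mult_right_mono) simp
  from power_mono[OF this norm_ge_zero, of 2] show ?thesis using True by (simp add: power_mult_distrib)
next
  case False
  then have "sgn (lin \<xi> p) = sgn (lin \<xi> q)" using assms by (auto simp: sep_def sgn_if)
  then show ?thesis by (simp add: hilbert_symbol_def lin_def)
qed

lemma max_modulus_divide:
  assumes "finite V" "0 < c"
  shows "max_modulus h V x = c * max_modulus (\<lambda>v x. h v x / complex_of_real c) V x"
proof (rule antisym)
  show "max_modulus h V x \<le> c * max_modulus (\<lambda>v x. h v x / complex_of_real c) V x"
  proof (rule max_modulus_le[OF assms(1)])
    show "0 \<le> c * max_modulus (\<lambda>v x. h v x / complex_of_real c) V x" using assms(2) max_modulus_nonneg[OF assms(1)] by (intro mult_nonneg_nonneg) simp_all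
    fix v assume "v \<in> V"
    from max_modulus_ge[OF assms(1) this, of "\<lambda>v x. h v x / complex_of_real c" x]
    show "cmod (h v x) \<le> c * max_modulus (\<lambda>v x. h v x / complex_of_real c) V x" using assms(2) by (simp add: norm_divide divide_le_eq mult.commute)
  qed
  have "max_modulus (\<lambda>v x. h v x / complex_of_real c) V x \<le> max_modulus h V x / c"
  proof (rule max_modulus_le[OF assms(1)])
    show "0 \<le> max_modulus h V x / c" using assms(2) max_modulus_nonneg[OF assms(1)] by (intro divide_nonneg_nonneg) simp_all
    fix v assume "v \<in> V"
    from max_modulus_ge[OF assms(1) this, of h x] show "cmod (h v x / complex_of_real c) \<le> max_modulus h V x / c" using assms(2) by (simp add: norm_divide divide_right_mono)
  qed
  then show "c * max_modulus (\<lambda>v x. h v x / complex_of_real c) V x \<le> max_modulus h V x" using assms(2) by (simp add: field_simps)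
qed

text \<open>The locale \<open>direction_family\<close> is instantiated at one fixed g, with
  transforms scaled by 1/c and D a multiple of the spectral mass of g on the separating
  frequencies.\<close>

lemma maximal_bound_bdd_integrable:
  assumes g: "bdd_integrable g" and P: "P \<in> polys_deg_le d" and d: "d \<ge> 1" and V: "\<Omega> \<subseteq> real_zeros P"
    and N: "N \<ge> 3" "card \<Omega> \<le> N" and fin: "finite \<Omega>"
  shows "(\<integral>\<^sup>+x. ennreal ((max_modulus (dir_hilbert g) \<Omega> x)\<^sup>2) \<partial>lborel) \<le> ennreal (norm_const * (88 * sqrt (real d) * ln (real N))\<^sup>2) * sq_norm g"
proof -
  note l2g = bdd_integrable_sq_integrable[OF g]
  have hm: "dir_hilbert g v \<in> borel_measurable borel" for v unfolding dir_hilbert_def by (rule hilbert_limit(1)[OF l2g])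
  note [measurable] = hm sq_integrableD(1)[OF sq_integrable_FT[OF g]]
  obtain G where G: "0 \<le> G" "sq_norm g = ennreal G" using sq_integrableD(2)[OF l2g] by (cases "sq_norm g") auto
  show ?thesis
  proof (cases "G = 0")
    \<comment> \<open>Scaling by 1/c is impossible here, but all transforms vanish almost
      everywhere.\<close>
    case True
    have "AE x in lborel. dir_hilbert g v x = 0" for v
      unfolding dir_hilbert_def using sq_norm_hilbert_limit_le[OF l2g, of "lift_dir v"] True G by (intro sq_norm_0_AE hilbert_limit(1)[OF l2g]) simp
    then have "AE x in lborel. \<forall>v\<in>\<Omega>. dir_hilbert g v x = 0" using fin by (simp add: AE_finite_all)
    then have "AE x in lborel. ennreal ((max_modulus (dir_hilbert g) \<Omega> x)\<^sup>2) = 0"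
    proof eventually_elim
      case (elim x)
      have "max_modulus (dir_hilbert g) \<Omega> x \<le> 0" using elim by (intro max_modulus_le fin) auto
      then show ?case using max_modulus_nonneg[OF fin, of "dir_hilbert g" x] by simp
    qed
    then have "(\<integral>\<^sup>+x. ennreal ((max_modulus (dir_hilbert g) \<Omega> x)\<^sup>2) \<partial>lborel) = (\<integral>\<^sup>+x. 0 \<partial>(lborel :: (real^3) measure))" by (rule nn_integral_cong_AE)
    then show ?thesis by simp
  next
    case False
    then have G0: "0 < G" using G by simp
    define c where "c = sqrt (norm_const * G)"
    have c: "0 < c" "c\<^sup>2 = norm_const * G" using norm_const(1) G0 by (auto simp: c_def)
    define h where "h v x = dir_hilbert g v x / complex_of_real c" for v x
    \<comment> \<open>The spectral density of g, normalised to have total mass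
      \<open>sq_norm g\<close>.\<close>
    define wt where "wt \<xi> = 1 / (2 * pi) ^ 3 * (norm (FT g \<xi>))\<^sup>2" for \<xi> :: "real^3"
    have wt0: "0 \<le> wt \<xi>" for \<xi> by (simp add: wt_def)
    have [measurable]: "wt \<in> borel_measurable borel" unfolding wt_def[abs_def] by measurable
    have wtG: "(\<integral>\<^sup>+\<xi>. ennreal (wt \<xi>) \<partial>lborel) = ennreal G"
    proof -
      have "(\<integral>\<^sup>+\<xi>. ennreal (wt \<xi>) \<partial>lborel) = ennreal (1 / (2 * pi) ^ 3) * (\<integral>\<^sup>+\<xi>. ennreal ((norm (FT g \<xi>))\<^sup>2) \<partial>lborel)"
        unfolding wt_def by (subst nn_integral_cmult[symmetric]) (auto simp: ennreal_mult[symmetric])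
      then show ?thesis using sq_norm_FT[OF g] G by simp
    qed
    then have iwt: "integrable lborel wt" using wt0 by (intro integrableI_nonneg) auto
    then have Iwt: "(\<integral>\<xi>. wt \<xi> \<partial>lborel) = G" using wtG wt0 G by (simp add: nn_integral_eq_integral)
    define S where "S p q = (\<integral>\<xi>. indicator {\<xi>. sep \<xi> p q} \<xi> * wt \<xi> \<partial>lborel)" for p q
    have [measurable]: "{\<xi>. sep \<xi> p q} \<in> sets borel" for p q unfolding sep_def lin_def by measurable
    have iS: "integrable lborel (\<lambda>\<xi>. indicator {\<xi>. sep \<xi> p q} \<xi> * wt \<xi>)" for p q
      using integrable_mult_indicator[OF _ iwt, of "{\<xi>. sep \<xi> p q}"] by simp
    have aelin: "AE \<xi> in lborel. lin \<xi> v \<noteq> 0" for v unfolding lin_def by (rule hyperplane_null[OF lift_dir_nonzero])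
    \<comment> \<open>64 is 16 from \<open>sq_norm_hilbert_limit_dir_diff\<close> times 4, the
      square of the largest difference between two values of the symbol.\<close>
    interpret direction_family \<Omega> h lborel "\<lambda>p q. 64 / c\<^sup>2 * S p q"
    proof (unfold_locales, rule fin)
      show "h v \<in> borel_measurable lborel" for v unfolding h_def[abs_def] by measurable
      show "(\<integral>\<^sup>+x. ennreal ((cmod (h v x))\<^sup>2) \<partial>lborel) \<le> 1" for v
      proof -
        have "sq_norm (h v) = ennreal (1 / c\<^sup>2) * sq_norm (dir_hilbert g v)" unfolding h_def[abs_def] by (rule sq_norm_divide[OF hm c(1)])
        also have "\<dots> \<le> ennreal (1 / c\<^sup>2) * (ennreal (16 * Si_bound\<^sup>2) * ennreal G)"
          unfolding dir_hilbert_def using sq_norm_hilbert_limit_le[OF l2g, of "lift_dir v"] G by (intro mult_left_mono) auto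
        also have "\<dots> = ennreal (16 * Si_bound\<^sup>2 * G / c\<^sup>2)" using G by (simp flip: ennreal_mult)
        also have "\<dots> \<le> ennreal 1"
          unfolding c(2) using norm_const G0 by (intro ennreal_leI) (simp add: divide_le_eq)
        finally show ?thesis by (simp add: sq_norm_def)
      qed
      show "0 \<le> 64 / c\<^sup>2 * S p q" for p q unfolding S_def using wt0 by (intro mult_nonneg_nonneg integral_nonneg) auto
      show "64 / c\<^sup>2 * S p q = 64 / c\<^sup>2 * S q p" for p q
      proof -
        have "sep \<xi> p q = sep \<xi> q p" for \<xi> by (auto simp: sep_def)
        then show ?thesis by (simp add: S_def)
      qed
      show "(\<integral>\<^sup>+x. ennreal ((cmod (h p x - h q x))\<^sup>2) \<partial>lborel) \<le> ennreal (64 / c\<^sup>2 * S p q)" for p q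
      proof -
        have "(\<lambda>x. h p x - h q x) = (\<lambda>x. (dir_hilbert g p x - dir_hilbert g q x) / complex_of_real c)" by (simp add: h_def diff_divide_distrib)
        then have "sq_norm (\<lambda>x. h p x - h q x) = ennreal (1 / c\<^sup>2) * sq_norm (\<lambda>x. dir_hilbert g p x - dir_hilbert g q x)"
          using sq_norm_divide[of "\<lambda>x. dir_hilbert g p x - dir_hilbert g q x" c] c(1) by simp
        also have "\<dots> \<le> ennreal (1 / c\<^sup>2) * (ennreal (16 / (2 * pi) ^ 3) * sq_norm (\<lambda>\<xi>. (hilbert_symbol (\<xi> \<bullet> lift_dir p) - hilbert_symbol (\<xi> \<bullet> lift_dir q)) * FT g \<xi>))"
          unfolding dir_hilbert_def using sq_norm_hilbert_limit_dir_diff[OF g, of "lift_dir p" "lift_dir q"] by (intro mult_left_mono) auto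
        also have "sq_norm (\<lambda>\<xi>. (hilbert_symbol (\<xi> \<bullet> lift_dir p) - hilbert_symbol (\<xi> \<bullet> lift_dir q)) * FT g \<xi>) \<le> (\<integral>\<^sup>+\<xi>. ennreal (4 * (2 * pi) ^ 3 * (indicator {\<xi>. sep \<xi> p q} \<xi> * wt \<xi>)) \<partial>lborel)"
          unfolding sq_norm_def
        proof (rule nn_integral_mono_AE)
          show "AE \<xi> in lborel. ennreal ((norm ((hilbert_symbol (\<xi> \<bullet> lift_dir p) - hilbert_symbol (\<xi> \<bullet> lift_dir q)) * FT g \<xi>))\<^sup>2) \<le> ennreal (4 * (2 * pi) ^ 3 * (indicator {\<xi>. sep \<xi> p q} \<xi> * wt \<xi>))"
            using aelin[of p] aelin[of q]
          proof eventually_elim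
            case (elim \<xi>)
            have "4 * indicator {\<xi>. sep \<xi> p q} \<xi> * (norm (FT g \<xi>))\<^sup>2 = 4 * (2 * pi) ^ 3 * (indicator {\<xi>. sep \<xi> p q} \<xi> * wt \<xi>)" by (simp add: wt_def)
            then show ?case using hilbert_symbol_diff_le[OF elim, of "FT g \<xi>"] by (intro ennreal_leI) (simp only:)
          qed
        qed
        also have "\<dots> = ennreal (\<integral>\<xi>. 4 * (2 * pi) ^ 3 * (indicator {\<xi>. sep \<xi> p q} \<xi> * wt \<xi>) \<partial>lborel)"
          using wt0 by (intro nn_integral_eq_integral integrable_mult_right iS AE_I2) (auto simp: zero_le_mult_iff)
        also have "(\<integral>\<xi>. 4 * (2 * pi) ^ 3 * (indicator {\<xi>. sep \<xi> p q} \<xi> * wt \<xi>) \<partial>lborel) = 4 * (2 * pi) ^ 3 * S p q"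
          unfolding S_def by (rule integral_mult_right_zero)
        finally have "sq_norm (\<lambda>x. h p x - h q x) \<le> ennreal (1 / c\<^sup>2) * (ennreal (16 / (2 * pi) ^ 3) * ennreal (4 * (2 * pi) ^ 3 * S p q))" by (simp add: mult_left_mono)
        also have "\<dots> = ennreal (64 / c\<^sup>2 * S p q)" by (simp flip: ennreal_mult')
        finally show ?thesis by (simp add: sq_norm_def)
      qed
      fix U k assume U: "U \<subseteq> \<Omega> \<times> \<Omega>" and k: "0 \<le> k"
        and card: "\<And>\<xi>. \<forall>v\<in>\<Omega>. lin \<xi> v \<noteq> 0 \<Longrightarrow> real (card {p \<in> U. sep \<xi> (fst p) (snd p)}) \<le> k"
      have finU: "finite U" using U fin finite_subset by blast
      \<comment> \<open>Under the integral each frequency is counted once for every pair that its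
        line separates, at most k times for almost every \<xi>.\<close>
      have "(\<Sum>p\<in>U. S (fst p) (snd p)) = (\<integral>\<xi>. (\<Sum>p\<in>U. indicator {\<xi>. sep \<xi> (fst p) (snd p)} \<xi> * wt \<xi>) \<partial>lborel)"
        unfolding S_def by (rule Bochner_Integration.integral_sum[symmetric]) (rule iS)
      also have "\<dots> \<le> (\<integral>\<xi>. k * wt \<xi> \<partial>lborel)"
      proof (rule integral_mono_AE)
        show "integrable lborel (\<lambda>\<xi>. \<Sum>p\<in>U. indicator {\<xi>. sep \<xi> (fst p) (snd p)} \<xi> * wt \<xi>)" by (intro Bochner_Integration.integrable_sum iS)
        show "integrable lborel (\<lambda>\<xi>. k * wt \<xi>)" by (intro integrable_mult_right iwt)
        have "AE \<xi> in lborel. \<forall>v\<in>\<Omega>. lin \<xi> v \<noteq> 0" using fin aelin by (simp add: AE_finite_all)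
        then show "AE \<xi> in lborel. (\<Sum>p\<in>U. indicator {\<xi>. sep \<xi> (fst p) (snd p)} \<xi> * wt \<xi>) \<le> k * wt \<xi>"
        proof eventually_elim
          case (elim \<xi>)
          have "(\<Sum>p\<in>U. indicator {\<xi>. sep \<xi> (fst p) (snd p)} \<xi> * wt \<xi>) = (\<Sum>p\<in>U. if sep \<xi> (fst p) (snd p) then 1 else 0) * wt \<xi>"
            unfolding sum_distrib_right by (rule sum.cong) (auto simp: indicator_def)
          also have "(\<Sum>p\<in>U. if sep \<xi> (fst p) (snd p) then 1 else (0::real)) = real (card {p \<in> U. sep \<xi> (fst p) (snd p)})"
            using finU by (simp add: sum.If_cases Int_def)
          also have "\<dots> * wt \<xi> \<le> k * wt \<xi>" by (rule mult_right_mono[OF card[OF elim] wt0])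
          finally show ?case .
        qed
      qed
      also have "\<dots> = k * G" using Iwt by simp
      finally have "64 / c\<^sup>2 * (\<Sum>p\<in>U. S (fst p) (snd p)) \<le> 64 / c\<^sup>2 * (k * G)" by (rule mult_left_mono) simp
      also have "\<dots> = 64 / norm_const * k" unfolding c(2) using G0 by simp
      also have "\<dots> \<le> 4 * k" using norm_const k by (intro mult_right_mono) (simp_all add: divide_le_eq)
      finally show "(\<Sum>p\<in>U. 64 / c\<^sup>2 * S (fst p) (snd p)) \<le> 4 * k" by (simp add: sum_distrib_left)
    qed
    have "(\<integral>\<^sup>+x. ennreal ((max_modulus (dir_hilbert g) \<Omega> x)\<^sup>2) \<partial>lborel) = (\<integral>\<^sup>+x. ennreal (c\<^sup>2) * ennreal ((max_modulus h \<Omega> x)\<^sup>2) \<partial>lborel)"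
      using max_modulus_divide[OF fin c(1), of "dir_hilbert g"] by (simp add: h_def[abs_def] power_mult_distrib ennreal_mult)
    also have "\<dots> = ennreal (c\<^sup>2) * E2 \<Omega>" unfolding E2_def
    proof (rule nn_integral_cmult)
      have "max_modulus h \<Omega> \<in> borel_measurable lborel" by (rule borel_measurable_max_modulus[OF fin meas])
      then show "(\<lambda>x. ennreal ((max_modulus h \<Omega> x)\<^sup>2)) \<in> borel_measurable lborel" by measurable
    qed
    also have "\<dots> \<le> ennreal (c\<^sup>2) * ennreal ((88 * sqrt (real d) * ln (real N))\<^sup>2)"
      by (intro mult_left_mono E2_bound[OF P d V N]) simp
    also have "\<dots> = ennreal (norm_const * (88 * sqrt (real d) * ln (real N))\<^sup>2) * sq_norm g"
      unfolding c(2) G(2) using norm_const(1) G(1) by (simp add: mult_ac flip: ennreal_mult)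
    finally show ?thesis .
  qed
qed

text \<open>Extension to L2 by truncation. The error is a sum over the finite set \<Omega> and tends
  to 0 whatever the size of \<Omega>, so only a factor 2 is lost.\<close>

lemma maximal_bound:
  assumes f: "sq_integrable f" and P: "P \<in> polys_deg_le d" and d: "d \<ge> 1" and V: "\<Omega> \<subseteq> real_zeros P"
    and N: "N \<ge> 3" "card \<Omega> \<le> N" and fin: "finite \<Omega>"
  shows "(\<integral>\<^sup>+x. ennreal ((max_modulus (dir_hilbert f) \<Omega> x)\<^sup>2) \<partial>lborel) \<le> 2 * (ennreal (norm_const * (88 * sqrt (real d) * ln (real N))\<^sup>2) * sq_norm f)"
proof (rule LIMSEQ_le_const)
  let ?B = "ennreal (norm_const * (88 * sqrt (real d) * ln (real N))\<^sup>2)"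
  let ?g = "\<lambda>m. trunc m f"
  have ng: "bdd_integrable (?g m)" and lg: "sq_integrable (?g m)" for m using bdd_integrable_trunc[OF sq_integrableD(1)[OF f]] bdd_integrable_sq_integrable by blast+
  let ?r = "\<lambda>m. 2 * (?B * sq_norm f) + (\<Sum>v\<in>\<Omega>. 2 * (ennreal (32 * Si_bound\<^sup>2) * sq_norm (\<lambda>x. f x - ?g m x)))"
  have "?r \<longlonglongrightarrow> 2 * (?B * sq_norm f) + (\<Sum>v\<in>\<Omega>. 2 * (ennreal (32 * Si_bound\<^sup>2) * 0))"
    by (intro tendsto_add tendsto_const tendsto_sum ennreal_tendsto_cmult sq_norm_trunc_lim[OF f]) (simp_all add: ennreal_mult_less_top)
  then show "?r \<longlonglongrightarrow> 2 * (?B * sq_norm f)" by simp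
  show "\<exists>N. \<forall>m\<ge>N. (\<integral>\<^sup>+x. ennreal ((max_modulus (dir_hilbert f) \<Omega> x)\<^sup>2) \<partial>lborel) \<le> ?r m"
  proof (intro exI allI impI)
    fix m
    have hm: "dir_hilbert f v \<in> borel_measurable borel" "dir_hilbert (?g m) v \<in> borel_measurable borel" for v
      unfolding dir_hilbert_def using hilbert_limit(1)[OF f] hilbert_limit(1)[OF lg] by blast+
    note [measurable] = hm
    have mxm: "max_modulus (dir_hilbert (?g m)) \<Omega> \<in> borel_measurable lborel"
      by (rule borel_measurable_max_modulus[OF fin]) simp
    note [measurable] = mxm
    have pw: "ennreal ((max_modulus (dir_hilbert f) \<Omega> x)\<^sup>2) \<le> 2 * ennreal ((max_modulus (dir_hilbert (?g m)) \<Omega> x)\<^sup>2) + (\<Sum>v\<in>\<Omega>. 2 * ennreal ((norm (dir_hilbert f v x - dir_hilbert (?g m) v x))\<^sup>2))" for x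
    proof -
      let ?b = "2 * (max_modulus (dir_hilbert (?g m)) \<Omega> x)\<^sup>2 + (\<Sum>v\<in>\<Omega>. 2 * (norm (dir_hilbert f v x - dir_hilbert (?g m) v x))\<^sup>2)"
      have b0: "0 \<le> ?b" by (intro add_nonneg_nonneg sum_nonneg) auto
      have "max_modulus (dir_hilbert f) \<Omega> x \<le> sqrt ?b"
      proof (rule max_modulus_le[OF fin])
        fix v assume v: "v \<in> \<Omega>"
        have "cmod (dir_hilbert f v x) \<le> cmod (dir_hilbert (?g m) v x) + cmod (dir_hilbert f v x - dir_hilbert (?g m) v x)"
          by (metis norm_triangle_sub)
        also have "\<dots> \<le> max_modulus (dir_hilbert (?g m)) \<Omega> x + cmod (dir_hilbert f v x - dir_hilbert (?g m) v x)" using max_modulus_ge[OF fin v] by simp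
        finally have "(cmod (dir_hilbert f v x))\<^sup>2 \<le> (max_modulus (dir_hilbert (?g m)) \<Omega> x + cmod (dir_hilbert f v x - dir_hilbert (?g m) v x))\<^sup>2" by (rule power_mono) simp
        also have "\<dots> \<le> 2 * (max_modulus (dir_hilbert (?g m)) \<Omega> x)\<^sup>2 + 2 * (cmod (dir_hilbert f v x - dir_hilbert (?g m) v x))\<^sup>2"
          using sum_squares_bound[of "max_modulus (dir_hilbert (?g m)) \<Omega> x" "cmod (dir_hilbert f v x - dir_hilbert (?g m) v x)"] by (simp add: power2_sum)
        also have "\<dots> \<le> ?b"
          using member_le_sum[OF v _ fin, of "\<lambda>v. 2 * (norm (dir_hilbert f v x - dir_hilbert (?g m) v x))\<^sup>2"] by simp
        finally show "cmod (dir_hilbert f v x) \<le> sqrt ?b" by (rule real_le_rsqrt)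
      qed (use b0 in simp)
      then have "(max_modulus (dir_hilbert f) \<Omega> x)\<^sup>2 \<le> (sqrt ?b)\<^sup>2" by (rule power_mono) (rule max_modulus_nonneg[OF fin])
      then have "(max_modulus (dir_hilbert f) \<Omega> x)\<^sup>2 \<le> ?b" using b0 by (simp only: real_sqrt_pow2)
      then have "ennreal ((max_modulus (dir_hilbert f) \<Omega> x)\<^sup>2) \<le> ennreal ?b" by (rule ennreal_leI)
      also have "ennreal ?b = ennreal (2 * (max_modulus (dir_hilbert (?g m)) \<Omega> x)\<^sup>2) + ennreal (\<Sum>v\<in>\<Omega>. 2 * (norm (dir_hilbert f v x - dir_hilbert (?g m) v x))\<^sup>2)"
        by (rule ennreal_plus) (auto intro: sum_nonneg)
      also have "ennreal (\<Sum>v\<in>\<Omega>. 2 * (norm (dir_hilbert f v x - dir_hilbert (?g m) v x))\<^sup>2) = (\<Sum>v\<in>\<Omega>. ennreal (2 * (norm (dir_hilbert f v x - dir_hilbert (?g m) v x))\<^sup>2))"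
        by (rule sum_ennreal[symmetric]) simp
      finally show ?thesis by (simp add: ennreal_mult)
    qed
    have "(\<integral>\<^sup>+x. ennreal ((max_modulus (dir_hilbert f) \<Omega> x)\<^sup>2) \<partial>lborel) \<le> (\<integral>\<^sup>+x. 2 * ennreal ((max_modulus (dir_hilbert (?g m)) \<Omega> x)\<^sup>2) + (\<Sum>v\<in>\<Omega>. 2 * ennreal ((norm (dir_hilbert f v x - dir_hilbert (?g m) v x))\<^sup>2)) \<partial>lborel)"
      by (rule nn_integral_mono) (rule pw)
    also have "\<dots> = (\<integral>\<^sup>+x. 2 * ennreal ((max_modulus (dir_hilbert (?g m)) \<Omega> x)\<^sup>2) \<partial>lborel) + (\<integral>\<^sup>+x. (\<Sum>v\<in>\<Omega>. 2 * ennreal ((norm (dir_hilbert f v x - dir_hilbert (?g m) v x))\<^sup>2)) \<partial>lborel)"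
      by (rule nn_integral_add) measurable
    also have "(\<integral>\<^sup>+x. 2 * ennreal ((max_modulus (dir_hilbert (?g m)) \<Omega> x)\<^sup>2) \<partial>lborel) = 2 * (\<integral>\<^sup>+x. ennreal ((max_modulus (dir_hilbert (?g m)) \<Omega> x)\<^sup>2) \<partial>lborel)"
      by (rule nn_integral_cmult) measurable
    also have "(\<integral>\<^sup>+x. (\<Sum>v\<in>\<Omega>. 2 * ennreal ((norm (dir_hilbert f v x - dir_hilbert (?g m) v x))\<^sup>2)) \<partial>lborel) = (\<Sum>v\<in>\<Omega>. 2 * sq_norm (\<lambda>x. dir_hilbert f v x - dir_hilbert (?g m) v x))"
      unfolding sq_norm_def by (subst nn_integral_sum) (auto simp: nn_integral_cmult)
    also have "2 * (\<integral>\<^sup>+x. ennreal ((max_modulus (dir_hilbert (?g m)) \<Omega> x)\<^sup>2) \<partial>lborel) + (\<Sum>v\<in>\<Omega>. 2 * sq_norm (\<lambda>x. dir_hilbert f v x - dir_hilbert (?g m) v x)) \<le> ?r m"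
    proof (intro add_mono mult_left_mono sum_mono)
      show "(\<integral>\<^sup>+x. ennreal ((max_modulus (dir_hilbert (?g m)) \<Omega> x)\<^sup>2) \<partial>lborel) \<le> ?B * sq_norm f"
        by (rule order_trans[OF maximal_bound_bdd_integrable[OF ng P d V N fin] mult_left_mono[OF sq_norm_trunc_le]]) simp
      show "sq_norm (\<lambda>x. dir_hilbert f v x - dir_hilbert (?g m) v x) \<le> ennreal (32 * Si_bound\<^sup>2) * sq_norm (\<lambda>x. f x - ?g m x)" for v
        unfolding dir_hilbert_def by (rule sq_norm_hilbert_limit_diff_le[OF f lg])
    qed simp_all
    finally show "(\<integral>\<^sup>+x. ennreal ((max_modulus (dir_hilbert f) \<Omega> x)\<^sup>2) \<partial>lborel) \<le> ?r m" .
  qed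
qed

subsection \<open>Lebesgue measurable functions\<close>

lemma lebesgue_measurable_cong_AE:
  fixes u u' :: "'a::euclidean_space \<Rightarrow> 'b::topological_space"
  assumes u': "u' \<in> borel_measurable borel" and ae: "AE t in lborel. u t = u' t"
  shows "u \<in> borel_measurable lebesgue"
proof -
  obtain N where N: "{t \<in> space lborel. u t \<noteq> u' t} \<subseteq> N" "N \<in> null_sets lborel"
    using ae by (auto elim: AE_E simp: null_sets_def)
  have u'm: "u' \<in> borel_measurable lebesgue" using u' by (simp add: measurable_completion)
  show ?thesis
  proof (rule measurableI)
    fix A :: "'b set" assume A: "A \<in> sets borel"
    let ?Z = "{t. u t \<noteq> u' t}"
    have Z: "Z' \<in> sets lebesgue" if "Z' \<subseteq> ?Z" for Z'
    proof -
      have "Z' \<subseteq> N" using that N(1) by auto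
      then have "Z' \<in> null_sets lebesgue" using null_sets_completionI[OF N(2)] by (rule null_sets_completion_subset)
      then show ?thesis by (rule null_setsD2)
    qed
    have "u -` A \<inter> space lebesgue = (u' -` A \<inter> space lebesgue - ?Z) \<union> (u -` A \<inter> ?Z)" by auto
    moreover have "u' -` A \<inter> space lebesgue \<in> sets lebesgue" by (rule measurable_sets[OF u'm A])
    ultimately show "u -` A \<inter> space lebesgue \<in> sets lebesgue" using Z[of ?Z] Z[of "u -` A \<inter> ?Z"] by (simp only:) (intro sets.Un sets.Diff; simp)
  qed simp
qed

lemma borel_version:
  fixes f :: "'a::euclidean_space \<Rightarrow> complex"
  assumes "f \<in> borel_measurable lebesgue"
  obtains f' where "f' \<in> borel_measurable borel" "AE x in lborel. f x = f' x"
proof -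
  have "(\<lambda>x. Re (f x)) \<in> borel_measurable lebesgue" "(\<lambda>x. Im (f x)) \<in> borel_measurable lebesgue" using assms by measurable
  then obtain a b where ab: "a \<in> borel_measurable lborel" "AE x in lborel. Re (f x) = a x" "b \<in> borel_measurable lborel" "AE x in lborel. Im (f x) = b x"
    using completion_ex_borel_measurable_real by metis
  have "(\<lambda>x. complex_of_real (a x) + \<i> * complex_of_real (b x)) \<in> borel_measurable borel" using ab by simp
  moreover have "AE x in lborel. f x = complex_of_real (a x) + \<i> * complex_of_real (b x)"
    using ab(2,4) by eventually_elim (simp add: complex_eq_iff)
  ultimately show ?thesis using that by blast
qed

text \<open>By Tonelli a null set meets almost every line in direction w in a null set. This allows
  a Lebesgue measurable f to be replaced by a Borel version inside
  \<open>hilbert_dir\<close>.\<close>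

lemma AE_along_lines:
  fixes w :: "'a::euclidean_space"
  assumes "AE x in lborel. Q x"
  shows "AE x in lborel. AE t in (lborel :: real measure). Q (x - t *\<^sub>R w)"
proof -
  obtain N where N: "{x \<in> space lborel. \<not> Q x} \<subseteq> N" "N \<in> null_sets (lborel :: 'a measure)"
    using assms by (auto elim: AE_E simp: null_sets_def)
  have [measurable]: "N \<in> sets borel" and N0: "emeasure lborel N = 0" using N(2) by auto
  have "(\<integral>\<^sup>+x. (\<integral>\<^sup>+t. indicator N (x - t *\<^sub>R w) \<partial>(lborel :: real measure)) \<partial>lborel) = (\<integral>\<^sup>+t. (\<integral>\<^sup>+x. indicator N (x - t *\<^sub>R w) \<partial>lborel) \<partial>(lborel :: real measure))"
    by (rule lborel_pair.Fubini'[symmetric]) measurable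
  also have "\<dots> = 0" using nn_integral_shift_line[of "indicator N" _ w] N0 by simp
  finally have "AE x in lborel. (\<integral>\<^sup>+t. indicator N (x - t *\<^sub>R w) \<partial>(lborel :: real measure)) = 0"
    by (subst (asm) nn_integral_0_iff_AE) simp_all
  then show ?thesis
  proof eventually_elim
    case (elim x)
    then have "AE t in lborel. indicator N (x - t *\<^sub>R w) = (0::ennreal)" by (subst (asm) nn_integral_0_iff_AE) simp_all
    then show ?case by eventually_elim (use N(1) in \<open>auto simp: indicator_def split: if_splits\<close>)
  qed
qed

lemma hilbert_dir_eq:
  assumes f': "sq_integrable f'" and ae: "AE x in lborel. f x = f' x"
  shows "AE x in lborel. hilbert_dir v f x = dir_hilbert f' v x"
  using hilbert_limit_pointwise[OF f' lift_dir_e, of v] AE_along_lines[OF ae, of "lift_dir v"]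
proof eventually_elim
  case (elim x)
  note [measurable] = sq_integrableD(1)[OF f']
  \<comment> \<open>The factor 1/pi stands outside the limit in \<open>hilbert_dir\<close> but
    inside \<open>tail_kernel\<close>.\<close>
  have eq: "(LINT t:{t. \<epsilon> < \<bar>t\<bar>}|lebesgue. (1 / t) *\<^sub>R f (x - t *\<^sub>R lift_dir v)) = pi *\<^sub>R dconv (tail_kernel \<epsilon>) (lift_dir v) f' x" for \<epsilon>
  proof -
    let ?u = "\<lambda>t. indicator {t. \<epsilon> < \<bar>t\<bar>} t *\<^sub>R ((1 / t) *\<^sub>R f (x - t *\<^sub>R lift_dir v))"
    let ?u' = "\<lambda>t. pi *\<^sub>R (tail_kernel \<epsilon> t *\<^sub>R f' (x - t *\<^sub>R lift_dir v))"
    have m: "?u' \<in> borel_measurable borel" by measurable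
    have a: "AE t in lborel. ?u t = ?u' t"
      using elim(2) by eventually_elim (simp add: tail_kernel_def)
    have "(\<integral>t. ?u t \<partial>lebesgue) = (\<integral>t. ?u' t \<partial>lebesgue)"
      by (rule integral_cong_AE[OF lebesgue_measurable_cong_AE[OF m a] _ AE_completion[OF a]]) (use m in \<open>simp add: measurable_completion\<close>)
    also have "\<dots> = (\<integral>t. ?u' t \<partial>lborel)" by (rule integral_completion) (use m in simp)
    also have "\<dots> = pi *\<^sub>R dconv (tail_kernel \<epsilon>) (lift_dir v) f' x" unfolding dconv_def by (rule integral_scaleR_right)
    finally show ?thesis unfolding set_lebesgue_integral_def .
  qed
  have "((\<lambda>\<epsilon>. pi *\<^sub>R dconv (tail_kernel \<epsilon>) (lift_dir v) f' x) \<longlongrightarrow> pi *\<^sub>R hilbert_limit (lift_dir v) f' x) (at_right 0)"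
    by (intro tendsto_intros elim(1))
  then have "Lim (at_right 0) (\<lambda>\<epsilon>. pi *\<^sub>R dconv (tail_kernel \<epsilon>) (lift_dir v) f' x) = pi *\<^sub>R hilbert_limit (lift_dir v) f' x"
    by (intro tendsto_Lim) simp_all
  then show ?case unfolding hilbert_dir_def eq by (simp add: dir_hilbert_def)
qed

lemma SUP_cmod_eq_max_modulus:
  assumes "finite \<Omega>" shows "(SUP v\<in>\<Omega>. ennreal (cmod (h v x))) = ennreal (max_modulus h \<Omega> x)"
proof (rule antisym)
  show "(SUP v\<in>\<Omega>. ennreal (cmod (h v x))) \<le> ennreal (max_modulus h \<Omega> x)" by (intro SUP_least ennreal_leI max_modulus_ge assms)
  have "max_modulus h \<Omega> x \<in> insert 0 ((\<lambda>v. cmod (h v x)) ` \<Omega>)" unfolding max_modulus_def using assms by (intro Max_in) auto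
  then show "ennreal (max_modulus h \<Omega> x) \<le> (SUP v\<in>\<Omega>. ennreal (cmod (h v x)))" by (auto intro: SUP_upper)
qed

lemma L2norm_le:
  assumes "(\<integral>\<^sup>+x. (g x)\<^sup>2 \<partial>lebesgue) \<le> ennreal (b\<^sup>2)" "0 \<le> b"
  shows "L2norm g \<le> ennreal b"
proof -
  let ?I = "\<integral>\<^sup>+x. (g x)\<^sup>2 \<partial>lebesgue"
  have fin: "?I \<noteq> \<infinity>" using assms(1) by (auto simp: top_unique)
  have "enn2real ?I \<le> b\<^sup>2" using assms(1) by (intro enn2real_leI) auto
  then have "sqrt (enn2real ?I) \<le> b" using assms(2) by (simp add: real_le_lsqrt)
  then show ?thesis using fin by (simp add: L2norm_def Let_def ennreal_leI)
qed

lemma L2norm_le_1D: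
  assumes "L2norm g \<le> 1" shows "(\<integral>\<^sup>+x. (g x)\<^sup>2 \<partial>lebesgue) \<le> 1"
proof -
  let ?I = "\<integral>\<^sup>+x. (g x)\<^sup>2 \<partial>lebesgue"
  have fin: "?I \<noteq> \<infinity>" using assms by (auto simp: L2norm_def Let_def top_unique)
  then have "ennreal (sqrt (enn2real ?I)) \<le> 1" using assms by (simp add: L2norm_def Let_def)
  then have "enn2real ?I \<le> 1" by (simp add: ennreal_le_1)
  then have "ennreal (enn2real ?I) \<le> 1" by (simp add: ennreal_le_1)
  then show ?thesis using fin by (simp add: less_top)
qed

theorem theorem3p6:
  shows "\<exists>A::real. A > 0 \<and>
    (\<forall>d N :: nat. d \<ge> 1 \<longrightarrow> N \<ge> 3 \<longrightarrow>
       C2_star N d \<le> ennreal (A * sqrt (real d) * ln (real N)))"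
proof (intro exI[of _ "sqrt (2 * norm_const) * 88"] conjI allI impI)
  show "0 < sqrt (2 * norm_const) * 88" using norm_const by simp
  fix d N :: nat assume d: "d \<ge> 1" and N: "N \<ge> 3"
  \<comment> \<open>88 is the constant of \<open>E2_bound\<close>, \<open>norm_const\<close> undoes
    the scaling of the transforms, and the 2 under the root is the loss in
    \<open>maximal_bound\<close>.\<close>
  let ?b = "sqrt (2 * norm_const) * 88 * sqrt (real d) * ln (real N)"
  have b0: "0 \<le> ?b" using norm_const N by (intro mult_nonneg_nonneg) auto
  have b2: "?b\<^sup>2 = 2 * (norm_const * (88 * sqrt (real d) * ln (real N))\<^sup>2)" using norm_const by (simp add: power_mult_distrib)
  show "C2_star N d \<le> ennreal ?b"
    unfolding C2_star_def op_norm_L2_def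
  proof (intro SUP_least L2norm_le b0)
    fix \<Omega> f assume "\<Omega> \<in> {\<Omega>. finite \<Omega> \<and> card \<Omega> \<le> N \<and> (\<exists>P\<in>polys_deg_le d. \<Omega> \<subseteq> real_zeros P)}"
    then obtain P where fin: "finite \<Omega>" and card: "card \<Omega> \<le> N" and P: "P \<in> polys_deg_le d" "\<Omega> \<subseteq> real_zeros P" by blast
    assume "f \<in> {f \<in> L2. L2norm (\<lambda>x. ennreal (cmod (f x))) \<le> 1}"
    then have f: "f \<in> borel_measurable lebesgue" "L2norm (\<lambda>x. ennreal (cmod (f x))) \<le> 1" by (auto simp: L2_def)
    obtain f' where f': "f' \<in> borel_measurable borel" "AE x in lborel. f x = f' x" using borel_version[OF f(1)] by blast
    have "sq_norm f' = (\<integral>\<^sup>+x. (ennreal (cmod (f x)))\<^sup>2 \<partial>lborel)"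
      unfolding sq_norm_def by (rule nn_integral_cong_AE) (use f'(2) in \<open>eventually_elim, simp add: ennreal_power\<close>)
    also have "\<dots> = (\<integral>\<^sup>+x. (ennreal (cmod (f x)))\<^sup>2 \<partial>lebesgue)" by (rule nn_integral_completion[symmetric])
    also have "\<dots> \<le> 1" by (rule L2norm_le_1D[OF f(2)])
    finally have N1: "sq_norm f' \<le> 1" .
    then have l2f: "sq_integrable f'" using f' by (auto simp: sq_integrable_def intro: le_less_trans)
    have "AE x in lborel. \<forall>v\<in>\<Omega>. hilbert_dir v f x = dir_hilbert f' v x"
      using fin hilbert_dir_eq[OF l2f f'(2)] by (simp add: AE_finite_all)
    then have "AE x in lborel. (hilbert_max \<Omega> f x)\<^sup>2 = ennreal ((max_modulus (dir_hilbert f') \<Omega> x)\<^sup>2)"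
    proof eventually_elim
      case (elim x)
      then have "hilbert_max \<Omega> f x = (SUP v\<in>\<Omega>. ennreal (cmod (dir_hilbert f' v x)))" unfolding hilbert_max_def by (intro SUP_cong) auto
      then show ?case using max_modulus_nonneg[OF fin, of "dir_hilbert f'" x] by (simp add: SUP_cmod_eq_max_modulus[OF fin] ennreal_power)
    qed
    then have "(\<integral>\<^sup>+x. (hilbert_max \<Omega> f x)\<^sup>2 \<partial>lborel) = (\<integral>\<^sup>+x. ennreal ((max_modulus (dir_hilbert f') \<Omega> x)\<^sup>2) \<partial>lborel)" by (rule nn_integral_cong_AE)
    also have "\<dots> \<le> 2 * (ennreal (norm_const * (88 * sqrt (real d) * ln (real N))\<^sup>2) * sq_norm f')"
      by (rule maximal_bound[OF l2f P(1) d P(2) N card fin])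
    also have "\<dots> \<le> 2 * (ennreal (norm_const * (88 * sqrt (real d) * ln (real N))\<^sup>2) * 1)" by (intro mult_left_mono N1) simp_all
    also have "\<dots> = ennreal (?b\<^sup>2)" unfolding b2 using norm_const by (simp add: ennreal_mult)
    finally show "(\<integral>\<^sup>+x. (hilbert_max \<Omega> f x)\<^sup>2 \<partial>lebesgue) \<le> ennreal (?b\<^sup>2)" by (simp only: nn_integral_completion)
  qed
qed

end
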